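(* Let $\mathrm{Der}^-(\mathcal{H},\mathcal{W})=\bigoplus_{k\le-1}\mathrm{Der}_{[k]}(\mathcal{H},\mathcal{W})$. If $n$ is even, then $$\mathrm{Der}^-(\mathcal{H},\mathcal{W})=\mathrm{ad}\,\mathcal{W}_{[-1]}+\mathbb{F}\,(\delta_{|\pi|>|\omega|}\Gamma_1)+\sum_{1\le r\le 2m}\ \sum_{\substack{1\le s_r\le t_r-1\\ n-p^{s_r}<0}}\big(\mathbb{F}\,\Phi_r^{(s_r)}+\mathbb{F}\,\Theta_r^{(s_r)}\big)+\sum_{r\in Y_0}\ \sum_{1\le s_r\le t_r-1}\mathbb{F}\,(\mathrm{ad}\,\partial_r)^{p^{s_r}},$$ where $\delta_{|\pi|>|\omega|}$ is $1$ if $|\pi|>|\omega|$ and $0$ otherwise. If $n$ is odd, then $$\mathrm{Der}^-(\mathcal{H},\mathcal{W})=\mathrm{ad}\,\mathcal{W}_{[-1]}+\sum_{r\in Y_0}\ \sum_{1\le s_r\le t_r-1}\mathbb{F}\,(\mathrm{ad}\,\partial_r)^{p^{s_r}}.$$ (All maps on the right-hand sides are restricted to $\mathcal{H}$.)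
   Context: Let $\mathbb{F}$ be a field of characteristic $p>3$, and let $m>1$, $n>3$ be integers. Put $Y_0=\{1,\dots,2m\}$, $Y_1=\{2m+1,\dots,2m+n\}$, $Y=Y_0\cup Y_1$. Fix $\underline t=(t_1,\dots,t_{2m})$ with positive integer entries, $\pi_i=p^{t_i}-1$, $\pi=(\pi_1,\dots,\pi_{2m})$, $\mathbb{A}=\{\alpha\in\mathbb{N}_0^{2m}:\alpha_i\le\pi_i\}$, $|\alpha|=\sum\alpha_i$; $\varepsilon_i$ is the $i$-th unit vector. $\mathbb{B}_k$ is the set of strictly increasing $k$-tuples $u=\langle i_1,\dots,i_k\rangle$ in $Y_1$ (also viewed as subsets), $|u|=k$, $\mathbb{B}=\bigcup_{k=0}^n\mathbb{B}_k$, $\mathbb{B}^0=\{u\in\mathbb{B}: |u|\text{ even}\}$, $x^u=x_{i_1}\cdots x_{i_k}$, $x^{\emptyset}=1$, $\omega=\langle 2m+1,\dots,2m+n\rangle$ (so $|\omega|=n$). $\mathcal{O}=\mathcal{O}(2m,n;\underline t)$ is the associative superalgebra with basis $\{x^{(\alpha)}x^u:\alpha\in\mathbb{A},u\in\mathbb{B}\}$ and products $x^{(\alpha)}x^{(\beta)}=\prod_i\binom{\alpha_i+\beta_i}{\alpha_i}x^{(\alpha+\beta)}$ (zero if $\alpha+\beta\notin\mathbb{A}$), $x_kx_l=-x_lx_k$, $x_k^2=0$ for $k,l\in Y_1$, $x^{(\alpha)}x_k=x_kx^{(\alpha)}$; write $x_i=x^{(\varepsilon_i)}$ for $i\in Y_0$.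 The parity of $x^{(\alpha)}x^u$ is $|u|$ mod 2 and its $\mathbb{Z}$-degree is $|\alpha|+|u|$. The superderivations $\partial_i$ ($i\in Y$) are $\partial_i(x^{(\alpha)}x^u)=x^{(\alpha-\varepsilon_i)}x^u$ for $i\in Y_0$ (zero if $\alpha_i=0$), and $\partial_i(x^{(\alpha)}x^u)=x^{(\alpha)}\,\partial x^u/\partial x_i$ (left derivative) for $i\in Y_1$; $\mu(i)=\overline 0$ for $i\in Y_0$, $\mu(i)=\overline 1$ for $i\in Y_1$ is the parity of $\partial_i$. $W=\{\sum_{i\in Y}a_i\partial_i: a_i\in\mathcal{O}\}$ is the generalized Witt Lie superalgebra (an $\mathcal{O}$-module), with bracket $[a\partial_i,b\partial_j]=a\partial_i(b)\partial_j-(-1)^{\mathrm p(a\partial_i)\mathrm p(b\partial_j)}b\partial_j(a)\partial_i$, where $\mathrm p(a\partial_i)=\mathrm p(a)+\mu(i)$; $(\mathrm{ad}\,D)(x)=[D,x]$. It is $\mathbb{Z}$-graded: $W_{[k]}$ is spanned by $f\partial_s$ with $f$ homogeneous of degree $k+1$. $\mathcal{W}$ is the even part of $W$, with the induced $\mathbb{Z}$-grading. For $i\in Y_0$: $i'=i+m$, $\tau(i)=1$ if $i\le m$; $i'=i-m$, $\tau(i)=-1$ if $m<i\le 2m$; for $i\in Y_1$: $i'=i$, $\tau(i)=1$. Define the linear map $\mathrm{D_H}:\mathcal{O}\to W$ by $\mathrm{D_H}(a)=\sum_{i\in Y}\tau(i)(-1)^{\mu(i)\mathrm p(a)}\partial_i(a)\partial_{i'}$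 for homogeneous $a$; its kernel is $\mathbb{F}1$. Let $$\mathcal{H}=\mathrm{span}_{\mathbb{F}}\{\mathrm{D_H}(x^{(\alpha)}x^u):\alpha\in\mathbb{A},u\in\mathbb{B}^0,(\alpha,u)\ne(\pi,\omega)\}$$ (the even part of the Hamiltonian superalgebra), $$\mathfrak{N}=\mathrm{span}_{\mathbb{F}}\{\mathrm{D_H}(x^{(\alpha)}x^u):\alpha\in\mathbb{A},u\in\mathbb{B}^0,(\alpha,u)\ne(\pi,\omega),(\alpha,u)\ne(\pi,\emptyset)\},$$ $\mathbb{Z}$-graded Lie subalgebras of $\mathcal{W}$ ($\mathrm{D_H}(x^{(\alpha)}x^u)$ has degree $|\alpha|+|u|-2$; $[k]$ denotes the degree-$k$ component), with $\mathcal{H}=\mathfrak{N}\oplus\mathbb{F}\,\mathrm{D_H}(x^{(\pi)})$. $\mathrm{Der}(\mathcal{H},\mathcal{W})$ is the space of linear maps $D:\mathcal{H}\to\mathcal{W}$ with $D([x,y])=[x,D(y)]-[y,D(x)]$, and $\mathrm{Der}_{[k]}(\mathcal{H},\mathcal{W})$ is the subspace of those $D$ with $D(\mathcal{H}_{[i]})\subset\mathcal{W}_{[i+k]}$ for all $i$. For $n$ even, $\Gamma_1:\mathcal{H}\to\mathcal{W}$ is the linear map with $\Gamma_1(\mathfrak{N})=0$ and $\Gamma_1(\mathrm{D_H}(x^{(\pi)}))=\mathrm{D_H}(x^{\omega})$; and for $r\in Y_0$ and a positive integer $q$, $\Phi_r^{(q)}(\mathrm{D_H}(f))=\partial_r^{p^q}(f)\,\mathrm{D_H}(x^{\omega})$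 and $\Theta_r^{(q)}(\mathrm{D_H}(f))=x^{\omega}(\mathrm{ad}\,\partial_r)^{p^q}(\mathrm{D_H}(f))$ are linear maps $\mathcal{H}\to\mathcal{W}$. *)

theory Defs
  imports
    "HOL-Library.Function_Algebras"
    "HOL-Computational_Algebra.Computational_Algebra"
begin

text \<open>
  A pair (alpha, u) stands for the basis element x^(alpha) x^u; a strictly increasing tuple u is
  represented by its set of entries, and multi-indices are functions vanishing off the index set
  of the even variables. A vector field D is the function of its coordinates, that is, it stands
  for the sum of the (D i) d_i. Addition on all these spaces is the pointwise addition of
  Function_Algebras (its pointwise product is never used), and the three scalings below are the
  pointwise scalar multiplications.
\<close>

type_synonym monomial = "(nat \<Rightarrow> nat) \<times> nat set"
type_synonym 'a sfun = "monomial \<Rightarrow> 'a"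
type_synonym 'a vfield = "nat \<Rightarrow> 'a sfun"

definition scaleO :: "'a::field \<Rightarrow> 'a sfun \<Rightarrow> 'a sfun" where
  "scaleO c f = (\<lambda>b. c * f b)"

definition scaleW :: "'a::field \<Rightarrow> 'a vfield \<Rightarrow> 'a vfield" where
  "scaleW c D = (\<lambda>i. scaleO c (D i))"

definition scaleL :: "'a::field \<Rightarrow> ('a vfield \<Rightarrow> 'a vfield) \<Rightarrow> ('a vfield \<Rightarrow> 'a vfield)" where
  "scaleL c \<phi> = (\<lambda>D. scaleW c (\<phi> D))"

interpretation sfun: vector_space "scaleO :: 'a::field \<Rightarrow> _"
  by unfold_locales (auto simp: scaleO_def fun_eq_iff algebra_simps)

interpretation vfield: vector_space "scaleW :: 'a::field \<Rightarrow> _"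
  by unfold_locales (auto simp: scaleW_def scaleO_def fun_eq_iff algebra_simps)

interpretation maps: vector_space "scaleL :: 'a::field \<Rightarrow> _"
  by unfold_locales (auto simp: scaleL_def scaleW_def scaleO_def fun_eq_iff algebra_simps)

definition mon :: "monomial \<Rightarrow> 'a::field sfun" where
  "mon b = (\<lambda>c. if c = b then 1 else 0)"

text \<open>The vector field f d_i.\<close>

definition fld :: "'a::field sfun \<Rightarrow> nat \<Rightarrow> 'a vfield" where
  "fld f i = (\<lambda>j. if j = i then f else 0)"

text \<open>
  The locale only carries the parameters; all hypotheses on them (and p being the characteristic
  of the ground field) are made explicit where the definitions are used.
\<close>

locale hamiltonian =
  fixes p m n :: nat and t :: "nat \<Rightarrow> nat"
begin

definition Y0 :: "nat set" where "Y0 = {1..2 * m}"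
definition Y1 :: "nat set" where "Y1 = {2 * m + 1..2 * m + n}"
definition Y :: "nat set" where "Y = Y0 \<union> Y1"

text \<open>The maximal multi-index, called pi in the literature.\<close>

definition top_index :: "nat \<Rightarrow> nat" where
  "top_index i = (if i \<in> Y0 then p ^ t i - 1 else 0)"

definition A :: "(nat \<Rightarrow> nat) set" where
  "A = {\<alpha>. (\<forall>i\<in>Y0. \<alpha> i \<le> top_index i) \<and> (\<forall>i. i \<notin> Y0 \<longrightarrow> \<alpha> i = 0)}"

definition size_index :: "(nat \<Rightarrow> nat) \<Rightarrow> nat" where
  "size_index \<alpha> = (\<Sum>i\<in>Y0. \<alpha> i)"

definition Basis :: "monomial set" where
  "Basis = A \<times> Pow Y1"

definition Osup :: "'a::field sfun set" where
  "Osup = {f. \<forall>b. b \<notin> Basis \<longrightarrow> f b = 0}"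

definition deg :: "monomial \<Rightarrow> int" where
  "deg b = int (size_index (fst b) + card (snd b))"

definition homogeneous :: "int \<Rightarrow> 'a::field sfun set" where
  "homogeneous k = {f \<in> Osup. \<forall>b. f b \<noteq> 0 \<longrightarrow> deg b = k}"

text \<open>The exponent of -1 counts the transpositions needed to sort the concatenation of u and v.\<close>

fun mult_mon :: "monomial \<Rightarrow> monomial \<Rightarrow> 'a::field sfun" where
  "mult_mon (\<alpha>, u) (\<beta>, v) =
     (if \<alpha> + \<beta> \<in> A \<and> u \<inter> v = {}
      then scaleO ((-1) ^ card {(k, l). k \<in> u \<and> l \<in> v \<and> l < k}
                   * (\<Prod>i\<in>Y0. of_nat ((\<alpha> i + \<beta> i) choose (\<alpha> i))))
             (mon (\<alpha> + \<beta>, u \<union> v))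
      else 0)"

definition mult :: "'a::field sfun \<Rightarrow> 'a sfun \<Rightarrow> 'a sfun" where
  "mult f g = (\<Sum>b\<in>Basis. \<Sum>c\<in>Basis. scaleO (f b * g c) (mult_mon b c))"

fun pd_mon :: "nat \<Rightarrow> monomial \<Rightarrow> 'a::field sfun" where
  "pd_mon i (\<alpha>, u) =
     (if i \<in> Y0 then (if \<alpha> i = 0 then 0 else mon (\<alpha>(i := \<alpha> i - 1), u))
      else if i \<in> u then scaleO ((-1) ^ card {j \<in> u. j < i}) (mon (\<alpha>, u - {i}))
      else 0)"

definition pd :: "nat \<Rightarrow> 'a::field sfun \<Rightarrow> 'a sfun" where
  "pd i f = (\<Sum>b\<in>Basis. scaleO (f b) (pd_mon i b))"

definition \<mu> :: "nat \<Rightarrow> nat" where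
  "\<mu> i = (if i \<in> Y1 then 1 else 0)"

definition par :: "monomial \<Rightarrow> nat" where
  "par b = card (snd b)"

definition Witt :: "'a::field vfield set" where
  "Witt = {D. (\<forall>i\<in>Y. D i \<in> Osup) \<and> (\<forall>i. i \<notin> Y \<longrightarrow> D i = 0)}"

definition smul :: "'a::field sfun \<Rightarrow> 'a vfield \<Rightarrow> 'a vfield" where
  "smul f D = (\<lambda>i. mult f (D i))"

definition bracket_mon :: "monomial \<Rightarrow> nat \<Rightarrow> monomial \<Rightarrow> nat \<Rightarrow> 'a::field vfield" where
  "bracket_mon b i c j =
     fld (mult (mon b) (pd i (mon c))) j
     - scaleW ((-1) ^ ((par b + \<mu> i) * (par c + \<mu> j))) (fld (mult (mon c) (pd j (mon b))) i)"

definition bracket :: "'a::field vfield \<Rightarrow> 'a vfield \<Rightarrow> 'a vfield" where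
  "bracket D E = (\<Sum>i\<in>Y. \<Sum>j\<in>Y. \<Sum>b\<in>Basis. \<Sum>c\<in>Basis.
     scaleW (D i b * E j c) (bracket_mon b i c j))"

definition ad :: "'a::field vfield \<Rightarrow> 'a vfield \<Rightarrow> 'a vfield" where
  "ad D = (\<lambda>E. bracket D E)"

definition partial :: "nat \<Rightarrow> 'a::field vfield" where
  "partial i = fld (mon (0, {})) i"

definition Witt_deg :: "int \<Rightarrow> 'a::field vfield set" where
  "Witt_deg k = vfield.span {fld f s |f s. s \<in> Y \<and> f \<in> homogeneous (k + 1)}"

definition Weven :: "'a::field vfield set" where
  "Weven = {D \<in> Witt. \<forall>s\<in>Y. \<forall>b. D s b \<noteq> 0 \<longrightarrow> even (par b + \<mu> s)}"

definition Weven_deg :: "int \<Rightarrow> 'a::field vfield set" where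
  "Weven_deg k = Weven \<inter> Witt_deg k"

definition conj_index :: "nat \<Rightarrow> nat" where
  "conj_index i = (if i \<in> Y0 then (if i \<le> m then i + m else i - m) else i)"

definition \<tau> :: "nat \<Rightarrow> 'a::field" where
  "\<tau> i = (if i \<in> Y0 \<and> m < i then -1 else 1)"

definition DH_mon :: "monomial \<Rightarrow> 'a::field vfield" where
  "DH_mon b = (\<Sum>i\<in>Y. scaleW (\<tau> i * (-1) ^ (\<mu> i * par b)) (fld (pd i (mon b)) (conj_index i)))"

definition DH :: "'a::field sfun \<Rightarrow> 'a vfield" where
  "DH f = (\<Sum>b\<in>Basis. scaleW (f b) (DH_mon b))"

definition x_pi :: "'a::field sfun" where
  "x_pi = mon (top_index, {})"

definition x_omega :: "'a::field sfun" where
  "x_omega = mon (0, Y1)"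

definition H_index :: "monomial set" where
  "H_index = {b \<in> Basis. even (card (snd b)) \<and> b \<noteq> (top_index, Y1)}"

definition H :: "'a::field vfield set" where
  "H = vfield.span {DH (mon b) |b. b \<in> H_index}"

definition N :: "'a::field vfield set" where
  "N = vfield.span {DH (mon b) |b. b \<in> H_index \<and> b \<noteq> (top_index, {})}"

definition H_deg :: "int \<Rightarrow> 'a::field vfield set" where
  "H_deg k = H \<inter> Weven_deg k"

text \<open>
  Linear maps from H to Weven are represented by their extension by 0 outside H, so that equality
  of functions is equality of maps on H.
\<close>

definition Lin :: "('a::field vfield \<Rightarrow> 'a vfield) set" where
  "Lin = {\<phi>. (\<forall>x. x \<notin> H \<longrightarrow> \<phi> x = 0) \<and> (\<forall>x\<in>H. \<phi> x \<in> Weven)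
     \<and> (\<forall>x\<in>H. \<forall>y\<in>H. \<phi> (x + y) = \<phi> x + \<phi> y)
     \<and> (\<forall>c. \<forall>x\<in>H. \<phi> (scaleW c x) = scaleW c (\<phi> x))}"

definition restrict_H :: "('a::field vfield \<Rightarrow> 'a vfield) \<Rightarrow> ('a vfield \<Rightarrow> 'a vfield)" where
  "restrict_H \<phi> = (\<lambda>x. if x \<in> H then \<phi> x else 0)"

definition Der :: "('a::field vfield \<Rightarrow> 'a vfield) set" where
  "Der = {\<phi> \<in> Lin. \<forall>x\<in>H. \<forall>y\<in>H. \<phi> (bracket x y) = bracket x (\<phi> y) - bracket y (\<phi> x)}"

definition Der_deg :: "int \<Rightarrow> ('a::field vfield \<Rightarrow> 'a vfield) set" where
  "Der_deg k = {\<phi> \<in> Der. \<forall>i. \<phi> ` H_deg i \<subseteq> Weven_deg (i + k)}"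

text \<open>The sum of the homogeneous components of negative degree; as these are components of
  different degrees between graded spaces, the sum is direct.\<close>

definition Der_neg :: "('a::field vfield \<Rightarrow> 'a vfield) set" where
  "Der_neg = maps.span (\<Union>k\<in>{..-1}. Der_deg k)"

text \<open>The maps below are used for even n only, when x_omega is even and they take values in Weven.\<close>

definition \<Gamma>1 :: "'a::field vfield \<Rightarrow> 'a vfield" where
  "\<Gamma>1 = (THE \<phi>. \<phi> \<in> Lin \<and> (\<forall>x\<in>N. \<phi> x = 0) \<and> \<phi> (DH x_pi) = DH x_omega)"

text \<open>The map DH f to (d_r)^(p^q)(f) DH(x_omega); it does not depend on the choice of f since the
  kernel of DH consists of the constants, which d_r kills.\<close>

definition \<Phi> :: "nat \<Rightarrow> nat \<Rightarrow> 'a::field vfield \<Rightarrow> 'a vfield" where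
  "\<Phi> r q = (THE \<phi>. \<phi> \<in> Lin \<and>
     (\<forall>f\<in>sfun.span (mon ` H_index). \<phi> (DH f) = smul ((pd r ^^ (p ^ q)) f) (DH x_omega)))"

definition \<Theta> :: "nat \<Rightarrow> nat \<Rightarrow> 'a::field vfield \<Rightarrow> 'a vfield" where
  "\<Theta> r q = restrict_H (\<lambda>x. smul x_omega ((ad (partial r) ^^ (p ^ q)) x))"

end

end

theory Submission
  imports Defs
begin

text \<open>
  Let \<open>\<phi>\<close> be a derivation of degree k < 0. The torus spanned by the fields of the x_i x_i' acts
  semisimply, so subtracting an inner derivation makes \<open>\<phi>\<close> vanish on it, and then on all elements
  of low degree, because the weights of their images do not fit. Such a \<open>\<phi>\<close> is determined by the
  coefficients without even variables of its values, by induction on the degree in the even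
  variables. Writing x^(alpha) x^u as a Poisson bracket of elements of even degree at least 3, or
  of an element killed by \<open>\<phi>\<close> with another one, shows that these coefficients vanish, except for
  alpha = pi and for x_r^(p^s) and x_r^(p^s) x_i with u empty. There they are invariant under the
  orthogonal algebra spanned by the fields of the x_k x_l, which leaves one scalar for x^(pi), one
  for each x_r^(p^s), and two for each x_r^(p^s) x_1. These are realised by \<open>\<Gamma>1\<close>, \<open>\<Phi>\<close>, and by
  \<open>(ad \<partial>_r)^(p^s)\<close> and \<open>\<Theta>\<close>; parity removes all but \<open>(ad \<partial>_r)^(p^s)\<close> when n is odd, and the
  degree k decides which of them occur.
\<close>

section \<open>The superalgebra\<close>

text \<open>Characteristic p decides where a derivation is free. The binomial coefficients of p^s
  vanish away from both ends, so the p^s-th power of an even partial derivative is again a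
  derivation, and its values on x_r^(p^s) are not forced by brackets. The element x^(pi) is free for
  another reason: its coefficient behaves like an integral, hence vanishes on all Poisson brackets.
  The possible values there come from x^omega: an even monomial that contains x_i contains a second
  odd variable, so for even n the field D_H(x^omega) commutes with all of H, and x^omega itself is a
  scalar for the action of H. Negative degree makes the values on quadratic elements constant
  fields; these have torus weights 0, 1 and -1, and p > 3 separates them from the weights 2 and 3 of
  x_i^(2) and x_i^(3). Hence the separate brackets for pairs of full indices, and for x^(pi) x^u
  with u neither empty nor omega.\<close>

lemma scaleO_apply [simp]: "scaleO c f b = c * f b"
  by (simp add: scaleO_def)

lemma scaleW_apply [simp]: "scaleW c D i = scaleO c (D i)"
  by (simp add: scaleW_def)

lemma scaleL_apply [simp]: "scaleL c \<phi> x = scaleW c (\<phi> x)"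
  by (simp add: scaleL_def)

lemma mon_apply: "mon b c = (if c = b then 1 else 0)"
  by (simp add: mon_def)

lemma fld_apply: "fld f i j = (if j = i then f else 0)"
  by (simp add: fld_def)

lemma sum_fun_apply: "(\<Sum>x\<in>S. F x) y = (\<Sum>x\<in>S. F x y)"
  by (induction S rule: infinite_finite_induct) auto

text \<open>Both sides are the trinomial coefficient (a + b + c)! / (a! b! c!), in the form that
  associativity of divided powers asks for.\<close>

lemma choose_mult_add:
  "((a + b) choose a) * ((a + b + c) choose (a + b)) = ((b + c) choose b) * ((a + b + c) choose a)"
  for a b c :: nat
proof -
  have "((a + b + c) choose (a + b)) * ((a + b) choose a)
      = ((a + b + c) choose a) * ((a + b + c - a) choose (a + b - a))"
    by (rule choose_mult) auto
  then show ?thesis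
    by (simp add: mult.commute add.assoc)
qed

text \<open>\<open>Osup\<close>, the parity parts \<open>Opar\<close>, the homogeneous components
  and the Hamiltonians \<open>Hfun\<close> are all of this form and share its closure rules and its
  induction.\<close>

definition supp_on :: "monomial set \<Rightarrow> 'a::field sfun set" where
  "supp_on S = {f. \<forall>b. b \<notin> S \<longrightarrow> f b = 0}"

lemma supp_on_closed [intro]:
  "0 \<in> supp_on S"
  "f \<in> supp_on S \<Longrightarrow> g \<in> supp_on S \<Longrightarrow> f + g \<in> supp_on S"
  "f \<in> supp_on S \<Longrightarrow> g \<in> supp_on S \<Longrightarrow> f - g \<in> supp_on S"
  "f \<in> supp_on S \<Longrightarrow> - f \<in> supp_on S"
  "f \<in> supp_on S \<Longrightarrow> scaleO c f \<in> supp_on S"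
  by (auto simp: supp_on_def)

lemma supp_on_sum: "(\<And>x. x \<in> X \<Longrightarrow> F x \<in> supp_on S) \<Longrightarrow> (\<Sum>x\<in>X. F x) \<in> supp_on S"
  by (simp add: supp_on_def sum_fun_apply)

lemma mon_supp_on [simp]: "(mon b :: 'a::field sfun) \<in> supp_on S \<longleftrightarrow> b \<in> S"
  unfolding supp_on_def mon_apply by (simp del: split_paired_All)

lemma supp_on_mono: "S \<subseteq> T \<Longrightarrow> f \<in> supp_on S \<Longrightarrow> f \<in> supp_on T"
  by (auto simp: supp_on_def)

lemma supp_on_expand:
  assumes "finite S" "f \<in> supp_on S"
  shows "f = (\<Sum>b\<in>S. scaleO (f b) (mon b))"
proof
  fix c
  have "(\<Sum>b\<in>S. scaleO (f b) (mon b)) c = (\<Sum>b\<in>S. if b = c then f c else 0)"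
    unfolding sum_fun_apply by (intro sum.cong) (auto simp: mon_apply)
  then show "f c = (\<Sum>b\<in>S. scaleO (f b) (mon b)) c"
    using assms by (simp add: supp_on_def del: split_paired_All)
qed

lemma supp_on_induct [consumes 2, case_names zero mon add scale]:
  assumes "finite S" "f \<in> supp_on S"
    and "P 0" "\<And>b. b \<in> S \<Longrightarrow> P (mon b)" "\<And>f g. P f \<Longrightarrow> P g \<Longrightarrow> P (f + g)"
    "\<And>c f. P f \<Longrightarrow> P (scaleO c f)"
  shows "P f"
proof -
  have "P (\<Sum>b\<in>T. scaleO (f b) (mon b))" if "finite T" "T \<subseteq> S" for T
    using that by (induction T) (auto intro: assms)
  from this[OF assms(1)] show ?thesis
    by (subst supp_on_expand[OF assms(1,2)]) simp
qed

lemma span_mon: "finite S \<Longrightarrow> sfun.span (mon ` S) = (supp_on S :: 'a::field sfun set)"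
proof
  assume S: "finite S"
  show "sfun.span (mon ` S) \<subseteq> (supp_on S :: 'a sfun set)"
    by (rule sfun.span_minimal) (auto simp: sfun.subspace_def)
  show "(supp_on S :: 'a sfun set) \<subseteq> sfun.span (mon ` S)"
  proof
    fix f :: "'a sfun" assume "f \<in> supp_on S"
    with S show "f \<in> sfun.span (mon ` S)"
    proof (induction rule: supp_on_induct)
      case (mon b)
      then show ?case by (intro sfun.span_base imageI)
    qed (fact sfun.span_zero sfun.span_add sfun.span_scale)+
  qed
qed

section \<open>Signs of products of odd variables\<close>

definition sort_sign :: "nat set \<Rightarrow> nat set \<Rightarrow> 'a::field" where
  "sort_sign u v = (-1) ^ card {(k, l). k \<in> u \<and> l \<in> v \<and> l < k}"

text \<open>The sign of moving x_i to its sorted place among the entries of u. It occurs both in the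
  left derivative by x_i and in the product of x_i with x^u.\<close>

definition pass_sign :: "nat \<Rightarrow> nat set \<Rightarrow> 'a::field" where
  "pass_sign i u = (-1) ^ card {j \<in> u. j < i}"

lemma finite_inversions: "finite u \<Longrightarrow> finite v \<Longrightarrow> finite {(k, l). k \<in> u \<and> l \<in> v \<and> l < k}"
  for u v :: "nat set"
  by (rule finite_subset[of _ "u \<times> v"]) auto

lemma sort_sign_union_left:
  assumes "finite u" "finite v" "finite w" "u \<inter> v = {}"
  shows "sort_sign (u \<union> v) w = sort_sign u w * sort_sign v w"
proof -
  have eq: "{(k, l). k \<in> u \<union> v \<and> l \<in> w \<and> l < k}
      = {(k, l). k \<in> u \<and> l \<in> w \<and> l < k} \<union> {(k, l). k \<in> v \<and> l \<in> w \<and> l < k}"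
    by auto
  show ?thesis
    unfolding sort_sign_def eq power_add[symmetric]
    by (subst card_Un_disjoint) (use assms in \<open>auto simp: finite_inversions\<close>)
qed

lemma sort_sign_union_right:
  assumes "finite u" "finite v" "finite w" "v \<inter> w = {}"
  shows "sort_sign u (v \<union> w) = sort_sign u v * sort_sign u w"
proof -
  have eq: "{(k, l). k \<in> u \<and> l \<in> v \<union> w \<and> l < k}
      = {(k, l). k \<in> u \<and> l \<in> v \<and> l < k} \<union> {(k, l). k \<in> u \<and> l \<in> w \<and> l < k}"
    by auto
  show ?thesis
    unfolding sort_sign_def eq power_add[symmetric]
    by (subst card_Un_disjoint) (use assms in \<open>auto simp: finite_inversions\<close>)
qed

text \<open>Every pair from u and v is an inversion of exactly one of the two
  concatenations.\<close>

lemma sort_sign_swap: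
  assumes "finite u" "finite v" "u \<inter> v = {}"
  shows "sort_sign u v = (-1) ^ (card u * card v) * (sort_sign v u :: 'a::field)"
proof -
  let ?A = "{(k, l). k \<in> u \<and> l \<in> v \<and> l < k}"
  let ?B = "{(k, l). k \<in> v \<and> l \<in> u \<and> l < k}"
  have B: "card (prod.swap ` ?B) = card ?B"
    by (rule card_image) (auto simp: inj_on_def)
  have "u \<times> v = ?A \<union> prod.swap ` ?B"
  proof (rule set_eqI, clarify)
    fix k l
    have "k \<in> u \<Longrightarrow> l \<in> v \<Longrightarrow> k < l \<or> l < k"
      using assms(3) by (metis disjoint_iff linorder_neqE_nat)
    then show "(k, l) \<in> u \<times> v \<longleftrightarrow> (k, l) \<in> ?A \<union> prod.swap ` ?B"
      by (auto simp: image_iff)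
  qed
  then have "card u * card v = card (?A \<union> prod.swap ` ?B)"
    by (metis card_cartesian_product)
  also have "\<dots> = card ?A + card ?B"
    unfolding B[symmetric] using assms
    by (intro card_Un_disjoint) (auto simp: finite_inversions)
  finally have e: "card u * card v = card ?A + card ?B" .
  have "(-1) ^ card ?B * (-1) ^ card ?B = (1 :: 'a)"
    by (simp flip: power_mult_distrib)
  then show ?thesis
    unfolding sort_sign_def e power_add by (simp add: mult.assoc)
qed

lemma pass_sign_union: "finite u \<Longrightarrow> finite v \<Longrightarrow> u \<inter> v = {} \<Longrightarrow> pass_sign i (u \<union> v) = pass_sign i u * pass_sign i v"
proof -
  assume *: "finite u" "finite v" "u \<inter> v = {}"
  have eq: "{j \<in> u \<union> v. j < i} = {j \<in> u. j < i} \<union> {j \<in> v. j < i}" by auto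
  show ?thesis
    unfolding pass_sign_def eq power_add[symmetric]
    by (subst card_Un_disjoint) (use * in auto)
qed

lemma pass_sign_insert_same [simp]: "pass_sign i (insert i u) = pass_sign i u"
  unfolding pass_sign_def by (rule arg_cong[of _ _ "\<lambda>S. (-1) ^ card S"]) auto

lemma pass_sign_remove_same [simp]: "pass_sign i (u - {i}) = pass_sign i u"
  unfolding pass_sign_def by (rule arg_cong[of _ _ "\<lambda>S. (-1) ^ card S"]) auto

lemma pass_sign_sq [simp]: "pass_sign i u * pass_sign i u = (1::'a::field)"
  by (simp add: pass_sign_def flip: power_mult_distrib)

lemma pass_sign_nonzero [simp]: "pass_sign i u \<noteq> (0::'a::field)"
  by (simp add: pass_sign_def)

lemma sort_sign_single_left: "sort_sign {i} v = pass_sign i v"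
proof -
  have "{(k, l). k \<in> {i} \<and> l \<in> v \<and> l < k} = Pair i ` {j \<in> v. j < i}" by auto
  then have "card {(k, l). k \<in> {i} \<and> l \<in> v \<and> l < k} = card {j \<in> v. j < i}"
    by (simp add: card_image inj_on_def)
  then show ?thesis by (simp add: sort_sign_def pass_sign_def)
qed

lemma sort_sign_single_right:
  assumes "finite u" "i \<notin> u"
  shows "sort_sign u {i} = (-1) ^ card u * (pass_sign i u :: 'a::field)"
  using sort_sign_swap[of u "{i}"] assms by (simp add: sort_sign_single_left)

lemma pass_sign_insert:
  assumes "finite u" "j \<notin> u" "i \<noteq> j"
  shows "pass_sign i (insert j u) = (if j < i then - 1 else 1) * (pass_sign i u :: 'a::field)"
proof -
  have "{k \<in> insert j u. k < i} = (if j < i then insert j {k \<in> u. k < i} else {k \<in> u. k < i})"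
    by auto
  then show ?thesis using assms by (auto simp: pass_sign_def)
qed

lemma sort_sign_empty [simp]: "sort_sign {} v = 1" "sort_sign u {} = 1"
  by (simp_all add: sort_sign_def)

lemma pass_sign_empty [simp]: "pass_sign i {} = 1"
  by (simp add: pass_sign_def)

section \<open>Product and partial derivatives by coordinates\<close>

context hamiltonian
begin

definition multi_binom :: "(nat \<Rightarrow> nat) \<Rightarrow> (nat \<Rightarrow> nat) \<Rightarrow> 'a::field" where
  "multi_binom \<alpha> \<beta> = (\<Prod>i\<in>Y0. of_nat ((\<alpha> i + \<beta> i) choose (\<alpha> i)))"

lemma finite_Y0 [simp]: "finite Y0" by (simp add: Y0_def)
lemma finite_Y1 [simp]: "finite Y1" by (simp add: Y1_def)
lemma finite_Y [simp]: "finite Y" by (simp add: Y_def)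
lemma Y0_Y1: "i \<in> Y0 \<Longrightarrow> i \<in> Y1 \<Longrightarrow> False" by (auto simp: Y0_def Y1_def)
lemma Y0_sub [simp]: "i \<in> Y0 \<Longrightarrow> i \<in> Y" by (simp add: Y_def)
lemma Y1_sub [simp]: "i \<in> Y1 \<Longrightarrow> i \<in> Y" by (simp add: Y_def)
lemma Y1_not_Y0 [simp]: "i \<in> Y1 \<Longrightarrow> i \<notin> Y0" using Y0_Y1 by blast
lemma Y0_not_Y1 [simp]: "i \<in> Y0 \<Longrightarrow> i \<notin> Y1" using Y0_Y1 by blast
lemma mu_simps [simp]: "i \<in> Y0 \<Longrightarrow> \<mu> i = 0" "i \<in> Y1 \<Longrightarrow> \<mu> i = 1"
  by (simp_all add: \<mu>_def)

lemma finite_A [simp]: "finite A"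
proof -
  define M where "M = (\<Sum>i\<in>Y0. top_index i)"
  have "A \<subseteq> {\<alpha>. \<forall>i. (i \<in> Y0 \<longrightarrow> \<alpha> i \<in> {..M}) \<and> (i \<notin> Y0 \<longrightarrow> \<alpha> i = 0)}"
  proof
    fix \<alpha> assume a: "\<alpha> \<in> A"
    have "\<alpha> i \<le> M" if "i \<in> Y0" for i
    proof -
      have "\<alpha> i \<le> top_index i" using a that by (simp add: A_def)
      also have "\<dots> \<le> M" unfolding M_def using that by (intro member_le_sum) auto
      finally show ?thesis .
    qed
    then show "\<alpha> \<in> {\<alpha>. \<forall>i. (i \<in> Y0 \<longrightarrow> \<alpha> i \<in> {..M}) \<and> (i \<notin> Y0 \<longrightarrow> \<alpha> i = 0)}"
      using a by (simp add: A_def)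
  qed
  moreover have "finite {\<alpha>. \<forall>i. (i \<in> Y0 \<longrightarrow> \<alpha> i \<in> {..M}) \<and> (i \<notin> Y0 \<longrightarrow> \<alpha> i = 0)}"
    by (rule finite_set_of_finite_funs) auto
  ultimately show ?thesis by (rule finite_subset)
qed

lemma finite_Basis [simp]: "finite Basis"
  by (simp add: Basis_def)

lemma Basis_iff: "(\<alpha>, u) \<in> Basis \<longleftrightarrow> \<alpha> \<in> A \<and> u \<subseteq> Y1"
  by (simp add: Basis_def)

lemma finite_sub_Y1: "u \<subseteq> Y1 \<Longrightarrow> finite u"
  by (rule finite_subset[OF _ finite_Y1])

lemma zero_in_A [simp]: "0 \<in> A"
  by (simp add: A_def)

lemma top_in_A [simp]: "top_index \<in> A"
  by (simp add: A_def top_index_def)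

lemma A_mono: "\<beta> \<in> A \<Longrightarrow> (\<And>i. \<alpha> i \<le> \<beta> i) \<Longrightarrow> \<alpha> \<in> A"
  unfolding A_def by (auto intro: order_trans) (metis le_zero_eq)

lemma A_addD: "\<alpha> + \<beta> \<in> A \<Longrightarrow> \<alpha> \<in> A" "\<alpha> + \<beta> \<in> A \<Longrightarrow> \<beta> \<in> A"
  by (auto intro: A_mono)

lemma A_le_top: "\<alpha> \<in> A \<Longrightarrow> \<alpha> i \<le> top_index i"
  by (cases "i \<in> Y0") (auto simp: A_def)

lemma A_outside: "\<alpha> \<in> A \<Longrightarrow> i \<notin> Y0 \<Longrightarrow> \<alpha> i = 0"
  by (auto simp: A_def)

lemma A_iff: "\<alpha> \<in> A \<longleftrightarrow> (\<forall>i. \<alpha> i \<le> top_index i)"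
  by (auto simp: A_def top_index_def)

lemma Osup_eq: "Osup = supp_on Basis"
  by (simp add: Osup_def supp_on_def)

lemma Osup_closed [simp, intro]:
  "0 \<in> Osup"
  "f \<in> Osup \<Longrightarrow> g \<in> Osup \<Longrightarrow> f + g \<in> Osup"
  "f \<in> Osup \<Longrightarrow> g \<in> Osup \<Longrightarrow> f - g \<in> Osup"
  "f \<in> Osup \<Longrightarrow> - f \<in> Osup"
  "f \<in> Osup \<Longrightarrow> scaleO c f \<in> Osup"
  by (auto simp: Osup_eq)

lemma Osup_sum: "(\<And>x. x \<in> X \<Longrightarrow> F x \<in> Osup) \<Longrightarrow> (\<Sum>x\<in>X. F x) \<in> Osup"
  unfolding Osup_eq by (rule supp_on_sum)

lemma mon_Osup [simp]: "(mon b :: 'a::field sfun) \<in> Osup \<longleftrightarrow> b \<in> Basis"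
  by (simp add: Osup_eq)

lemma Osup_outside: "f \<in> Osup \<Longrightarrow> b \<notin> Basis \<Longrightarrow> f b = 0"
  unfolding Osup_def by blast

lemma mult_mon_alt:
  "mult_mon (\<alpha>, u) (\<beta>, v) =
    (if \<alpha> + \<beta> \<in> A \<and> u \<inter> v = {} then scaleO (sort_sign u v * multi_binom \<alpha> \<beta>) (mon (\<alpha> + \<beta>, u \<union> v)) else 0)"
  by (simp add: sort_sign_def multi_binom_def)

declare mult_mon.simps [simp del]

lemma mult_add_left: "mult (f + g) h = mult f h + mult g h"
  by (simp add: mult_def sum.distrib distrib_right sfun.scale_left_distrib)

lemma mult_add_right: "mult h (f + g) = mult h f + mult h g"
  by (simp add: mult_def sum.distrib distrib_left sfun.scale_left_distrib)

lemma mult_scale_left: "mult (scaleO c f) h = scaleO c (mult f h)"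
  by (simp add: mult_def sfun.scale_sum_right mult.assoc)

lemma mult_scale_right: "mult h (scaleO c f) = scaleO c (mult h f)"
  by (simp add: mult_def sfun.scale_sum_right mult.assoc mult.left_commute)

lemma mult_zero [simp]: "mult 0 f = 0" "mult f 0 = 0"
  by (simp_all add: mult_def)

lemma mult_minus_left: "mult (- f) g = - mult f g"
  using mult_add_left[of "-f" f g] by (simp add: add_eq_0_iff)

lemma mult_minus_right: "mult f (- g) = - mult f g"
  using mult_add_right[of f "-g" g] by (simp add: add_eq_0_iff)

lemma mult_diff_left: "mult (f - g) h = mult f h - mult g h"
  using mult_add_left[of "f - g" g h] by simp

lemma mult_diff_right: "mult h (f - g) = mult h f - mult h g"
  using mult_add_right[of h "f - g" g] by simp

lemma mult_sum_left: "mult (\<Sum>x\<in>X. F x) g = (\<Sum>x\<in>X. mult (F x) g)"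
  by (rule additive.sum[of "\<lambda>f. mult f g"]) (simp add: additive_def mult_add_left)

lemma mult_sum_right: "mult g (\<Sum>x\<in>X. F x) = (\<Sum>x\<in>X. mult g (F x))"
  by (rule additive.sum[of "mult g"]) (simp add: additive_def mult_add_right)

lemmas mult_linear = mult_add_left mult_add_right mult_scale_left mult_scale_right
  mult_minus_left mult_minus_right mult_diff_left mult_diff_right mult_sum_left mult_sum_right

lemma mult_mon_mon: 
  assumes "b \<in> Basis" "c \<in> Basis"
  shows "mult (mon b) (mon c) = mult_mon b c"
proof -
  have "mult (mon b) (mon c) = (\<Sum>b'\<in>Basis. if b' = b then (\<Sum>c'\<in>Basis. if c' = c then mult_mon b c else 0) else 0)"
    unfolding mult_def mon_apply
    by (intro sum.cong refl) (simp add: if_distrib[of "\<lambda>x. scaleO x y" for y] if_distrib[of "\<lambda>x. y * x" for y] cong: if_cong)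
  then show ?thesis using assms by simp
qed

lemma mult_mon_Osup: "b \<in> Basis \<Longrightarrow> c \<in> Basis \<Longrightarrow> mult_mon b c \<in> Osup"
  by (cases b; cases c) (auto simp: mult_mon_alt Basis_iff)

lemma mult_Osup [simp, intro]: "mult f g \<in> Osup"
  unfolding mult_def by (intro Osup_sum Osup_closed mult_mon_Osup)

lemma pd_add: "pd i (f + g) = pd i f + pd i g"
  by (simp add: pd_def sum.distrib sfun.scale_left_distrib)

lemma pd_scale: "pd i (scaleO c f) = scaleO c (pd i f)"
  by (simp add: pd_def sfun.scale_sum_right)

lemma pd_zero [simp]: "pd i 0 = 0"
  by (simp add: pd_def)

lemma pd_minus: "pd i (- f) = - pd i f"
  using pd_add[of i "-f" f] by (simp add: add_eq_0_iff)

lemma pd_diff: "pd i (f - g) = pd i f - pd i g"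
  using pd_add[of i "f - g" g] by simp

lemma pd_sum: "pd i (\<Sum>x\<in>X. F x) = (\<Sum>x\<in>X. pd i (F x))"
  by (rule additive.sum[of "pd i"]) (simp add: additive_def pd_add)

lemmas pd_linear = pd_add pd_scale pd_minus pd_diff pd_sum

lemma A_lower: "\<alpha> \<in> A \<Longrightarrow> \<alpha>(i := \<alpha> i - Suc 0) \<in> A"
  by (erule A_mono) auto

lemma pd_even_apply:
  fixes f :: "'a::field sfun"
  assumes "f \<in> Osup" "i \<in> Y0"
  shows "pd i f (\<alpha>, u) = f (\<alpha>(i := Suc (\<alpha> i)), u)"
proof -
  have *: "pd_mon i b (\<alpha>, u) = (if b = (\<alpha>(i := Suc (\<alpha> i)), u) then 1 else (0 :: 'a))" for b :: monomial
  proof (cases b)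
    case (Pair \<beta> v)
    have "\<alpha> = \<beta>(i := \<beta> i - 1) \<longleftrightarrow> \<beta> = \<alpha>(i := Suc (\<alpha> i))" if "\<beta> i > 0"
      using that by (auto simp: fun_eq_iff)
    then show ?thesis using Pair assms(2) by (auto simp: mon_apply)
  qed
  have "pd i f (\<alpha>, u) = (\<Sum>b\<in>Basis. if b = (\<alpha>(i := Suc (\<alpha> i)), u) then f (\<alpha>(i := Suc (\<alpha> i)), u) else 0)"
    unfolding pd_def sum_fun_apply by (intro sum.cong) (simp_all add: *)
  then show ?thesis using assms(1) by (simp add: Osup_outside)
qed

lemma pd_odd_apply:
  fixes f :: "'a::field sfun"
  assumes "f \<in> Osup" "i \<in> Y1"
  shows "pd i f (\<alpha>, u) = (if i \<in> u then 0 else pass_sign i u * f (\<alpha>, insert i u))"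
proof -
  have *: "pd_mon i b (\<alpha>, u) = (if i \<notin> u \<and> b = (\<alpha>, insert i u) then pass_sign i u else (0 :: 'a))" for b :: monomial
  proof (cases b)
    case (Pair \<beta> v)
    have "u = v - {i} \<longleftrightarrow> i \<notin> u \<and> v = insert i u" if "i \<in> v"
      using that by auto
    then show ?thesis using Pair assms(2) pass_sign_def[of i v, symmetric]
      by (auto simp: mon_apply)
  qed
  show ?thesis
  proof (cases "i \<in> u")
    case True
    then show ?thesis by (simp add: pd_def sum_fun_apply *)
  next
    case False
    have "pd i f (\<alpha>, u) = (\<Sum>b\<in>Basis. if b = (\<alpha>, insert i u) then pass_sign i u * f (\<alpha>, insert i u) else 0)"
      unfolding pd_def sum_fun_apply using False by (intro sum.cong) (simp_all add: *)
    then show ?thesis using assms(1) False by (simp add: Osup_outside)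
  qed
qed

lemma pd_mon_mon: "b \<in> Basis \<Longrightarrow> pd i (mon b) = pd_mon i b"
proof -
  assume b: "b \<in> Basis"
  have "pd i (mon b) = (\<Sum>b'\<in>Basis. if b' = b then pd_mon i b else 0)"
    unfolding pd_def by (intro sum.cong) (auto simp: mon_apply)
  with b show ?thesis by simp
qed

lemma pd_mon_Y0:
  "(\<alpha>, u) \<in> Basis \<Longrightarrow> i \<in> Y0 \<Longrightarrow>
    pd i (mon (\<alpha>, u)) = (if \<alpha> i = 0 then 0 else mon (\<alpha>(i := \<alpha> i - 1), u))"
  by (simp add: pd_mon_mon)

lemma pd_mon_Y1:
  "(\<alpha>, u) \<in> Basis \<Longrightarrow> i \<in> Y1 \<Longrightarrow>
    pd i (mon (\<alpha>, u)) = (if i \<in> u then scaleO (pass_sign i u) (mon (\<alpha>, u - {i})) else 0)"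
  by (simp add: pd_mon_mon pass_sign_def)

lemma pd_Osup [simp, intro]: "pd i f \<in> (Osup :: 'a::field sfun set)"
proof -
  have "(pd_mon i b :: 'a sfun) \<in> Osup" if "b \<in> Basis" for b
    using that by (cases b) (auto simp: Basis_iff intro!: Osup_closed A_lower)
  then show ?thesis unfolding pd_def by (intro Osup_sum Osup_closed)
qed

lemma pd_not_Y [simp]: "i \<notin> Y \<Longrightarrow> pd i f = (0 :: 'a::field sfun)"
proof -
  assume i: "i \<notin> Y"
  have "pd_mon i b = (0 :: 'a sfun)" if "b \<in> Basis" for b
    using that i by (cases b) (auto simp: Basis_iff Y_def)
  then have "(\<Sum>b\<in>Basis. scaleO (f b) (pd_mon i b)) = (\<Sum>b\<in>Basis. 0)"
    by (intro sum.cong) (simp_all only: sfun.scale_zero_right)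
  then show ?thesis by (simp add: pd_def)
qed

lemma pd_commute:
  assumes "f \<in> Osup" "i \<in> Y" "j \<in> Y"
  shows "pd i (pd j f) = scaleO ((-1) ^ (\<mu> i * \<mu> j)) (pd j (pd i f))"
proof
  fix b :: monomial
  obtain \<alpha> u where b: "b = (\<alpha>, u)" by (cases b)
  \<comment> \<open>\<open>pass_sign_insert\<close> needs a finite set; for an infinite one the
    coefficients on both sides are zero.\<close>
  have fin: "f (\<alpha>, insert i (insert j u)) \<noteq> 0 \<Longrightarrow> finite u"
    using Osup_outside[OF assms(1)] by (auto simp: Basis_iff) (meson finite_sub_Y1 insert_subset)
  consider "i \<in> Y0" "j \<in> Y0" | "i \<in> Y0" "j \<in> Y1" | "i \<in> Y1" "j \<in> Y0" | "i \<in> Y1" "j \<in> Y1"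
    using assms by (auto simp: Y_def)
  then show "pd i (pd j f) b = scaleO ((-1) ^ (\<mu> i * \<mu> j)) (pd j (pd i f)) b"
  proof cases
    case 1
    show ?thesis
      by (cases "i = j") (use 1 assms b in \<open>auto simp: pd_even_apply fun_upd_twist\<close>)
  next
    case 4
    show ?thesis
    proof (cases "finite u")
      case True
      then show ?thesis using 4 assms b
        by (cases "i = j") (auto simp: pd_odd_apply pass_sign_insert insert_commute)
    next
      case False
      then have "f (\<alpha>, insert i (insert j u)) = 0" using fin by blast
      then show ?thesis using 4 assms b
        by (auto simp: pd_odd_apply insert_commute)
    qed
  qed (use assms b in \<open>auto simp: pd_even_apply pd_odd_apply\<close>)
qed

lemma pd_odd_square: "f \<in> Osup \<Longrightarrow> i \<in> Y1 \<Longrightarrow> pd i (pd i f) = 0"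
  by (rule ext) (auto simp: pd_odd_apply split_paired_all)

end

declare zero_fun_apply [simp del] plus_fun_apply [simp del] scaleO_apply [simp del] scaleW_apply [simp del]
  scaleL_apply [simp del] minus_apply [simp del] uminus_apply [simp del]

lemmas pointwise_apply = zero_fun_apply plus_fun_apply scaleO_apply scaleW_apply scaleL_apply minus_apply uminus_apply

section \<open>Associativity, parity and supercommutativity of the product\<close>

context hamiltonian
begin

lemma multi_binom_add: "multi_binom \<alpha> \<beta> * multi_binom (\<alpha> + \<beta>) \<gamma> = multi_binom \<beta> \<gamma> * (multi_binom \<alpha> (\<beta> + \<gamma>) :: 'a::field)"
proof -
  have "of_nat ((\<alpha> i + \<beta> i) choose \<alpha> i) * of_nat ((\<alpha> i + \<beta> i + \<gamma> i) choose (\<alpha> i + \<beta> i))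
      = of_nat ((\<beta> i + \<gamma> i) choose \<beta> i) * (of_nat ((\<alpha> i + (\<beta> i + \<gamma> i)) choose \<alpha> i) :: 'a)" for i
    unfolding of_nat_mult[symmetric] choose_mult_add by (simp add: add.assoc)
  then show ?thesis
    by (simp add: multi_binom_def prod.distrib[symmetric] pointwise_apply)
qed

lemma multi_binom_commute: "multi_binom \<alpha> \<beta> = multi_binom \<beta> \<alpha>"
  unfolding multi_binom_def by (intro prod.cong refl) (simp add: binomial_symmetric[of "\<alpha> _"] add.commute)

lemma multi_binom_zero [simp]: "multi_binom 0 \<beta> = 1" "multi_binom \<alpha> 0 = 1"
  by (simp_all add: multi_binom_def pointwise_apply)

lemma mult_mon_mon':
  assumes "\<alpha> \<in> A" "\<beta> \<in> A" "u \<subseteq> Y1" "v \<subseteq> Y1"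
  shows "mult (mon (\<alpha>, u)) (mon (\<beta>, v)) =
    (if \<alpha> + \<beta> \<in> A \<and> u \<inter> v = {} then scaleO (sort_sign u v * multi_binom \<alpha> \<beta>) (mon (\<alpha> + \<beta>, u \<union> v))
     else (0 :: 'a::field sfun))"
  using assms by (simp add: mult_mon_mon Basis_iff mult_mon_alt)

lemma mult_mon_assoc:
  assumes "a \<in> Basis" "b \<in> Basis" "c \<in> Basis"
  shows "mult (mult (mon a) (mon b)) (mon c) = mult (mon a) (mult (mon b) (mon c) :: 'a::field sfun)"
proof -
  obtain \<alpha> u \<beta> v \<gamma> w where abc: "a = (\<alpha>, u)" "b = (\<beta>, v)" "c = (\<gamma>, w)"
    by (metis surj_pair)
  have in_A: "\<alpha> \<in> A" "\<beta> \<in> A" "\<gamma> \<in> A" and sub: "u \<subseteq> Y1" "v \<subseteq> Y1" "w \<subseteq> Y1"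
    using assms abc by (auto simp: Basis_iff)
  then have fin: "finite u" "finite v" "finite w"
    by (auto intro: finite_sub_Y1)
  have sub': "u \<union> v \<subseteq> Y1" "v \<union> w \<subseteq> Y1" using sub by auto
  show ?thesis
  \<comment> \<open>Both bracketings survive under the same condition on the whole product:
    \<open>A\<close> contains every smaller multi-index, so no partial product dies before the whole
    one does.\<close>
  proof (cases "\<alpha> + \<beta> + \<gamma> \<in> A \<and> u \<inter> v = {} \<and> (u \<union> v) \<inter> w = {}")
    case True
    then have "\<alpha> + \<beta> \<in> A" "\<alpha> + (\<beta> + \<gamma>) \<in> A" "v \<inter> w = {}" "u \<inter> (v \<union> w) = {}" "u \<inter> w = {}"
      using A_addD(1)[of "\<alpha> + \<beta>" \<gamma>] by (auto simp: add.assoc)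
    moreover from this have "\<beta> + \<gamma> \<in> A" using A_addD(2) by blast
    ultimately have "sort_sign u v * multi_binom \<alpha> \<beta> * (sort_sign (u \<union> v) w * multi_binom (\<alpha> + \<beta>) \<gamma>) =
        sort_sign v w * multi_binom \<beta> \<gamma> * (sort_sign u (v \<union> w) * (multi_binom \<alpha> (\<beta> + \<gamma>) :: 'a))"
      using True fin multi_binom_add[of \<alpha> \<beta> \<gamma>, where 'a = 'a]
      by (simp add: sort_sign_union_left sort_sign_union_right mult.left_commute mult.assoc)
         (simp add: mult.left_commute)?
    then show ?thesis
      using True A_addD(2)[of \<alpha> \<open>\<beta> + \<gamma>\<close>] A_addD(1)[of \<open>\<alpha> + \<beta>\<close> \<gamma>]
      Int_Un_distrib[of u v w] Int_Un_distrib2[of u v w]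
      unfolding abc
      by (simp add: mult_mon_mon' in_A sub sub' mult_linear add.assoc Un_assoc)
  next
    case False
    have l: "mult (mult (mon a) (mon b)) (mon c) = (0 :: 'a sfun)"
      using False unfolding abc
      by (auto simp: mult_mon_mon' in_A sub sub' mult_linear)
    have r: "mult (mon a) (mult (mon b) (mon c)) = (0 :: 'a sfun)"
      using False unfolding abc
      by (auto simp: mult_mon_mon' in_A sub sub' mult_linear add.assoc)
    show ?thesis using l r by simp
  qed
qed

lemma mult_assoc:
  assumes "f \<in> Osup" "g \<in> Osup" "h \<in> Osup"
  shows "mult (mult f g) h = mult f (mult g (h :: 'a::field sfun))"
proof -
  have 1: "mult (mult (mon a) (mon b)) h = mult (mon a) (mult (mon b) h)"
    if "a \<in> Basis" "b \<in> Basis" for a b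
    using finite_Basis assms(3)[unfolded Osup_eq]
    by (induction rule: supp_on_induct) (simp_all add: mult_linear mult_mon_assoc that)
  have 2: "mult (mult (mon a) g) h = mult (mon a) (mult g h)" if "a \<in> Basis" for a
    using finite_Basis assms(2)[unfolded Osup_eq]
    by (induction rule: supp_on_induct) (simp_all add: mult_linear 1 that)
  show ?thesis
    using finite_Basis assms(1)[unfolded Osup_eq]
    by (induction rule: supp_on_induct) (simp_all add: mult_linear 2)
qed

text \<open>Only the parity of q matters, by \<open>Opar_cong\<close>. Keeping a natural number lets
  parities be added under products and derivatives.\<close>

definition Opar :: "nat \<Rightarrow> 'a::field sfun set" where
  "Opar q = supp_on {b \<in> Basis. even (par b + q)}"

lemma Opar_closed [intro]:
  "0 \<in> Opar q"
  "f \<in> Opar q \<Longrightarrow> g \<in> Opar q \<Longrightarrow> f + g \<in> Opar q"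
  "f \<in> Opar q \<Longrightarrow> g \<in> Opar q \<Longrightarrow> f - g \<in> Opar q"
  "f \<in> Opar q \<Longrightarrow> - f \<in> Opar q"
  "f \<in> Opar q \<Longrightarrow> scaleO c f \<in> Opar q"
  by (auto simp: Opar_def)

lemma Opar_sum: "(\<And>x. x \<in> X \<Longrightarrow> F x \<in> Opar q) \<Longrightarrow> (\<Sum>x\<in>X. F x) \<in> Opar q"
  unfolding Opar_def by (rule supp_on_sum)

lemma Opar_Osup: "f \<in> Opar q \<Longrightarrow> f \<in> Osup"
  unfolding Opar_def Osup_eq by (erule supp_on_mono[rotated]) auto

lemma Opar_cong: "even (q + r) \<Longrightarrow> Opar q = Opar r"
  unfolding Opar_def by (rule arg_cong[of _ _ supp_on]) auto

lemma mon_Opar [simp]: "(mon b :: 'a::field sfun) \<in> Opar q \<longleftrightarrow> b \<in> Basis \<and> even (par b + q)"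
  by (simp add: Opar_def)

lemma Opar_induct [consumes 1, case_names zero mon add scale]:
  assumes "f \<in> Opar q" "P 0"
    "\<And>b. b \<in> Basis \<Longrightarrow> even (par b + q) \<Longrightarrow> P (mon b)" "\<And>f g. P f \<Longrightarrow> P g \<Longrightarrow> P (f + g)"
    "\<And>c f. P f \<Longrightarrow> P (scaleO c f)"
  shows "P f"
  using assms(1) unfolding Opar_def
  by (rule supp_on_induct[rotated]) (use assms in auto)

lemma Osup_induct [consumes 1, case_names zero mon add scale]:
  assumes "f \<in> Osup" "P 0"
    "\<And>b. b \<in> Basis \<Longrightarrow> P (mon b)" "\<And>f g. P f \<Longrightarrow> P g \<Longrightarrow> P (f + g)"
    "\<And>c f. P f \<Longrightarrow> P (scaleO c f)"
  shows "P f"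
  using assms(1) unfolding Osup_eq
  by (rule supp_on_induct[rotated]) (use assms in auto)

lemma mult_mon_commute:
  assumes "b \<in> Basis" "c \<in> Basis"
  shows "mult (mon b) (mon c) = scaleO ((-1) ^ (par b * par c)) (mult (mon c) (mon b) :: 'a::field sfun)"
proof -
  obtain \<alpha> u \<beta> v where multi_binom: "b = (\<alpha>, u)" "c = (\<beta>, v)" by (metis surj_pair)
  have *: "\<alpha> \<in> A" "\<beta> \<in> A" "u \<subseteq> Y1" "v \<subseteq> Y1" using assms multi_binom by (auto simp: Basis_iff)
  show ?thesis
  proof (cases "u \<inter> v = {}")
    case True
    then have "v \<inter> u = {}" by blast
    then show ?thesis
      using True * sort_sign_swap[of u v, where 'a = 'a]
      by (simp add: multi_binom mult_mon_mon' par_def finite_sub_Y1 multi_binom_commute[of \<alpha>] add.commute Un_commute mult.assoc)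
  next
    case False
    then have "v \<inter> u \<noteq> {}" by blast
    then show ?thesis using False * by (simp add: multi_binom mult_mon_mon')
  qed
qed

lemma mult_commute:
  assumes "f \<in> Opar q" "g \<in> Opar r"
  shows "mult f g = scaleO ((-1) ^ (q * r)) (mult g (f :: 'a::field sfun))"
proof -
  have sgn: "(-1) ^ (a * b) = ((-1) ^ (q * r) :: 'a)" if "even (a + q)" "even (b + r)" for a b
  proof -
    have "even (a * b) = even (q * r)" using that by auto
    then show ?thesis by (simp add: minus_one_power_iff)
  qed
  have 1: "mult (mon b) g = scaleO ((-1) ^ (q * r)) (mult g (mon b))"
    if b: "b \<in> Basis" "even (par b + q)" for b
    using assms(2)
  proof (induction rule: Opar_induct)
    case (mon c)
    show ?case using mult_mon_commute[OF b(1) mon(1), where 'a = 'a] sgn[OF b(2) mon(2)] by simp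
  qed (simp_all add: mult_linear sfun.scale_right_distrib mult.commute)
  show ?thesis
    using assms(1)
    by (induction rule: Opar_induct)
      (simp_all add: mult_linear sfun.scale_right_distrib 1 mult.commute)
qed

lemma mult_Opar [intro]:
  assumes "f \<in> Opar q" "g \<in> Opar r"
  shows "mult f g \<in> (Opar (q + r) :: 'a::field sfun set)"
proof -
  have 0: "mult (mon b) (mon c) \<in> (Opar (q + r) :: 'a sfun set)"
    if "b \<in> Basis" "even (par b + q)" "c \<in> Basis" "even (par c + r)" for b c
  proof -
    obtain \<alpha> u \<beta> v where multi_binom: "b = (\<alpha>, u)" "c = (\<beta>, v)" by (metis surj_pair)
    have *: "\<alpha> \<in> A" "\<beta> \<in> A" "u \<subseteq> Y1" "v \<subseteq> Y1" using that multi_binom by (auto simp: Basis_iff)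
    then have "card (u \<union> v) = card u + card v" if "u \<inter> v = {}"
      using that by (intro card_Un_disjoint finite_sub_Y1)
    then show ?thesis using that * unfolding multi_binom
      by (auto simp: mult_mon_mon' par_def Basis_iff intro!: Opar_closed)
  qed
  have 1: "mult (mon b) g \<in> Opar (q + r)" if "b \<in> Basis" "even (par b + q)" for b
    using assms(2)
  proof (induction rule: Opar_induct)
    case (mon c)
    then show ?case using 0 that by blast
  qed (simp_all add: mult_linear Opar_closed)
  show ?thesis
    using assms(1)
    by (induction rule: Opar_induct) (simp_all add: mult_linear Opar_closed 1)
qed

lemma pd_Opar [intro]:
  assumes "f \<in> Opar q" "i \<in> Y"
  shows "pd i f \<in> (Opar (q + \<mu> i) :: 'a::field sfun set)"
  using assms(1)
proof (induction rule: Opar_induct)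
  case (mon b)
  obtain \<alpha> u where b: "b = (\<alpha>, u)" by (metis surj_pair)
  have u: "finite u" "u \<subseteq> Y1" "\<alpha> \<in> A" using mon b finite_sub_Y1 by (auto simp: Basis_iff)
  show ?case
  proof (cases "i \<in> Y0")
    case True
    then show ?thesis using mon u
      by (auto simp: b pd_mon_Y0 par_def Basis_iff A_lower)
  next
    case False
    then have i: "i \<in> Y1" using assms(2) by (simp add: Y_def)
    show ?thesis
    proof (cases "i \<in> u")
      case True
      then have "card u = Suc (card (u - {i}))" using u(1) True by (simp only: card_Suc_Diff1)
      then have "even (card (u - {i}) + (q + 1))" using mon
        by (simp add: b par_def)
      then show ?thesis using True i mon u
        by (auto simp: b pd_mon_Y1 par_def Basis_iff intro!: Opar_closed)
    next
      case False
      then show ?thesis using i mon by (simp add: b pd_mon_Y1 Opar_closed)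
    qed
  qed
qed (simp_all add: pd_linear Opar_closed)

end

text \<open>The hypotheses of the theorem. The characteristic belongs to the type of scalars, so a
  type token fixes the ground field for the whole locale.\<close>

locale hamiltonian_char = hamiltonian p m n t
  for p m n :: nat and t :: "nat \<Rightarrow> nat" +
  fixes field_type :: "'a::field itself"
  assumes char_p: "CHAR('a) = p"
    and p_gt_3: "p > 3" and m_gt_1: "m > 1" and n_gt_3: "n > 3"
    and t_pos: "\<forall>i\<in>{1..2 * m}. t i \<ge> 1"
begin

lemma prime_p: "prime p"
proof -
  have "CHAR('a) > 0" using char_p p_gt_3 by simp
  then have "prime CHAR('a)" by (rule prime_CHAR_semidom)
  then show ?thesis using char_p by simp
qed

lemma of_nat_eq_0_iff': "of_nat k = (0 :: 'a) \<longleftrightarrow> p dvd k"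
  using of_nat_eq_0_iff_char_dvd[where 'a = 'a, of k] char_p by simp

text \<open>By absorption p^s divides a times the binomial coefficient. If p did not divide the
  latter, p^s would divide a, which is smaller.\<close>

lemma of_nat_choose_zero:
  assumes "0 < a" "a < p ^ s"
  shows "of_nat (p ^ s choose a) = (0 :: 'a)"
proof -
  have "a * (p ^ s choose a) = p ^ s * ((p ^ s - 1) choose (a - 1))"
    using binomial_absorption[of "a - 1" "p ^ s"] assms by simp
  then have dvd: "p ^ s dvd a * (p ^ s choose a)" by simp
  show ?thesis
  proof (rule ccontr)
    assume "of_nat (p ^ s choose a) \<noteq> (0 :: 'a)"
    then have "\<not> p dvd (p ^ s choose a)" by (simp add: of_nat_eq_0_iff')
    then have "coprime (p ^ s) (p ^ s choose a)"
      using prime_p by (simp add: prime_imp_coprime)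
    then have "p ^ s dvd a" using dvd by (simp add: coprime_dvd_mult_left_iff)
    then show False using assms by (auto dest: dvd_imp_le)
  qed
qed

section \<open>The Leibniz rule\<close>

lemma top_index_pos: "i \<in> Y0 \<Longrightarrow> Suc (top_index i) = p ^ t i"
  using p_gt_3 by (simp add: top_index_def)

lemma multi_binom_remove:
  assumes "i \<in> Y0"
  shows "multi_binom \<alpha> \<beta> = of_nat ((\<alpha> i + \<beta> i) choose \<alpha> i) *
    (\<Prod>j\<in>Y0 - {i}. of_nat ((\<alpha> j + \<beta> j) choose (\<alpha> j)) :: 'b::field)"
  unfolding multi_binom_def using assms by (rule prod.remove[OF finite_Y0])

text \<open>Pascal's rule, except at the truncation. If \<alpha> + \<beta> leaves \<open>A\<close>
  but its derivative does not, then the index at i is exactly p^(t i), and the two terms on the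
  right add up to a multiple of a binomial coefficient divisible by p.\<close>

lemma leibniz_mon_even:
  assumes "b \<in> Basis" "c \<in> Basis" "i \<in> Y0"
  shows "pd i (mult (mon b) (mon c)) =
    mult (pd i (mon b)) (mon c) + mult (mon b) (pd i (mon c) :: 'a sfun)"
proof -
  obtain \<alpha> u \<beta> v where multi_binom: "b = (\<alpha>, u)" "c = (\<beta>, v)" by (metis surj_pair)
  have *: "\<alpha> \<in> A" "\<beta> \<in> A" "u \<subseteq> Y1" "v \<subseteq> Y1" "(\<alpha>, u) \<in> Basis" "(\<beta>, v) \<in> Basis"
    using assms multi_binom by (auto simp: Basis_iff)
  define \<gamma> where "\<gamma> = (\<alpha> + \<beta>)(i := \<alpha> i + \<beta> i - 1)"
  define P where "P = (\<Prod>j\<in>Y0 - {i}. of_nat ((\<alpha> j + \<beta> j) choose (\<alpha> j)) :: 'a)"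
  have low: "\<alpha>(i := \<alpha> i - Suc 0) \<in> A" "\<beta>(i := \<beta> i - Suc 0) \<in> A" using * A_lower by blast+
  have s1: "\<alpha>(i := \<alpha> i - Suc 0) + \<beta> = \<gamma>" if "\<alpha> i > 0" using that by (auto simp: \<gamma>_def fun_eq_iff pointwise_apply)
  have s2: "\<alpha> + \<beta>(i := \<beta> i - Suc 0) = \<gamma>" if "\<beta> i > 0" using that by (auto simp: \<gamma>_def fun_eq_iff pointwise_apply)
  have b0: "multi_binom \<alpha> \<beta> = of_nat ((\<alpha> i + \<beta> i) choose \<alpha> i) * P" unfolding P_def using assms(3) by (rule multi_binom_remove)
  have b1: "multi_binom (\<alpha>(i := \<alpha> i - Suc 0)) \<beta> = of_nat ((\<alpha> i - 1 + \<beta> i) choose (\<alpha> i - 1)) * P"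
    unfolding multi_binom_remove[OF assms(3)] P_def by simp
  have b2: "multi_binom \<alpha> (\<beta>(i := \<beta> i - Suc 0)) = of_nat ((\<alpha> i + (\<beta> i - 1)) choose \<alpha> i) * P"
    unfolding multi_binom_remove[OF assms(3)] P_def by simp
  have bin: "((\<alpha> i + \<beta> i) choose \<alpha> i) =
      (if \<alpha> i > 0 then (\<alpha> i - 1 + \<beta> i) choose (\<alpha> i - 1) else 0) +
      (if \<beta> i > 0 then (\<alpha> i + (\<beta> i - 1)) choose \<alpha> i else 0)" if "\<alpha> i + \<beta> i > 0"
    using that by (cases "\<alpha> i"; cases "\<beta> i") auto
  have rhs: "mult (pd i (mon b)) (mon c) + mult (mon b) (pd i (mon c)) =
    (if \<gamma> \<in> A \<and> u \<inter> v = {} \<and> \<alpha> i + \<beta> i > 0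
     then scaleO (sort_sign u v * (of_nat ((\<alpha> i + \<beta> i) choose \<alpha> i) * P)) (mon (\<gamma>, u \<union> v)) else (0 :: 'a sfun))"
    unfolding multi_binom using bin
    by (auto simp: pd_mon_Y0 assms * low mult_mon_mon' s1 s2 b1 b2
        sfun.scale_left_distrib[symmetric] distrib_left[symmetric] distrib_right[symmetric] of_nat_add[symmetric]
        simp del: of_nat_add)
  show ?thesis
  proof (cases "\<alpha> + \<beta> \<in> A")
    case True
    then have "\<gamma> \<in> A" unfolding \<gamma>_def using A_lower[of "\<alpha> + \<beta>" i] by (simp add: pointwise_apply)
    then show ?thesis using True unfolding rhs unfolding multi_binom
      by (auto simp: mult_mon_mon' * pd_linear pd_mon_Y0 Basis_iff assms(3) b0 \<gamma>_def pointwise_apply)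
  next
    case False
    have "of_nat ((\<alpha> i + \<beta> i) choose \<alpha> i) = (0 :: 'a)" if "\<gamma> \<in> A" "\<alpha> i + \<beta> i > 0"
    proof -
      have "(\<alpha> + \<beta>) j \<le> top_index j" if "j \<noteq> i" for j
        using A_le_top[OF \<open>\<gamma> \<in> A\<close>, of j] that by (simp add: \<gamma>_def pointwise_apply)
      then have "\<alpha> i + \<beta> i > top_index i" using False by (metis A_iff leI plus_fun_apply)
      moreover have "\<alpha> i + \<beta> i - 1 \<le> top_index i"
        using A_le_top[OF \<open>\<gamma> \<in> A\<close>, of i] by (simp add: \<gamma>_def pointwise_apply)
      ultimately have e: "\<alpha> i + \<beta> i = p ^ t i"
        using top_index_pos[OF assms(3)] that by linarith
      moreover have "\<beta> i < p ^ t i" "\<alpha> i < p ^ t i"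
        using A_le_top[of \<beta> i] A_le_top[of \<alpha> i] * top_index_pos[OF assms(3)] by linarith+
      ultimately show ?thesis by (intro of_nat_choose_zero[of _ "t i", folded e]) auto
    qed
    then show ?thesis using False unfolding rhs unfolding multi_binom
      by (auto simp: mult_mon_mon' *)
  qed
qed

text \<open>A comparison of signs. If x_i occurs in both factors, the product is zero, and the two
  terms on the right are the same monomial with opposite signs.\<close>

lemma leibniz_mon_odd:
  assumes "b \<in> Basis" "c \<in> Basis" "i \<in> Y1"
  shows "pd i (mult (mon b) (mon c)) =
    mult (pd i (mon b)) (mon c) + scaleO ((-1) ^ par b) (mult (mon b) (pd i (mon c) :: 'b::field sfun))"
proof -
  obtain \<alpha> u \<beta> v where multi_binom: "b = (\<alpha>, u)" "c = (\<beta>, v)" by (metis surj_pair)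
  have *: "\<alpha> \<in> A" "\<beta> \<in> A" "u \<subseteq> Y1" "v \<subseteq> Y1" "(\<alpha>, u) \<in> Basis" "(\<beta>, v) \<in> Basis"
    "u - {i} \<subseteq> Y1" "v - {i} \<subseteq> Y1"
    using assms multi_binom by (auto simp: Basis_iff)
  have fin: "finite u" "finite v" using * finite_sub_Y1 by auto
  have left: "sort_sign u v = sort_sign (u - {i}) v * (pass_sign i v :: 'b)" if "i \<in> u"
  proof -
    have "sort_sign ((u - {i}) \<union> {i}) v = sort_sign (u - {i}) v * (sort_sign {i} v :: 'b)"
      using fin by (intro sort_sign_union_left) auto
    moreover have "(u - {i}) \<union> {i} = u" using that by auto
    ultimately show ?thesis by (simp add: sort_sign_single_left)
  qed
  have right: "sort_sign w v = sort_sign w (v - {i}) * ((-1) ^ card w * pass_sign i w :: 'b)"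
    if "i \<in> v" "finite w" "i \<notin> w" for w
  proof -
    have "sort_sign w ((v - {i}) \<union> {i}) = sort_sign w (v - {i}) * (sort_sign w {i} :: 'b)"
      using fin that by (intro sort_sign_union_right) auto
    moreover have "(v - {i}) \<union> {i} = v" using that by auto
    ultimately show ?thesis using that by (simp add: sort_sign_single_right)
  qed
  have m1: "(-1) ^ k * ((-1) ^ k * x) = (x :: 'b)" for k x
    by (simp add: mult.assoc[symmetric] power_mult_distrib[symmetric])
  have sl2: "pass_sign i w * (pass_sign i w * x) = (x :: 'b)" for w x
    by (simp add: mult.assoc[symmetric])
  consider "i \<notin> u" "i \<notin> v" | "i \<in> u" "i \<notin> v" | "i \<notin> u" "i \<in> v" | "i \<in> u" "i \<in> v" by blast
  then show ?thesis
  proof cases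
    case 1
    then show ?thesis unfolding multi_binom
      by (auto simp: mult_mon_mon' * pd_linear pd_mon_Y1 Basis_iff assms(3))
  next
    case 2
    have "(u - {i}) \<inter> v = u \<inter> v" "u \<union> v - {i} = (u - {i}) \<union> v" using 2 by auto
    moreover have "sort_sign u v * multi_binom \<alpha> \<beta> * pass_sign i (u \<union> v) = pass_sign i u * (sort_sign (u - {i}) v * (multi_binom \<alpha> \<beta> :: 'b))" if "u \<inter> v = {}"
    proof -
      have "sort_sign u v * multi_binom \<alpha> \<beta> * pass_sign i (u \<union> v) = pass_sign i u * (sort_sign (u - {i}) v * multi_binom \<alpha> \<beta>) * (pass_sign i v * (pass_sign i v :: 'b))"
        unfolding left[OF 2(1)] pass_sign_union[OF fin that] by (simp only: mult_ac)
      then show ?thesis by simp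
    qed
    ultimately show ?thesis using 2 unfolding multi_binom
      by (cases "u \<inter> v = {}") (simp_all add: mult_mon_mon' * pd_linear pd_mon_Y1 Basis_iff assms(3) mult_linear mult.assoc)
  next
    case 3
    have "u \<inter> (v - {i}) = u \<inter> v" "u \<union> v - {i} = u \<union> (v - {i})" using 3 by auto
    moreover have "sort_sign u v * multi_binom \<alpha> \<beta> * pass_sign i (u \<union> v) = (-1) ^ card u * (pass_sign i v * (sort_sign u (v - {i}) * (multi_binom \<alpha> \<beta> :: 'b)))"
      if "u \<inter> v = {}"
    proof -
      have "sort_sign u v * multi_binom \<alpha> \<beta> * pass_sign i (u \<union> v)
          = (-1) ^ card u * (pass_sign i v * (sort_sign u (v - {i}) * multi_binom \<alpha> \<beta>)) * (pass_sign i u * (pass_sign i u :: 'b))"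
        unfolding right[OF 3(2) fin(1) 3(1)] pass_sign_union[OF fin that] by (simp only: mult_ac)
      then show ?thesis by simp
    qed
    ultimately show ?thesis using 3 unfolding multi_binom
      by (cases "u \<inter> v = {}") (simp_all add: mult_mon_mon' * pd_linear pd_mon_Y1 Basis_iff assms(3) par_def mult_linear)
  next
    case 4
    have c: "card u = Suc (card (u - {i}))" using fin 4 by (simp only: card_Suc_Diff1)
    have "(u - {i}) \<inter> v = u \<inter> (v - {i})" "(u - {i}) \<union> v = u \<union> (v - {i})" "u \<inter> v \<noteq> {}" using 4 by auto
    moreover have "pass_sign i u * sort_sign (u - {i}) v + (-1) ^ card u * (pass_sign i v * sort_sign u (v - {i})) = (0 :: 'b)"
    proof -
      have 1: "sort_sign (u - {i}) v = sort_sign (u - {i}) (v - {i}) * ((-1) ^ card (u - {i}) * pass_sign i u :: 'b)"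
        using right[OF 4(2), of "u - {i}"] fin by simp
      have "sort_sign ((u - {i}) \<union> {i}) (v - {i}) = sort_sign (u - {i}) (v - {i}) * (sort_sign {i} (v - {i}) :: 'b)"
        using fin by (intro sort_sign_union_left) auto
      moreover have "(u - {i}) \<union> {i} = u" using 4 by auto
      ultimately have 2: "sort_sign u (v - {i}) = sort_sign (u - {i}) (v - {i}) * (pass_sign i v :: 'b)"
        by (simp add: sort_sign_single_left)
      let ?S = "sort_sign (u - {i}) (v - {i}) :: 'b" and ?k = "card (u - {i})"
      have "pass_sign i u * (?S * ((-1) ^ ?k * pass_sign i u)) = ?S * (-1) ^ ?k * (pass_sign i u * pass_sign i u)"
        by (simp only: mult_ac)
      moreover have "(-1) ^ Suc ?k * (pass_sign i v * (?S * pass_sign i v)) = ?S * (-1) ^ Suc ?k * (pass_sign i v * pass_sign i v)"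
        by (simp only: mult_ac)
      ultimately show ?thesis unfolding 1 2 c by simp
    qed
    then have "pass_sign i u * (sort_sign (u - {i}) v * multi_binom \<alpha> \<beta>) +
        (-1) ^ card u * (pass_sign i v * (sort_sign u (v - {i}) * multi_binom \<alpha> \<beta>)) = (0 :: 'b)"
      by (simp only: mult.assoc[symmetric] distrib_right[symmetric] mult_zero_left)
    ultimately show ?thesis using 4 unfolding multi_binom
      by (cases "u \<inter> (v - {i}) = {}")
        (simp_all add: mult_mon_mon' * pd_linear pd_mon_Y1 assms(3) par_def mult_linear mult.assoc
          sfun.scale_left_distrib[symmetric])
  qed
qed

lemma leibniz:
  assumes "f \<in> Opar q" "g \<in> Osup" "i \<in> Y"
  shows "pd i (mult f g) = mult (pd i f) g + scaleO ((-1) ^ (\<mu> i * q)) (mult f (pd i g :: 'a sfun))"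
proof -
  have sgn: "(-1) ^ (\<mu> i * k) = ((-1) ^ (\<mu> i * q) :: 'a)" if "even (k + q)" for k
    using that by (auto simp: minus_one_power_iff)
  have 0: "pd i (mult (mon b) (mon c)) =
      mult (pd i (mon b)) (mon c) + scaleO ((-1) ^ (\<mu> i * par b)) (mult (mon b) (pd i (mon c) :: 'a sfun))"
    if "b \<in> Basis" "c \<in> Basis" for b c
  proof (cases "i \<in> Y0")
    case True
    then show ?thesis using leibniz_mon_even[OF that] by simp
  next
    case False
    then have "i \<in> Y1" using assms by (simp add: Y_def)
    then show ?thesis using leibniz_mon_odd[OF that, where 'b = 'a] by simp
  qed
  have 1: "pd i (mult (mon b) g) = mult (pd i (mon b)) g + scaleO ((-1) ^ (\<mu> i * q)) (mult (mon b) (pd i g))"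
    if "b \<in> Basis" "even (par b + q)" for b
    using assms(2)
  proof (induction rule: Osup_induct)
    case (mon c)
    show ?case unfolding 0[OF that(1) mon] sgn[OF that(2)] ..
  qed (simp_all add: mult_linear pd_linear sfun.scale_right_distrib mult.commute)
  show ?thesis
    using assms(1)
    by (induction rule: Opar_induct)
      (simp_all add: 1 mult_linear pd_linear sfun.scale_right_distrib mult.commute)
qed

end

section \<open>Even vector fields and the Poisson bracket\<close>

text \<open>A vector field is a function with functions as values, and the general pointwise rules
  would fire at every level. These rules unfold coordinates only, \<open>sf_apply\<close>
  coefficients only, and \<open>lf_apply\<close> the maps between fields only.\<close>

lemma vf_apply:
  fixes D E :: "'b::field vfield"
  shows "(D + E) i = D i + E i" "(D - E) i = D i - E i" "(- D) i = - D i" "(0 :: 'b vfield) i = 0"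
    "scaleW c D i = scaleO c (D i)" "(\<Sum>x\<in>X. F x) i = (\<Sum>x\<in>X. (F x :: 'b vfield) i)"
  by (simp_all add: pointwise_apply sum_fun_apply)

lemma sf_apply:
  fixes f g :: "'b::field sfun"
  shows "(f + g) b = f b + g b" "(f - g) b = f b - g b" "(- f) b = - f b" "(0 :: 'b sfun) b = 0"
    "scaleO c f b = c * f b" "(\<Sum>x\<in>X. F x) b = (\<Sum>x\<in>X. (F x :: 'b sfun) b)"
  by (simp_all add: pointwise_apply sum_fun_apply)

section \<open>Even fields as derivations of functions\<close>

context hamiltonian
begin

lemma mult_apply_nonzeroE:
  assumes "mult f g (\<gamma>, w) \<noteq> (0 :: 'b::field)"
  obtains \<alpha> u \<beta> v where "(\<alpha>, u) \<in> Basis" "(\<beta>, v) \<in> Basis" "f (\<alpha>, u) \<noteq> 0" "g (\<beta>, v) \<noteq> 0"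
    "\<gamma> = \<alpha> + \<beta>" "w = u \<union> v" "u \<inter> v = {}"
proof -
  obtain b where b: "b \<in> Basis" "(\<Sum>c\<in>Basis. f b * g c * mult_mon b c (\<gamma>, w)) \<noteq> 0"
    using assms unfolding mult_def sum_fun_apply pointwise_apply by (meson sum.not_neutral_contains_not_neutral)
  then obtain c where c: "c \<in> Basis" "f b * g c * mult_mon b c (\<gamma>, w) \<noteq> 0"
    by (meson sum.not_neutral_contains_not_neutral)
  obtain \<alpha> u \<beta> v where multi_binom: "b = (\<alpha>, u)" "c = (\<beta>, v)" by (metis surj_pair)
  have "\<gamma> = \<alpha> + \<beta>" "w = u \<union> v" "u \<inter> v = {}"
    using c(2) unfolding multi_binom mult_mon_alt by (auto simp: pointwise_apply mon_apply split: if_splits)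
  then show ?thesis using that[of \<alpha> u \<beta> v] b(1) c unfolding multi_binom by auto
qed

lemma Weven_iff: "D \<in> Weven \<longleftrightarrow> (\<forall>i\<in>Y. D i \<in> Opar (\<mu> i)) \<and> (\<forall>i. i \<notin> Y \<longrightarrow> D i = (0 :: 'b::field sfun))"
proof -
  have "D i \<in> Opar (\<mu> i) \<longleftrightarrow> D i \<in> Osup \<and> (\<forall>b. D i b \<noteq> 0 \<longrightarrow> even (par b + \<mu> i))" for i
    unfolding Opar_def Osup_def supp_on_def by blast
  then show ?thesis unfolding Weven_def Witt_def by blast
qed

lemma Weven_Opar: "D \<in> Weven \<Longrightarrow> i \<in> Y \<Longrightarrow> D i \<in> Opar (\<mu> i)"
  by (simp add: Weven_iff)

lemma Weven_outside: "D \<in> Weven \<Longrightarrow> i \<notin> Y \<Longrightarrow> D i = 0"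
  by (simp add: Weven_iff)

lemma Weven_Osup [simp]: "D \<in> Weven \<Longrightarrow> D i \<in> Osup"
  by (cases "i \<in> Y") (auto simp: Weven_outside dest: Weven_Opar Opar_Osup)

lemma Weven_closed [simp, intro]:
  "0 \<in> Weven"
  "D \<in> Weven \<Longrightarrow> E \<in> Weven \<Longrightarrow> D + E \<in> Weven"
  "D \<in> Weven \<Longrightarrow> E \<in> Weven \<Longrightarrow> D - E \<in> Weven"
  "D \<in> Weven \<Longrightarrow> - D \<in> Weven"
  "D \<in> Weven \<Longrightarrow> scaleW c D \<in> Weven"
  by (auto simp: Weven_iff vf_apply)

definition act :: "'b::field vfield \<Rightarrow> 'b sfun \<Rightarrow> 'b sfun" where
  "act D f = (\<Sum>i\<in>Y. mult (D i) (pd i f))"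

lemma act_add: "act D (f + g) = act D f + act D g"
  by (simp add: act_def pd_add mult_add_right sum.distrib)

lemma act_scale: "act D (scaleO c f) = scaleO c (act D f)"
  by (simp add: act_def pd_scale mult_scale_right sfun.scale_sum_right)

lemma act_zero [simp]: "act D 0 = 0"
  by (simp add: act_def)

lemma act_minus: "act D (- f) = - act D f"
  by (simp add: act_def pd_minus mult_minus_right sum_negf)

lemma act_diff: "act D (f - g) = act D f - act D g"
  by (simp add: act_def pd_diff mult_diff_right sum_subtractf)

lemma act_add_left: "act (D + E) f = act D f + act E f"
  by (simp add: act_def mult_add_left sum.distrib plus_fun_apply[of D])

lemma act_scale_left: "act (scaleW c D) f = scaleO c (act D f)"
  by (simp add: act_def mult_scale_left sfun.scale_sum_right scaleW_apply)

lemma act_zero_left [simp]: "act 0 f = 0"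
  by (simp add: act_def zero_fun_apply)

lemma act_Opar:
  assumes "D \<in> Weven" "f \<in> Opar q"
  shows "act D f \<in> (Opar q :: 'b::field sfun set)"
  unfolding act_def
proof (rule Opar_sum)
  fix i assume i: "i \<in> Y"
  have "Opar (\<mu> i + (q + \<mu> i)) = (Opar q :: 'b sfun set)" by (rule Opar_cong) presburger
  then show "mult (D i) (pd i f) \<in> Opar q"
    using mult_Opar[OF Weven_Opar[OF assms(1) i] pd_Opar[OF assms(2) i]] by simp
qed

lemma mult_pd_expand:
  assumes "f \<in> Osup" "g \<in> Osup"
  shows "mult f (pd i g) = (\<Sum>b\<in>Basis. \<Sum>c\<in>Basis. scaleO (f b * g c) (mult (mon b) (pd i (mon c) :: 'b::field sfun)))"
proof -
  note f = supp_on_expand[OF finite_Basis assms(1)[unfolded Osup_eq]]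
  note g = supp_on_expand[OF finite_Basis assms(2)[unfolded Osup_eq]]
  have "mult f (pd i g) = mult (\<Sum>b\<in>Basis. scaleO (f b) (mon b)) (pd i (\<Sum>c\<in>Basis. scaleO (g c) (mon c)))"
    by (rule arg_cong2[of _ _ _ _ "\<lambda>x y. mult x (pd i y)", OF f g])
  also have "\<dots> = (\<Sum>c\<in>Basis. \<Sum>b\<in>Basis. scaleO (g c * f b) (mult (mon b) (pd i (mon c))))"
    by (simp only: mult_sum_left mult_sum_right mult_scale_left mult_scale_right pd_sum pd_scale
        sfun.scale_sum_right sfun.scale_scale)
  also have "\<dots> = (\<Sum>b\<in>Basis. \<Sum>c\<in>Basis. scaleO (f b * g c) (mult (mon b) (pd i (mon c))))"
    by (subst sum.swap) (simp only: mult.commute)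
  finally show ?thesis .
qed

text \<open>A monomial that occurs in an even field has even total parity, so the sign in
  \<open>bracket_mon\<close> is 1 and the bracket becomes a commutator without signs.\<close>

lemma bracket_eq:
  fixes D E :: "'b::field vfield"
  assumes "D \<in> Weven" "E \<in> Weven"
  shows "bracket D E = (\<lambda>j. act D (E j) - act E (D j))"
proof
  fix k
  let ?M = "\<lambda>b i c. mult (mon b) (pd i (mon c)) :: 'b sfun"
  have summand: "scaleW (D i b * E j c) (bracket_mon b i c j) k =
      (if j = k then scaleO (D i b * E j c) (?M b i c) else 0) -
      (if i = k then scaleO (E j c * D i b) (?M c j b) else 0)"
    if "i \<in> Y" "j \<in> Y" for i j b c
  proof (cases "D i b * E j c = 0")
    case False
    then have "D i b \<noteq> 0" "E j c \<noteq> 0" by auto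
    then have "even (par b + \<mu> i)" "even (par c + \<mu> j)"
      using assms that unfolding Weven_def by blast+
    then have "even ((par b + \<mu> i) * (par c + \<mu> j))" by simp
    then show ?thesis
      by (simp add: bracket_mon_def fld_apply minus_apply[of "fld _ _"] scaleW_apply mult.commute sfun.scale_right_diff_distrib)
  qed (auto simp: scaleW_apply)
  have swap: "(\<Sum>b\<in>Basis. \<Sum>c\<in>Basis. scaleO (E j c * D i b) (?M c j b)) = mult (E j) (pd j (D i))" for i j
    by (subst sum.swap) (simp add: mult_pd_expand assms)
  have "bracket D E k = (\<Sum>i\<in>Y. \<Sum>j\<in>Y. \<Sum>b\<in>Basis. \<Sum>c\<in>Basis.
      (if j = k then scaleO (D i b * E j c) (?M b i c) else 0) -
      (if i = k then scaleO (E j c * D i b) (?M c j b) else 0))"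
    unfolding bracket_def vf_apply(6) by (intro sum.cong refl summand)
  also have "\<dots> = (\<Sum>i\<in>Y. \<Sum>j\<in>Y. if j = k then (\<Sum>b\<in>Basis. \<Sum>c\<in>Basis. scaleO (D i b * E j c) (?M b i c)) else 0)
      - (\<Sum>i\<in>Y. \<Sum>j\<in>Y. if i = k then (\<Sum>b\<in>Basis. \<Sum>c\<in>Basis. scaleO (E j c * D i b) (?M c j b)) else 0)"
    unfolding sum_subtractf[symmetric] by (intro sum.cong refl) (simp add: sum_subtractf)
  also have "(\<Sum>i\<in>Y. \<Sum>j\<in>Y. if i = k then (\<Sum>b\<in>Basis. \<Sum>c\<in>Basis. scaleO (E j c * D i b) (?M c j b)) else 0)
      = (\<Sum>i\<in>Y. if i = k then (\<Sum>j\<in>Y. mult (E j) (pd j (D i))) else 0)"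
    by (intro sum.cong refl) (simp add: swap)
  also have "(\<Sum>i\<in>Y. \<Sum>j\<in>Y. if j = k then (\<Sum>b\<in>Basis. \<Sum>c\<in>Basis. scaleO (D i b * E j c) (?M b i c)) else 0)
      = (\<Sum>i\<in>Y. if k \<in> Y then mult (D i) (pd i (E k)) else 0)"
    using assms by (intro sum.cong refl) (simp add: mult_pd_expand)
  finally show "bracket D E k = act D (E k) - act E (D k)"
    using assms by (cases "k \<in> Y") (simp_all add: act_def Weven_outside)
qed

lemma bracket_Weven [simp, intro]:
  assumes "D \<in> Weven" "E \<in> Weven"
  shows "bracket D E \<in> Weven"
  using assms by (auto simp: Weven_iff bracket_eq[OF assms] intro!: act_Opar Opar_closed)

lemma bracket_add_right:
  assumes "D \<in> Weven" "E \<in> Weven" "F \<in> Weven"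
  shows "bracket D (E + F) = bracket D E + bracket D F"
  using assms by (simp add: bracket_eq fun_eq_iff pointwise_apply act_add act_add_left)

lemma bracket_scale_right:
  assumes "D \<in> Weven" "E \<in> Weven"
  shows "bracket D (scaleW c E) = scaleW c (bracket D E)"
  using assms by (simp add: bracket_eq fun_eq_iff pointwise_apply act_scale act_scale_left right_diff_distrib)

lemma bracket_minus:
  assumes "D \<in> Weven" "E \<in> Weven"
  shows "bracket D E = - bracket E D"
  using assms by (simp add: bracket_eq fun_eq_iff pointwise_apply)

lemma bracket_zero [simp]: "D \<in> Weven \<Longrightarrow> bracket D 0 = 0" "D \<in> Weven \<Longrightarrow> bracket 0 D = 0"
  by (simp_all add: bracket_eq fun_eq_iff zero_fun_apply minus_apply)

section \<open>Conjugate indices, Hamiltonian fields and the Poisson bracket\<close>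

lemma conj_Y0 [simp]: "conj_index i \<in> Y0 \<longleftrightarrow> i \<in> Y0"
  by (auto simp: conj_index_def Y0_def)
lemma conj_Y1 [simp]: "i \<in> Y1 \<Longrightarrow> conj_index i = i"
  by (auto simp: conj_index_def)
lemma conj_Y [simp]: "conj_index i \<in> Y \<longleftrightarrow> i \<in> Y"
  by (auto simp: Y_def conj_index_def Y0_def Y1_def)
lemma conj_conj [simp]: "conj_index (conj_index i) = i"
  by (auto simp: conj_index_def Y0_def)
lemma conj_eq_iff [simp]: "conj_index i = conj_index j \<longleftrightarrow> i = j"
  by (metis conj_conj)
lemma conj_eq_swap: "conj_index i = j \<longleftrightarrow> i = conj_index j"
  by (metis conj_conj)
lemma conj_neq: "i \<in> Y0 \<Longrightarrow> m > 0 \<Longrightarrow> conj_index i \<noteq> i"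
  by (auto simp: conj_index_def Y0_def)
lemma tau_conj [simp]: "i \<in> Y0 \<Longrightarrow> \<tau> (conj_index i) = - \<tau> i"
  by (auto simp: \<tau>_def conj_index_def Y0_def)
lemma tau_Y1 [simp]: "i \<in> Y1 \<Longrightarrow> \<tau> i = 1"
  by (simp add: \<tau>_def)
lemma tau_sq [simp]: "\<tau> i * \<tau> i = (1 :: 'b::field)" "\<tau> i * (\<tau> i * x) = (x :: 'b::field)"
  by (simp_all add: \<tau>_def)
lemma tau_nonzero [simp]: "\<tau> i \<noteq> (0 :: 'b::field)"
  by (simp add: \<tau>_def)
lemma mu_conj [simp]: "\<mu> (conj_index i) = \<mu> i"
  by (auto simp: \<mu>_def conj_index_def Y0_def Y1_def)

lemma sum_conj: "(\<Sum>i\<in>Y. F (conj_index i)) = (\<Sum>i\<in>Y. F i)"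
  by (rule sum.reindex_bij_witness[of _ conj_index conj_index]) auto

lemma sum_conj_Y0: "(\<Sum>i\<in>Y0. F (conj_index i)) = (\<Sum>i\<in>Y0. F i)"
  by (rule sum.reindex_bij_witness[of _ conj_index conj_index]) auto

lemma sum_Y: "(\<Sum>i\<in>Y. F i) = (\<Sum>i\<in>Y0. F i) + (\<Sum>i\<in>Y1. F i)"
  unfolding Y_def by (rule sum.union_disjoint) (auto dest: Y0_Y1)

lemma DH_add: "DH (f + g) = DH f + DH g"
  by (simp add: DH_def plus_fun_apply[of f] vfield.scale_left_distrib sum.distrib)

lemma DH_scale: "DH (scaleO c f) = scaleW c (DH f)"
  by (simp add: DH_def scaleO_apply vfield.scale_sum_right)

lemma DH_zero [simp]: "DH 0 = 0"
  by (simp add: DH_def zero_fun_apply)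

lemma DH_minus: "DH (- f) = - DH f"
  using DH_add[of "- f" f] by (simp add: add_eq_0_iff)

lemma DH_diff: "DH (f - g) = DH f - DH g"
  using DH_add[of "f - g" g] by simp

lemma DH_mon: "b \<in> Basis \<Longrightarrow> DH (mon b) = (DH_mon b :: 'b::field vfield)"
proof -
  assume b: "b \<in> Basis"
  have "DH (mon b) = (\<Sum>b'\<in>Basis. if b' = b then DH_mon b else (0 :: 'b vfield))"
    unfolding DH_def by (intro sum.cong) (auto simp: mon_apply)
  with b show ?thesis by simp
qed

lemma DH_apply:
  assumes "f \<in> Opar 0"
  shows "DH f j = (if j \<in> Y then scaleO (\<tau> (conj_index j)) (pd (conj_index j) f) else (0 :: 'b::field sfun))"
  using assms
proof (induction rule: Opar_induct)
  case (mon b)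
  have "DH (mon b) j = (\<Sum>i\<in>Y. if i = conj_index j then scaleO (\<tau> i) (pd i (mon b)) else (0 :: 'b sfun))"
    unfolding DH_mon[OF mon(1)] DH_mon_def vf_apply
    using mon(2) by (intro sum.cong) (auto simp: fld_apply conj_eq_swap)
  then show ?case by simp
next
  case (add f g)
  then show ?case
    by (simp add: DH_add pd_linear sfun.scale_right_distrib plus_fun_apply[of "DH f"])
next
  case (scale c f)
  then show ?case
    by (simp add: DH_scale pd_linear scaleW_apply mult.commute)
qed (simp add: vf_apply)

lemma DH_Weven [simp, intro]: "f \<in> Opar 0 \<Longrightarrow> DH f \<in> Weven"
  using pd_Opar[of f 0 "conj_index _"]
  by (auto simp: Weven_iff DH_apply intro!: Opar_closed)

definition poisson :: "'b::field sfun \<Rightarrow> 'b sfun \<Rightarrow> 'b sfun" where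
  "poisson f g = (\<Sum>i\<in>Y. scaleO (\<tau> i) (mult (pd i f) (pd (conj_index i) g)))"

lemma poisson_add: "poisson (f + g) h = poisson f h + poisson g h" "poisson h (f + g) = poisson h f + poisson h g"
  by (simp_all add: poisson_def pd_linear mult_linear sfun.scale_right_distrib sum.distrib)

lemma poisson_scale: "poisson (scaleO c f) h = scaleO c (poisson f h)" "poisson h (scaleO c f) = scaleO c (poisson h f)"
  by (simp_all add: poisson_def pd_linear mult_linear sfun.scale_sum_right mult.commute)

lemma act_DH: "f \<in> Opar 0 \<Longrightarrow> act (DH f) g = poisson f g"
  unfolding act_def poisson_def
  by (subst sum_conj[symmetric]) (simp add: DH_apply mult_linear)

lemma poisson_Opar: "f \<in> Opar 0 \<Longrightarrow> g \<in> Opar q \<Longrightarrow> poisson f g \<in> (Opar q :: 'b::field sfun set)"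
  unfolding act_DH[symmetric] by (intro act_Opar DH_Weven)

text \<open>The Hamiltonians of the elements of H. The constants are among them, although
  \<open>DH\<close> kills them.\<close>

definition Hfun :: "'b::field sfun set" where
  "Hfun = supp_on H_index"

lemma H_index_Basis: "H_index \<subseteq> Basis"
  by (auto simp: H_index_def)

lemma finite_H_index [simp]: "finite H_index"
  using H_index_Basis finite_Basis by (rule finite_subset)

lemma Hfun_Opar [simp]: "f \<in> Hfun \<Longrightarrow> f \<in> Opar 0"
  unfolding Hfun_def Opar_def by (erule supp_on_mono[rotated]) (auto simp: H_index_def par_def)

lemma Hfun_Osup [simp]: "f \<in> Hfun \<Longrightarrow> f \<in> Osup"
  using Opar_Osup Hfun_Opar by blast

lemma Hfun_closed [simp, intro]:
  "0 \<in> Hfun"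
  "f \<in> Hfun \<Longrightarrow> g \<in> Hfun \<Longrightarrow> f + g \<in> Hfun"
  "f \<in> Hfun \<Longrightarrow> g \<in> Hfun \<Longrightarrow> f - g \<in> Hfun"
  "f \<in> Hfun \<Longrightarrow> - f \<in> Hfun"
  "f \<in> Hfun \<Longrightarrow> scaleO c f \<in> Hfun"
  by (auto simp: Hfun_def)

lemma span_DH:
  assumes "S \<subseteq> Basis"
  shows "vfield.span {DH (mon b) |b. b \<in> S} = DH ` (supp_on S :: 'b::field sfun set)"
proof
  have fin: "finite S" using assms finite_Basis by (rule finite_subset)
  show "vfield.span {DH (mon b) |b. b \<in> S} \<subseteq> DH ` (supp_on S :: 'b sfun set)"
  proof (rule vfield.span_minimal)
    show "vfield.subspace (DH ` (supp_on S :: 'b sfun set))"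
      unfolding vfield.subspace_def
    proof (intro conjI ballI allI)
      show "0 \<in> DH ` (supp_on S :: 'b sfun set)"
        by (metis DH_zero image_eqI supp_on_closed(1))
      show "x + y \<in> DH ` (supp_on S :: 'b sfun set)"
        if "x \<in> DH ` supp_on S" "y \<in> DH ` supp_on S" for x y
        using that by (auto simp: DH_add[symmetric] intro!: imageI supp_on_closed)
      show "scaleW c x \<in> DH ` (supp_on S :: 'b sfun set)" if "x \<in> DH ` supp_on S" for c x
        using that by (auto simp: DH_scale[symmetric] intro!: imageI supp_on_closed)
    qed
  qed auto
  show "DH ` (supp_on S :: 'b sfun set) \<subseteq> vfield.span {DH (mon b) |b. b \<in> S}"
  proof clarify
    fix f :: "'b sfun" assume "f \<in> supp_on S"
    with fin show "DH f \<in> vfield.span {DH (mon b) |b. b \<in> S}"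
    proof (induction rule: supp_on_induct)
      case (mon b)
      then show ?case by (intro vfield.span_base) blast
    next
      case (add f g)
      then show ?case unfolding DH_add by (rule vfield.span_add)
    next
      case (scale c f)
      then show ?case unfolding DH_scale by (rule vfield.span_scale)
    qed (simp add: vfield.span_zero)
  qed
qed

lemma H_eq: "H = DH ` Hfun"
  unfolding H_def Hfun_def by (rule span_DH[OF H_index_Basis])

lemma N_eq: "N = DH ` supp_on (H_index - {(top_index, {})})"
proof -
  have eq: "{DH (mon b) |b. b \<in> H_index \<and> b \<noteq> (top_index, {})}
      = {DH (mon b) |b. b \<in> H_index - {(top_index, {})}}" by blast
  have "H_index - {(top_index, {})} \<subseteq> Basis" using H_index_Basis by blast
  then show ?thesis
    unfolding N_def eq by (rule span_DH)
qed

end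

section \<open>The Jacobi identity and brackets of Hamiltonian fields\<close>

context hamiltonian_char
begin

text \<open>The sign that the Leibniz rule gives for an odd derivative cancels the sign of moving
  the coefficient of D past f, because D is even.\<close>

lemma act_mult:
  fixes D :: "'a vfield"
  assumes "D \<in> Weven" "f \<in> Opar q" "g \<in> Osup"
  shows "act D (mult f g) = mult (act D f) g + mult f (act D g)"
proof -
  have f: "f \<in> Osup" using assms(2) by (rule Opar_Osup)
  have "mult (D i) (pd i (mult f g)) = mult (mult (D i) (pd i f)) g + mult f (mult (D i) (pd i g))"
    if "i \<in> Y" for i
  proof -
    have "mult (D i) (mult f (pd i g)) = mult (mult (D i) f) (pd i g)"
      using assms f by (intro mult_assoc[symmetric]) auto
    also have "mult (D i) f = scaleO ((-1) ^ (\<mu> i * q)) (mult f (D i))"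
      using assms that by (intro mult_commute Weven_Opar)
    also have "mult (scaleO ((-1) ^ (\<mu> i * q)) (mult f (D i))) (pd i g)
        = scaleO ((-1) ^ (\<mu> i * q)) (mult f (mult (D i) (pd i g)))"
      using assms f by (simp add: mult_linear mult_assoc)
    finally have "mult (D i) (scaleO ((-1) ^ (\<mu> i * q)) (mult f (pd i g))) = mult f (mult (D i) (pd i g))"
      by (simp add: mult_linear power_mult_distrib[symmetric])
    then show ?thesis
      using assms that f by (simp add: leibniz mult_add_right mult_assoc)
  qed
  then show ?thesis
    by (simp add: act_def mult_linear sum.distrib)
qed

text \<open>The second-order part of the composite of two even derivations is symmetric: exchanging
  the coefficients and exchanging the partial derivatives produce the same sign.\<close>

lemma act_pd_commute:
  fixes D E :: "'a vfield"
  assumes "D \<in> Weven" "E \<in> Weven" "f \<in> Osup"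
  shows "(\<Sum>j\<in>Y. mult (E j) (act D (pd j f))) = (\<Sum>j\<in>Y. mult (D j) (act E (pd j f)))"
proof -
  have "mult (E j) (mult (D i) (pd i (pd j f))) = mult (D i) (mult (E j) (pd j (pd i f)))"
    if "i \<in> Y" "j \<in> Y" for i j
  proof -
    have "mult (E j) (mult (D i) (pd i (pd j f))) = mult (mult (E j) (D i)) (pd i (pd j f))"
      using assms by (intro mult_assoc[symmetric]) auto
    also have "\<dots> = mult (scaleO ((-1) ^ (\<mu> j * \<mu> i)) (mult (D i) (E j))) (scaleO ((-1) ^ (\<mu> i * \<mu> j)) (pd j (pd i f)))"
      using assms that by (intro arg_cong2[of _ _ _ _ mult] mult_commute Weven_Opar pd_commute)
    also have "\<dots> = mult (mult (D i) (E j)) (pd j (pd i f))"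
      by (simp add: mult_linear mult.commute power_mult_distrib[symmetric])
    also have "\<dots> = mult (D i) (mult (E j) (pd j (pd i f)))"
      using assms by (intro mult_assoc) auto
    finally show ?thesis .
  qed
  then have "(\<Sum>j\<in>Y. \<Sum>i\<in>Y. mult (E j) (mult (D i) (pd i (pd j f)))) =
      (\<Sum>j\<in>Y. \<Sum>i\<in>Y. mult (D i) (mult (E j) (pd j (pd i f))))"
    by (intro sum.cong refl) auto
  also have "\<dots> = (\<Sum>j\<in>Y. \<Sum>i\<in>Y. mult (D j) (mult (E i) (pd i (pd j f))))"
    by (rule sum.swap)
  finally show ?thesis by (simp add: act_def mult_sum_right)
qed

lemma act_act:
  fixes D E :: "'a vfield"
  assumes "D \<in> Weven" "E \<in> Weven" "f \<in> Osup"
  shows "act D (act E f) = (\<Sum>j\<in>Y. mult (act D (E j)) (pd j f)) + (\<Sum>j\<in>Y. mult (E j) (act D (pd j f)))"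
proof -
  have "act D (act E f) = (\<Sum>j\<in>Y. act D (mult (E j) (pd j f)))"
    unfolding act_def[of E] by (rule additive.sum[of "act D"]) (simp add: additive_def act_add)
  also have "\<dots> = (\<Sum>j\<in>Y. mult (act D (E j)) (pd j f) + mult (E j) (act D (pd j f)))"
    using assms by (intro sum.cong refl act_mult) (auto intro: Weven_Opar)
  finally show ?thesis by (simp add: sum.distrib)
qed

lemma act_bracket:
  fixes D E :: "'a vfield"
  assumes "D \<in> Weven" "E \<in> Weven" "f \<in> Osup"
  shows "act (bracket D E) f = act D (act E f) - act E (act D f)"
proof -
  have "act (bracket D E) f = (\<Sum>j\<in>Y. mult (act D (E j)) (pd j f)) - (\<Sum>j\<in>Y. mult (act E (D j)) (pd j f))"
    unfolding act_def[of "bracket D E"] by (simp add: bracket_eq assms mult_diff_left sum_subtractf)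
  then show ?thesis
    using act_pd_commute[OF assms] by (simp add: act_act assms)
qed

lemma jacobi:
  fixes D E F :: "'a vfield"
  assumes "D \<in> Weven" "E \<in> Weven" "F \<in> Weven"
  shows "bracket D (bracket E F) = bracket (bracket D E) F + bracket E (bracket D F)"
proof
  fix j
  have o: "F j \<in> Osup" "E j \<in> Osup" "D j \<in> Osup" using assms by simp_all
  have "bracket D (bracket E F) j = act D (act E (F j) - act F (E j)) - (act E (act F (D j)) - act F (act E (D j)))"
    using assms o by (simp add: bracket_eq[of D "bracket E F"] act_bracket) (simp add: bracket_eq)
  moreover have "bracket (bracket D E) F j = (act D (act E (F j)) - act E (act D (F j))) - act F (act D (E j) - act E (D j))"
    using assms o by (simp add: bracket_eq[of "bracket D E" F] act_bracket) (simp add: bracket_eq)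
  moreover have "bracket E (bracket D F) j = act E (act D (F j) - act F (D j)) - (act D (act F (E j)) - act F (act D (E j)))"
    using assms o by (simp add: bracket_eq[of E "bracket D F"] act_bracket) (simp add: bracket_eq)
  ultimately show "bracket D (bracket E F) j = (bracket (bracket D E) F + bracket E (bracket D F)) j"
    by (simp add: act_diff plus_fun_apply[of "bracket (bracket D E) F"])
qed

text \<open>In the coordinate k, with s conjugate to k, the claim is that the derivative of {f, g}
  by x_s is {f, d_s g} - {g, d_s f}. The second term arises from the Leibniz rule after the sum is
  reindexed by \<open>conj_index\<close>.\<close>

lemma bracket_DH:
  fixes f g :: "'a sfun"
  assumes "f \<in> Opar 0" "g \<in> Opar 0"
  shows "bracket (DH f) (DH g) = DH (poisson f g)"
proof
  fix k
  show "bracket (DH f) (DH g) k = DH (poisson f g) k"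
  proof (cases "k \<in> Y")
    case False
    then show ?thesis using assms by (simp add: bracket_eq DH_apply poisson_Opar)
  next
    case True
    define s where "s = conj_index k"
    have s: "s \<in> Y" using True by (simp add: s_def)
    have o: "f \<in> Osup" "g \<in> Osup" using assms Opar_Osup by auto
    have t: "mult (pd s (pd i f)) (pd (conj_index i) g) =
        scaleO ((-1) ^ \<mu> i) (mult (pd (conj_index i) g) (pd i (pd s f)))" if "i \<in> Y" for i
    proof -
      have p1: "pd (conj_index i) g \<in> Opar (\<mu> i)" using pd_Opar[OF assms(2), of "conj_index i"] that by simp
      have p2: "pd i (pd s f) \<in> Opar (\<mu> s + \<mu> i)" using pd_Opar[OF pd_Opar[OF assms(1) s] that] by simp
      have "mult (pd s (pd i f)) (pd (conj_index i) g) =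
          scaleO ((-1) ^ (\<mu> s * \<mu> i) * (-1) ^ ((\<mu> s + \<mu> i) * \<mu> i)) (mult (pd (conj_index i) g) (pd i (pd s f)))"
        unfolding pd_commute[OF o(1) s that] mult_scale_left mult_commute[OF p2 p1] by simp
      also have "(-1) ^ (\<mu> s * \<mu> i) * (-1) ^ ((\<mu> s + \<mu> i) * \<mu> i) = ((-1) ^ \<mu> i :: 'a)"
        by (auto simp: \<mu>_def)
      finally show ?thesis .
    qed
    have u: "pd s (mult (pd i f) (pd (conj_index i) g)) =
       scaleO ((-1) ^ \<mu> i) (mult (pd (conj_index i) g) (pd i (pd s f))) + mult (pd i f) (pd (conj_index i) (pd s g))"
      if "i \<in> Y" for i
    proof -
      have "pd i f \<in> Opar (\<mu> i)" using pd_Opar[OF assms(1) that] by simp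
      from leibniz[OF this pd_Osup s, of "conj_index i" g] show ?thesis
        unfolding t[OF that] pd_commute[OF o(2) s, of "conj_index i"]
        using that pd_commute[OF o(2) s, of "conj_index i"]
        by (simp add: mult_linear power_mult_distrib[symmetric])
    qed
    have neg: "\<tau> (conj_index i) * (-1) ^ \<mu> i = - (\<tau> i :: 'a)" if "i \<in> Y" for i
      using that by (auto simp: Y_def)
    have "pd s (poisson f g) = (\<Sum>i\<in>Y. scaleO (\<tau> i) (scaleO ((-1) ^ \<mu> i) (mult (pd (conj_index i) g) (pd i (pd s f)))))
        + (\<Sum>i\<in>Y. scaleO (\<tau> i) (mult (pd i f) (pd (conj_index i) (pd s g))))"
      unfolding poisson_def pd_sum pd_scale sum.distrib[symmetric]
      by (intro sum.cong refl) (simp add: u sfun.scale_right_distrib)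
    also have "(\<Sum>i\<in>Y. scaleO (\<tau> i) (mult (pd i f) (pd (conj_index i) (pd s g)))) = poisson f (pd s g)"
      by (simp add: poisson_def)
    also have "(\<Sum>i\<in>Y. scaleO (\<tau> i) (scaleO ((-1) ^ \<mu> i) (mult (pd (conj_index i) g) (pd i (pd s f)))))
        = (\<Sum>i\<in>Y. scaleO (\<tau> (conj_index i)) (scaleO ((-1) ^ \<mu> i) (mult (pd i g) (pd (conj_index i) (pd s f)))))"
      by (subst sum_conj[symmetric]) simp
    also have "\<dots> = (\<Sum>i\<in>Y. - scaleO (\<tau> i) (mult (pd i g) (pd (conj_index i) (pd s f))))"
      by (intro sum.cong refl) (simp add: neg sfun.scale_minus_left)
    also have "\<dots> = - poisson g (pd s f)"
      by (simp add: poisson_def sum_negf)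
    finally have "pd s (poisson f g) = poisson f (pd s g) - poisson g (pd s f)" by simp
    then show ?thesis using assms True
      by (simp add: bracket_eq DH_apply poisson_Opar act_DH poisson_scale s_def[symmetric] sfun.scale_right_diff_distrib)
  qed
qed

lemma two_neq_0: "(2 :: 'a) \<noteq> 0"
  using of_nat_eq_0_iff'[of 2] p_gt_3 by (auto dest: dvd_imp_le)

lemma self_neg_zero: "x = - x \<Longrightarrow> x = (0 :: 'a)"
proof -
  assume "x = - x"
  then have "x + x = 0" by (metis add.left_inverse)
  then have "2 * x = 0" by simp
  then show ?thesis using two_neq_0 by simp
qed

lemma pd_top [simp]: "f \<in> Osup \<Longrightarrow> i \<in> Y0 \<Longrightarrow> pd i f (top_index, u) = (0 :: 'b::field)"
  using A_le_top[of "top_index(i := Suc (top_index i))" i]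
  by (subst pd_even_apply) (auto intro!: Osup_outside simp: Basis_iff)

text \<open>The top coefficient is an integral: even derivatives have none. Integration by parts
  turns the even part of the bracket into a sum S over f times second derivatives of g, and
  exchanging conjugate indices gives S = -S. For the odd part, d_i f is odd and has no term with u
  empty, while d_i f times d_i g is the derivative by x_i of f times d_i g and so omits x_i. The
  case \<open>u = Y1\<close> keeps brackets inside \<open>Hfun\<close>; the case of empty u makes
  \<open>\<Gamma>1\<close> a derivation.\<close>

lemma poisson_top:
  fixes f g :: "'a sfun"
  assumes "f \<in> Opar 0" "g \<in> Opar 0" and u: "u = {} \<or> u = Y1"
  shows "poisson f g (top_index, u) = 0"
proof -
  have o: "f \<in> Osup" "g \<in> Osup" using assms Opar_Osup by auto
  define S where "S = (\<Sum>i\<in>Y0. scaleO (\<tau> i) (mult f (pd i (pd (conj_index i) g)))) (top_index, u)"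
  have "S = (\<Sum>i\<in>Y0. scaleO (\<tau> (conj_index i)) (mult f (pd (conj_index i) (pd i g)))) (top_index, u)"
    unfolding S_def by (subst sum_conj_Y0[symmetric]) simp
  also have "(\<Sum>i\<in>Y0. scaleO (\<tau> (conj_index i)) (mult f (pd (conj_index i) (pd i g))))
      = (\<Sum>i\<in>Y0. - scaleO (\<tau> i) (mult f (pd i (pd (conj_index i) g))))"
  proof (intro sum.cong refl)
    fix i assume i: "i \<in> Y0"
    have "pd (conj_index i) (pd i g) = pd i (pd (conj_index i) g)"
      using pd_commute[OF o(2), of "conj_index i" i] i by simp
    then show "scaleO (\<tau> (conj_index i)) (mult f (pd (conj_index i) (pd i g)))
        = - scaleO (\<tau> i) (mult f (pd i (pd (conj_index i) g)))"
      using i by (simp add: sfun.scale_minus_left)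
  qed
  also have "(\<Sum>i\<in>Y0. - scaleO (\<tau> i) (mult f (pd i (pd (conj_index i) g)))) (top_index, u) = - S"
    by (simp add: S_def sum_negf uminus_apply)
  finally have "S = 0" by (rule self_neg_zero)
  have "mult (pd i f) (pd (conj_index i) g) (top_index, u) = - mult f (pd i (pd (conj_index i) g)) (top_index, u)"
    if "i \<in> Y0" for i
  proof -
    have "pd i (mult f (pd (conj_index i) g)) = mult (pd i f) (pd (conj_index i) g) + mult f (pd i (pd (conj_index i) g))"
      using leibniz[OF assms(1) pd_Osup, of i "conj_index i" g] that by simp
    then have "0 = (mult (pd i f) (pd (conj_index i) g) + mult f (pd i (pd (conj_index i) g))) (top_index, u)"
      using pd_top[OF mult_Osup that, of f "pd (conj_index i) g" u] by simp
    then show ?thesis by (simp add: plus_fun_apply eq_neg_iff_add_eq_0)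
  qed
  then have "(\<Sum>i\<in>Y0. scaleO (\<tau> i) (mult (pd i f) (pd (conj_index i) g))) (top_index, u) = - S"
    unfolding S_def by (simp add: sum_fun_apply scaleO_apply sum_negf)
  moreover have "mult (pd i f) (pd (conj_index i) g) (top_index, u) = 0" if i: "i \<in> Y1" for i
    using u
  proof
    assume "u = {}"
    show ?thesis
    proof (rule ccontr)
      assume "mult (pd i f) (pd (conj_index i) g) (top_index, u) \<noteq> 0"
      then obtain \<alpha> v where "pd i f (\<alpha>, v) \<noteq> 0" "v = {}"
        using \<open>u = {}\<close> by (elim mult_apply_nonzeroE) auto
      moreover have "pd i f \<in> Opar 1" using pd_Opar[OF assms(1), of i] i by simp
      ultimately show False by (auto simp: Opar_def supp_on_def par_def)
    qed
  next
    assume "u = Y1"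
    have "pd i (mult f (pd i g)) = mult (pd i f) (pd i g)"
      using leibniz[OF assms(1) pd_Osup, of i i g] i o by (simp add: pd_odd_square)
    moreover have "pd i (mult f (pd i g)) (top_index, u) = 0"
      using i \<open>u = Y1\<close> by (simp add: pd_odd_apply)
    ultimately show ?thesis using i by simp
  qed
  ultimately show ?thesis
    using \<open>S = 0\<close> unfolding poisson_def sum_Y
    by (simp add: plus_fun_apply sum_fun_apply scaleO_apply)
qed

lemma poisson_Hfun [simp, intro]:
  fixes f g :: "'a sfun"
  assumes "f \<in> Opar 0" "g \<in> Opar 0"
  shows "poisson f g \<in> Hfun"
proof -
  have "poisson f g \<in> Opar 0" using assms by (rule poisson_Opar)
  then show ?thesis
    unfolding Opar_def Hfun_def supp_on_def H_index_def
    using poisson_top[OF assms, of Y1] by (auto simp: par_def)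
qed

end

lemma lf_apply:
  fixes \<phi> \<psi> :: "'b::field vfield \<Rightarrow> 'b vfield"
  shows "(\<phi> + \<psi>) x = \<phi> x + \<psi> x" "(\<phi> - \<psi>) x = \<phi> x - \<psi> x"
    "(0 :: 'b vfield \<Rightarrow> 'b vfield) x = 0" "scaleL c \<phi> x = scaleW c (\<phi> x)"
    "(\<Sum>i\<in>X. F i) x = (\<Sum>i\<in>X. (F i :: 'b vfield \<Rightarrow> 'b vfield) x)"
  by (simp_all add: pointwise_apply sum_fun_apply)

section \<open>The kernel of the Hamiltonian map and the grading\<close>

context hamiltonian
begin

lemma pd_zero_imp:
  assumes "f \<in> Osup" "\<And>i. i \<in> Y \<Longrightarrow> pd i f = (0 :: 'b::field sfun)" "b \<noteq> (0, {})"
  shows "f b = 0"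
proof (rule ccontr)
  assume nz: "f b \<noteq> 0"
  obtain \<alpha> u where b: "b = (\<alpha>, u)" by (cases b)
  have B: "\<alpha> \<in> A" "u \<subseteq> Y1" using nz Osup_outside[OF assms(1), of b] by (auto simp: b Basis_iff)
  show False
  proof (cases "u = {}")
    case True
    then obtain i where i: "\<alpha> i \<noteq> 0" using assms(3) b by (auto simp: fun_eq_iff sf_apply zero_fun_apply)
    then have Y0: "i \<in> Y0" using B(1) A_outside[of \<alpha> i] i by auto
    have "pd i f (\<alpha>(i := \<alpha> i - 1), u) = f (\<alpha>, u)"
      using i by (simp add: pd_even_apply[OF assms(1) Y0])
    then show False using assms(2)[of i] Y0 nz b by (simp add: sf_apply)
  next
    case False
    then obtain i where i: "i \<in> u" by blast
    then have Y1: "i \<in> Y1" using B by blast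
    have "pd i f (\<alpha>, u - {i}) = pass_sign i u * f (\<alpha>, u)"
      using i by (simp add: pd_odd_apply[OF assms(1) Y1] insert_absorb)
    then show False using assms(2)[of i] Y1 nz b by (simp add: sf_apply)
  qed
qed

lemma DH_eq_0_imp:
  assumes "f \<in> Opar 0" "DH f = 0" "b \<noteq> (0, {})"
  shows "f b = (0 :: 'b::field)"
proof (rule pd_zero_imp[OF Opar_Osup[OF assms(1)] _ assms(3)])
  fix i assume "i \<in> Y"
  then have "scaleO (\<tau> i) (pd i f) = 0"
    using DH_apply[OF assms(1), of "conj_index i"] assms(2) by (simp add: vf_apply)
  then show "pd i f = 0" by simp
qed

lemma DH_const [simp]: "DH (mon (0, {})) = (0 :: 'b::field vfield)"
proof -
  have B: "(0, {}) \<in> Basis" by (simp add: Basis_iff)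
  have "pd i (mon (0, {})) = (0 :: 'b sfun)" if "i \<in> Y" for i
    using that by (auto simp: Y_def pd_mon_Y0[OF B] pd_mon_Y1[OF B] zero_fun_apply)
  moreover have "mon (0, {}) \<in> (Opar 0 :: 'b sfun set)" using B by (simp add: par_def)
  ultimately show ?thesis
    by (intro ext[of "DH _"]) (simp add: DH_apply vf_apply(4))
qed

lemma homogeneous_eq: "homogeneous k = supp_on {b \<in> Basis. deg b = k}"
  unfolding homogeneous_def Osup_def supp_on_def by blast

lemma homogeneous_Osup: "f \<in> homogeneous k \<Longrightarrow> f \<in> Osup"
  by (simp add: homogeneous_def)

lemma homogeneousD: "f \<in> homogeneous k \<Longrightarrow> f b \<noteq> 0 \<Longrightarrow> deg b = k"
  unfolding homogeneous_def by blast

lemma homogeneous_closed [simp, intro]: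
  "0 \<in> homogeneous k"
  "f \<in> homogeneous k \<Longrightarrow> g \<in> homogeneous k \<Longrightarrow> f + g \<in> homogeneous k"
  "f \<in> homogeneous k \<Longrightarrow> g \<in> homogeneous k \<Longrightarrow> f - g \<in> homogeneous k"
  "f \<in> homogeneous k \<Longrightarrow> - f \<in> homogeneous k"
  "f \<in> homogeneous k \<Longrightarrow> scaleO c f \<in> homogeneous k"
  by (auto simp: homogeneous_eq)

lemma homogeneous_sum: "(\<And>x. x \<in> X \<Longrightarrow> F x \<in> homogeneous k) \<Longrightarrow> (\<Sum>x\<in>X. F x) \<in> homogeneous k"
  unfolding homogeneous_eq by (rule supp_on_sum)

lemma size_index_add: "size_index (\<alpha> + \<beta>) = size_index \<alpha> + size_index \<beta>"
  by (simp add: size_index_def sum.distrib plus_fun_apply)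

lemma mult_homogeneous:
  assumes "f \<in> homogeneous k" "g \<in> homogeneous l"
  shows "mult f g \<in> (homogeneous (k + l) :: 'b::field sfun set)"
  unfolding homogeneous_def
proof (intro CollectI conjI allI impI)
  fix b assume nz: "mult f g b \<noteq> 0"
  obtain \<gamma> w where b: "b = (\<gamma>, w)" by (cases b)
  from nz[unfolded b] show "deg b = k + l"
  proof (rule mult_apply_nonzeroE)
    fix \<alpha> u \<beta> v
    assume *: "(\<alpha>, u) \<in> Basis" "(\<beta>, v) \<in> Basis" "f (\<alpha>, u) \<noteq> 0" "g (\<beta>, v) \<noteq> 0"
      "\<gamma> = \<alpha> + \<beta>" "w = u \<union> v" "u \<inter> v = {}"
    have "deg (\<alpha>, u) = k" "deg (\<beta>, v) = l" using * assms homogeneousD by blast+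
    moreover have "card w = card u + card v"
      using * by (simp add: card_Un_disjoint Basis_iff finite_sub_Y1)
    ultimately show ?thesis using * by (simp add: b deg_def size_index_add)
  qed
qed simp

lemma size_index_Suc:
  assumes "i \<in> Y0"
  shows "size_index (\<alpha>(i := Suc (\<alpha> i))) = Suc (size_index \<alpha>)"
proof -
  have "(\<Sum>j\<in>Y0 - {i}. (\<alpha>(i := Suc (\<alpha> i))) j) = (\<Sum>j\<in>Y0 - {i}. \<alpha> j)"
    by (intro sum.cong) auto
  then show ?thesis
    unfolding size_index_def sum.remove[OF finite_Y0 assms] by simp
qed

lemma pd_homogeneous:
  assumes "f \<in> homogeneous k" "i \<in> Y"
  shows "pd i f \<in> (homogeneous (k - 1) :: 'b::field sfun set)"
  unfolding homogeneous_def
proof (intro CollectI conjI allI impI)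
  fix b assume nz: "pd i f b \<noteq> 0"
  have o: "f \<in> Osup" using assms homogeneous_Osup by blast
  obtain \<alpha> u where b: "b = (\<alpha>, u)" by (cases b)
  show "deg b = k - 1"
  proof (cases "i \<in> Y0")
    case True
    then have "deg (\<alpha>(i := Suc (\<alpha> i)), u) = k"
      using nz homogeneousD[OF assms(1)] by (simp add: b pd_even_apply[OF o])
    then show ?thesis using True by (simp add: b deg_def size_index_Suc)
  next
    case False
    then have i: "i \<in> Y1" using assms(2) by (simp add: Y_def)
    then have "i \<notin> u" "f (\<alpha>, insert i u) \<noteq> 0"
      using nz by (auto simp: b pd_odd_apply[OF o] split: if_splits)
    moreover from this have "finite u"
      using Osup_outside[OF o] by (metis Basis_iff finite_insert finite_sub_Y1)
    ultimately show ?thesis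
      using homogeneousD[OF assms(1), of "(\<alpha>, insert i u)"] by (simp add: b deg_def)
  qed
qed simp

lemma Witt_deg_iff:
  "D \<in> Witt_deg k \<longleftrightarrow> (\<forall>s\<in>Y. D s \<in> homogeneous (k + 1)) \<and> (\<forall>s. s \<notin> Y \<longrightarrow> D s = (0 :: 'b::field sfun))"
proof
  let ?S = "{D. (\<forall>s\<in>Y. D s \<in> homogeneous (k + 1)) \<and> (\<forall>s. s \<notin> Y \<longrightarrow> D s = (0 :: 'b sfun))}"
  have "Witt_deg k \<subseteq> ?S"
    unfolding Witt_deg_def
  proof (rule vfield.span_minimal)
    show "vfield.subspace ?S"
      unfolding vfield.subspace_def by (auto simp: vf_apply)
  qed (auto simp: fld_apply)
  then show "D \<in> Witt_deg k \<Longrightarrow> (\<forall>s\<in>Y. D s \<in> homogeneous (k + 1)) \<and> (\<forall>s. s \<notin> Y \<longrightarrow> D s = 0)"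
    by blast
  assume *: "(\<forall>s\<in>Y. D s \<in> homogeneous (k + 1)) \<and> (\<forall>s. s \<notin> Y \<longrightarrow> D s = 0)"
  have "D = (\<Sum>s\<in>Y. fld (D s) s)"
  proof
    fix j
    have "(\<Sum>s\<in>Y. fld (D s) s) j = (\<Sum>s\<in>Y. if s = j then D j else 0)"
      unfolding vf_apply by (intro sum.cong) (auto simp: fld_apply)
    then show "D j = (\<Sum>s\<in>Y. fld (D s) s) j" using * by simp
  qed
  also have "\<dots> \<in> Witt_deg k"
    unfolding Witt_deg_def by (intro vfield.span_sum vfield.span_base) (use * in blast)
  finally show "D \<in> Witt_deg k" .
qed

lemma Weven_deg_iff: "D \<in> Weven_deg k \<longleftrightarrow> D \<in> Weven \<and> (\<forall>s\<in>Y. D s \<in> homogeneous (k + 1))"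
  by (auto simp: Weven_deg_def Witt_deg_iff Weven_outside)

lemma Weven_deg_Weven: "D \<in> Weven_deg k \<Longrightarrow> D \<in> Weven"
  by (simp add: Weven_deg_iff)

lemma Weven_deg_homogeneous: "D \<in> Weven_deg k \<Longrightarrow> D s \<in> homogeneous (k + 1)"
  by (cases "s \<in> Y") (auto simp: Weven_deg_iff Weven_outside)

lemma Weven_deg_closed [simp, intro]:
  "0 \<in> Weven_deg k"
  "D \<in> Weven_deg k \<Longrightarrow> E \<in> Weven_deg k \<Longrightarrow> D + E \<in> Weven_deg k"
  "D \<in> Weven_deg k \<Longrightarrow> E \<in> Weven_deg k \<Longrightarrow> D - E \<in> Weven_deg k"
  "D \<in> Weven_deg k \<Longrightarrow> scaleW c D \<in> Weven_deg k"
  by (auto simp: Weven_deg_iff vf_apply)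

lemma act_homogeneous:
  assumes "D \<in> Weven_deg k" "f \<in> homogeneous l"
  shows "act D f \<in> homogeneous (k + l)"
  unfolding act_def
proof (rule homogeneous_sum)
  fix i assume "i \<in> Y"
  then show "mult (D i) (pd i f) \<in> homogeneous (k + l)"
    using mult_homogeneous[OF Weven_deg_homogeneous[OF assms(1), of i] pd_homogeneous[OF assms(2), of i]] by simp
qed

lemma bracket_deg:
  assumes "D \<in> Weven_deg k" "E \<in> Weven_deg l"
  shows "bracket D E \<in> Weven_deg (k + l)"
  unfolding Weven_deg_iff
proof (intro conjI ballI)
  have *: "D \<in> Weven" "E \<in> Weven" using assms Weven_deg_Weven by auto
  then show "bracket D E \<in> Weven" by simp
  fix s
  have "act D (E s) \<in> homogeneous (k + l + 1)" "act E (D s) \<in> homogeneous (k + l + 1)"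
    using act_homogeneous[OF assms(1) Weven_deg_homogeneous[OF assms(2), of s]]
      act_homogeneous[OF assms(2) Weven_deg_homogeneous[OF assms(1), of s]]
    by (simp_all add: algebra_simps)
  then show "bracket D E s \<in> homogeneous (k + l + 1)"
    by (simp add: bracket_eq[OF *])
qed

lemma DH_deg:
  assumes "f \<in> Opar 0" "f \<in> homogeneous (k + 2)"
  shows "DH f \<in> (Weven_deg k :: 'b::field vfield set)"
  unfolding Weven_deg_iff
proof (intro conjI ballI)
  fix s assume "s \<in> Y"
  then show "DH f s \<in> homogeneous (k + 1)"
    using pd_homogeneous[OF assms(2), of "conj_index s"] by (simp add: DH_apply[OF assms(1)] add.commute)
qed (use assms in auto)

text \<open>Every monomial of f other than the constant survives some partial derivative, and the
  coordinates of \<open>DH f\<close> show the degree of that derivative. The constant term is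
  invisible in \<open>DH f\<close>.\<close>

lemma deg_of_DH:
  assumes "f \<in> Opar 0" "f (0, {}) = 0" "DH f \<in> (Weven_deg k :: 'b::field vfield set)"
  shows "f \<in> homogeneous (k + 2)"
  unfolding homogeneous_def
proof (intro CollectI conjI allI impI)
  show o: "f \<in> Osup" using assms Opar_Osup by blast
  have h: "pd i f \<in> homogeneous (k + 1)" if "i \<in> Y" for i
  proof -
    have "scaleO (\<tau> i) (pd i f) \<in> homogeneous (k + 1)"
      using Weven_deg_homogeneous[OF assms(3), of "conj_index i"] that
      by (simp add: DH_apply[OF assms(1)])
    from homogeneous_closed(5)[OF this, of "\<tau> i"] show ?thesis by simp
  qed
  fix b assume nz: "f b \<noteq> 0"
  obtain \<alpha> u where b: "b = (\<alpha>, u)" by (cases b)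
  have B: "\<alpha> \<in> A" "u \<subseteq> Y1" using nz Osup_outside[OF o, of b] by (auto simp: b Basis_iff)
  show "deg b = k + 2"
  proof (cases "u = {}")
    case True
    then have "\<alpha> \<noteq> 0" using assms(2) nz b by auto
    then obtain i where i: "\<alpha> i \<noteq> 0" by (metis ext zero_fun_apply)
    then have Y0: "i \<in> Y0" using B(1) A_outside[of \<alpha> i] i by auto
    define \<beta> where "\<beta> = \<alpha>(i := \<alpha> i - 1)"
    have \<beta>: "\<beta>(i := Suc (\<beta> i)) = \<alpha>" using i by (auto simp: \<beta>_def)
    have "pd i f (\<beta>, u) \<noteq> 0" using nz by (simp add: pd_even_apply[OF o Y0] \<beta> b)
    then have "deg (\<beta>, u) = k + 1" by (rule homogeneousD[OF h[OF Y0_sub[OF Y0]]])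
    then show ?thesis using size_index_Suc[OF Y0, of \<beta>] by (simp add: \<beta> b deg_def)
  next
    case False
    then obtain i where i: "i \<in> u" by blast
    then have Y1: "i \<in> Y1" using B by blast
    have "pd i f (\<alpha>, u - {i}) \<noteq> 0"
      using i nz by (simp add: pd_odd_apply[OF o Y1] insert_absorb b)
    then have "deg (\<alpha>, u - {i}) = k + 1" by (rule homogeneousD[OF h[OF Y1_sub[OF Y1]]])
    moreover have "card u = Suc (card (u - {i}))"
      using i finite_sub_Y1[OF B(2)] by (simp only: card_Suc_Diff1)
    ultimately show ?thesis by (simp add: b deg_def)
  qed
qed

section \<open>Linear maps and derivations on H\<close>

lemma LinD:
  assumes "\<phi> \<in> Lin"
  shows "x \<notin> H \<Longrightarrow> \<phi> x = 0" "x \<in> H \<Longrightarrow> \<phi> x \<in> Weven" "x \<in> H \<Longrightarrow> y \<in> H \<Longrightarrow> \<phi> (x + y) = \<phi> x + \<phi> y"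
    "x \<in> H \<Longrightarrow> \<phi> (scaleW c x) = scaleW c (\<phi> x)"
  using assms unfolding Lin_def by blast+

lemma DH_in_H [simp, intro]: "f \<in> Hfun \<Longrightarrow> DH f \<in> H"
  by (simp add: H_eq)

lemma H_Weven: "x \<in> H \<Longrightarrow> x \<in> Weven"
  by (auto simp: H_eq)

lemma Lin_DH:
  assumes "\<phi> \<in> Lin" "f \<in> Hfun"
  shows "\<phi> (DH f) \<in> Weven"
    "g \<in> Hfun \<Longrightarrow> \<phi> (DH (f + g)) = \<phi> (DH f) + \<phi> (DH g)"
    "\<phi> (DH (scaleO c f)) = scaleW c (\<phi> (DH f))"
  using LinD[OF assms(1)] assms(2) by (simp_all add: DH_add DH_scale)

lemma Lin_DH_0: "\<phi> \<in> Lin \<Longrightarrow> \<phi> 0 = 0"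
  using Lin_DH(3)[of \<phi> 0 0] by simp

lemma Lin_DH_minus: "\<phi> \<in> Lin \<Longrightarrow> f \<in> Hfun \<Longrightarrow> \<phi> (DH (- f)) = - \<phi> (DH f)"
  using Lin_DH(2)[of \<phi> f "- f"] Lin_DH_0[of \<phi>] by (simp add: minus_unique)

lemma Lin_DH_diff: "\<phi> \<in> Lin \<Longrightarrow> f \<in> Hfun \<Longrightarrow> g \<in> Hfun \<Longrightarrow> \<phi> (DH (f - g)) = \<phi> (DH f) - \<phi> (DH g)"
  using Lin_DH(2)[of \<phi> f "- g"] Lin_DH_minus[of \<phi> g] by simp

lemma Lin_eqI:
  assumes "\<phi> \<in> Lin" "\<psi> \<in> Lin" "\<And>f. f \<in> Hfun \<Longrightarrow> \<phi> (DH f) = \<psi> (DH f)"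
  shows "\<phi> = \<psi>"
proof
  fix x
  show "\<phi> x = \<psi> x"
    using assms LinD(1)[OF assms(1), of x] LinD(1)[OF assms(2), of x] by (cases "x \<in> H") (auto simp: H_eq)
qed

lemma Lin_eqI_mon:
  fixes \<phi> \<psi> :: "'b::field vfield \<Rightarrow> 'b vfield"
  assumes "\<phi> \<in> Lin" "\<psi> \<in> Lin" "\<And>b. b \<in> H_index \<Longrightarrow> \<phi> (DH (mon b)) = \<psi> (DH (mon b))"
  shows "\<phi> = \<psi>"
proof (rule Lin_eqI[OF assms(1,2)])
  fix f :: "'b sfun" assume f: "f \<in> Hfun"
  have "f \<in> Hfun \<and> \<phi> (DH f) = \<psi> (DH f)"
    using finite_H_index f[unfolded Hfun_def]
  proof (induction rule: supp_on_induct)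
    case zero
    then show ?case using Lin_DH_0[OF assms(1)] Lin_DH_0[OF assms(2)] by simp
  next
    case (mon b)
    then show ?case using assms(3) by (simp add: Hfun_def)
  next
    case (add f g)
    then show ?case using Lin_DH(2)[OF assms(1)] Lin_DH(2)[OF assms(2)] by auto
  next
    case (scale c f)
    then show ?case using Lin_DH(3)[OF assms(1)] Lin_DH(3)[OF assms(2)] by auto
  qed
  then show "\<phi> (DH f) = \<psi> (DH f)" ..
qed

lemma Lin_subspace: "maps.subspace Lin"
  unfolding maps.subspace_def Lin_def
  by (auto simp add: lf_apply vfield.scale_right_distrib add_ac mult.commute)

lemma DerI:
  assumes "\<phi> \<in> Lin"
    "\<And>f g. f \<in> Hfun \<Longrightarrow> g \<in> Hfun \<Longrightarrow>
      \<phi> (bracket (DH f) (DH g)) = bracket (DH f) (\<phi> (DH g)) - bracket (DH g) (\<phi> (DH f))"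
  shows "\<phi> \<in> Der"
  using assms by (auto simp: Der_def H_eq)

lemma Der_Lin: "\<phi> \<in> Der \<Longrightarrow> \<phi> \<in> Lin"
  by (simp add: Der_def)

lemma Der_subspace: "maps.subspace Der"
  unfolding maps.subspace_def
proof (intro conjI ballI allI)
  note L = Lin_subspace[unfolded maps.subspace_def]
  have W: "\<phi> x \<in> Weven" if "\<phi> \<in> Der" "x \<in> H" for \<phi> :: "'b::field vfield \<Rightarrow> 'b vfield" and x
    using that LinD(2) Der_Lin by blast
  show "0 \<in> Der"
    unfolding Der_def using L by (auto simp: lf_apply H_Weven)
  show "\<phi> + \<psi> \<in> Der" if "\<phi> \<in> Der" "\<psi> \<in> Der" for \<phi> \<psi>
    using that L W[OF that(1)] W[OF that(2)] unfolding Der_def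
    by (auto simp: lf_apply H_Weven bracket_add_right)
  show "scaleL c \<phi> \<in> Der" if "\<phi> \<in> Der" for c \<phi>
    using that L W[OF that] unfolding Der_def
    by (auto simp: lf_apply H_Weven bracket_scale_right vfield.scale_right_diff_distrib)
qed

lemma bracket_smul:
  fixes D E :: "'b::field vfield"
  shows "smul (f + g) D = smul f D + smul g D" "smul (scaleO c f) D = scaleW c (smul f D)"
    "smul f (D + E) = smul f D + smul f E" "smul f (scaleW c D) = scaleW c (smul f D)"
    "smul f (D - E) = smul f D - smul f E"
  by (rule ext, simp add: smul_def vf_apply mult_linear)+

lemma smul_zero [simp]: "smul 0 D = 0" "smul f 0 = 0"
  by (rule ext, simp add: smul_def vf_apply)+

lemma smul_Weven:
  assumes "f \<in> Opar 0" "D \<in> Weven"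
  shows "smul f D \<in> (Weven :: 'b::field vfield set)"
  unfolding Weven_iff smul_def
  using mult_Opar[OF assms(1) Weven_Opar[OF assms(2)]] assms(2) by (auto simp: Weven_outside)

lemma smul_deg:
  assumes "f \<in> Opar 0" "f \<in> homogeneous k" "D \<in> Weven_deg l"
  shows "smul f D \<in> (Weven_deg (k + l) :: 'b::field vfield set)"
  unfolding Weven_deg_iff
  using smul_Weven[OF assms(1) Weven_deg_Weven[OF assms(3)]]
    mult_homogeneous[OF assms(2) Weven_deg_homogeneous[OF assms(3)]]
  by (simp add: smul_def add.assoc)

lemma act_smul:
  assumes "f \<in> Osup" "D \<in> Weven" "g \<in> Osup"
  shows "act (smul f D) g = mult f (act D (g :: 'b::field sfun))"
  using assms by (simp add: act_def smul_def mult_sum_right mult_assoc)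

lemma mult_one:
  assumes "f \<in> Osup"
  shows "mult (mon (0, {})) f = (f :: 'b::field sfun)"
  using assms
proof (induction rule: Osup_induct)
  case (mon b)
  obtain \<alpha> u where b: "b = (\<alpha>, u)" by (cases b)
  have "(0 :: nat \<Rightarrow> nat) + \<alpha> = \<alpha>" by simp
  then show ?case using mon by (simp add: b mult_mon_mon' Basis_iff)
qed (simp_all add: mult_linear)

lemma const_Basis [simp]: "(0, {}) \<in> Basis"
  by (simp add: Basis_iff)

lemma pd_const [simp]: "pd i (mon (0, {})) = (0 :: 'b::field sfun)"
proof (cases "i \<in> Y")
  case True
  then show ?thesis
    by (auto simp: Y_def pd_mon_Y0[OF const_Basis] pd_mon_Y1[OF const_Basis] zero_fun_apply)
qed simp

section \<open>Even partial derivatives as inner derivations\<close>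

lemma partial_Weven_deg: "i \<in> Y0 \<Longrightarrow> partial i \<in> (Weven_deg (-1) :: 'b::field vfield set)"
  unfolding Weven_deg_iff Weven_iff partial_def
  by (auto simp: fld_apply par_def homogeneous_eq deg_def size_index_def sf_apply zero_fun_apply)

lemma act_partial: "i \<in> Y0 \<Longrightarrow> act (partial i) f = pd i (f :: 'b::field sfun)"
proof -
  assume i: "i \<in> Y0"
  have "act (partial i) f = (\<Sum>j\<in>Y. if j = i then pd i f else 0)"
    unfolding act_def by (intro sum.cong) (auto simp: partial_def fld_apply mult_one)
  then show ?thesis using i by simp
qed

lemma ad_partial:
  assumes "i \<in> Y0" "E \<in> Weven"
  shows "ad (partial i) E = (\<lambda>j. pd i (E j :: 'b::field sfun))"
proof -
  have P: "partial i \<in> (Weven :: 'b vfield set)"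
    by (rule Weven_deg_Weven[OF partial_Weven_deg[OF assms(1)]])
  have "act E (partial i j) = 0" for j
    by (simp add: act_def partial_def fld_apply)
  then show ?thesis
    using assms by (simp add: ad_def bracket_eq[OF P assms(2)] act_partial)
qed

lemma pd_DH:
  assumes "r \<in> Y0" "f \<in> Opar 0"
  shows "DH (pd r f) = (\<lambda>j. pd r (DH f j :: 'b::field sfun))"
proof
  fix j
  have "pd r f \<in> Opar 0" using pd_Opar[OF assms(2), of r] assms(1) by simp
  then show "DH (pd r f) j = pd r (DH f j)"
    using assms pd_commute[OF Opar_Osup[OF assms(2)], of r "conj_index j"]
    by (simp add: DH_apply pd_scale)
qed

lemma pd_pow_Opar: "r \<in> Y0 \<Longrightarrow> f \<in> Opar q \<Longrightarrow> (pd r ^^ k) f \<in> Opar q"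
proof (induction k)
  case (Suc k)
  then show ?case using pd_Opar[of "(pd r ^^ k) f" q r] by simp
qed simp

lemma ad_partial_pow:
  assumes "r \<in> Y0" "f \<in> Opar 0"
  shows "(ad (partial r) ^^ k) (DH f) = DH ((pd r ^^ k) f :: 'b::field sfun)"
proof (induction k)
  case (Suc k)
  then show ?case
    using assms by (simp add: ad_partial pd_DH pd_pow_Opar)
qed simp

lemma pd_pow_add: "(pd r ^^ k) (f + g) = (pd r ^^ k) f + (pd r ^^ k) g"
  by (induction k) (simp_all add: pd_add)

lemma pd_pow_scale: "(pd r ^^ k) (scaleO c f) = scaleO c ((pd r ^^ k) f)"
  by (induction k) (simp_all add: pd_scale)

lemma pd_pow_zero [simp]: "(pd r ^^ k) 0 = 0"
  by (induction k) simp_all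

lemma pd_pow_const: "k > 0 \<Longrightarrow> (pd r ^^ k) (mon (0, {})) = (0 :: 'b::field sfun)"
  by (cases k) (simp_all add: funpow_Suc_right del: funpow.simps)

lemma pd_pow_apply:
  assumes "f \<in> Osup" "r \<in> Y0"
  shows "(pd r ^^ k) f (\<alpha>, u) = f (\<alpha>(r := \<alpha> r + k), u)"
  using assms(1)
proof (induction k arbitrary: f)
  case (Suc k)
  have "(pd r ^^ Suc k) f (\<alpha>, u) = pd r f (\<alpha>(r := \<alpha> r + k), u)"
    by (simp only: funpow_Suc_right o_apply Suc.IH[OF pd_Osup])
  also have "\<dots> = f (\<alpha>(r := \<alpha> r + Suc k), u)"
    by (simp only: pd_even_apply[OF Suc.prems assms(2)] fun_upd_upd fun_upd_same add_Suc_right)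
  finally show ?case .
qed simp

lemma pd_pow_homogeneous:
  "r \<in> Y0 \<Longrightarrow> f \<in> homogeneous d \<Longrightarrow> (pd r ^^ k) f \<in> (homogeneous (d - int k) :: 'b::field sfun set)"
proof (induction k)
  case (Suc k)
  then show ?case using pd_homogeneous[of "(pd r ^^ k) f" "d - int k" r] by (simp add: algebra_simps)
qed simp

section \<open>The top odd monomial\<close>

lemma x_omega_Basis [simp]: "(0, Y1) \<in> Basis"
  by (simp add: Basis_iff)

lemma pd_x_omega_Y0: "i \<in> Y0 \<Longrightarrow> pd i x_omega = (0 :: 'b::field sfun)"
  by (simp add: x_omega_def pd_mon_Y0 zero_fun_apply)

lemma pd_x_omega_Y1: "i \<in> Y1 \<Longrightarrow> pd i x_omega = scaleO (pass_sign i Y1) (mon (0, Y1 - {i}))"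
  by (simp add: x_omega_def pd_mon_Y1)

text \<open>An even monomial that contains x_i contains a second odd variable, which collides with
  the derivative of x^omega by x_i. So the action of H kills x^omega, and for even n its Hamiltonian
  field commutes with H.\<close>

lemma poisson_x_omega:
  assumes "f \<in> Opar 0"
  shows "poisson f x_omega = (0 :: 'b::field sfun)"
  using assms
proof (induction rule: Opar_induct)
  case (mon b)
  obtain \<alpha> u where b: "b = (\<alpha>, u)" by (cases b)
  have B: "(\<alpha>, u) \<in> Basis" "\<alpha> \<in> A" "u \<subseteq> Y1" using mon b by (auto simp: Basis_iff)
  have "mult (pd i (mon b)) (pd (conj_index i) x_omega) = (0 :: 'b sfun)" if "i \<in> Y" for i
  proof (cases "i \<in> Y0 \<or> i \<notin> u")
    case True
    then show ?thesis using that B by (auto simp: Y_def pd_x_omega_Y0 b pd_mon_Y1)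
  next
    case False
    then have i: "i \<in> Y1" "i \<in> u" using that by (auto simp: Y_def)
    have "u \<noteq> {i}" using mon b by (auto simp: par_def)
    then have "(u - {i}) \<inter> (Y1 - {i}) \<noteq> {}" using i B by auto
    then show ?thesis
      using i B by (simp add: b pd_mon_Y1 pd_x_omega_Y1 mult_linear mult_mon_mon' subset_iff)
  qed
  then show ?case by (simp add: poisson_def)
next
  case zero
  show ?case by (simp add: poisson_def)
qed (simp_all add: poisson_add poisson_scale)

definition ham_fun :: "'b::field vfield \<Rightarrow> 'b sfun" where
  "ham_fun x = (THE f. f \<in> Hfun \<and> f (0, {}) = 0 \<and> DH f = x)"

text \<open>Passes from a linear map on Hamiltonians that kills the constants to an element of
  \<open>Lin\<close>. Apart from the inner derivations, the maps of the theorem are of this kind, so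
  their derivation property becomes an identity for Poisson brackets.\<close>

definition lift :: "('b::field sfun \<Rightarrow> 'b vfield) \<Rightarrow> 'b vfield \<Rightarrow> 'b vfield" where
  "lift T x = (if x \<in> H then T (ham_fun x) else 0)"

definition liftable :: "('b::field sfun \<Rightarrow> 'b vfield) \<Rightarrow> bool" where
  "liftable T \<longleftrightarrow> (\<forall>f\<in>Hfun. T f \<in> Weven) \<and> (\<forall>f\<in>Hfun. \<forall>g\<in>Hfun. T (f + g) = T f + T g)
    \<and> (\<forall>c. \<forall>f\<in>Hfun. T (scaleO c f) = scaleW c (T f)) \<and> T (mon (0, {})) = 0"

lemma Der_degI:
  fixes \<phi> :: "'b::field vfield \<Rightarrow> 'b vfield"
  assumes "\<phi> \<in> Der" "(0, {}) \<in> H_index"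
    "\<And>i f. f \<in> Hfun \<Longrightarrow> f \<in> homogeneous (i + 2) \<Longrightarrow> \<phi> (DH f) \<in> Weven_deg (i + k)"
  shows "\<phi> \<in> Der_deg k"
  unfolding Der_deg_def
proof (intro CollectI conjI allI subsetI)
  fix i y assume "y \<in> \<phi> ` H_deg i"
  then obtain x where x: "y = \<phi> x" "x \<in> H" "x \<in> Weven_deg i" by (auto simp: H_deg_def)
  then obtain g where g: "g \<in> Hfun" "x = DH g" by (auto simp: H_eq)
  \<comment> \<open>The Hamiltonian of a homogeneous field is homogeneous only after its constant
    term is removed.\<close>
  define f where "f = g - scaleO (g (0, {})) (mon (0, {}))"
  have "mon (0, {}) \<in> (Hfun :: 'b sfun set)" using assms(2) by (simp add: Hfun_def)
  then have f: "f \<in> Hfun" "DH f = x" "f (0, {}) = 0"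
    using g by (simp_all add: f_def DH_diff DH_scale sf_apply mon_apply)
  then have "f \<in> homogeneous (i + 2)" using x by (intro deg_of_DH) auto
  then show "y \<in> Weven_deg (i + k)" using assms(3)[OF f(1)] x f by simp
qed (fact assms(1))

end

context hamiltonian_char
begin

lemma Y1_nonempty: "Y1 \<noteq> {}" and Y0_nonempty: "1 \<in> Y0" and card_Y1: "card Y1 = n"
  using n_gt_3 m_gt_1 by (auto simp: Y1_def Y0_def)

lemma const_H_index [simp]: "(0, {}) \<in> H_index"
  using Y1_nonempty by (simp add: H_index_def)

lemma const_Hfun [simp]: "mon (0, {}) \<in> (Hfun :: 'b::field sfun set)"
  by (simp add: Hfun_def)

lemma ham_fun_DH:
  fixes f :: "'b::field sfun"
  assumes "f \<in> Hfun"
  shows "ham_fun (DH f) = f - scaleO (f (0, {})) (mon (0, {}))"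
  unfolding ham_fun_def
proof (rule the_equality)
  let ?g = "f - scaleO (f (0, {})) (mon (0, {}))"
  show *: "?g \<in> Hfun \<and> ?g (0, {}) = 0 \<and> DH ?g = DH f"
    using assms by (simp add: DH_diff DH_scale sf_apply mon_apply)
  fix h assume h: "h \<in> Hfun \<and> h (0, {}) = 0 \<and> DH h = DH f"
  show "h = ?g"
  proof
    fix b
    have "DH (h - ?g) = 0" "h - ?g \<in> Opar 0" using h * by (simp_all add: DH_diff)
    then have "b \<noteq> (0, {}) \<Longrightarrow> (h - ?g) b = 0" using DH_eq_0_imp by blast
    then show "h b = ?g b" using h * by (cases "b = (0, {})") (simp_all add: sf_apply)
  qed
qed

lemma lift_DH:
  assumes "liftable T" "f \<in> Hfun"
  shows "lift T (DH f) = (T f :: 'b::field vfield)"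
proof -
  let ?c = "scaleO (- f (0, {})) (mon (0, {}))"
  have e: "f - scaleO (f (0, {})) (mon (0, {})) = f + ?c"
    by (simp add: sfun.scale_minus_left)
  have "T (f + ?c) = T f + T ?c" "T ?c = scaleW (- f (0, {})) (T (mon (0, {})))" "T (mon (0, {})) = 0"
    using assms const_Hfun Hfun_closed(5) unfolding liftable_def by blast+
  then have "T (f - scaleO (f (0, {})) (mon (0, {}))) = T f" unfolding e by simp
  then show ?thesis using assms(2) by (simp add: lift_def ham_fun_DH)
qed

lemma lift_Lin:
  assumes "liftable (T :: 'b::field sfun \<Rightarrow> _)"
  shows "lift T \<in> Lin"
  unfolding Lin_def
proof (intro CollectI conjI ballI allI impI)
  fix x y :: "'b vfield" and c
  show "x \<notin> H \<Longrightarrow> lift T x = 0" by (simp add: lift_def)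
  assume "x \<in> H"
  then obtain f where f: "x = DH f" "f \<in> Hfun" by (auto simp: H_eq)
  show "lift T x \<in> Weven" using assms f by (simp add: lift_DH) (simp add: liftable_def)
  have "lift T (DH (scaleO c f)) = scaleW c (lift T x)"
    using assms f by (simp add: lift_DH) (simp add: liftable_def)
  then show "lift T (scaleW c x) = scaleW c (lift T x)" by (simp add: f DH_scale)
  assume "y \<in> H"
  then obtain g where g: "y = DH g" "g \<in> Hfun" by (auto simp: H_eq)
  have "lift T (DH (f + g)) = lift T x + lift T y"
    using assms f g by (simp add: lift_DH) (simp add: liftable_def)
  then show "lift T (x + y) = lift T x + lift T y" by (simp add: f g DH_add)
qed

lemma lift_Der:
  fixes T :: "'a sfun \<Rightarrow> 'a vfield"
  assumes "liftable T" "\<And>f g. f \<in> Hfun \<Longrightarrow> g \<in> Hfun \<Longrightarrow>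
    T (poisson f g) = bracket (DH f) (T g) - bracket (DH g) (T f)"
  shows "lift T \<in> Der"
  using assms by (intro DerI lift_Lin) (simp_all add: bracket_DH lift_DH)

lemma the_lift:
  assumes "liftable (T :: 'b::field sfun \<Rightarrow> _)"
  shows "(THE \<phi>. \<phi> \<in> Lin \<and> (\<forall>f\<in>sfun.span (mon ` H_index). \<phi> (DH f) = T f)) = lift T"
  unfolding span_mon[OF finite_H_index] Hfun_def[symmetric]
proof (rule the_equality)
  show "lift T \<in> Lin \<and> (\<forall>f\<in>Hfun. lift T (DH f) = T f)"
    using assms by (simp add: lift_Lin lift_DH)
  fix \<phi> assume "\<phi> \<in> Lin \<and> (\<forall>f\<in>Hfun. \<phi> (DH f) = T f)"
  then show "\<phi> = lift T" using assms by (intro Lin_eqI) (simp_all add: lift_Lin lift_DH)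
qed

lemma restrict_H_eq_lift:
  assumes "liftable (T :: 'b::field sfun \<Rightarrow> _)" "\<And>f. f \<in> Hfun \<Longrightarrow> \<psi> (DH f) = T f"
  shows "restrict_H \<psi> = lift T"
proof
  fix x
  show "restrict_H \<psi> x = lift T x"
  proof (cases "x \<in> H")
    case True
    then obtain f where "x = DH f" "f \<in> Hfun" by (auto simp: H_eq)
    then show ?thesis using True assms by (simp add: restrict_H_def lift_DH)
  qed (simp add: restrict_H_def lift_def)
qed

lemma lift_Der_deg:
  fixes T :: "'a sfun \<Rightarrow> 'a vfield"
  assumes "liftable T" "\<And>f g. f \<in> Hfun \<Longrightarrow> g \<in> Hfun \<Longrightarrow>
    T (poisson f g) = bracket (DH f) (T g) - bracket (DH g) (T f)"
    "\<And>i f. f \<in> Hfun \<Longrightarrow> f \<in> homogeneous (i + 2) \<Longrightarrow> T f \<in> Weven_deg (i + k)"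
  shows "lift T \<in> Der_deg k"
  using assms by (intro Der_degI lift_Der) (simp_all add: lift_DH)

section \<open>The derivations in the generating family\<close>

lemma pd_Hfun: "r \<in> Y0 \<Longrightarrow> f \<in> Opar 0 \<Longrightarrow> pd r f \<in> (Hfun :: 'b::field sfun set)"
  using pd_Opar[of f 0 r] pd_top[OF Opar_Osup, of f 0 r Y1]
  unfolding Hfun_def supp_on_def Opar_def H_index_def by (auto simp: par_def)

lemma pd_poisson:
  fixes f g :: "'a sfun"
  assumes "r \<in> Y0" "f \<in> Opar 0" "g \<in> Opar 0"
  shows "pd r (poisson f g) = poisson (pd r f) g + poisson f (pd r g)"
proof -
  have o: "f \<in> Osup" "g \<in> Osup" using assms Opar_Osup by auto
  have "pd r (mult (pd i f) (pd (conj_index i) g)) =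
      mult (pd i (pd r f)) (pd (conj_index i) g) + mult (pd i f) (pd (conj_index i) (pd r g))"
    if i: "i \<in> Y" for i
    using leibniz[OF pd_Opar[OF assms(2) i] pd_Osup, of r "conj_index i" g] assms(1)
      pd_commute[OF o(1), of r i] pd_commute[OF o(2), of r "conj_index i"] i
    by simp
  then show ?thesis
    by (simp add: poisson_def pd_linear sfun.scale_right_distrib sum.distrib)
qed

lemma pd_pow_poisson:
  fixes f g :: "'a sfun"
  assumes "r \<in> Y0" "f \<in> Opar 0" "g \<in> Opar 0"
  shows "(pd r ^^ k) (poisson f g) =
    (\<Sum>i\<le>k. scaleO (of_nat (k choose i)) (poisson ((pd r ^^ i) f) ((pd r ^^ (k - i)) g)))"
proof (induction k)
  case 0
  then show ?case by simp
next
  case (Suc k)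
  define F where "F i j = poisson ((pd r ^^ i) f) ((pd r ^^ j) g)" for i j
  let ?c = "\<lambda>k i. of_nat (k choose i) :: 'a"
  have F: "pd r (F i j) = F (Suc i) j + F i (Suc j)" for i j
    using assms by (simp add: F_def pd_poisson pd_pow_Opar)
  have "(pd r ^^ Suc k) (poisson f g) = (\<Sum>i\<le>k. scaleO (?c k i) (F (Suc i) (k - i) + F i (Suc (k - i))))"
    by (simp add: Suc.IH pd_linear F F_def[symmetric])
  also have "\<dots> = (\<Sum>i\<le>k. scaleO (?c k i) (F (Suc i) (k - i))) + (\<Sum>i\<le>k. scaleO (?c k i) (F i (Suc k - i)))"
    unfolding sum.distrib[symmetric] by (intro sum.cong refl) (simp add: sfun.scale_right_distrib Suc_diff_le)
  also have "(\<Sum>i\<le>k. scaleO (?c k i) (F i (Suc k - i))) = (\<Sum>i\<le>Suc k. scaleO (?c k i) (F i (Suc k - i)))"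
    by (simp add: binomial_eq_0)
  also have "\<dots> = F 0 (Suc k) + (\<Sum>i\<le>k. scaleO (?c k (Suc i)) (F (Suc i) (k - i)))"
    by (subst sum.atMost_Suc_shift) simp
  also have "(\<Sum>i\<le>k. scaleO (?c k i) (F (Suc i) (k - i))) + \<dots> =
      F 0 (Suc k) + (\<Sum>i\<le>k. scaleO (?c (Suc k) (Suc i)) (F (Suc i) (k - i)))"
    by (simp add: sfun.scale_left_distrib sum.distrib)
  also have "\<dots> = (\<Sum>i\<le>Suc k. scaleO (?c (Suc k) i) (F i (Suc k - i)))"
    by (subst sum.atMost_Suc_shift) simp
  finally show ?case by (simp add: F_def)
qed

text \<open>In the Leibniz formula of order p^s all inner binomial coefficients vanish in
  characteristic p, so this power is again a derivation of the Poisson bracket.\<close>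

lemma pd_frobenius:
  fixes f g :: "'a sfun"
  assumes "r \<in> Y0" "f \<in> Opar 0" "g \<in> Opar 0"
  shows "(pd r ^^ (p ^ s)) (poisson f g) = poisson ((pd r ^^ (p ^ s)) f) g + poisson f ((pd r ^^ (p ^ s)) g)"
proof -
  define q where "q = p ^ s"
  have q: "q > 0" using p_gt_3 by (simp add: q_def)
  let ?F = "\<lambda>i. scaleO (of_nat (q choose i)) (poisson ((pd r ^^ i) f) ((pd r ^^ (q - i)) g))"
  have "(\<Sum>i\<le>q. ?F i) = (\<Sum>i\<in>{0, q}. ?F i)"
  proof (rule sum.mono_neutral_right)
    show "\<forall>i\<in>{..q} - {0, q}. ?F i = 0"
    proof
      fix i assume "i \<in> {..q} - {0, q}"
      then have "0 < i" "i < p ^ s" by (auto simp: q_def)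
      then have "of_nat (q choose i) = (0 :: 'a)" unfolding q_def by (rule of_nat_choose_zero)
      then show "?F i = 0" by simp
    qed
  qed auto
  also have "\<dots> = poisson f ((pd r ^^ q) g) + poisson ((pd r ^^ q) f) g" using q by simp
  finally show ?thesis using pd_pow_poisson[OF assms, of q] by (simp add: q_def add.commute)
qed

lemma poisson_antisym:
  fixes f g :: "'a sfun"
  assumes "f \<in> Opar 0" "g \<in> Opar 0"
  shows "poisson f g = - poisson g f"
proof -
  have "scaleO (\<tau> i) (mult (pd i f) (pd (conj_index i) g)) =
      - scaleO (\<tau> (conj_index i)) (mult (pd (conj_index i) g) (pd i f))" if i: "i \<in> Y" for i
  proof -
    have "pd i f \<in> Opar (\<mu> i)" "pd (conj_index i) g \<in> Opar (\<mu> i)"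
      using pd_Opar[OF assms(1) i] pd_Opar[OF assms(2), of "conj_index i"] i by simp_all
    from mult_commute[OF this] show ?thesis
      using i by (auto simp: Y_def sfun.scale_minus_left)
  qed
  then have "poisson f g = (\<Sum>i\<in>Y. - scaleO (\<tau> (conj_index i)) (mult (pd (conj_index i) g) (pd i f)))"
    unfolding poisson_def by (intro sum.cong refl)
  also have "\<dots> = (\<Sum>i\<in>Y. - scaleO (\<tau> i) (mult (pd i g) (pd (conj_index i) f)))"
    by (subst sum_conj[symmetric]) simp
  finally show ?thesis by (simp add: poisson_def sum_negf)
qed

lemma liftable_pow:
  assumes "r \<in> Y0"
  shows "liftable (\<lambda>f. DH ((pd r ^^ (p ^ s)) f) :: 'b::field vfield)"
  using assms p_gt_3
  by (simp add: liftable_def pd_pow_add pd_pow_scale DH_add DH_scale pd_pow_const pd_pow_Opar)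

lemma ad_pow_eq_lift:
  assumes "r \<in> Y0"
  shows "restrict_H (ad (partial r) ^^ (p ^ s)) = lift (\<lambda>f. DH ((pd r ^^ (p ^ s)) f) :: 'b::field vfield)"
  using liftable_pow[OF assms] assms by (intro restrict_H_eq_lift) (simp_all add: ad_partial_pow)

lemma ad_pow_Der_deg:
  assumes "r \<in> Y0"
  shows "restrict_H (ad (partial r) ^^ (p ^ s)) \<in> (Der_deg (- int (p ^ s)) :: ('a vfield \<Rightarrow> 'a vfield) set)"
  unfolding ad_pow_eq_lift[OF assms]
proof (rule lift_Der_deg[OF liftable_pow[OF assms]])
  fix f g :: "'a sfun" and i
  assume f: "f \<in> Hfun"
  show "DH ((pd r ^^ p ^ s) f) \<in> Weven_deg (i + - int (p ^ s))" if "f \<in> homogeneous (i + 2)"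
    using pd_pow_homogeneous[OF assms that, of "p ^ s"] assms f
    by (intro DH_deg) (simp_all add: pd_pow_Opar algebra_simps)
  assume g: "g \<in> Hfun"
  have o: "(pd r ^^ p ^ s) f \<in> Opar 0" "(pd r ^^ p ^ s) g \<in> Opar 0" using f g assms by (simp_all add: pd_pow_Opar)
  show "DH ((pd r ^^ p ^ s) (poisson f g)) =
      bracket (DH f) (DH ((pd r ^^ p ^ s) g)) - bracket (DH g) (DH ((pd r ^^ p ^ s) f))"
    using f g assms o poisson_antisym[OF _ o(1), of g]
    by (simp add: pd_frobenius bracket_DH DH_add DH_minus)
qed

lemma ad_Der_deg:
  fixes w :: "'a vfield"
  assumes "w \<in> Weven_deg k"
  shows "restrict_H (ad w) \<in> Der_deg k"
proof (rule Der_degI)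
  have w: "w \<in> Weven" using assms by (rule Weven_deg_Weven)
  have r: "x \<in> H \<Longrightarrow> restrict_H (ad w) x = bracket w x" for x
    by (simp add: restrict_H_def ad_def)
  have r0: "x \<notin> H \<Longrightarrow> restrict_H (ad w) x = 0" for x
    by (simp add: restrict_H_def)
  have H_closed: "x \<in> H \<Longrightarrow> y \<in> H \<Longrightarrow> x + y \<in> H" "x \<in> H \<Longrightarrow> scaleW c x \<in> H" for x y :: "'a vfield" and c
    by (auto simp: H_def intro: vfield.span_add vfield.span_scale)
  have L: "restrict_H (ad w) \<in> Lin"
    unfolding Lin_def
    using w by (auto simp: r r0 H_Weven H_closed bracket_add_right bracket_scale_right)
  then show "restrict_H (ad w) \<in> Der"
  proof (rule DerI)
    fix f g :: "'a sfun" assume fg: "f \<in> Hfun" "g \<in> Hfun"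
    then have "bracket (DH f) (DH g) \<in> H" by (simp add: bracket_DH DH_in_H)
    then show "restrict_H (ad w) (bracket (DH f) (DH g)) =
        bracket (DH f) (restrict_H (ad w) (DH g)) - bracket (DH g) (restrict_H (ad w) (DH f))"
      using fg w jacobi[OF w, of "DH f" "DH g"] bracket_minus[of "bracket w (DH f)" "DH g"]
      by (simp add: r DH_in_H)
  qed
  fix f :: "'a sfun" and i
  assume "f \<in> Hfun" "f \<in> homogeneous (i + 2)"
  then show "restrict_H (ad w) (DH f) \<in> Weven_deg (i + k)"
    using bracket_deg[OF assms DH_deg[of f i]] by (simp add: r DH_in_H add.commute)
qed simp

lemma top_nonzero: "i \<in> Y0 \<Longrightarrow> top_index i \<ge> p - 1"
proof -
  assume i: "i \<in> Y0"
  then have "t i \<ge> 1" using t_pos by (simp add: Y0_def)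
  then have "p ^ 1 \<le> p ^ t i" using p_gt_3 by (intro power_increasing) auto
  then show ?thesis using top_index_pos[OF i] by simp
qed

lemma x_pi_H_index [simp]: "(top_index, {}) \<in> H_index"
  using Y1_nonempty by (simp add: H_index_def Basis_iff)

lemma top_index_neq_0: "top_index \<noteq> 0"
  using top_nonzero[OF Y0_nonempty] p_gt_3 by (auto simp: zero_fun_apply)

section \<open>The additional derivations for even n\<close>

context
  assumes even_n: "even n"
begin

lemma x_omega_Opar: "x_omega \<in> (Opar 0 :: 'b::field sfun set)"
  using even_n by (simp add: x_omega_def par_def card_Y1)

lemma x_omega_homogeneous: "x_omega \<in> (homogeneous (int n) :: 'b::field sfun set)"
  by (simp add: x_omega_def homogeneous_eq deg_def card_Y1 size_index_def zero_fun_apply)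

lemma DH_omega_deg: "DH x_omega \<in> (Weven_deg (int n - 2) :: 'b::field vfield set)"
  using x_omega_Opar x_omega_homogeneous by (intro DH_deg) simp_all

lemma DH_omega_Weven [simp]: "DH x_omega \<in> (Weven :: 'b::field vfield set)"
  by (rule DH_Weven[OF x_omega_Opar])

lemma bracket_DH_omega: "f \<in> Opar 0 \<Longrightarrow> bracket (DH f) (DH x_omega) = (0 :: 'a vfield)"
  by (simp add: bracket_DH x_omega_Opar poisson_x_omega)

lemma bracket_smul_right:
  fixes D x :: "'a vfield"
  assumes "f \<in> Opar 0" "D \<in> Weven" "x \<in> Weven"
  shows "bracket x (smul f D) = smul (act x f) D + smul f (bracket x D)"
proof -
  have o: "f \<in> Osup" using assms(1) by (rule Opar_Osup)
  show ?thesis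
  proof
    fix j
    have "bracket x (smul f D) j = act x (mult f (D j)) - act (smul f D) (x j)"
      unfolding bracket_eq[OF assms(3) smul_Weven[OF assms(1,2)]] by (simp add: smul_def)
    also have "\<dots> = mult (act x f) (D j) + mult f (act x (D j)) - mult f (act D (x j))"
      using assms o by (simp add: act_mult[OF assms(3,1)] act_smul)
    finally show "bracket x (smul f D) j = (smul (act x f) D + smul f (bracket x D)) j"
      using assms by (simp add: vf_apply smul_def bracket_eq mult_diff_right)
  qed
qed

lemma liftable_gamma: "liftable (\<lambda>f. scaleW (f (top_index, {})) (DH x_omega) :: 'b::field vfield)"
  using top_index_neq_0
  by (simp add: liftable_def sf_apply vfield.scale_left_distrib mon_apply)

lemma gamma_eq_lift: "\<Gamma>1 = lift (\<lambda>f. scaleW (f (top_index, {})) (DH x_omega) :: 'b::field vfield)"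
  (is "_ = lift ?T")
  unfolding \<Gamma>1_def
proof (rule the_equality)
  have pi: "x_pi \<in> (Hfun :: 'b sfun set)" by (simp add: Hfun_def x_pi_def)
  have sub: "f \<in> Hfun" "f (top_index, {}) = 0" if "f \<in> supp_on (H_index - {(top_index, {})})" for f :: "'b sfun"
    using that by (auto simp: Hfun_def supp_on_def)
  show "lift ?T \<in> Lin \<and> (\<forall>x\<in>N. lift ?T x = 0) \<and> lift ?T (DH x_pi) = DH x_omega"
    using pi by (auto simp: lift_Lin[OF liftable_gamma] N_eq sub lift_DH[OF liftable_gamma])
      (simp add: x_pi_def mon_apply)
  fix \<phi> :: "'b vfield \<Rightarrow> 'b vfield"
  assume *: "\<phi> \<in> Lin \<and> (\<forall>x\<in>N. \<phi> x = 0) \<and> \<phi> (DH x_pi) = DH x_omega"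
  show "\<phi> = lift ?T"
  proof (rule Lin_eqI_mon)
    fix b assume b: "b \<in> H_index"
    then have "mon b \<in> (Hfun :: 'b sfun set)" by (simp add: Hfun_def)
    then have l: "lift ?T (DH (mon b)) = ?T (mon b)" by (rule lift_DH[OF liftable_gamma])
    show "\<phi> (DH (mon b)) = lift ?T (DH (mon b))"
    proof (cases "b = (top_index, {})")
      case True
      then show ?thesis using * l by (simp add: x_pi_def mon_apply)
    next
      case False
      then have "DH (mon b) \<in> (N :: 'b vfield set)" using b by (simp add: N_eq)
      then show ?thesis using * l False by (auto simp: mon_apply)
    qed
  qed (use * lift_Lin[OF liftable_gamma] in blast)+
qed

text \<open>Both sides of the derivation rule are zero: brackets have no coefficient at x^(pi) by
  \<open>poisson_top\<close>, and the field of x^omega commutes with H.\<close>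

lemma gamma_Der_deg: "\<Gamma>1 \<in> (Der_deg (int n - int (size_index top_index)) :: ('a vfield \<Rightarrow> 'a vfield) set)"
  unfolding gamma_eq_lift
proof (rule lift_Der_deg[OF liftable_gamma])
  fix f g :: "'a sfun" and i
  assume f: "f \<in> Hfun"
  show "scaleW (f (top_index, {})) (DH x_omega) \<in> Weven_deg (i + (int n - int (size_index top_index)))"
    if "f \<in> homogeneous (i + 2)"
  proof (cases "f (top_index, {}) = 0")
    case False
    then have "int (size_index top_index) = i + 2" using homogeneousD[OF that] by (fastforce simp: deg_def)
    then show ?thesis by (simp add: DH_omega_deg)
  qed simp
  assume g: "g \<in> Hfun"
  show "scaleW (poisson f g (top_index, {})) (DH x_omega) =
      bracket (DH f) (scaleW (g (top_index, {})) (DH x_omega)) - bracket (DH g) (scaleW (f (top_index, {})) (DH x_omega))"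
    using f g by (simp add: poisson_top bracket_scale_right bracket_DH_omega)
qed

lemma liftable_Phi:
  assumes "r \<in> Y0"
  shows "liftable (\<lambda>f. smul ((pd r ^^ (p ^ s)) f) (DH x_omega) :: 'b::field vfield)"
  using assms p_gt_3
  by (simp add: liftable_def pd_pow_add pd_pow_scale bracket_smul pd_pow_const pd_pow_Opar smul_Weven)

lemma Phi_eq_lift:
  assumes "r \<in> Y0"
  shows "\<Phi> r s = lift (\<lambda>f. smul ((pd r ^^ (p ^ s)) f) (DH x_omega) :: 'b::field vfield)"
  unfolding \<Phi>_def by (rule the_lift[OF liftable_Phi[OF assms]])

text \<open>The power of d_r is a derivation of the Poisson bracket, and the field of x^omega, by
  which its values are multiplied, commutes with H.\<close>

lemma Phi_Der_deg:
  assumes "r \<in> Y0"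
  shows "\<Phi> r s \<in> (Der_deg (int n - int (p ^ s)) :: ('a vfield \<Rightarrow> 'a vfield) set)"
  unfolding Phi_eq_lift[OF assms]
proof (rule lift_Der_deg[OF liftable_Phi[OF assms]])
  fix f g :: "'a sfun" and i
  assume f: "f \<in> Hfun"
  show "smul ((pd r ^^ p ^ s) f) (DH x_omega) \<in> Weven_deg (i + (int n - int (p ^ s)))" if "f \<in> homogeneous (i + 2)"
    using smul_deg[OF pd_pow_Opar[OF assms Hfun_Opar[OF f], of "p ^ s"] pd_pow_homogeneous[OF assms that] DH_omega_deg]
    by (simp add: algebra_simps)
  assume g: "g \<in> Hfun"
  have o: "(pd r ^^ p ^ s) f \<in> Opar 0" "(pd r ^^ p ^ s) g \<in> Opar 0" using f g assms by (simp_all add: pd_pow_Opar)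
  show "smul ((pd r ^^ p ^ s) (poisson f g)) (DH x_omega) =
      bracket (DH f) (smul ((pd r ^^ p ^ s) g) (DH x_omega)) - bracket (DH g) (smul ((pd r ^^ p ^ s) f) (DH x_omega))"
    using f g assms o poisson_antisym[OF _ o(1), of g]
      bracket_smul(1)[of "poisson ((pd r ^^ p ^ s) f) g" "poisson f ((pd r ^^ p ^ s) g)" "DH x_omega"]
      bracket_smul(2)[of "-1" "poisson ((pd r ^^ p ^ s) f) g" "DH x_omega"]
    by (simp add: pd_frobenius bracket_smul_right bracket_DH_omega act_DH sfun.scale_minus_left vfield.scale_minus_left)
qed

lemma liftable_Theta:
  assumes "r \<in> Y0"
  shows "liftable (\<lambda>f. smul x_omega (DH ((pd r ^^ (p ^ s)) f)) :: 'b::field vfield)"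
  using assms p_gt_3
  by (simp add: liftable_def pd_pow_add pd_pow_scale DH_add DH_scale bracket_smul pd_pow_const pd_pow_Opar smul_Weven
      x_omega_Opar)

lemma Theta_eq_lift:
  assumes "r \<in> Y0"
  shows "\<Theta> r s = lift (\<lambda>f. smul x_omega (DH ((pd r ^^ (p ^ s)) f)) :: 'b::field vfield)"
  unfolding \<Theta>_def
  using liftable_Theta[OF assms] assms by (intro restrict_H_eq_lift) (simp_all add: ad_partial_pow)

text \<open>Since H annihilates x^omega, multiplication by it commutes with bracketing by elements
  of H; composed with the derivation given by the power of \<open>ad (partial r)\<close> it is a
  derivation again.\<close>

lemma Theta_Der_deg:
  assumes "r \<in> Y0"
  shows "\<Theta> r s \<in> (Der_deg (int n - int (p ^ s)) :: ('a vfield \<Rightarrow> 'a vfield) set)"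
  unfolding Theta_eq_lift[OF assms]
proof (rule lift_Der_deg[OF liftable_Theta[OF assms]])
  fix f g :: "'a sfun" and i
  assume f: "f \<in> Hfun"
  show "smul x_omega (DH ((pd r ^^ p ^ s) f)) \<in> Weven_deg (i + (int n - int (p ^ s)))" if "f \<in> homogeneous (i + 2)"
  proof -
    have "DH ((pd r ^^ p ^ s) f) \<in> Weven_deg (i - int (p ^ s))"
      using pd_pow_homogeneous[OF assms that, of "p ^ s"] assms f
      by (intro DH_deg) (simp_all add: pd_pow_Opar algebra_simps)
    from smul_deg[OF x_omega_Opar x_omega_homogeneous this] show ?thesis by (simp add: algebra_simps)
  qed
  assume g: "g \<in> Hfun"
  have o: "(pd r ^^ p ^ s) f \<in> Opar 0" "(pd r ^^ p ^ s) g \<in> Opar 0" using f g assms by (simp_all add: pd_pow_Opar)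
  show "smul x_omega (DH ((pd r ^^ p ^ s) (poisson f g))) =
      bracket (DH f) (smul x_omega (DH ((pd r ^^ p ^ s) g))) - bracket (DH g) (smul x_omega (DH ((pd r ^^ p ^ s) f)))"
    using f g assms o poisson_antisym[OF _ o(1), of g]
    by (simp add: pd_frobenius bracket_smul_right x_omega_Opar act_DH poisson_x_omega bracket_DH DH_add DH_minus add.commute
        bracket_smul(3)[symmetric] bracket_smul(5)[symmetric])
qed

end

end

section \<open>Leading coefficients of a derivation\<close>

definition sgl :: "nat \<Rightarrow> nat \<Rightarrow> nat \<Rightarrow> nat" where
  "sgl i k = (\<lambda>j. if j = i then k else 0)"

lemma sgl_apply: "sgl i k j = (if j = i then k else 0)"
  by (simp add: sgl_def)

lemma sgl_0 [simp]: "sgl i 0 = 0"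
  by (simp add: sgl_def fun_eq_iff zero_fun_apply)

lemma sgl_eq_0 [simp]: "sgl i k = 0 \<longleftrightarrow> k = 0"
  by (auto simp: sgl_def fun_eq_iff zero_fun_apply)

text \<open>Setting the even variables to zero, which is a homomorphism by \<open>ev_mult\<close>
  and commutes with the odd derivatives by \<open>ev_pd_Y1\<close>.\<close>

definition ev :: "'b::field sfun \<Rightarrow> 'b sfun" where
  "ev f = (\<lambda>b. if fst b = 0 then f b else 0)"

lemma ev_apply: "ev f (\<alpha>, u) = (if \<alpha> = 0 then f (\<alpha>, u) else 0)"
  by (simp add: ev_def)

lemma ev_linear:
  "ev (f + g) = ev f + ev g" "ev (f - g) = ev f - ev g" "ev (- f) = - ev f" "ev 0 = (0 :: 'b::field sfun)"
  "ev (scaleO c f) = scaleO c (ev f)"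
  by (rule ext, simp add: ev_def sf_apply)+

lemma ev_sum: "ev (\<Sum>x\<in>X. F x) = (\<Sum>x\<in>X. ev (F x))"
  by (rule additive.sum[of ev]) (simp add: additive_def ev_linear)

context hamiltonian
begin

lemma ev_Osup [simp]: "f \<in> Osup \<Longrightarrow> ev f \<in> Osup"
  by (simp add: Osup_def ev_def)

lemma ev_mon: "ev (mon (\<alpha>, u)) = (if \<alpha> = 0 then mon (\<alpha>, u) else (0 :: 'b::field sfun))"
  by (rule ext) (auto simp: ev_def mon_apply sf_apply)

lemma ev_mult:
  assumes "f \<in> Osup" "g \<in> Osup"
  shows "ev (mult f g) = mult (ev f) (ev g :: 'b::field sfun)"
proof -
  have 0: "ev (mult (mon b) (mon c)) = mult (ev (mon b)) (ev (mon c) :: 'b sfun)"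
    if "b \<in> Basis" "c \<in> Basis" for b c
  proof -
    obtain \<alpha> u \<beta> v where multi_binom: "b = (\<alpha>, u)" "c = (\<beta>, v)" by (metis surj_pair)
    have *: "\<alpha> \<in> A" "\<beta> \<in> A" "u \<subseteq> Y1" "v \<subseteq> Y1" using that multi_binom by (auto simp: Basis_iff)
    have "\<alpha> + \<beta> = 0 \<longleftrightarrow> \<alpha> = 0 \<and> \<beta> = 0"
      by (auto simp: fun_eq_iff plus_fun_apply zero_fun_apply)
    then show ?thesis using *
      by (auto simp: multi_binom mult_mon_mon' ev_mon ev_linear)
  qed
  have 1: "ev (mult (mon b) g) = mult (ev (mon b)) (ev g)" if b: "b \<in> Basis" for b
    using assms(2)
    by (induction rule: Osup_induct) (simp_all add: 0 b mult_linear ev_linear)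
  show ?thesis
    using assms(1)
    by (induction rule: Osup_induct) (simp_all add: 1 mult_linear ev_linear)
qed

lemma ev_pd_Y1: "f \<in> Osup \<Longrightarrow> i \<in> Y1 \<Longrightarrow> ev (pd i f) = pd i (ev f)"
proof
  fix b :: monomial
  assume *: "f \<in> Osup" "i \<in> Y1"
  obtain \<alpha> u where "b = (\<alpha>, u)" by (cases b)
  then show "ev (pd i f) b = pd i (ev f) b"
    using * by (simp add: ev_apply pd_odd_apply)
qed

text \<open>With divided powers, a coefficient at a positive even index is literally a coefficient
  of an even derivative.\<close>

lemma ev_pd_zero_imp:
  assumes "f \<in> Osup" "ev f = 0" "\<And>i. i \<in> Y0 \<Longrightarrow> pd i f = (0 :: 'b::field sfun)"
  shows "f = 0"
proof
  fix b :: monomial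
  obtain \<alpha> u where b: "b = (\<alpha>, u)" by (cases b)
  show "f b = 0 b"
  proof (cases "\<alpha> = 0")
    case True
    then show ?thesis using assms(2) b by (metis ev_apply)
  next
    case False
    then obtain i where i: "\<alpha> i \<noteq> 0" by (metis ext zero_fun_apply)
    show ?thesis
    proof (cases "i \<in> Y0")
      case True
      have "pd i f (\<alpha>(i := \<alpha> i - 1), u) = f (\<alpha>, u)"
        using i by (simp add: pd_even_apply[OF assms(1) True])
      then show ?thesis using assms(3)[OF True] by (simp add: sf_apply b)
    next
      case False
      then have "b \<notin> Basis" using i b by (auto simp: Basis_iff dest: A_outside)
      then show ?thesis using Osup_outside[OF assms(1)] by (simp add: sf_apply)
    qed
  qed
qed

text \<open>The filtration by the degree in the even variables (not the powers of an ideal, because of the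
  divided powers); \<open>ev\<close> is the projection modulo its first step.\<close>

definition low :: "nat \<Rightarrow> 'b::field sfun \<Rightarrow> bool" where
  "low k f \<longleftrightarrow> (\<forall>\<alpha> u. size_index \<alpha> < k \<longrightarrow> f (\<alpha>, u) = 0)"

lemma low_ev: "low 1 f \<Longrightarrow> ev f = 0"
proof
  fix b assume "low 1 f"
  moreover have "size_index 0 = 0" by (simp add: size_index_def zero_fun_apply)
  ultimately show "ev f b = 0 b" by (cases b) (simp add: ev_apply low_def sf_apply)
qed

lemma low_mono: "low k f \<Longrightarrow> l \<le> k \<Longrightarrow> low l f"
  by (simp add: low_def)

lemma low_pd:
  assumes "low (Suc k) f" "f \<in> Osup"
  shows "low k (pd i f)"
proof -
  consider "i \<in> Y0" | "i \<in> Y1" | "i \<notin> Y" by (auto simp: Y_def)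
  then show ?thesis
    by cases (use assms in \<open>auto simp: low_def pd_even_apply pd_odd_apply size_index_Suc sf_apply\<close>)
qed

lemma low_mon: "k \<le> size_index \<beta> \<Longrightarrow> low k (mon (\<beta>, u))"
  by (auto simp: low_def mon_apply)

lemma ev_act_low:
  assumes "low 2 f" "f \<in> Osup"
  shows "ev (act E f) = (0 :: 'b::field sfun)"
proof -
  have "low 1 (pd i f)" for i using low_pd[of 1 f i] assms by (simp add: numeral_2_eq_2)
  then have "mult (ev (E i)) (ev (pd i f)) = 0" for i by (simp add: low_ev)
  have "ev (mult (E i) (pd i f)) = 0" for i
  proof -
    have "low 1 (mult (E i) (pd i f))"
      unfolding low_def
    proof (intro allI impI)
      fix \<alpha> u assume s: "size_index \<alpha> < 1"
      show "mult (E i) (pd i f) (\<alpha>, u) = 0"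
      proof (rule ccontr)
        assume "mult (E i) (pd i f) (\<alpha>, u) \<noteq> 0"
        then obtain \<beta> \<gamma> v where "\<alpha> = \<beta> + \<gamma>" "pd i f (\<gamma>, v) \<noteq> 0" by (rule mult_apply_nonzeroE)
        moreover from this s have "size_index \<gamma> < 1" by (simp add: size_index_add)
        ultimately show False using \<open>low 1 (pd i f)\<close> by (simp add: low_def)
      qed
    qed
    then show ?thesis by (rule low_ev)
  qed
  then show ?thesis by (simp add: act_def ev_sum)
qed

text \<open>The coordinates of \<open>DH f\<close> are first derivatives of f and vanish at zero
  even variables. What remains is E differentiating these coordinates.\<close>

lemma ev_bracket_low2:
  assumes "f \<in> Opar 0" "low 2 f" "E \<in> Weven" "j \<in> Y"
  shows "ev (bracket (DH f) E j) = - scaleO (\<tau> (conj_index j)) (ev (act E (pd (conj_index j) f)) :: 'b::field sfun)"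
proof -
  have o: "f \<in> Osup" using assms(1) Opar_Osup by blast
  have "ev (DH f i) = 0" for i
    using low_pd[of 1 f "conj_index i"] assms o by (simp add: DH_apply ev_linear low_ev numeral_2_eq_2)
  then have "ev (act (DH f) (E j)) = 0"
    using assms by (simp add: act_def ev_sum ev_mult)
  then show ?thesis
    using assms by (simp add: bracket_eq ev_linear DH_apply act_scale)
qed

text \<open>Now the coordinates of \<open>DH f\<close> have even degree at least 2, so E cannot
  bring them down to degree zero either. This is why brackets of elements of even degree at least 3
  give no leading coefficients.\<close>

lemma ev_bracket_low3:
  assumes "f \<in> Opar 0" "low 3 f" "E \<in> Weven"
  shows "ev (bracket (DH f) E j) = (0 :: 'b::field sfun)"
proof (cases "j \<in> Y")
  case True
  have "low (Suc 2) f" using assms(2) by (simp add: numeral_3_eq_3 numeral_2_eq_2)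
  then have "low 2 (pd (conj_index j) f)"
    using Opar_Osup[OF assms(1)] by (rule low_pd)
  then show ?thesis
    using ev_bracket_low2[OF assms(1) low_mono[OF assms(2)] assms(3) True] by (simp add: ev_act_low)
next
  case False
  then show ?thesis
    using bracket_Weven[OF DH_Weven[OF assms(1)] assms(3)] by (simp add: Weven_outside ev_linear)
qed

text \<open>\<open>xx\<close> is the product and not the monomial with index set
  \<open>{k, l}\<close>, so that no order of k and l has to be fixed; the sign is recovered by
  \<open>xx_mon\<close>.\<close>

abbreviation xe :: "nat \<Rightarrow> 'b::field sfun" where "xe i \<equiv> mon (sgl i (Suc 0), {})"
abbreviation xo :: "nat \<Rightarrow> 'b::field sfun" where "xo k \<equiv> mon (0, {k})"
abbreviation xx :: "nat \<Rightarrow> nat \<Rightarrow> 'b::field sfun" where "xx k l \<equiv> mult (xo k) (xo l)"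

lemma sgl_A: "i \<in> Y0 \<Longrightarrow> sgl i k \<in> A \<longleftrightarrow> k \<le> top_index i"
  by (auto simp: A_iff sgl_def)

lemma pd_mon_empty_Y1: "(\<alpha>, {}) \<in> Basis \<Longrightarrow> i \<in> Y1 \<Longrightarrow> pd i (mon (\<alpha>, {})) = (0 :: 'b::field sfun)"
  by (simp add: pd_mon_Y1)

lemma mult_one_right: "f \<in> Osup \<Longrightarrow> mult f (mon (0, {})) = (f :: 'b::field sfun)"
proof (induction rule: Osup_induct)
  case (mon b)
  obtain \<alpha> u where b: "b = (\<alpha>, u)" by (cases b)
  have "\<alpha> + (0 :: nat \<Rightarrow> nat) = \<alpha>" by simp
  then show ?case using mon by (simp add: b mult_mon_mon' Basis_iff)
qed (simp_all add: mult_linear)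

lemma xo_Basis [simp]: "(0, {k}) \<in> Basis \<longleftrightarrow> k \<in> Y1"
  by (simp add: Basis_iff)

lemma pd_xo: "k \<in> Y1 \<Longrightarrow> pd i (xo k) = (if i = k then mon (0, {}) else (0 :: 'b::field sfun))"
proof -
  assume k: "k \<in> Y1"
  consider "i \<in> Y0" | "i \<in> Y1" | "i \<notin> Y" by (auto simp: Y_def)
  then show ?thesis
    by cases (use k in \<open>auto simp: pd_mon_Y0 pd_mon_Y1 zero_fun_apply\<close>)
qed

lemma act_xo: "k \<in> Y1 \<Longrightarrow> E \<in> Weven \<Longrightarrow> act E (xo k) = (E k :: 'b::field sfun)"
proof -
  assume *: "k \<in> Y1" "E \<in> Weven"
  have "act E (xo k) = (\<Sum>i\<in>Y. if i = k then E k else 0)"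
    unfolding act_def using * by (intro sum.cong) (auto simp: pd_xo mult_one_right)
  then show ?thesis using * by simp
qed

lemma xx_mon:
  assumes "k \<in> Y1" "l \<in> Y1" "k \<noteq> l"
  obtains s where "s \<noteq> 0" "xx k l = scaleO s (mon (0, {k, l})) " "s * s = (1 :: 'b::field)"
proof
  have "{k} \<inter> {l} = {}" using assms by auto
  then show "xx k l = scaleO (sort_sign {k} {l}) (mon (0, {k, l}) :: 'b sfun)"
    using assms by (simp add: mult_mon_mon' insert_commute)
qed (simp_all add: sort_sign_def flip: power_mult_distrib)

lemma xx_Opar [simp]: "k \<in> Y1 \<Longrightarrow> l \<in> Y1 \<Longrightarrow> xx k l \<in> (Opar 0 :: 'b::field sfun set)"
proof -
  assume "k \<in> Y1" "l \<in> Y1"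
  then have "xx k l \<in> (Opar (1 + 1) :: 'b sfun set)"
    by (intro mult_Opar) (simp_all add: par_def)
  also have "Opar (1 + 1) = (Opar 0 :: 'b sfun set)" by (rule Opar_cong) simp
  finally show ?thesis .
qed

end

context hamiltonian_char
begin

text \<open>A prime above 3 is at least 5. So elements of even degree at most 3 never reach the top
  multi-index.\<close>

lemma top_ge: "i \<in> Y0 \<Longrightarrow> top_index i \<ge> 4"
  using top_nonzero[of i] p_gt_3 prime_p by (cases "p = 4") auto

lemma xe_Basis [simp]: "i \<in> Y0 \<Longrightarrow> (sgl i (Suc 0), {}) \<in> Basis"
  using top_ge[of i] by (simp add: Basis_iff sgl_A)

lemma pd_xe: "k \<in> Y0 \<Longrightarrow> pd i (xe k) = (if i = k then mon (0, {}) else (0 :: 'b::field sfun))"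
proof -
  assume k: "k \<in> Y0"
  note B = xe_Basis[OF k]
  have z: "(sgl k (Suc 0))(k := 0) = 0" by (auto simp: sgl_def fun_eq_iff zero_fun_apply)
  consider "i \<in> Y0" | "i \<in> Y1" | "i \<notin> Y" by (auto simp: Y_def)
  then show ?thesis
  proof cases
    case 1
    then show ?thesis using pd_mon_Y0[OF B 1, where 'a = 'b] z by (simp add: sgl_apply split: if_splits)
  next
    case 2
    then show ?thesis using pd_mon_Y1[OF B 2, where 'a = 'b] k by auto
  next
    case 3
    then show ?thesis using k by auto
  qed
qed

lemma act_xe: "k \<in> Y0 \<Longrightarrow> E \<in> Weven \<Longrightarrow> act E (xe k) = (E k :: 'b::field sfun)"
proof -
  assume *: "k \<in> Y0" "E \<in> Weven"
  have "act E (xe k) = (\<Sum>i\<in>Y. if i = k then E k else 0)"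
    unfolding act_def using * by (intro sum.cong) (auto simp: pd_xe mult_one_right)
  then show ?thesis using * by simp
qed

lemma xe_Hfun [simp]: "i \<in> Y0 \<Longrightarrow> xe i \<in> (Hfun :: 'b::field sfun set)"
  using xe_Basis[of i] Y1_nonempty by (simp add: Hfun_def H_index_def)

lemma poisson_xe:
  assumes "i \<in> Y0"
  shows "poisson (xe i) g = scaleO (\<tau> i) (pd (conj_index i) g :: 'b::field sfun)"
proof -
  have "poisson (xe i) g = (\<Sum>k\<in>Y. if k = i then scaleO (\<tau> i) (pd (conj_index i) g) else 0)"
    unfolding poisson_def using assms by (intro sum.cong) (auto simp: pd_xe mult_one)
  then show ?thesis using assms by simp
qed

lemma bracket_DH_xe:
  fixes E :: "'b::field vfield"
  assumes "i \<in> Y0" "E \<in> Weven"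
  shows "bracket (DH (xe i)) E = (\<lambda>j. scaleO (\<tau> i) (pd (conj_index i) (E j)))"
proof
  fix j
  have x: "xe i \<in> (Opar 0 :: 'b sfun set)" using xe_Hfun[OF assms(1)] by (rule Hfun_Opar)
  have "act E (DH (xe i) j) = 0"
    using assms(1)
    by (auto simp: DH_apply[OF Hfun_Opar[OF xe_Hfun[OF assms(1)]]] pd_xe act_def pd_scale)
  then show "bracket (DH (xe i)) E j = scaleO (\<tau> i) (pd (conj_index i) (E j))"
    unfolding bracket_eq[OF DH_Weven[OF x] assms(2)] act_DH[OF x] poisson_xe[OF assms(1)] by simp
qed

section \<open>Derivations seen through their leading coefficients\<close>

lemma Der_DH:
  fixes \<phi> :: "'a vfield \<Rightarrow> 'a vfield"
  assumes "\<phi> \<in> Der" "f \<in> Hfun" "g \<in> Hfun"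
  shows "\<phi> (DH (poisson f g)) = bracket (DH f) (\<phi> (DH g)) - bracket (DH g) (\<phi> (DH f))"
  using assms by (simp add: Der_def bracket_DH[symmetric] DH_in_H)

lemma Der_Weven: "\<phi> \<in> Der \<Longrightarrow> f \<in> Hfun \<Longrightarrow> \<phi> (DH f) \<in> Weven"
  using Lin_DH(1) Der_Lin by blast

text \<open>Bracketing with the field of x_i' is the derivative by x_i up to sign. So a derivation
  that kills these fields commutes with the even derivatives.\<close>

lemma Der_pd:
  fixes \<phi> :: "'a vfield \<Rightarrow> 'a vfield"
  assumes "\<phi> \<in> Der" "\<And>i. i \<in> Y0 \<Longrightarrow> \<phi> (DH (xe i)) = 0" "g \<in> Hfun" "i \<in> Y0"
  shows "\<phi> (DH (pd i g)) j = pd i (\<phi> (DH g) j)"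
proof -
  have c: "conj_index i \<in> Y0" using assms(4) by simp
  have W: "\<phi> (DH g) \<in> Weven" using assms by (simp add: Der_Weven)
  have "\<phi> (DH (poisson (xe (conj_index i)) g)) = bracket (DH (xe (conj_index i))) (\<phi> (DH g))"
    using Der_DH[OF assms(1) xe_Hfun[OF c] assms(3)] assms(2)[OF c] assms(3) by simp
  moreover have "\<phi> (DH (poisson (xe (conj_index i)) g)) = scaleW (\<tau> (conj_index i)) (\<phi> (DH (pd i g)))"
    unfolding poisson_xe[OF c] conj_conj
    by (rule Lin_DH(3)[OF Der_Lin[OF assms(1)] pd_Hfun[OF assms(4) Hfun_Opar[OF assms(3)]]])
  ultimately have "scaleO (\<tau> (conj_index i)) (\<phi> (DH (pd i g)) j) = scaleO (\<tau> (conj_index i)) (pd i (\<phi> (DH g) j))"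
    using W c by (metis bracket_DH_xe conj_conj vf_apply(5))
  then show ?thesis by (metis sfun.scale_left_imp_eq tau_nonzero)
qed

text \<open>The leading coefficients of the value of a derivation: by \<open>Der_pd\<close> they determine it.\<close>

definition dv :: "('a vfield \<Rightarrow> 'a vfield) \<Rightarrow> 'a sfun \<Rightarrow> nat \<Rightarrow> 'a sfun" where
  "dv \<phi> g j = ev (\<phi> (DH g) j)"

lemma dv_linear:
  assumes "\<phi> \<in> Der" "f \<in> Hfun"
  shows "g \<in> Hfun \<Longrightarrow> dv \<phi> (f + g) j = dv \<phi> f j + dv \<phi> g j" "dv \<phi> (scaleO c f) j = scaleO c (dv \<phi> f j)"
    "g \<in> Hfun \<Longrightarrow> dv \<phi> (f - g) j = dv \<phi> f j - dv \<phi> g j" "dv \<phi> (- f) j = - dv \<phi> f j"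
  using Lin_DH[OF Der_Lin[OF assms(1)] assms(2)] Lin_DH_diff[OF Der_Lin[OF assms(1)] assms(2)]
    Lin_DH_minus[OF Der_Lin[OF assms(1)] assms(2)]
  by (simp_all add: dv_def vf_apply ev_linear)

lemma dv_zero: "\<phi> \<in> Der \<Longrightarrow> dv \<phi> 0 j = 0"
  by (simp add: dv_def vf_apply ev_linear Lin_DH_0[OF Der_Lin])

lemma dv_Osup [simp]: "\<phi> \<in> Der \<Longrightarrow> f \<in> Hfun \<Longrightarrow> dv \<phi> f j \<in> Osup"
  by (simp add: dv_def Der_Weven)

lemma dv_Opar: "\<phi> \<in> Der \<Longrightarrow> f \<in> Hfun \<Longrightarrow> j \<in> Y \<Longrightarrow> dv \<phi> f j \<in> Opar (\<mu> j)"
  using Weven_Opar[OF Der_Weven, of \<phi> f j] by (auto simp: dv_def ev_def Opar_def supp_on_def)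

lemma dv_support: "dv \<phi> f j (\<alpha>, u) \<noteq> 0 \<Longrightarrow> \<alpha> = 0"
  by (auto simp: dv_def ev_apply split: if_splits)

lemma dv_outside: "\<phi> \<in> Der \<Longrightarrow> f \<in> Hfun \<Longrightarrow> j \<notin> Y \<Longrightarrow> dv \<phi> f j = 0"
  by (simp add: dv_def Weven_outside[OF Der_Weven] ev_linear)

text \<open>The term in which \<phi> is applied to f drops out: either it is zero, or g has too high
  an even degree for it to reach the leading coefficients.\<close>

lemma dv_poisson:
  assumes "\<phi> \<in> Der" "f \<in> Hfun" "g \<in> Hfun" "\<phi> (DH f) = 0 \<or> low 3 g"
  shows "dv \<phi> (poisson f g) j = ev (bracket (DH f) (\<phi> (DH g)) j)"
proof -
  have "ev (bracket (DH g) (\<phi> (DH f)) j) = 0"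
    using assms ev_bracket_low3[of g "\<phi> (DH f)" j] by (auto simp: Der_Weven vf_apply ev_linear)
  then show ?thesis using assms by (simp add: dv_def Der_DH vf_apply ev_linear)
qed

lemma dv_poisson_low3:
  assumes "\<phi> \<in> Der" "f \<in> Hfun" "g \<in> Hfun" "\<phi> (DH f) = 0 \<or> low 3 g" "low 3 f"
  shows "dv \<phi> (poisson f g) j = 0"
  using assms by (simp add: dv_poisson ev_bracket_low3 Der_Weven)

lemma dv_poisson_low2:
  assumes "\<phi> \<in> Der" "f \<in> Hfun" "g \<in> Hfun" "\<phi> (DH f) = 0" "low 2 f" "j \<in> Y"
  shows "dv \<phi> (poisson f g) j = - scaleO (\<tau> (conj_index j)) (ev (act (\<phi> (DH g)) (pd (conj_index j) f)))"
  using assms by (simp add: dv_poisson ev_bracket_low2 Der_Weven)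

text \<open>The induction step on the even degree: \<open>Der_pd\<close> reduces the even
  derivatives of the value to the values on the derivatives of g, and only the part without even
  variables is left.\<close>

lemma Der_zero_of_dv:
  fixes \<phi> :: "'a vfield \<Rightarrow> 'a vfield"
  assumes "\<phi> \<in> Der" "\<And>i. i \<in> Y0 \<Longrightarrow> \<phi> (DH (xe i)) = 0" "g \<in> Hfun"
    "\<And>j. dv \<phi> g j = 0" "\<And>i. i \<in> Y0 \<Longrightarrow> \<phi> (DH (pd i g)) = 0"
  shows "\<phi> (DH g) = 0"
proof
  fix j
  have "\<phi> (DH g) j = 0"
  proof (rule ev_pd_zero_imp)
    show "\<phi> (DH g) j \<in> Osup" using assms by (simp add: Der_Weven)
    show "ev (\<phi> (DH g) j) = 0" using assms(4) by (simp add: dv_def)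
    fix i assume i: "i \<in> Y0"
    show "pd i (\<phi> (DH g) j) = 0"
      using Der_pd[OF assms(1,2,3) i, of j] assms(5)[OF i] by (simp add: vf_apply)
  qed
  then show "\<phi> (DH g) j = 0 j" by (simp add: vf_apply)
qed

text \<open>The rotation in the plane of two odd variables, which is the action of \<open>DH (xx k l)\<close> up to sign.\<close>

definition so :: "nat \<Rightarrow> nat \<Rightarrow> 'b::field sfun \<Rightarrow> 'b sfun" where
  "so k l g = mult (xo l) (pd k g) - mult (xo k) (pd l g)"

lemma pd_xx:
  assumes "k \<in> Y1" "l \<in> Y1" "i \<in> Y" "k \<noteq> l"
  shows "pd i (xx k l) = (if i = k then xo l else if i = l then - xo k else (0 :: 'a sfun))"
proof -
  have "pd i (xx k l) = mult (pd i (xo k)) (xo l) + scaleO ((-1) ^ (\<mu> i * 1)) (mult (xo k) (pd i (xo l) :: 'a sfun))"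
    using assms by (intro leibniz) (simp_all add: par_def)
  then show ?thesis using assms
    by (auto simp: pd_xo mult_one mult_one_right sfun.scale_minus_left)
qed

lemma poisson_xx:
  assumes "k \<in> Y1" "l \<in> Y1" "k \<noteq> l"
  shows "poisson (xx k l) g = so k l (g :: 'a sfun)"
proof -
  have "poisson (xx k l) g = (\<Sum>i\<in>Y. (if i = k then mult (xo l) (pd k g) else 0) - (if i = l then mult (xo k) (pd l g) else 0))"
    unfolding poisson_def using assms by (intro sum.cong) (auto simp: pd_xx mult_minus_left)
  then show ?thesis using assms by (simp add: so_def sum_subtractf)
qed

lemma bracket_DH_xx:
  fixes E :: "'a vfield"
  assumes "k \<in> Y1" "l \<in> Y1" "k \<noteq> l" "E \<in> Weven" "j \<in> Y"
  shows "bracket (DH (xx k l)) E j = so k l (E j) - (if j = k then E l else 0) + (if j = l then E k else 0)"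
proof -
  have "DH (xx k l) j = (if j = k then xo l else if j = l then - xo k else (0 :: 'a sfun))"
    using assms pd_xx[of k l "conj_index j"] by (auto simp: DH_apply conj_eq_swap)
  then have "act E (DH (xx k l) j) = (if j = k then E l else 0) - (if j = l then E k else 0)"
    using assms by (simp add: act_xo act_minus)
  then show ?thesis
    using assms by (simp add: bracket_eq act_DH poisson_xx)
qed

lemma ev_so: "k \<in> Y1 \<Longrightarrow> l \<in> Y1 \<Longrightarrow> f \<in> Osup \<Longrightarrow> ev (so k l f) = so k l (ev f)"
  by (simp add: so_def ev_linear ev_mult ev_mon ev_pd_Y1)

lemma xx_Hfun [simp]: "k \<in> Y1 \<Longrightarrow> l \<in> Y1 \<Longrightarrow> xx k l \<in> (Hfun :: 'b::field sfun set)"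
proof -
  assume *: "k \<in> Y1" "l \<in> Y1"
  show ?thesis
  proof (cases "k = l")
    case True
    then show ?thesis using * by (simp add: mult_mon_mon')
  next
    case False
    have "(0, {k, l}) \<in> H_index"
      using * False top_index_neq_0 by (auto simp: H_index_def Basis_iff)
    moreover obtain s where "xx k l = scaleO s (mon (0, {k, l}) :: 'b sfun)"
      using xx_mon[OF * False, where 'b = 'b] by blast
    ultimately show ?thesis by (simp add: Hfun_def supp_on_closed)
  qed
qed

text \<open>Equivariance under the orthogonal algebra. The corrections at j = k and j = l express
  that the odd coordinates transform as a vector.\<close>

lemma dv_xx:
  assumes "\<phi> \<in> Der" "g \<in> Hfun" "\<phi> (DH (xx k l)) = 0" "k \<in> Y1" "l \<in> Y1" "k \<noteq> l" "j \<in> Y"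
  shows "dv \<phi> (so k l g) j = so k l (dv \<phi> g j) - (if j = k then dv \<phi> g l else 0) + (if j = l then dv \<phi> g k else 0)"
proof -
  have "dv \<phi> (so k l g) j = ev (bracket (DH (xx k l)) (\<phi> (DH g)) j)"
    using dv_poisson[OF assms(1) xx_Hfun assms(2), of k l j] assms by (simp add: poisson_xx)
  then show ?thesis
    using assms by (simp add: bracket_DH_xx Der_Weven ev_linear ev_so dv_def)
qed

text \<open>The element x_i x_k x_l. By \<open>poisson_xexx\<close>, bracketing with it either
  inserts x_k x_l while lowering the index conjugate to i, or exchanges x_k and x_l while raising
  the index i. It is thus the tool for changing the odd part of a monomial.\<close>

definition xexx :: "nat \<Rightarrow> nat \<Rightarrow> nat \<Rightarrow> 'b::field sfun" where
  "xexx i k l = mult (xe i) (xx k l)"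

lemma xexx_mon:
  assumes "i \<in> Y0" "k \<in> Y1" "l \<in> Y1" "k \<noteq> l"
  obtains s where "s \<noteq> 0" "xexx i k l = scaleO s (mon (sgl i (Suc 0), {k, l}) :: 'b::field sfun)"
proof -
  obtain s where s: "s \<noteq> 0" "xx k l = scaleO s (mon (0, {k, l}) :: 'b sfun)" using xx_mon[OF assms(2-4), where 'b = 'b] by blast
  have "sgl i (Suc 0) + 0 = sgl i (Suc 0)" by simp
  moreover have "sgl i (Suc 0) \<in> A" using xe_Basis[OF assms(1)] by (simp add: Basis_iff)
  ultimately have "xexx i k l = scaleO s (mon (sgl i (Suc 0), {k, l}) :: 'b sfun)"
    using assms s by (simp add: xexx_def mult_linear mult_mon_mon')
  with s that show ?thesis by blast
qed

lemma xexx_Hfun [simp]: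
  assumes "i \<in> Y0" "k \<in> Y1" "l \<in> Y1"
  shows "xexx i k l \<in> (Hfun :: 'b::field sfun set)"
proof (cases "k = l")
  case True
  then show ?thesis using assms by (simp add: xexx_def mult_mon_mon')
next
  case False
  have "sgl i (Suc 0) \<noteq> top_index" using top_ge[OF assms(1)] by (auto simp: sgl_def fun_eq_iff)
  moreover have "sgl i (Suc 0) \<in> A" using xe_Basis[OF assms(1)] by (simp add: Basis_iff)
  ultimately have "(sgl i (Suc 0), {k, l}) \<in> H_index" using assms False by (auto simp: H_index_def Basis_iff)
  moreover obtain s where "xexx i k l = scaleO s (mon (sgl i (Suc 0), {k, l}) :: 'b sfun)"
    using xexx_mon[OF assms False, where 'b = 'b] by blast
  ultimately show ?thesis by (simp add: Hfun_def supp_on_closed)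
qed

lemma pd_xexx:
  assumes "i \<in> Y0" "k \<in> Y1" "l \<in> Y1" "k \<noteq> l" "j \<in> Y"
  shows "pd j (xexx i k l) = (if j = i then xx k l else 0) + mult (xe i) (pd j (xx k l) :: 'a sfun)"
proof -
  have "pd j (xexx i k l) = mult (pd j (xe i)) (xx k l) + scaleO ((-1) ^ (\<mu> j * 0)) (mult (xe i) (pd j (xx k l) :: 'a sfun))"
    unfolding xexx_def using assms by (intro leibniz) (simp_all add: par_def)
  then show ?thesis using assms by (auto simp: pd_xe mult_one)
qed

lemma poisson_xexx:
  assumes "i \<in> Y0" "k \<in> Y1" "l \<in> Y1" "k \<noteq> l" "g \<in> Osup"
  shows "poisson (xexx i k l) g = scaleO (\<tau> i) (mult (xx k l) (pd (conj_index i) g)) + mult (xe i) (so k l (g :: 'a sfun))"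
proof -
  have "poisson (xexx i k l) g = (\<Sum>j\<in>Y. (if j = i then scaleO (\<tau> i) (mult (xx k l) (pd (conj_index i) g)) else 0) +
      mult (xe i) (scaleO (\<tau> j) (mult (pd j (xx k l)) (pd (conj_index j) g))))"
    unfolding poisson_def using assms
    by (intro sum.cong) (auto simp: pd_xexx mult_linear mult_assoc sfun.scale_right_distrib)
  also have "\<dots> = scaleO (\<tau> i) (mult (xx k l) (pd (conj_index i) g)) + mult (xe i) (poisson (xx k l) g)"
    using assms by (simp add: sum.distrib poisson_def mult_sum_right)
  finally show ?thesis using assms by (simp add: poisson_xx)
qed

text \<open>At zero even variables the summand of \<open>poisson_xexx\<close> with the factor x_i
  disappears. The other terms come from the field \<phi>(D_H g) differentiating the coordinates of
  D_H(x_i x_k x_l), which are x_k x_l, x_i x_l and x_i x_k up to sign.\<close>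

lemma dv_xexx:
  fixes \<phi> :: "'a vfield \<Rightarrow> 'a vfield"
  assumes "\<phi> \<in> Der" "g \<in> Hfun" "\<phi> (DH (xexx i k l)) = 0" "\<And>i. i \<in> Y0 \<Longrightarrow> \<phi> (DH (xe i)) = 0"
    "i \<in> Y0" "k \<in> Y1" "l \<in> Y1" "k \<noteq> l" "j \<in> Y"
  shows "dv \<phi> (poisson (xexx i k l) g) j =
    scaleO (\<tau> i) (mult (xx k l) (dv \<phi> (pd (conj_index i) g) j))
    - (if j = conj_index i then scaleO (\<tau> i) (mult (dv \<phi> g k) (xo l) + mult (xo k) (dv \<phi> g l)) else 0)
    - (if j = k then mult (dv \<phi> g i) (xo l) else 0) + (if j = l then mult (dv \<phi> g i) (xo k) else 0)"
proof -
  let ?E = "\<phi> (DH g)"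
  have E: "?E \<in> Weven" using assms by (simp add: Der_Weven)
  have xo: "xo k \<in> Opar 1" "xo l \<in> (Opar 1 :: 'a sfun set)" "xe i \<in> (Opar 0 :: 'a sfun set)"
    using assms by (simp_all add: par_def)
  have "ev (act (DH (xexx i k l)) (?E j)) = scaleO (\<tau> i) (mult (xx k l) (ev (pd (conj_index i) (?E j))))"
    using assms E by (simp add: act_DH poisson_xexx ev_linear ev_mult ev_mon so_def)
  also have "ev (pd (conj_index i) (?E j)) = dv \<phi> (pd (conj_index i) g) j"
    using Der_pd[OF assms(1,4,2), of "conj_index i" j] assms(5) by (simp add: dv_def)
  finally have 1: "ev (act (DH (xexx i k l)) (?E j)) =
    scaleO (\<tau> i) (mult (xx k l) (dv \<phi> (pd (conj_index i) g) j))" .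
  have act_xx: "act ?E (xx k l) = mult (?E k) (xo l) + mult (xo k) (?E l)"
    using act_mult[OF E xo(1), of "xo l"] assms E by (simp add: act_xo)
  have act_xexo: "ev (act ?E (mult (xe i) (xo s))) = mult (dv \<phi> g i) (xo s)" if "s \<in> Y1" for s
    using act_mult[OF E xo(3), of "xo s"] assms E that
    by (simp add: act_xo act_xe ev_linear ev_mult ev_mon dv_def)
  have "DH (xexx i k l) j = (if j = conj_index i then scaleO (\<tau> i) (xx k l) else 0) +
    (if j = k then mult (xe i) (xo l) else 0) - (if j = l then mult (xe i) (xo k) else (0 :: 'a sfun))"
  proof (cases "j \<in> Y0")
    case True
    then have "pd (conj_index j) (xx k l) = (0 :: 'a sfun)"
      using assms pd_xx[of k l "conj_index j"] by (metis Y1_not_Y0 Y0_sub conj_Y0)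
    then show ?thesis using True assms Hfun_Opar[OF xexx_Hfun[OF assms(5-7)]]
      by (auto simp: DH_apply pd_xexx conj_eq_swap)
  next
    case False
    then have "j \<in> Y1" using assms(9) by (simp add: Y_def)
    moreover from this have "j \<noteq> i" "j \<noteq> conj_index i" using assms(5) by (metis Y1_not_Y0 conj_Y0)+
    ultimately show ?thesis using assms Hfun_Opar[OF xexx_Hfun[OF assms(5-7)]]
      by (auto simp: DH_apply pd_xexx pd_xx mult_linear)
  qed
  moreover have "k \<noteq> conj_index i" "l \<noteq> conj_index i" using assms by (metis Y1_not_Y0 conj_Y0)+
  ultimately have 2: "ev (act ?E (DH (xexx i k l) j)) =
    (if j = conj_index i then scaleO (\<tau> i) (mult (dv \<phi> g k) (xo l) + mult (xo k) (dv \<phi> g l)) else 0)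
    + (if j = k then mult (dv \<phi> g i) (xo l) else 0) - (if j = l then mult (dv \<phi> g i) (xo k) else 0)"
    using assms E
    by (simp add: act_diff act_add act_scale act_xx act_xexo ev_linear ev_mult ev_mon dv_def)
  have "dv \<phi> (poisson (xexx i k l) g) j = ev (bracket (DH (xexx i k l)) ?E j)"
    using assms by (intro dv_poisson) simp_all
  also have "\<dots> = ev (act (DH (xexx i k l)) (?E j)) - ev (act ?E (DH (xexx i k l) j))"
    using assms E by (simp add: bracket_eq ev_linear)
  finally show ?thesis unfolding 1 2 by (simp add: algebra_simps)
qed

end

section \<open>Monomials as Poisson brackets\<close>

context hamiltonian
begin

lemma multi_binom_sgl:
  assumes "i \<in> Y0"
  shows "multi_binom (sgl i k) \<beta> = (of_nat ((k + \<beta> i) choose k) :: 'b::field)"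
proof -
  have "multi_binom (sgl i k) \<beta> = (\<Prod>j\<in>Y0. if j = i then of_nat ((k + \<beta> i) choose k) else (1 :: 'b))"
    unfolding multi_binom_def by (intro prod.cong) (auto simp: sgl_apply)
  then show ?thesis using assms by simp
qed

lemma size_index_sgl: "i \<in> Y0 \<Longrightarrow> size_index (sgl i k) = k"
  by (simp add: size_index_def sgl_def)

lemma size_index_ge: "i \<in> Y0 \<Longrightarrow> \<alpha> i \<le> size_index \<alpha>"
  unfolding size_index_def by (intro member_le_sum) auto

lemma pd_sgl:
  assumes "i \<in> Y0" "Suc k \<le> top_index i"
  shows "pd j (mon (sgl i (Suc k), {})) = (if j = i then mon (sgl i k, {}) else (0 :: 'b::field sfun))"
proof -
  have B: "(sgl i (Suc k), {}) \<in> Basis" using assms by (simp add: Basis_iff sgl_A)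
  have z: "(sgl i (Suc k))(i := k) = sgl i k" by (auto simp: sgl_def fun_eq_iff)
  consider "j \<in> Y0" | "j \<in> Y1" | "j \<notin> Y" by (auto simp: Y_def)
  then show ?thesis
  proof cases
    case 1
    then show ?thesis using pd_mon_Y0[OF B 1, where 'a = 'b] z by (simp add: sgl_apply)
  next
    case 2
    then show ?thesis using pd_mon_Y1[OF B 2, where 'a = 'b] assms by auto
  next
    case 3
    then show ?thesis using assms by auto
  qed
qed

text \<open>Since x_i^(k+1) depends on x_i only, the bracket has one term: it differentiates
  x^(\<gamma>) by the variable conjugate to x_i and multiplies by x_i^(k). The index \<gamma> is
  solved from this, and the product of divided powers leaves a binomial coefficient.\<close>

lemma poisson_single:
  assumes i: "i \<in> Y0" "Suc k \<le> top_index i" and \<alpha>: "\<alpha> \<in> A" "k \<le> \<alpha> i"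
    and up: "\<alpha> (conj_index i) < top_index (conj_index i)" and u: "u \<subseteq> Y1" and m: "m > 0"
  defines "\<gamma> \<equiv> \<alpha>(i := \<alpha> i - k, conj_index i := Suc (\<alpha> (conj_index i)))"
  shows "\<gamma> \<in> A" "poisson (mon (sgl i (Suc k), {})) (mon (\<gamma>, u)) =
      scaleO (\<tau> i * of_nat (\<alpha> i choose k)) (mon (\<alpha>, u) :: 'b::field sfun)"
proof -
  have c: "conj_index i \<in> Y0" "conj_index i \<noteq> i" using i conj_neq[OF i(1) m] by auto
  show \<gamma>: "\<gamma> \<in> A" using \<alpha> up unfolding \<gamma>_def A_iff by (auto intro: le_trans[OF diff_le_self])
  have low: "\<alpha>(i := \<alpha> i - k) \<in> A" using \<alpha>(1) by (rule A_mono) auto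
  have "\<gamma>(conj_index i := \<gamma> (conj_index i) - 1) = \<alpha>(i := \<alpha> i - k)"
    using c by (auto simp: \<gamma>_def fun_eq_iff)
  then have pd: "pd (conj_index i) (mon (\<gamma>, u)) = (mon (\<alpha>(i := \<alpha> i - k), u) :: 'b sfun)"
    using \<gamma> u c by (simp add: pd_mon_Y0 Basis_iff) (simp add: \<gamma>_def)
  have s: "sgl i k + \<alpha>(i := \<alpha> i - k) = \<alpha>"
    using \<alpha>(2) by (auto simp: fun_eq_iff plus_fun_apply sgl_apply)
  have "sgl i k \<in> A" using i by (simp add: sgl_A)
  then have mul: "mult (mon (sgl i k, {})) (mon (\<alpha>(i := \<alpha> i - k), u)) = scaleO (of_nat (\<alpha> i choose k)) (mon (\<alpha>, u) :: 'b sfun)"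
    using low u \<alpha> i by (simp add: mult_mon_mon' s multi_binom_sgl)
  have "poisson (mon (sgl i (Suc k), {})) (mon (\<gamma>, u)) =
      (\<Sum>j\<in>Y. if j = i then scaleO (\<tau> i * of_nat (\<alpha> i choose k)) (mon (\<alpha>, u) :: 'b sfun) else 0)"
    unfolding poisson_def by (intro sum.cong refl) (auto simp: pd_sgl[OF i] pd mul)
  then show "poisson (mon (sgl i (Suc k), {})) (mon (\<gamma>, u)) =
      scaleO (\<tau> i * of_nat (\<alpha> i choose k)) (mon (\<alpha>, u) :: 'b sfun)"
    using i by simp
qed

lemma pd_double:
  assumes "j \<in> Y0" "l \<in> Y0" "l \<noteq> j" "Suc a \<le> top_index j" "1 \<le> top_index l"
  shows "pd s (mon (sgl j (Suc a) + sgl l 1, {})) =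
    (if s = j then mon (sgl j a + sgl l 1, {}) else if s = l then mon (sgl j (Suc a), {}) else (0 :: 'b::field sfun))"
proof -
  let ?\<beta> = "sgl j (Suc a) + sgl l 1"
  have B: "(?\<beta>, {}) \<in> Basis" using assms by (auto simp: Basis_iff A_iff sgl_def plus_fun_apply)
  have z: "?\<beta>(j := a) = sgl j a + sgl l 1" "?\<beta>(l := 0) = sgl j (Suc a)"
    using assms by (auto simp: sgl_def fun_eq_iff plus_fun_apply)
  consider "s \<in> Y0" | "s \<in> Y1" | "s \<notin> Y" by (auto simp: Y_def)
  then show ?thesis
  proof cases
    case 1
    then show ?thesis using pd_mon_Y0[OF B 1, where 'a = 'b] z assms by (auto simp: sgl_apply plus_fun_apply)
  next
    case 2
    then show ?thesis using pd_mon_Y1[OF B 2, where 'a = 'b] assms by auto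
  next
    case 3
    then show ?thesis using assms by auto
  qed
qed

text \<open>The wanted term comes from differentiating the first factor by x_l, so it needs room at
  the index conjugate to l and not at the one conjugate to j. The price is a second term, with index
  \<alpha>', from differentiating by x_j.\<close>

lemma poisson_double:
  assumes j: "j \<in> Y0" "Suc a \<le> top_index j" and l: "l \<in> Y0" "l \<noteq> j" "l \<noteq> conj_index j" "1 \<le> top_index l"
    and \<alpha>: "\<alpha> \<in> A" "Suc a \<le> \<alpha> j" and up: "\<alpha> (conj_index l) < top_index (conj_index l)"
    and u: "u \<subseteq> Y1" and m: "m > 0"
  defines "\<gamma> \<equiv> \<alpha>(j := \<alpha> j - Suc a, conj_index l := Suc (\<alpha> (conj_index l)))"
    and "\<alpha>' \<equiv> \<alpha>(j := \<alpha> j - 1, conj_index j := \<alpha> (conj_index j) - 1, l := Suc (\<alpha> l), conj_index l := Suc (\<alpha> (conj_index l)))"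
  shows "\<gamma> \<in> A" "\<exists>c. poisson (mon (sgl j (Suc a) + sgl l 1, {})) (mon (\<gamma>, u)) =
      scaleO (\<tau> l * of_nat (\<alpha> j choose Suc a)) (mon (\<alpha>, u) :: 'b::field sfun) +
      (if \<alpha> (conj_index j) > 0 \<and> \<alpha>' \<in> A then scaleO c (mon (\<alpha>', u)) else 0)"
proof -
  have ne: "conj_index l \<noteq> j" "conj_index l \<noteq> l" "conj_index j \<noteq> j" "conj_index j \<noteq> l" "conj_index j \<noteq> conj_index l"
    using l conj_neq[OF l(1) m] conj_neq[OF j(1) m] conj_eq_swap[of l j] by auto
  have c: "conj_index j \<in> Y0" "conj_index l \<in> Y0" using j l by auto
  show \<gamma>: "\<gamma> \<in> A" using \<alpha> up unfolding \<gamma>_def A_iff by (auto intro: le_trans[OF diff_le_self])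
  have low: "\<alpha>(j := \<alpha> j - Suc a) \<in> A" using \<alpha>(1) by (rule A_mono) auto
  have "\<gamma>(conj_index l := \<gamma> (conj_index l) - 1) = \<alpha>(j := \<alpha> j - Suc a)"
    using ne by (auto simp: \<gamma>_def fun_eq_iff)
  then have pdl: "pd (conj_index l) (mon (\<gamma>, u)) = (mon (\<alpha>(j := \<alpha> j - Suc a), u) :: 'b sfun)"
    using \<gamma> u c by (simp add: pd_mon_Y0 Basis_iff) (simp add: \<gamma>_def)
  have s: "sgl j (Suc a) + \<alpha>(j := \<alpha> j - Suc a) = \<alpha>"
    using \<alpha>(2) by (auto simp: fun_eq_iff plus_fun_apply sgl_apply)
  have sA: "sgl j (Suc a) \<in> A" using j by (simp add: sgl_A)
  have mul: "mult (mon (sgl j (Suc a), {})) (mon (\<alpha>(j := \<alpha> j - Suc a), u)) =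
      scaleO (of_nat (\<alpha> j choose Suc a)) (mon (\<alpha>, u) :: 'b sfun)"
    using sA low u \<alpha> j by (simp add: mult_mon_mon' s multi_binom_sgl del: binomial_Suc_Suc) 
  define b where "b = (multi_binom (sgl j a + sgl l 1) (\<gamma>(conj_index j := \<alpha> (conj_index j) - 1)) :: 'b)"
  have T: "mult (mon (sgl j a + sgl l 1, {})) (pd (conj_index j) (mon (\<gamma>, u))) =
      (if \<alpha> (conj_index j) > 0 \<and> \<alpha>' \<in> A then scaleO b (mon (\<alpha>', u)) else (0 :: 'b sfun))"
  proof -
    have gj: "\<gamma> (conj_index j) = \<alpha> (conj_index j)" using ne by (simp add: \<gamma>_def)
    have "sgl j a + sgl l 1 \<in> A" using j l by (auto simp: A_iff sgl_def plus_fun_apply)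
    moreover have "\<gamma>(conj_index j := \<alpha> (conj_index j) - Suc 0) \<in> A" using A_lower[OF \<gamma>, of "conj_index j"] gj by simp
    moreover have "sgl j a + sgl l 1 + \<gamma>(conj_index j := \<alpha> (conj_index j) - Suc 0) = \<alpha>'"
      using ne l \<alpha>(2) by (auto simp: \<gamma>_def \<alpha>'_def fun_eq_iff plus_fun_apply sgl_apply)
    ultimately show ?thesis using \<gamma> u c gj by (simp add: pd_mon_Y0 Basis_iff mult_mon_mon' b_def)
  qed
  have "poisson (mon (sgl j (Suc a) + sgl l 1, {})) (mon (\<gamma>, u)) =
      (\<Sum>s\<in>Y. (if s = l then scaleO (\<tau> l * of_nat (\<alpha> j choose Suc a)) (mon (\<alpha>, u) :: 'b sfun) else 0) +
        (if s = j then scaleO (\<tau> j) (mult (mon (sgl j a + sgl l 1, {})) (pd (conj_index j) (mon (\<gamma>, u)))) else 0))"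
    unfolding poisson_def using pd_double[OF j(1) l(1,2) j(2) l(4), where 'b = 'b]
    by (intro sum.cong refl) (auto simp: pdl mul l simp del: One_nat_def binomial_Suc_Suc)
  also have "\<dots> = scaleO (\<tau> l * of_nat (\<alpha> j choose Suc a)) (mon (\<alpha>, u)) +
      (if \<alpha> (conj_index j) > 0 \<and> \<alpha>' \<in> A then scaleO (\<tau> j * b) (mon (\<alpha>', u)) else 0)"
    using j l unfolding T by (simp add: sum.distrib del: binomial_Suc_Suc)
  finally show "\<exists>c. poisson (mon (sgl j (Suc a) + sgl l 1, {})) (mon (\<gamma>, u)) =
      scaleO (\<tau> l * of_nat (\<alpha> j choose Suc a)) (mon (\<alpha>, u) :: 'b sfun) +
      (if \<alpha> (conj_index j) > 0 \<and> \<alpha>' \<in> A then scaleO c (mon (\<alpha>', u)) else 0)" by blast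
qed

lemma euler:
  assumes "i \<in> Y0" "1 \<le> top_index i" "(\<alpha>, u) \<in> Basis"
  shows "mult (xe i) (pd i (mon (\<alpha>, u))) = scaleO (of_nat (\<alpha> i)) (mon (\<alpha>, u) :: 'b::field sfun)"
proof (cases "\<alpha> i = 0")
  case True
  then show ?thesis using assms by (simp add: pd_mon_Y0)
next
  case False
  have "sgl i 1 + \<alpha>(i := \<alpha> i - 1) = \<alpha>" using False by (auto simp: fun_eq_iff sgl_apply plus_fun_apply)
  then show ?thesis using assms False
    by (simp add: pd_mon_Y0 mult_mon_mon' Basis_iff A_lower sgl_A multi_binom_sgl)
qed

lemma poisson_torus:
  assumes "i \<in> Y0" "1 \<le> top_index i" "1 \<le> top_index (conj_index i)" "(\<alpha>, u) \<in> Basis" "m > 0"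
  shows "poisson (mon (sgl i 1 + sgl (conj_index i) 1, {})) (mon (\<alpha>, u)) =
    scaleO (\<tau> i * (of_nat (\<alpha> (conj_index i)) - of_nat (\<alpha> i))) (mon (\<alpha>, u) :: 'b::field sfun)"
proof -
  let ?c = "conj_index i"
  have c: "?c \<in> Y0" "?c \<noteq> i" using assms conj_neq[OF assms(1,5)] by auto
  have pd: "pd s (mon (sgl i 1 + sgl ?c 1, {})) = (if s = i then xe ?c else if s = ?c then xe i else (0 :: 'b sfun))" for s
    using pd_double[OF assms(1) c, of 0 s, where 'b = 'b] assms by simp
  have "poisson (mon (sgl i 1 + sgl ?c 1, {})) (mon (\<alpha>, u)) =
      (\<Sum>s\<in>Y. (if s = i then scaleO (\<tau> i * of_nat (\<alpha> ?c)) (mon (\<alpha>, u)) else 0) +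
        (if s = ?c then scaleO (- \<tau> i * of_nat (\<alpha> i)) (mon (\<alpha>, u) :: 'b sfun) else 0))"
    unfolding poisson_def using c euler[OF assms(1,2,4), where 'b = 'b] euler[OF c(1) assms(3,4), where 'b = 'b] assms(1)
    by (intro sum.cong refl) (auto simp: pd simp del: One_nat_def)
  also have "\<dots> = scaleO (\<tau> i * of_nat (\<alpha> ?c)) (mon (\<alpha>, u)) + scaleO (- \<tau> i * of_nat (\<alpha> i)) (mon (\<alpha>, u))"
    using assms(1) c by (simp add: sum.distrib)
  finally show ?thesis
    by (simp add: sfun.scale_left_diff_distrib right_diff_distrib)
qed

end

section \<open>Torus weights and normalised derivations\<close>

context hamiltonian_char
begin

lemma mon_Hfun [simp]: "(mon b :: 'b::field sfun) \<in> Hfun \<longleftrightarrow> b \<in> H_index"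
  by (simp add: Hfun_def)

lemma H_indexI: "\<alpha> \<in> A \<Longrightarrow> u \<subseteq> Y1 \<Longrightarrow> even (card u) \<Longrightarrow> \<alpha> \<noteq> top_index \<or> u \<noteq> Y1 \<Longrightarrow> (\<alpha>, u) \<in> H_index"
  by (auto simp: H_index_def Basis_iff)

lemma H_indexD: "(\<alpha>, u) \<in> H_index \<Longrightarrow> \<alpha> \<in> A" "(\<alpha>, u) \<in> H_index \<Longrightarrow> u \<subseteq> Y1" "(\<alpha>, u) \<in> H_index \<Longrightarrow> even (card u)"
  "(\<alpha>, u) \<in> H_index \<Longrightarrow> (\<alpha>, u) \<in> Basis"
  by (auto simp: H_index_def Basis_iff)

lemma H_index_empty: "\<alpha> \<in> A \<Longrightarrow> (\<alpha>, {}) \<in> H_index"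
  using Y1_nonempty by (intro H_indexI) auto

definition kills_torus :: "('a vfield \<Rightarrow> 'a vfield) \<Rightarrow> bool" where
  "kills_torus \<phi> \<longleftrightarrow> \<phi> \<in> Der \<and> (\<forall>i\<in>Y0. \<phi> (DH (mon (sgl i 1 + sgl (conj_index i) 1, {}))) = 0)"

lemma torus_H_index: "i \<in> Y0 \<Longrightarrow> j \<in> Y0 \<Longrightarrow> i \<noteq> j \<Longrightarrow> k \<le> 3 \<Longrightarrow> (sgl i k + sgl j 1, {}) \<in> H_index"
  using top_ge[of i] top_ge[of j] by (intro H_index_empty) (auto simp: A_iff sgl_def plus_fun_apply)

lemma conj_neq' [simp]: "i \<in> Y0 \<Longrightarrow> conj_index i \<noteq> i" "i \<in> Y0 \<Longrightarrow> i \<noteq> conj_index i"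
  using conj_neq[of i] m_gt_1 by auto

lemma top_ge1: "i \<in> Y0 \<Longrightarrow> 1 \<le> top_index i"
  using top_ge[of i] by simp

text \<open>The bracket with x_i x_i' multiplies the leading coefficient by the weight of the
  monomial. Computed through the fields, only the torus element itself is differentiated, which
  gives the weight of the constant field d_j. A nonzero coefficient forces the two scalars to
  agree.\<close>

lemma weight:
  assumes "kills_torus \<phi>" "(\<alpha>, u) \<in> H_index" "j \<in> Y" "dv \<phi> (mon (\<alpha>, u)) j \<noteq> 0" "i \<in> Y0"
  shows "of_nat (\<alpha> (conj_index i)) - of_nat (\<alpha> i) = (if j = i then 1 else if j = conj_index i then -1 else (0 :: 'a))"
proof -
  let ?c = "conj_index i" and ?g = "mon (\<alpha>, u) :: 'a sfun"
  let ?h = "mon (sgl i 1 + sgl ?c 1, {}) :: 'a sfun"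
  have c: "?c \<in> Y0" "?c \<noteq> i" using assms(5) by auto
  have \<phi>: "\<phi> \<in> Der" "\<phi> (DH ?h) = 0" using assms by (auto simp: kills_torus_def)
  have g: "?g \<in> Hfun" using assms by simp
  have h: "?h \<in> Hfun" using torus_H_index[OF assms(5) c(1)] c(2) by simp
  have E: "\<phi> (DH ?g) \<in> Weven" by (rule Der_Weven[OF \<phi>(1) g])
  have pd: "pd s ?h = (if s = i then xe ?c else if s = ?c then xe i else 0)" for s
    using pd_double[OF assms(5) c, of 0 s, where 'b = 'a] top_ge1[OF assms(5)] top_ge1[OF c(1)] by simp
  have low: "low 2 ?h" using assms(5) c by (intro low_mon) (simp add: size_index_add size_index_sgl)
  have "scaleO (\<tau> i * (of_nat (\<alpha> ?c) - of_nat (\<alpha> i))) (dv \<phi> ?g j) = dv \<phi> (poisson ?h ?g) j"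
    using dv_linear(2)[OF \<phi>(1) g]
      poisson_torus[OF assms(5) top_ge1[OF assms(5)] top_ge1[OF c(1)] H_indexD(4)[OF assms(2)], where 'b = 'a] m_gt_1
    by simp
  also have "\<dots> = - scaleO (\<tau> (conj_index j)) (ev (act (\<phi> (DH ?g)) (pd (conj_index j) ?h)))"
    using \<phi> h g low assms(3) by (intro dv_poisson_low2)
  also have "\<dots> = scaleO (\<tau> i * (if j = i then 1 else if j = ?c then -1 else 0)) (dv \<phi> ?g j)"
    using assms(5) c E
    by (auto simp: pd act_xe ev_linear dv_def sfun.scale_minus_left conj_eq_swap simp del: One_nat_def)
  finally have "\<tau> i * (of_nat (\<alpha> ?c) - of_nat (\<alpha> i)) = \<tau> i * (if j = i then 1 else if j = ?c then -1 else (0 :: 'a))"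
    using assms(4) sfun.scale_cancel_right by blast
  then show ?thesis using mult_cancel_left tau_nonzero by blast
qed

text \<open>The elements that serve below as killed factors of brackets. In negative degree
  \<open>kills_torus\<close> already implies all of it, by
  \<open>normalised_of_torus\<close>.\<close>

definition normalised :: "('a vfield \<Rightarrow> 'a vfield) \<Rightarrow> bool" where
  "normalised \<phi> \<longleftrightarrow> kills_torus \<phi>
    \<and> (\<forall>i\<in>Y0. \<phi> (DH (xe i)) = 0)
    \<and> (\<forall>i\<in>Y0. \<phi> (DH (mon (sgl i 2, {}))) = 0)
    \<and> (\<forall>i\<in>Y0. \<forall>j\<in>Y0. i \<noteq> j \<longrightarrow> \<phi> (DH (mon (sgl i 1 + sgl j 1, {}))) = 0)
    \<and> (\<forall>k\<in>Y1. \<forall>l\<in>Y1. k \<noteq> l \<longrightarrow> \<phi> (DH (xx k l)) = 0)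
    \<and> (\<forall>i\<in>Y0. \<phi> (DH (mon (sgl i 3, {}))) = 0)
    \<and> (\<forall>i\<in>Y0. \<forall>j\<in>Y0. j \<noteq> i \<longrightarrow> j \<noteq> conj_index i \<longrightarrow> \<phi> (DH (mon (sgl i 2 + sgl j 1, {}))) = 0)
    \<and> (\<forall>i\<in>Y0. \<forall>k\<in>Y1. \<forall>l\<in>Y1. k \<noteq> l \<longrightarrow> \<phi> (DH (xexx i k l)) = 0)"

lemma normalisedD:
  assumes "normalised \<phi>"
  shows "kills_torus \<phi>" "\<phi> \<in> Der" "\<And>i. i \<in> Y0 \<Longrightarrow> \<phi> (DH (xe i)) = 0"
    "\<And>i. i \<in> Y0 \<Longrightarrow> \<phi> (DH (mon (sgl i 2, {}))) = 0"
    "\<And>i j. i \<in> Y0 \<Longrightarrow> j \<in> Y0 \<Longrightarrow> i \<noteq> j \<Longrightarrow> \<phi> (DH (mon (sgl i 1 + sgl j 1, {}))) = 0"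
    "\<And>k l. k \<in> Y1 \<Longrightarrow> l \<in> Y1 \<Longrightarrow> k \<noteq> l \<Longrightarrow> \<phi> (DH (xx k l)) = 0"
    "\<And>i. i \<in> Y0 \<Longrightarrow> \<phi> (DH (mon (sgl i 3, {}))) = 0"
    "\<And>i j. i \<in> Y0 \<Longrightarrow> j \<in> Y0 \<Longrightarrow> j \<noteq> i \<Longrightarrow> j \<noteq> conj_index i \<Longrightarrow> \<phi> (DH (mon (sgl i 2 + sgl j 1, {}))) = 0"
    "\<And>i k l. i \<in> Y0 \<Longrightarrow> k \<in> Y1 \<Longrightarrow> l \<in> Y1 \<Longrightarrow> k \<noteq> l \<Longrightarrow> \<phi> (DH (xexx i k l)) = 0"
  using assms unfolding normalised_def kills_torus_def by auto

section \<open>Multi-indices modulo p\<close>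

lemma top_mod: "i \<in> Y0 \<Longrightarrow> top_index i mod p = p - 1"
proof -
  assume i: "i \<in> Y0"
  then have "t i \<ge> 1" using t_pos by (simp add: Y0_def)
  then have "p dvd Suc (top_index i)" using top_index_pos[OF i] by (simp add: dvd_power)
  then have "Suc (top_index i) mod p = 0" by simp
  then show ?thesis using p_gt_3 by (auto simp: mod_Suc split: if_splits)
qed

lemma mod_pred: "0 < a \<Longrightarrow> a mod p = 0 \<Longrightarrow> (a - 1) mod p = p - 1"
  using p_gt_3 mod_Suc[of "a - 1" p] by (auto split: if_splits)

lemma mod_01_less_top:
  assumes "\<alpha> \<in> A" "i \<in> Y0" "\<alpha> i mod p \<in> {0, 1}"
  shows "\<alpha> i < top_index i"
proof (rule ccontr)
  assume "\<not> \<alpha> i < top_index i"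
  then have "\<alpha> i = top_index i" using A_le_top[OF assms(1), of i] by simp
  then show False using top_mod[OF assms(2)] assms(3) p_gt_3 by auto
qed

lemma choose_two_nonzero:
  assumes "a mod p \<notin> {0, 1}"
  shows "of_nat (a choose 2) \<noteq> (0 :: 'a)" "a \<ge> 2"
proof -
  show a: "a \<ge> 2" using assms p_gt_3 by (cases "a = 0"; cases "a = 1") auto
  show "of_nat (a choose 2) \<noteq> (0 :: 'a)"
  proof
    assume "of_nat (a choose 2) = (0 :: 'a)"
    then have "p dvd a choose 2" by (simp add: of_nat_eq_0_iff')
    then have "p dvd 2 * (a choose 2)" by simp
    also have "2 * (a choose 2) = a * (a - 1)"
    proof -
      have "even (a * (a - 1))" by (cases a) auto
      then show ?thesis by (simp add: choose_two)
    qed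
    finally consider "p dvd a" | "p dvd a - 1" using prime_p by (auto simp: prime_dvd_mult_iff)
    then show False
    proof cases
      case 2
      then have "a mod p = 1 mod p" using a mod_eq_dvd_iff_nat[of 1 a p] by simp
      then show False using assms p_gt_3 by auto
    qed (use assms in auto)
  qed
qed

lemma of_nat_mod_1: "a mod p = 1 \<Longrightarrow> of_nat a = (1 :: 'a)"
  using of_nat_eq_0_iff'[of "a div p * p"] by (metis add_0 div_mult_mod_eq dvd_triv_right of_nat_1 of_nat_add)

text \<open>Up to a factor \<alpha> i, the monomial is a bracket with x_i^(2), which \<phi> kills.
  The field of x_i^(2) is a multiple of x_i d_i', so leading coefficients can only appear in the
  coordinate conjugate to i.\<close>

lemma dv_squares:
  assumes "normalised \<phi>" "(\<alpha>, u) \<in> H_index" "i \<in> Y0" "of_nat (\<alpha> i) \<noteq> (0 :: 'a)"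
    "\<alpha> (conj_index i) < top_index (conj_index i)" "j \<noteq> conj_index i"
  shows "dv \<phi> (mon (\<alpha>, u)) j = 0"
proof (cases "j \<in> Y")
  case False
  then show ?thesis using normalisedD(2)[OF assms(1)] assms(2) by (simp add: dv_outside)
next
  case True
  let ?f = "mon (sgl i 2, {}) :: 'a sfun"
  define \<gamma> where "\<gamma> = \<alpha>(i := \<alpha> i - 1, conj_index i := Suc (\<alpha> (conj_index i)))"
  note D = normalisedD[OF assms(1)] and H = H_indexD[OF assms(2)]
  have a: "1 \<le> \<alpha> i" using assms(4) by (cases "\<alpha> i") auto
  have two: "Suc 1 = 2" by simp
  have t2: "Suc 1 \<le> top_index i" using top_ge[OF assms(3)] by simp
  have m0: "m > 0" using m_gt_1 by simp
  note ps = poisson_single[OF assms(3) t2 H(1) a assms(5) H(2) m0, folded \<gamma>_def, unfolded two]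
  have "\<gamma> i \<noteq> top_index i" using A_le_top[OF H(1), of i] a assms(3) by (auto simp: \<gamma>_def)
  then have g: "(\<gamma>, u) \<in> H_index" using ps(1) H by (intro H_indexI) auto
  have f: "?f \<in> Hfun" using top_ge[OF assms(3)] assms(3) by (simp add: H_index_empty sgl_A)
  have pd: "pd s ?f = (if s = i then xe i else 0)" for s
    using pd_sgl[OF assms(3) t2, of s, where 'b = 'a] by (simp add: numeral_2_eq_2)
  have "scaleO (\<tau> i * of_nat (\<alpha> i)) (dv \<phi> (mon (\<alpha>, u)) j) = dv \<phi> (poisson ?f (mon (\<gamma>, u))) j"
    using dv_linear(2)[OF D(2)] assms(2) ps(2)[where 'b = 'a] by simp
  also have "\<dots> = - scaleO (\<tau> (conj_index j)) (ev (act (\<phi> (DH (mon (\<gamma>, u)))) (pd (conj_index j) ?f)))"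
    using D(2) D(4)[OF assms(3)] f g assms(3) True
    by (intro dv_poisson_low2) (auto intro!: low_mon simp: size_index_sgl)
  also have "\<dots> = 0"
    using assms(6) by (auto simp: pd ev_linear conj_eq_swap)
  finally show ?thesis using assms(4) by simp
qed

text \<open>The same with x_i^(3), whose even degree 3 excludes every coordinate. The factor is now
  \<open>\<alpha> i choose 2\<close>, nonzero in the field when \<alpha> i is neither 0 nor 1 modulo
  p.\<close>

lemma dv_cubes:
  assumes "normalised \<phi>" "(\<alpha>, u) \<in> H_index" "i \<in> Y0" "\<alpha> i mod p \<notin> {0, 1}"
    "\<alpha> (conj_index i) < top_index (conj_index i)"
  shows "dv \<phi> (mon (\<alpha>, u)) j = 0"
proof -
  let ?f = "mon (sgl i 3, {}) :: 'a sfun"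
  define \<gamma> where "\<gamma> = \<alpha>(i := \<alpha> i - 2, conj_index i := Suc (\<alpha> (conj_index i)))"
  note D = normalisedD[OF assms(1)] and H = H_indexD[OF assms(2)]
  note a = choose_two_nonzero[OF assms(4)]
  have three: "Suc 2 = 3" by simp
  have t2: "Suc 2 \<le> top_index i" using top_ge[OF assms(3)] by simp
  have m0: "m > 0" using m_gt_1 by simp
  note ps = poisson_single[OF assms(3) t2 H(1) a(2) assms(5) H(2) m0, folded \<gamma>_def, unfolded three]
  have "\<gamma> i \<noteq> top_index i" using A_le_top[OF H(1), of i] a assms(3) by (auto simp: \<gamma>_def)
  then have g: "(\<gamma>, u) \<in> H_index" using ps(1) H by (intro H_indexI) auto
  have f: "?f \<in> Hfun" using top_ge[OF assms(3)] assms(3) by (simp add: H_index_empty sgl_A)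
  have "scaleO (\<tau> i * of_nat (\<alpha> i choose 2)) (dv \<phi> (mon (\<alpha>, u)) j) = dv \<phi> (poisson ?f (mon (\<gamma>, u))) j"
    using dv_linear(2)[OF D(2)] assms(2) ps(2)[where 'b = 'a] by simp
  also have "\<dots> = 0"
    using D(2) D(7)[OF assms(3)] f g assms(3)
    by (intro dv_poisson_low3) (auto intro!: low_mon simp: size_index_sgl)
  finally show ?thesis using a(1) by simp
qed

text \<open>With both indices of the pair of i full, \<open>dv_cubes\<close> has no room. The
  bracket with x_i^(2) x_j uses the room at another pair instead; its second term has indices top -
  1 at i and at its conjugate, which are p - 2 modulo p, so \<open>dv_cubes\<close> removes
  it.\<close>

lemma dv_mixed:
  assumes "normalised \<phi>" "(\<alpha>, u) \<in> H_index" "i \<in> Y0" "\<alpha> i = top_index i" "\<alpha> (conj_index i) = top_index (conj_index i)"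
    "j \<in> Y0" "\<alpha> (conj_index j) < top_index (conj_index j)"
  shows "dv \<phi> (mon (\<alpha>, u)) k = 0"
proof -
  note D = normalisedD[OF assms(1)] and H = H_indexD[OF assms(2)]
  have ji: "j \<noteq> i" "j \<noteq> conj_index i" using assms(4,5,7) by auto
  let ?f = "mon (sgl i 2 + sgl j 1, {}) :: 'a sfun"
  define \<gamma> where "\<gamma> = \<alpha>(i := \<alpha> i - Suc 1, conj_index j := Suc (\<alpha> (conj_index j)))"
  define \<alpha>' where "\<alpha>' = \<alpha>(i := \<alpha> i - 1, conj_index i := \<alpha> (conj_index i) - 1, j := Suc (\<alpha> j), conj_index j := Suc (\<alpha> (conj_index j)))"
  have t: "Suc 1 \<le> top_index i" "1 \<le> top_index j" "Suc 1 \<le> \<alpha> i" "m > 0"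
    using top_ge[OF assms(3)] top_ge[OF assms(6)] m_gt_1 assms(4) by simp_all
  note ps = poisson_double[OF assms(3) t(1) assms(6) ji t(2) H(1) t(3) assms(7) H(2) t(4), folded \<gamma>_def \<alpha>'_def]
  have two: "Suc 1 = 2" by simp
  obtain c where c: "poisson ?f (mon (\<gamma>, u)) = scaleO (\<tau> j * of_nat (\<alpha> i choose 2)) (mon (\<alpha>, u) :: 'a sfun) +
      (if \<alpha> (conj_index i) > 0 \<and> \<alpha>' \<in> A then scaleO c (mon (\<alpha>', u)) else 0)"
    using ps(2)[where 'b = 'a] unfolding two by blast
  have ne: "conj_index j \<noteq> i" "conj_index j \<noteq> conj_index i" using ji conj_eq_swap[of j i] by auto
  have ti: "top_index i \<ge> 4" "top_index (conj_index i) \<ge> 4" using top_ge assms(3) by auto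
  have "\<gamma> i \<noteq> top_index i" using t(3) assms(4) ne by (auto simp: \<gamma>_def)
  then have g: "mon (\<gamma>, u) \<in> (Hfun :: 'a sfun set)" using ps(1) H by (auto intro!: H_indexI)
  have a'i: "\<alpha>' i = top_index i - 1" "\<alpha>' (conj_index i) = top_index (conj_index i) - 1"
    using ji ne assms by (auto simp: \<alpha>'_def)
  have R: "dv \<phi> (if \<alpha> (conj_index i) > 0 \<and> \<alpha>' \<in> A then scaleO c (mon (\<alpha>', u)) else 0) k = 0"
    and RH: "(if \<alpha> (conj_index i) > 0 \<and> \<alpha>' \<in> A then scaleO c (mon (\<alpha>', u)) else 0) \<in> (Hfun :: 'a sfun set)"
  proof -
    have h: "(\<alpha>', u) \<in> H_index" if "\<alpha>' \<in> A" using that H a'i ti by (intro H_indexI) auto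
    have "(top_index i - 1) mod p = p - 2"
    proof -
      have "Suc (top_index i - 1) mod p = p - 1" using top_mod[OF assms(3)] ti by simp
      then show ?thesis using p_gt_3 by (auto simp: mod_Suc split: if_splits)
    qed
    then have "\<alpha>' i mod p \<notin> {0, 1}" using a'i p_gt_3 by auto
    then have "dv \<phi> (mon (\<alpha>', u)) k = 0" if "\<alpha>' \<in> A"
      using a'i ti by (intro dv_cubes[OF assms(1) h[OF that] assms(3)]) auto
    then show "dv \<phi> (if \<alpha> (conj_index i) > 0 \<and> \<alpha>' \<in> A then scaleO c (mon (\<alpha>', u)) else 0) k = 0"
      "(if \<alpha> (conj_index i) > 0 \<and> \<alpha>' \<in> A then scaleO c (mon (\<alpha>', u)) else 0) \<in> (Hfun :: 'a sfun set)"
      using h dv_linear(2)[OF D(2)] dv_zero[OF D(2)] by auto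
  qed
  have f: "?f \<in> Hfun" using torus_H_index[OF assms(3,6), of 2] ji by simp
  have "0 = dv \<phi> (poisson ?f (mon (\<gamma>, u))) k"
    using D(2) D(8)[OF assms(3,6) ji] f g assms(3,6)
    by (intro dv_poisson_low3[symmetric]) (auto intro!: low_mon simp: size_index_sgl size_index_add)
  also have "\<dots> = scaleO (\<tau> j * of_nat (\<alpha> i choose 2)) (dv \<phi> (mon (\<alpha>, u)) k)"
    unfolding c using dv_linear(1)[OF D(2) _ RH] dv_linear(2)[OF D(2)] assms(2) R by simp
  finally show ?thesis
    using choose_two_nonzero(1)[of "\<alpha> i"] assms(3,4) top_mod[OF assms(3)] p_gt_3 by auto
qed

text \<open>A residue other than 0 and 1 at i forces the conjugate index to be full by
  \<open>dv_cubes\<close>. A full index has residue p - 1, so the index i is full as well, and then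
  \<open>dv_mixed\<close> forces all the others.\<close>

lemma dv_classes:
  assumes "normalised \<phi>" "(\<alpha>, u) \<in> H_index" "dv \<phi> (mon (\<alpha>, u)) k \<noteq> 0"
  shows "\<alpha> = top_index \<or> (\<forall>i\<in>Y0. \<alpha> i mod p \<in> {0, 1})"
proof (cases "\<forall>i\<in>Y0. \<alpha> i mod p \<in> {0, 1}")
  case False
  then obtain i where i: "i \<in> Y0" "\<alpha> i mod p \<notin> {0, 1}" by blast
  have H: "\<alpha> \<in> A" using assms(2) by (rule H_indexD)
  have c: "conj_index i \<in> Y0" using i by simp
  have 1: "\<alpha> (conj_index i) = top_index (conj_index i)"
    using dv_cubes[OF assms(1,2) i] assms(3) A_le_top[OF H, of "conj_index i"] by fastforce
  then have "\<alpha> (conj_index i) mod p \<notin> {0, 1}" using top_mod[OF c] p_gt_3 by auto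
  then have 2: "\<alpha> i = top_index i"
    using dv_cubes[OF assms(1,2) c] assms(3) A_le_top[OF H, of i] by fastforce
  have "\<alpha> (conj_index j) = top_index (conj_index j)" if "j \<in> Y0" for j
    using dv_mixed[OF assms(1,2) i(1) 2 1 that] assms(3) A_le_top[OF H, of "conj_index j"] by fastforce
  then have "\<alpha> j = top_index j" if "j \<in> Y0" for j using that by (metis conj_Y0 conj_conj)
  then have "\<alpha> = top_index" using H by (auto simp: fun_eq_iff top_index_def A_outside)
  then show ?thesis ..
qed blast

text \<open>A case of Lucas's congruence: when one block of p^s is split off, only the two outer
  terms of Vandermonde's sum survive.\<close>

lemma choose_prime_power: "of_nat (a choose p ^ s) = (of_nat (a div p ^ s) :: 'a)"
proof (induction a rule: less_induct)
  case (less a)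
  define q where "q = p ^ s"
  have q: "q > 0" using p_gt_3 by (simp add: q_def)
  show ?case
  proof (cases "a < q")
    case True
    then show ?thesis by (simp add: q_def binomial_eq_0)
  next
    case False
    define b where "b = a - q"
    have a: "a = q + b" using False by (simp add: b_def)
    have "of_nat (a choose q) = (\<Sum>k\<le>q. of_nat (q choose k) * of_nat (b choose (q - k)) :: 'a)"
      unfolding a vandermonde[symmetric] by simp
    also have "\<dots> = (\<Sum>k\<in>{0, q}. of_nat (q choose k) * of_nat (b choose (q - k)))"
    proof (rule sum.mono_neutral_right)
      show "\<forall>k\<in>{..q} - {0, q}. of_nat (q choose k) * of_nat (b choose (q - k)) = (0 :: 'a)"
      proof
        fix k assume "k \<in> {..q} - {0, q}"
        then have "0 < k" "k < p ^ s" by (auto simp: q_def)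
        then have "of_nat (q choose k) = (0 :: 'a)" unfolding q_def by (rule of_nat_choose_zero)
        then show "of_nat (q choose k) * of_nat (b choose (q - k)) = (0 :: 'a)" by simp
      qed
    qed auto
    also have "\<dots> = of_nat (b choose q) + 1" using q by simp
    also have "of_nat (b choose q) = (of_nat (b div q) :: 'a)"
      using less[of b] q a by (simp add: q_def)
    also have "\<dots> + 1 = of_nat (a div q)" using q by (simp add: a)
    finally show ?thesis by (simp add: q_def)
  qed
qed

end

section \<open>Invariants of the orthogonal algebra\<close>

context hamiltonian
begin

lemma mult_xo_apply:
  fixes h :: "'b::field sfun"
  assumes "h \<in> Osup" "l \<in> Y1"
  shows "mult (xo l) h (\<alpha>, w) = (if l \<in> w then pass_sign l w * h (\<alpha>, w - {l}) else 0)"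
  using assms(1)
proof (induction rule: Osup_induct)
  case (mon b)
  obtain \<beta> v where b: "b = (\<beta>, v)" by (cases b)
  have B: "\<beta> \<in> A" "v \<subseteq> Y1" using mon by (auto simp: b Basis_iff)
  have z: "(0 :: nat \<Rightarrow> nat) + \<beta> = \<beta>" by simp
  have M: "mult (xo l) (mon b) = (if l \<in> v then 0 else scaleO (pass_sign l v) (mon (\<beta>, insert l v)) :: 'b sfun)"
    using B assms(2) z by (simp add: b mult_mon_mon' sort_sign_single_left)
  have N: "mon b (\<alpha>, w - {l}) = (if \<alpha> = \<beta> \<and> w - {l} = v then 1 else (0 :: 'b))"
    by (simp add: b mon_apply)
  show ?case
  proof (cases "l \<in> v")
    case True
    then show ?thesis unfolding M N by (auto simp: sf_apply(4))
  next
    case False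
    then have "w = insert l v \<longleftrightarrow> l \<in> w \<and> w - {l} = v" by auto
    moreover have "pass_sign l w = (pass_sign l v :: 'b)" if "w = insert l v" using that by simp
    ultimately show ?thesis using False unfolding M N by (auto simp: sf_apply(5) mon_apply)
  qed
next
  case zero
  show ?case by (subst mult_zero(2)) (simp add: sf_apply(4))
next
  case (add f g)
  show ?case by (subst mult_add_right) (simp add: sf_apply(1) add distrib_left)
next
  case (scale c f)
  show ?case by (subst mult_scale_right) (simp add: sf_apply(5) scale)
qed

end

context hamiltonian_char
begin

lemma so_apply:
  assumes "e \<in> Osup" "k \<in> Y1" "l \<in> Y1" "k \<noteq> l" "k \<in> v" "l \<notin> v"
  shows "so k l e (\<alpha>, insert l (v - {k})) = pass_sign l (insert l (v - {k})) * pass_sign k v * (e (\<alpha>, v) :: 'b::field)"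
proof -
  let ?w = "insert l (v - {k})"
  have "?w - {l} = v - {k}" "k \<notin> ?w" "insert k (v - {k}) = v" using assms by auto
  moreover have "pass_sign k (v - {k}) = (pass_sign k v :: 'b)" by simp
  ultimately show ?thesis
    unfolding so_def by (simp add: sf_apply mult_xo_apply pd_odd_apply assms(1-3))
qed

text \<open>If v contained k but not l, the rotation of k into l would carry the coefficient at v to
  the set with k replaced by l, where no other monomial contributes.\<close>

lemma so_invariant_support:
  assumes "e \<in> Osup" "S \<subseteq> Y1" "\<And>k l. k \<in> S \<Longrightarrow> l \<in> S \<Longrightarrow> k \<noteq> l \<Longrightarrow> so k l e = 0" "e (\<alpha>, v) \<noteq> (0 :: 'b::field)"
  shows "v \<inter> S = {} \<or> S \<subseteq> v"
proof (rule ccontr)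
  assume "\<not> ?thesis"
  then obtain k l where kl: "k \<in> v" "k \<in> S" "l \<in> S" "l \<notin> v" by blast
  then have "so k l e (\<alpha>, insert l (v - {k})) = pass_sign l (insert l (v - {k})) * pass_sign k v * e (\<alpha>, v)"
    using assms(1,2) by (intro so_apply) auto
  moreover have "so k l e = 0" using kl by (intro assms(3)) auto
  ultimately show False using assms(4) by (simp add: sf_apply)
qed

lemma so_zero [simp]: "so k l 0 = 0"
  by (simp add: so_def)

text \<open>The orthogonal invariants \<open>e\<close> with values in the odd part of the module are spanned by the Euler
  field and the Hamiltonian field of the top odd monomial; the last two hypotheses exclude both.\<close>

lemma so_invariant_zero:
  fixes e :: "nat \<Rightarrow> 'a sfun"
  assumes e: "\<And>j. j \<in> Y1 \<Longrightarrow> e j \<in> Opar 1" "\<And>j \<alpha> u. e j (\<alpha>, u) \<noteq> 0 \<Longrightarrow> \<alpha> = 0"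
    and inv: "\<And>j k l. j \<in> Y1 \<Longrightarrow> k \<in> Y1 \<Longrightarrow> l \<in> Y1 \<Longrightarrow> k \<noteq> l \<Longrightarrow>
      so k l (e j) - (if j = k then e l else 0) + (if j = l then e k else 0) = 0"
    and comm: "\<And>k l. k \<in> Y1 \<Longrightarrow> l \<in> Y1 \<Longrightarrow> k \<noteq> l \<Longrightarrow> mult (e k) (xo l) + mult (xo k) (e l) = 0"
    and k0: "k0 \<in> Y1" "e k0 (0, Y1 - {k0}) = 0"
    and j: "j \<in> Y1"
  shows "e j = 0"
proof -
  have o: "e j \<in> Osup" if "j \<in> Y1" for j using e(1)[OF that] by (rule Opar_Osup)
  have par: "odd (card v)" if "j \<in> Y1" "e j (0, v) \<noteq> 0" for j v
    using e(1)[OF that(1)] that(2) by (auto simp: Opar_def supp_on_def par_def)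
  have sub: "v \<subseteq> Y1" if "j \<in> Y1" "e j (0, v) \<noteq> 0" for j v
    using Osup_outside[OF o[OF that(1)], of "(0, v)"] that(2) by (auto simp: Basis_iff)
  have S: "v \<inter> (Y1 - {j}) = {} \<or> Y1 - {j} \<subseteq> v" if "j \<in> Y1" "e j (0, v) \<noteq> 0" for j v
  proof (rule so_invariant_support[OF o[OF that(1)] _ _ that(2)])
    show "so k l (e j) = 0" if "k \<in> Y1 - {j}" "l \<in> Y1 - {j}" "k \<noteq> l" for k l
      using inv[OF \<open>j \<in> Y1\<close>, of k l] that by auto
  qed auto
  \<comment> \<open>By \<open>comm\<close>, the coefficients of x_k in e k and of x_l in e l are
    opposite for any two indices. Going round three indices gives x = -x.\<close>
  have single: "e j (0, {j}) = 0" if j: "j \<in> Y1" for j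
  proof -
    have rel: "e k (0, {k}) = - e l (0, {l})" if "k \<in> Y1" "l \<in> Y1" "k \<noteq> l" for k l
    proof -
      have "mult (e k) (xo l) = - mult (xo l) (e k)"
        using mult_commute[OF e(1)[OF that(1)], of "xo l" 1] that by (simp add: par_def sfun.scale_minus_left)
      then have "mult (xo k) (e l) (0, {k, l}) = mult (xo l) (e k) (0, {k, l})"
        using comm[OF that] by (simp add: sf_apply)
      then have "pass_sign k {k, l} * e l (0, {l}) = pass_sign l {k, l} * e k (0, {k})"
        using that by (simp add: mult_xo_apply o insert_Diff_if)
      moreover have "{k, l} = insert l {k}" by auto
      ultimately have "pass_sign k {l} * e l (0, {l}) = pass_sign l {k} * e k (0, {k})" by (metis pass_sign_insert_same)
      moreover have "pass_sign k {l} = - (pass_sign l {k} :: 'a)"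
        using pass_sign_insert[of "{}" l k, where 'a = 'a] pass_sign_insert[of "{}" k l, where 'a = 'a] that(3) by auto
      ultimately have "pass_sign l {k} * e k (0, {k}) = - (pass_sign l {k} * e l (0, {l}))" by simp
      then have "pass_sign l {k} * (e k (0, {k}) + e l (0, {l})) = 0" by (simp add: distrib_left)
      then have "e k (0, {k}) + e l (0, {l}) = 0" using pass_sign_nonzero[of l "{k}", where 'a = 'a] by (simp only: mult_eq_0_iff) blast
      then show ?thesis by (simp only: eq_neg_iff_add_eq_0)
    qed
    have "card (Y1 - {j}) \<ge> 3" using n_gt_3 j by (simp add: card_Y1)
    then obtain k where k: "k \<in> Y1" "k \<noteq> j"
      by (metis DiffD1 DiffD2 card.empty equals0I insertI1 not_numeral_le_zero)
    have "card (Y1 - {j} - {k}) \<ge> 2" using n_gt_3 j k by (simp add: card_Y1)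
    then obtain l where l: "l \<in> Y1" "l \<noteq> j" "l \<noteq> k"
      by (metis DiffD1 DiffD2 card.empty equals0I insertI1 not_numeral_le_zero)
    have "e j (0, {j}) = - e j (0, {j})"
      using rel[OF j k(1)] rel[OF k(1) l(1)] rel[OF l(1) j] k l by auto
    then show ?thesis by (rule self_neg_zero)
  qed
  have cls: "v = Y1 - {j} \<or> v = Y1" if "j \<in> Y1" "e j (0, v) \<noteq> 0" for j v
  proof -
    have "v \<noteq> {j}" using single that by auto
    moreover have "v \<noteq> {}" using par[OF that] by auto
    ultimately show ?thesis using S[OF that] sub[OF that] by blast
  qed
  \<comment> \<open>Invariance at j = k expresses every coordinate through one of them, so it
    suffices to treat \<open>k0\<close>.\<close>
  have step: "e l = so k l (e k)" if "k \<in> Y1" "l \<in> Y1" "k \<noteq> l" for k l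
    using inv[OF that(1) that] that by simp
  \<comment> \<open>A rotation removes x_k or x_l before inserting the other one, so it never
    produces the full odd monomial.\<close>
  have full: "e l (0, Y1) = 0" if l: "l \<in> Y1" for l
  proof -
    obtain k where k: "k \<in> Y1" "k \<noteq> l"
    proof -
      have "card (Y1 - {l}) \<ge> 3" using n_gt_3 l by (simp add: card_Y1)
      then show thesis by (metis that DiffD1 DiffD2 card.empty equals0I insertI1 not_numeral_le_zero)
    qed
    have "so k l (e k) (0, Y1) = 0"
      using k l o by (simp add: so_def sf_apply mult_xo_apply pd_odd_apply)
    then show ?thesis using step[OF k(1) l k(2)] by simp
  qed
  have "e k0 = 0"
  proof
    fix b :: monomial
    obtain \<alpha> v where b: "b = (\<alpha>, v)" by (cases b)
    show "e k0 b = 0 b"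
    proof (rule ccontr)
      assume nz: "e k0 b \<noteq> 0 b"
      then have "\<alpha> = 0" using e(2) b by (auto simp: sf_apply)
      then have "e k0 (0, v) \<noteq> 0" using nz b by (simp add: sf_apply)
      then show False using cls[OF k0(1)] k0(2) full[OF k0(1)] by auto
    qed
  qed
  then show ?thesis using step[OF k0(1) j] by (cases "j = k0") auto
qed

section \<open>The multi-indices that can carry leading coefficients\<close>

lemma of_nat_mod_0: "a mod p = 0 \<Longrightarrow> of_nat a = (0 :: 'a)"
  by (simp add: of_nat_eq_0_iff' mod_eq_0_iff_dvd)

text \<open>\<open>dv_squares\<close> at i leaves only the coordinate conjugate to i, and at j only
  the one conjugate to j.\<close>

lemma dv_two_ones:
  assumes "normalised \<phi>" "(\<alpha>, u) \<in> H_index" "\<forall>i\<in>Y0. \<alpha> i mod p \<in> {0, 1}" "i \<in> Y0" "j \<in> Y0" "i \<noteq> j"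
    "\<alpha> i mod p = 1" "\<alpha> j mod p = 1"
  shows "dv \<phi> (mon (\<alpha>, u)) k = 0"
proof -
  have H: "\<alpha> \<in> A" using assms(2) by (rule H_indexD)
  have "dv \<phi> (mon (\<alpha>, u)) k = 0" if "s \<in> Y0" "\<alpha> s mod p = 1" "k \<noteq> conj_index s" for s
    using that assms(3) of_nat_mod_1[OF that(2)] mod_01_less_top[OF H, of "conj_index s"]
    by (intro dv_squares[OF assms(1,2), of s]) auto
  then show ?thesis using assms by (metis conj_eq_iff)
qed

text \<open>The position s is that of the lowest nonzero digit of a in base p above the units digit;
  it is one more than the exponent of p in \<open>a div p\<close>.\<close>

lemma multiple_of_p_part:
  assumes "p \<le> a"
  obtains s where "1 \<le> s" "p ^ s \<le> a" "of_nat (a div p ^ s) \<noteq> (0 :: 'a)"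
proof -
  have c: "a div p > 0" using assms p_gt_3 by (simp add: div_greater_zero_iff)
  obtain e b where e: "a div p = p ^ e * b" "\<not> p dvd b"
    using c prime_p by (metis multiplicity_decompose' not_prime_unit less_numeral_extra(3))
  have "a div p ^ Suc e = b"
    using e(1) p_gt_3 by (simp add: div_mult2_eq)
  moreover have "b > 0" using e(2) by (cases b) auto
  ultimately have "p ^ Suc e \<le> a" by (metis div_greater_zero_iff)
  then show thesis using that[of "Suc e"] \<open>a div p ^ Suc e = b\<close> e(2) by (simp add: of_nat_eq_0_iff')
qed

text \<open>The indices of the monomials x_r^(p^s) that the p^s-th power of d_r sends to 1. They
  will label the maps \<open>\<Phi>\<close>, \<open>\<Theta>\<close> and the powers of
  \<open>ad (partial r)\<close>.\<close>

definition frobenius_indices :: "(nat \<Rightarrow> nat) set" where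
  "frobenius_indices = {sgl r (p ^ s) |r s. r \<in> Y0 \<and> 1 \<le> s \<and> s < t r}"

lemma small_class:
  assumes "\<alpha> \<in> A" "\<forall>i\<in>Y0. \<alpha> i mod p \<in> {0, 1}" "\<forall>i\<in>Y0. \<forall>j\<in>Y0. \<alpha> i mod p = 1 \<longrightarrow> \<alpha> j mod p = 1 \<longrightarrow> i = j"
    "\<forall>i\<in>Y0. \<alpha> i < p"
  shows "\<alpha> = 0 \<or> (\<exists>i\<in>Y0. \<alpha> = sgl i 1)"
proof -
  have *: "\<alpha> i \<in> {0, 1}" "\<alpha> i = 1 \<longleftrightarrow> \<alpha> i mod p = 1" if "i \<in> Y0" for i
    using assms(2,4) that p_gt_3 by auto
  show ?thesis
  proof (cases "\<exists>i\<in>Y0. \<alpha> i = 1")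
    case True
    then obtain i where i: "i \<in> Y0" "\<alpha> i = 1" by blast
    have "\<alpha> j = 0" if "j \<noteq> i" for j
    proof (cases "j \<in> Y0")
      case j: True
      then have "\<alpha> j \<noteq> 1" using assms(3) *(2)[OF i(1)] *(2)[OF j] i that by blast
      then show ?thesis using *(1)[OF j] by blast
    next
      case False
      then show ?thesis by (rule A_outside[OF assms(1)])
    qed
    then have "\<alpha> = sgl i 1" using i by (auto simp: fun_eq_iff sgl_apply)
    then show ?thesis using i by blast
  next
    case False
    then have "\<alpha> j = 0" for j
      using *[of j] A_outside[OF assms(1), of j] by (cases "j \<in> Y0") auto
    then show ?thesis by (auto simp: fun_eq_iff zero_fun_apply)
  qed
qed

text \<open>For any other index some \<alpha> j is at least p. Splitting off its lowest power q =
  p^s above the units leaves an index \<delta> that again has an entry at least p. Then the monomial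
  is, up to a killed term, a bracket of x_j^(q) x_l with a second factor, both of even degree at
  least 3, and its coefficient \<open>\<alpha> j div q\<close> is nonzero in the field.\<close>

lemma dv_exceptional:
  assumes "normalised \<phi>" "\<alpha> \<in> A" "dv \<phi> (mon (\<alpha>, {})) k \<noteq> 0"
  shows "\<alpha> = top_index \<or> (\<exists>\<gamma>\<in>insert 0 frobenius_indices. \<alpha> = \<gamma> \<or> (\<exists>i\<in>Y0. \<alpha> = \<gamma> + sgl i 1))"
proof (rule ccontr)
  assume contra: "\<not> ?thesis"
  note D = normalisedD[OF assms(1)]
  have H: "(\<alpha>, {}) \<in> H_index" using assms(2) by (rule H_index_empty)
  have m01: "\<forall>i\<in>Y0. \<alpha> i mod p \<in> {0, 1}" using dv_classes[OF assms(1) H assms(3)] contra by blast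
  have one: "\<forall>i\<in>Y0. \<forall>j\<in>Y0. \<alpha> i mod p = 1 \<longrightarrow> \<alpha> j mod p = 1 \<longrightarrow> i = j"
    using dv_two_ones[OF assms(1) H m01] assms(3) by blast
  have contra0: "\<alpha> \<noteq> 0" "\<not> (\<exists>i\<in>Y0. \<alpha> = sgl i 1)" using contra by auto
  have "\<not> (\<forall>i\<in>Y0. \<alpha> i < p)" using small_class[OF assms(2) m01 one] contra0 by blast
  then obtain j where j: "j \<in> Y0" "p \<le> \<alpha> j" by (auto simp: not_less)
  obtain s where s: "1 \<le> s" "p ^ s \<le> \<alpha> j" "of_nat (\<alpha> j div p ^ s) \<noteq> (0 :: 'a)"
    using multiple_of_p_part[OF j(2)] by blast
  define q where "q = p ^ s"
  have q: "p \<le> q" using s(1) p_gt_3 power_increasing[of 1 s p] by (simp add: q_def)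
  have qp: "q mod p = 0" using s(1) by (simp add: q_def)
  have "p ^ s < p ^ t j"
    using s(2) A_le_top[OF assms(2), of j] top_index_pos[OF j(1)] by linarith
  then have "s < t j" using p_gt_3 by (simp add: power_less_imp_less_exp)
  then have frobenius_index: "sgl j q \<in> frobenius_indices" using s j by (auto simp: frobenius_indices_def q_def)
  define \<delta> where "\<delta> = \<alpha>(j := \<alpha> j - q)"
  have \<alpha>\<delta>: "\<alpha> = sgl j q + \<delta>" using s(2) by (auto simp: fun_eq_iff \<delta>_def plus_fun_apply sgl_apply q_def)
  have \<delta>A: "\<delta> \<in> A" using assms(2) unfolding \<delta>_def by (rule A_mono) auto
  have "(\<alpha> j - q) mod p = \<alpha> j mod p"
  proof -
    have "\<alpha> j mod p = ((\<alpha> j - q) + q) mod p" using s(2) by (simp add: q_def)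
    also have "\<dots> = (\<alpha> j - q) mod p" 
    proof -
      obtain c where "q = p * c" using qp by (auto simp: mod_eq_0_iff_dvd)
      then show ?thesis by simp
    qed
    finally show ?thesis by simp
  qed
  then have \<delta>mod: "\<delta> i mod p = \<alpha> i mod p" for i by (simp add: \<delta>_def)
  \<comment> \<open>Otherwise \<alpha> would be a Frobenius index or a Frobenius index plus a unit
    vector.\<close>
  have \<delta>ne: "\<delta> \<noteq> 0" "\<And>i. i \<in> Y0 \<Longrightarrow> \<delta> \<noteq> sgl i 1" using contra frobenius_index \<alpha>\<delta> by auto
  have "\<forall>i\<in>Y0. \<delta> i mod p \<in> {0, 1}" "\<forall>i\<in>Y0. \<forall>j\<in>Y0. \<delta> i mod p = 1 \<longrightarrow> \<delta> j mod p = 1 \<longrightarrow> i = j"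
    using m01 one unfolding \<delta>mod by blast+
  then have "\<not> (\<forall>i\<in>Y0. \<delta> i < p)" using small_class[OF \<delta>A] \<delta>ne by blast
  then obtain i where i: "i \<in> Y0" "p \<le> \<delta> i" by (auto simp: not_less)
  have size\<delta>: "size_index \<delta> \<ge> p" using size_index_ge[OF i(1), of \<delta>] i(2) by linarith
  \<comment> \<open>A second conjugate pair exists because m > 1.\<close>
  obtain l where l: "l \<in> Y0" "l \<noteq> j" "l \<noteq> conj_index j"
  proof -
    have "card (Y0 - {j, conj_index j}) \<ge> card Y0 - card {j, conj_index j}"
      by (rule diff_card_le_card_Diff) simp
    moreover have "card {j, conj_index j} \<le> 2" by (simp add: card_insert_if)
    moreover have "card Y0 \<ge> 4" using m_gt_1 by (simp add: Y0_def)
    ultimately have "card (Y0 - {j, conj_index j}) \<noteq> 0" by linarith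
    then have "Y0 - {j, conj_index j} \<noteq> {}" by (metis card.empty)
    then show thesis using that by auto
  qed
  obtain a where a: "q = Suc a" using q p_gt_3 by (cases q) auto
  define \<gamma> where "\<gamma> = \<alpha>(j := \<alpha> j - Suc a, conj_index l := Suc (\<alpha> (conj_index l)))"
  define \<alpha>' where "\<alpha>' = \<alpha>(j := \<alpha> j - 1, conj_index j := \<alpha> (conj_index j) - 1, l := Suc (\<alpha> l), conj_index l := Suc (\<alpha> (conj_index l)))"
  have up: "\<alpha> (conj_index l) < top_index (conj_index l)" using m01 l(1) by (intro mod_01_less_top[OF assms(2)]) auto
  have tj: "Suc a \<le> top_index j" "Suc a \<le> \<alpha> j"
    using s(2) A_le_top[OF assms(2), of j] unfolding a[symmetric] q_def by linarith+
  have m0: "m > 0" using m_gt_1 by simp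
  note ps = poisson_double[OF j(1) tj(1) l top_ge1[OF l(1)] assms(2) tj(2) up _ m0, of "{}", folded \<gamma>_def \<alpha>'_def, unfolded a[symmetric]]
  let ?f = "mon (sgl j q + sgl l 1, {}) :: 'a sfun" and ?g = "mon (\<gamma>, {}) :: 'a sfun"
  obtain c where c: "poisson ?f ?g = scaleO (\<tau> l * of_nat (\<alpha> j choose q)) (mon (\<alpha>, {}) :: 'a sfun) +
      (if \<alpha> (conj_index j) > 0 \<and> \<alpha>' \<in> A then scaleO c (mon (\<alpha>', {})) else 0)"
    using ps(2)[where 'b = 'a] by blast
  have ne: "conj_index l \<noteq> j" "conj_index l \<noteq> conj_index j" using l conj_eq_swap[of l j] by auto
  have a': "\<alpha>' j = \<alpha> j - 1" "\<alpha>' (conj_index j) = \<alpha> (conj_index j) - 1"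
    using l ne j(1) by (auto simp: \<alpha>'_def)
  \<comment> \<open>The second term lowers both indices of the pair of j. At most one of them is 1
    modulo p, so one that was 0 modulo p becomes p - 1, while its conjugate stays below the top;
    \<open>dv_cubes\<close> applies.\<close>
  have R: "dv \<phi> (if \<alpha> (conj_index j) > 0 \<and> \<alpha>' \<in> A then scaleO c (mon (\<alpha>', {})) else 0) k = 0"
    and RH: "(if \<alpha> (conj_index j) > 0 \<and> \<alpha>' \<in> A then scaleO c (mon (\<alpha>', {})) else 0) \<in> (Hfun :: 'a sfun set)"
  proof -
    have cj: "conj_index j \<in> Y0" "conj_index j \<noteq> j" using j by auto
    have lt: "\<alpha> j < top_index j" "\<alpha> (conj_index j) < top_index (conj_index j)"
      using m01 j(1) cj(1) mod_01_less_top[OF assms(2)] by blast+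
    have "dv \<phi> (mon (\<alpha>', {})) k = 0" if "\<alpha>' \<in> A" "\<alpha> (conj_index j) > 0"
    proof (cases "\<alpha> j mod p = 0")
      case True
      then have "\<alpha>' j mod p = p - 1" using mod_pred[of "\<alpha> j"] j(2) p_gt_3 a' by simp
      then show ?thesis
        using p_gt_3 lt a' by (intro dv_cubes[OF assms(1) H_index_empty[OF that(1)] j(1)]) auto
    next
      case False
      then have "\<alpha> j mod p = 1" using m01 j(1) by auto
      then have "\<alpha> (conj_index j) mod p \<noteq> 1" using one j(1) cj by blast
      then have "\<alpha> (conj_index j) mod p = 0" using m01 cj(1) by blast
      then have "\<alpha>' (conj_index j) mod p = p - 1" using mod_pred[of "\<alpha> (conj_index j)"] that(2) a' by simp
      then show ?thesis
        using p_gt_3 lt a' by (intro dv_cubes[OF assms(1) H_index_empty[OF that(1)] cj(1)]) auto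
    qed
    then show "dv \<phi> (if \<alpha> (conj_index j) > 0 \<and> \<alpha>' \<in> A then scaleO c (mon (\<alpha>', {})) else 0) k = 0"
      "(if \<alpha> (conj_index j) > 0 \<and> \<alpha>' \<in> A then scaleO c (mon (\<alpha>', {})) else 0) \<in> (Hfun :: 'a sfun set)"
      using dv_linear(2)[OF D(2)] dv_zero[OF D(2)] H_index_empty by auto
  qed
  have fA: "sgl j q + sgl l 1 \<in> A" using tj l top_ge1[OF l(1)] by (auto simp: A_iff plus_fun_apply sgl_apply a)
  have g: "size_index \<gamma> \<ge> 3"
  proof -
    have "\<gamma> = \<delta>(conj_index l := Suc (\<delta> (conj_index l)))" using ne by (auto simp: \<gamma>_def \<delta>_def a fun_eq_iff)
    then show ?thesis using size_index_Suc[of "conj_index l" \<delta>] l(1) size\<delta> p_gt_3 by simp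
  qed
  have "0 = dv \<phi> (poisson ?f ?g) k"
    using D(2) fA ps(1) g j(1) l(1) q p_gt_3
    by (intro dv_poisson_low3[symmetric])
      (auto intro!: low_mon H_index_empty simp: size_index_sgl size_index_add)
  also have "\<dots> = scaleO (\<tau> l * of_nat (\<alpha> j choose q)) (dv \<phi> (mon (\<alpha>, {})) k)"
    unfolding c using dv_linear(1)[OF D(2) _ RH] dv_linear(2)[OF D(2)] H R by simp
  also have "of_nat (\<alpha> j choose q) = (of_nat (\<alpha> j div q) :: 'a)" unfolding q_def by (rule choose_prime_power)
  finally show False using s(3) assms(3) by (simp add: q_def)
qed

lemma so_mon_empty: "(\<alpha>, {}) \<in> Basis \<Longrightarrow> k \<in> Y1 \<Longrightarrow> l \<in> Y1 \<Longrightarrow> so k l (mon (\<alpha>, {})) = (0 :: 'b::field sfun)"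
  by (simp add: so_def pd_mon_empty_Y1)

lemma dv_so_invariant:
  assumes "normalised \<phi>" "\<alpha> \<in> A" "k \<in> Y1" "l \<in> Y1" "k \<noteq> l" "j \<in> Y"
  shows "so k l (dv \<phi> (mon (\<alpha>, {})) j) - (if j = k then dv \<phi> (mon (\<alpha>, {})) l else 0)
    + (if j = l then dv \<phi> (mon (\<alpha>, {})) k else 0) = 0"
  using dv_xx[OF normalisedD(2)[OF assms(1)] _ normalisedD(6)[OF assms(1,3,4,5)] assms(3-6), of "mon (\<alpha>, {})"]
    H_index_empty[OF assms(2)] so_mon_empty[of \<alpha> k l, where 'b = 'a] assms H_indexD(4)[OF H_index_empty[OF assms(2)]]
  by (simp add: dv_zero[OF normalisedD(2)[OF assms(1)]])

text \<open>The even coordinates vanish by weight: the monomial has weight 0 where d_j would need 1.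
  The odd coordinates are an orthogonal invariant, to which \<open>so_invariant_zero\<close>
  applies; its commutation hypothesis is read off from the bracket with x_i' x_k x_l.\<close>

lemma dv_invariant_zero:
  assumes kill: "normalised \<phi>" and \<alpha>: "\<alpha> \<in> A" and k0: "k0 \<in> Y1" "dv \<phi> (mon (\<alpha>, {})) k0 (0, Y1 - {k0}) = 0"
    and wt: "\<And>i. i \<in> Y0 \<Longrightarrow> of_nat (\<alpha> (conj_index i)) = (of_nat (\<alpha> i) :: 'a)"
    and i: "i \<in> Y0" and low: "\<And>j. dv \<phi> (pd i (mon (\<alpha>, {}))) j = 0"
      "\<And>j k l. k \<in> Y1 \<Longrightarrow> l \<in> Y1 \<Longrightarrow> k \<noteq> l \<Longrightarrow> dv \<phi> (mult (xx k l) (pd i (mon (\<alpha>, {})))) j = 0"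
  shows "dv \<phi> (mon (\<alpha>, {})) j = 0"
proof -
  note D = normalisedD[OF kill]
  let ?g = "mon (\<alpha>, {}) :: 'a sfun" and ?c = "conj_index i"
  have H: "(\<alpha>, {}) \<in> H_index" using \<alpha> by (rule H_index_empty)
  have g: "?g \<in> Hfun" using H by simp
  have even_zero: "dv \<phi> ?g j = 0" if "j \<in> Y0" for j
    using weight[OF D(1) H, of j j] wt[OF that] that by auto
  have c: "?c \<in> Y0" using i by simp
  have odd_zero: "dv \<phi> ?g j = 0" if "j \<in> Y1" for j
  proof (rule so_invariant_zero[of "dv \<phi> ?g" k0])
    show "dv \<phi> ?g j \<in> Opar 1" if "j \<in> Y1" for j
      using dv_Opar[OF D(2) g, of j] that by simp
    show "\<alpha>' = 0" if "dv \<phi> ?g j (\<alpha>', u) \<noteq> 0" for j \<alpha>' u using that by (rule dv_support)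
    show "so k l (dv \<phi> ?g j) - (if j = k then dv \<phi> ?g l else 0) + (if j = l then dv \<phi> ?g k else 0) = 0"
      if "j \<in> Y1" "k \<in> Y1" "l \<in> Y1" "k \<noteq> l" for j k l
      using that by (intro dv_so_invariant[OF kill \<alpha>]) auto
    show "mult (dv \<phi> ?g k) (xo l) + mult (xo k) (dv \<phi> ?g l) = 0" if kl: "k \<in> Y1" "l \<in> Y1" "k \<noteq> l" for k l
    proof -
      have pd: "pd i ?g \<in> Hfun" using pd_Hfun[OF i Hfun_Opar[OF g]] .
      have "poisson (xexx ?c k l) ?g = scaleO (\<tau> ?c) (mult (xx k l) (pd i ?g))"
        using poisson_xexx[OF c kl Hfun_Osup[OF g]] so_mon_empty[OF H_indexD(4)[OF H] kl(1,2), where 'b = 'a] by simp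
      moreover have "mult (xx k l) (pd i ?g) \<in> Hfun"
      proof -
        have "mult (xx k l) (pd i ?g) \<in> Opar (0 + 0)" using kl Hfun_Opar[OF pd] by (intro mult_Opar xx_Opar) auto
        moreover have "mult (xx k l) (pd i ?g) (top_index, Y1) = 0"
        proof (rule ccontr)
          assume nz: "mult (xx k l) (pd i ?g) (top_index, Y1) \<noteq> 0"
          show False
            using nz
          proof (rule mult_apply_nonzeroE)
          fix \<beta> v \<gamma> w
          assume *: "(xx k l :: 'a sfun) (\<beta>, v) \<noteq> 0" "pd i ?g (\<gamma>, w) \<noteq> 0" "top_index = \<beta> + \<gamma>"
          obtain s where "xx k l = scaleO s (mon (0, {k, l}) :: 'a sfun)" using xx_mon[OF kl, where 'b = 'a] by blast
          then have "scaleO s (mon (0, {k, l})) (\<beta>, v) \<noteq> 0" using *(1) by (simp only:) simp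
          then have "\<beta> = 0" unfolding sf_apply mon_apply by (simp split: if_splits)
          then have "\<gamma> = top_index" using *(3) by simp
          then show False using *(2) pd_top[OF Hfun_Osup[OF g] i] by simp
          qed
        qed
        ultimately show ?thesis unfolding Hfun_def supp_on_def Opar_def H_index_def by (auto simp: par_def)
      qed
      \<comment> \<open>The coordinate i is conjugate to \<open>?c\<close>; there
        \<open>dv_xexx\<close> contains the desired combination, and its other terms vanish by
        \<open>low\<close>.\<close>
      ultimately have "dv \<phi> (poisson (xexx ?c k l) ?g) i = 0"
        using low(2)[OF kl] dv_linear(2)[OF D(2)] by simp
      moreover have "i \<noteq> k" "i \<noteq> l" using i kl by auto
      ultimately have "scaleO (\<tau> ?c) (mult (dv \<phi> ?g k) (xo l) + mult (xo k) (dv \<phi> ?g l)) = 0"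
        using dv_xexx[OF D(2) g D(9)[OF c kl] D(3) c kl, of i] low(1) i by simp
      then show ?thesis by simp
    qed
  qed (use k0 that in auto)
  show ?thesis using even_zero odd_zero dv_outside[OF D(2) g] by (cases "j \<in> Y") (auto simp: Y_def)
qed

lemma ev_act_zero:
  assumes "E \<in> Weven" "\<And>i. ev (E i) = 0" "f \<in> Osup"
  shows "ev (act E f) = (0 :: 'b::field sfun)"
  using assms by (simp add: act_def ev_sum ev_mult)

section \<open>Vanishing of normalised derivations\<close>

lemma of_nat_top: "i \<in> Y0 \<Longrightarrow> of_nat (top_index i) = (- 1 :: 'a)"
proof -
  assume i: "i \<in> Y0"
  then have "t i \<ge> 1" using t_pos by (simp add: Y0_def)
  then have "p dvd Suc (top_index i)" using top_index_pos[OF i] by (simp add: dvd_power)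
  then have "of_nat (Suc (top_index i)) = (0 :: 'a)" by (simp only: of_nat_eq_0_iff')
  then have "1 + of_nat (top_index i) = (0 :: 'a)" by simp
  then show ?thesis by (metis add_eq_0_iff2 minus_unique)
qed

text \<open>The entry top - 1 is p - 2 modulo p, so the index belongs to neither class of
  \<open>dv_classes\<close>.\<close>

lemma dv_top_lower:
  assumes "normalised \<phi>" "(\<alpha>, u) \<in> H_index" "i \<in> Y0" "\<alpha> i = top_index i - 1"
  shows "dv \<phi> (mon (\<alpha>, u)) j = 0"
proof (rule ccontr)
  assume nz: "dv \<phi> (mon (\<alpha>, u)) j \<noteq> 0"
  have ti: "top_index i \<ge> 4" using assms(3) by (rule top_ge)
  have "Suc (top_index i - 1) mod p = p - 1" using top_mod[OF assms(3)] ti by simp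
  then have "(top_index i - 1) mod p = p - 2" using p_gt_3 by (auto simp: mod_Suc split: if_splits)
  then have "\<alpha> i mod p \<notin> {0, 1}" using assms(4) p_gt_3 by auto
  moreover have "\<alpha> \<noteq> top_index" using assms(4) ti by auto
  ultimately show False using dv_classes[OF assms(1,2) nz] assms(3) by blast
qed

lemma frobenius_indicesD:
  assumes "\<gamma> \<in> frobenius_indices"
  shows "\<gamma> \<in> A" "\<And>i. \<gamma> i mod p = 0" "\<And>i. i \<in> Y0 \<Longrightarrow> \<gamma> i < top_index i" "\<And>i. of_nat (\<gamma> i) = (0 :: 'a)"
    "\<And>i. i \<in> Y0 \<Longrightarrow> \<gamma> + sgl i 1 \<in> A"
proof -
  obtain r s where rs: "\<gamma> = sgl r (p ^ s)" "r \<in> Y0" "1 \<le> s" "s < t r" using assms by (auto simp: frobenius_indices_def)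
  have "p ^ s < p ^ t r" using rs p_gt_3 by (intro power_strict_increasing) auto
  then have "p ^ s \<le> top_index r" using top_index_pos[OF rs(2)] by linarith
  then show A: "\<gamma> \<in> A" using rs by (simp add: sgl_A)
  show m: "\<gamma> i mod p = 0" for i using rs by (simp add: sgl_apply)
  show lt: "\<gamma> i < top_index i" if "i \<in> Y0" for i using m[of i] by (intro mod_01_less_top[OF A that]) auto
  show "of_nat (\<gamma> i) = (0 :: 'a)" for i using m by (rule of_nat_mod_0)
  show "\<gamma> + sgl i 1 \<in> A" if "i \<in> Y0" for i
    unfolding A_iff using lt[OF that] A_le_top[OF A] by (auto simp: plus_fun_apply sgl_apply Suc_le_eq)
qed

text \<open>A fixed odd index; the coefficient of an invariant in one odd coordinate determines
  those in all the others.\<close>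

definition k0 :: nat where "k0 = 2 * m + 1"

lemma k0_Y1 [simp]: "k0 \<in> Y1"
  using n_gt_3 by (simp add: k0_def Y1_def)

text \<open>The scalars left free for a normalised derivation. In the order of the conditions they
  detect \<open>\<Gamma>1\<close> and \<open>\<Phi>\<close>, then the powers of
  \<open>ad (partial r)\<close>, then \<open>\<Theta>\<close>. The variable x_1 stands for all x_i,
  by \<open>dv_frobenius_indices_Y0\<close>.\<close>

definition vanishing :: "('a vfield \<Rightarrow> 'a vfield) \<Rightarrow> bool" where
  "vanishing \<phi> \<longleftrightarrow> (\<forall>\<gamma>\<in>insert top_index frobenius_indices. dv \<phi> (mon (\<gamma>, {})) k0 (0, Y1 - {k0}) = 0)
    \<and> (\<forall>\<gamma>\<in>frobenius_indices. dv \<phi> (mon (\<gamma> + sgl 1 1, {})) (conj_index 1) (0, {}) = 0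
        \<and> dv \<phi> (mon (\<gamma> + sgl 1 1, {})) (conj_index 1) (0, Y1) = 0)"

text \<open>All entries of the top index are -1 in the field, so the weights are 0, and one
  derivative by x_1 leads to indices covered by \<open>dv_top_lower\<close>.\<close>

lemma dv_top:
  assumes "normalised \<phi>" "vanishing \<phi>"
  shows "dv \<phi> (mon (top_index, {})) j = 0"
proof -
  let ?\<delta> = "top_index(1 := top_index 1 - Suc 0)"
  have \<delta>: "?\<delta> \<in> A" using top_in_A by (rule A_lower)
  have pd: "pd 1 (mon (top_index, {})) = (mon (?\<delta>, {}) :: 'a sfun)"
    using pd_mon_Y0[OF H_indexD(4)[OF x_pi_H_index] Y0_nonempty, where 'a = 'a] top_ge[OF Y0_nonempty] by simp
  have ne: "?\<delta> \<noteq> top_index" using top_ge[OF Y0_nonempty] by (auto simp: fun_eq_iff)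
  show ?thesis
  proof (rule dv_invariant_zero[OF assms(1) top_in_A k0_Y1 _ _ Y0_nonempty])
    show "dv \<phi> (mon (top_index, {})) k0 (0, Y1 - {k0}) = 0" using assms(2) by (simp add: vanishing_def)
    show "of_nat (top_index (conj_index i)) = (of_nat (top_index i) :: 'a)" if "i \<in> Y0" for i
      using that by (simp add: of_nat_top)
    show "dv \<phi> (pd 1 (mon (top_index, {}))) j = 0" for j
      unfolding pd by (rule dv_top_lower[OF assms(1) H_index_empty[OF \<delta>] Y0_nonempty]) simp
    show "dv \<phi> (mult (xx k l) (pd 1 (mon (top_index, {})))) j = 0" if kl: "k \<in> Y1" "l \<in> Y1" "k \<noteq> l" for j k l
    proof -
      obtain s where s: "xx k l = scaleO s (mon (0, {k, l}) :: 'a sfun)" using xx_mon[OF kl, where 'b = 'a] by blast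
      have z: "(0 :: nat \<Rightarrow> nat) + ?\<delta> = ?\<delta>" by simp
      have "mult (xx k l) (pd 1 (mon (top_index, {}))) = scaleO s (mon (?\<delta>, {k, l}) :: 'a sfun)"
        unfolding pd s mult_scale_left using kl \<delta> z by (simp add: mult_mon_mon' del: fun_upd_apply)
      moreover have H: "(?\<delta>, {k, l}) \<in> H_index" using kl \<delta> ne by (intro H_indexI) auto
      moreover have "dv \<phi> (mon (?\<delta>, {k, l})) j = 0"
        by (rule dv_top_lower[OF assms(1) H Y0_nonempty]) simp
      ultimately show ?thesis using dv_linear(2)[OF normalisedD(2)[OF assms(1)]] by simp
    qed
  qed
qed

lemma Y0_other: "\<exists>i\<in>Y0. i \<noteq> r"
  using m_gt_1 by (intro bexI[of _ "if r = 1 then 2 else 1"]) (auto simp: Y0_def)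

lemma dv_frobenius_indices:
  assumes "normalised \<phi>" "vanishing \<phi>" "\<gamma> \<in> frobenius_indices"
  shows "dv \<phi> (mon (\<gamma>, {})) j = 0"
proof -
  obtain r s where rs: "\<gamma> = sgl r (p ^ s)" using assms(3) by (auto simp: frobenius_indices_def)
  \<comment> \<open>Differentiating by another variable kills the monomial, which makes the
    hypotheses of \<open>dv_invariant_zero\<close> on the derivative trivial.\<close>
  obtain i where i: "i \<in> Y0" "i \<noteq> r" using Y0_other by blast
  note G = frobenius_indicesD[OF assms(3)]
  have pd: "pd i (mon (\<gamma>, {})) = (0 :: 'a sfun)"
    using pd_mon_Y0[OF H_indexD(4)[OF H_index_empty[OF G(1)]] i(1), where 'a = 'a] i(2) rs by (simp add: sgl_apply)
  show ?thesis
  proof (rule dv_invariant_zero[OF assms(1) G(1) k0_Y1 _ _ i(1)])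
    show "dv \<phi> (mon (\<gamma>, {})) k0 (0, Y1 - {k0}) = 0" using assms(2,3) by (simp add: vanishing_def)
  qed (simp_all add: pd G dv_zero[OF normalisedD(2)[OF assms(1)]])
qed

text \<open>\<open>dv_squares\<close> leaves the coordinate conjugate to 1. This coordinate is
  invariant under rotations without correction terms, so only the empty and the full odd monomial
  can occur, and \<open>vanishing\<close> excludes both.\<close>

lemma dv_frobenius_indices_1:
  assumes "normalised \<phi>" "vanishing \<phi>" "\<gamma> \<in> frobenius_indices"
  shows "dv \<phi> (mon (\<gamma> + sgl 1 1, {})) j = 0"
proof (cases "j = conj_index 1")
  case False
  note G = frobenius_indicesD[OF assms(3)]
  have c: "conj_index 1 \<in> Y0" "conj_index 1 \<noteq> 1" using Y0_nonempty by auto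
  show ?thesis
    using False G(4)[of 1] G(3)[OF c(1)] c
    by (intro dv_squares[OF assms(1) H_index_empty[OF G(5)[OF Y0_nonempty]] Y0_nonempty])
      (simp_all add: plus_fun_apply sgl_apply)
next
  case True
  note G = frobenius_indicesD[OF assms(3)]
  let ?e = "dv \<phi> (mon (\<gamma> + sgl 1 1, {})) (conj_index 1)"
  have c: "conj_index 1 \<in> Y0" using Y0_nonempty by simp
  have A1: "\<gamma> + sgl 1 1 \<in> A" using G(5)[OF Y0_nonempty] .
  have H: "mon (\<gamma> + sgl 1 1, {}) \<in> (Hfun :: 'a sfun set)" using H_index_empty[OF A1] by simp
  have o: "?e \<in> Osup" using normalisedD(2)[OF assms(1)] H by (rule dv_Osup)
  have "?e = 0"
  proof
    fix b :: monomial
    obtain \<alpha> v where b: "b = (\<alpha>, v)" by (cases b)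
    show "?e b = 0 b"
    proof (rule ccontr)
      assume "?e b \<noteq> 0 b"
      then have nz: "?e (\<alpha>, v) \<noteq> 0" by (simp add: b sf_apply)
      then have "\<alpha> = 0" by (rule dv_support)
      have "v \<subseteq> Y1" using Osup_outside[OF o, of "(\<alpha>, v)"] nz by (auto simp: Basis_iff)
      moreover have "v \<inter> Y1 = {} \<or> Y1 \<subseteq> v"
      proof (rule so_invariant_support[OF o subset_refl _ nz])
        show "so k l ?e = 0" if "k \<in> Y1" "l \<in> Y1" "k \<noteq> l" for k l
        proof -
          have "conj_index 1 \<noteq> k" "conj_index 1 \<noteq> l" using c that by auto
          then show ?thesis
            using dv_so_invariant[OF assms(1) A1 that Y0_sub[OF c]] by simp
        qed
      qed
      ultimately have "v = {} \<or> v = Y1" by blast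
      then show False using assms(2,3) nz \<open>\<alpha> = 0\<close> by (auto simp: vanishing_def)
    qed
  qed
  then show ?thesis using True by simp
qed

text \<open>The monomial with x_i arises from the one with x_1 by a bracket with x_i x_c, c
  conjugate to 1, or with x_c^(2) if i = c. These quadratic elements are killed. The coefficient of
  the wanted term is 1 modulo p up to sign, and the second term has an entry p - 1 modulo p and is
  removed by \<open>dv_cubes\<close>.\<close>

lemma dv_frobenius_indices_Y0:
  assumes "normalised \<phi>" "vanishing \<phi>" "\<gamma> \<in> frobenius_indices" "i \<in> Y0"
  shows "dv \<phi> (mon (\<gamma> + sgl i 1, {})) j = 0"
proof (cases "i = 1 \<or> j \<notin> Y")
  case True
  then show ?thesis
    using dv_frobenius_indices_1[OF assms(1-3)] dv_outside[OF normalisedD(2)[OF assms(1)], of "mon (\<gamma> + sgl i 1, {})" j]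
      H_index_empty[OF frobenius_indicesD(5)[OF assms(3,4)]] by auto
next
  case False
  then have i1: "i \<noteq> 1" and j: "j \<in> Y" by auto
  note G = frobenius_indicesD[OF assms(3)] and D = normalisedD[OF assms(1)]
  let ?\<alpha> = "\<gamma> + sgl i 1"
  have \<alpha>: "?\<alpha> \<in> A" using G(5)[OF assms(4)] .
  have H: "(?\<alpha>, {}) \<in> H_index" using \<alpha> by (rule H_index_empty)
  define c where "c = conj_index 1"
  have c: "c \<in> Y0" "conj_index c = 1" "c \<noteq> 1" using Y0_nonempty conj_neq'(1)[OF Y0_nonempty] by (simp_all add: c_def)
  let ?g = "mon (\<gamma> + sgl 1 1, {}) :: 'a sfun"
  have g: "?g \<in> Hfun" using H_index_empty[OF G(5)[OF Y0_nonempty]] by simp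
  have E: "\<phi> (DH ?g) \<in> Weven" using D(2) g by (rule Der_Weven)
  have e0: "ev (\<phi> (DH ?g) j) = 0" for j using dv_frobenius_indices_1[OF assms(1-3), of j] by (simp add: dv_def)
  have \<alpha>i: "?\<alpha> i = Suc (\<gamma> i)" by (simp add: plus_fun_apply sgl_apply)
  have up: "?\<alpha> 1 < top_index 1" using G(3)[OF Y0_nonempty] i1 by (simp add: plus_fun_apply sgl_apply)
  have m0: "m > 0" using m_gt_1 by simp
  show ?thesis
  proof (cases "i = c")
    case True
    let ?f = "mon (sgl i 2, {}) :: 'a sfun"
    have two: "Suc 1 = 2" by simp
    have t2: "Suc 1 \<le> top_index i" "1 \<le> ?\<alpha> i" using top_ge[OF assms(4)] \<alpha>i by simp_all
    have up': "?\<alpha> (conj_index i) < top_index (conj_index i)" using up c True by simp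
    have \<gamma>': "?\<alpha>(i := ?\<alpha> i - 1, conj_index i := Suc (?\<alpha> (conj_index i))) = \<gamma> + sgl 1 1"
      using True c i1 by (auto simp: fun_eq_iff plus_fun_apply sgl_apply)
    have poisson: "poisson ?f ?g = scaleO (\<tau> i * of_nat (?\<alpha> i)) (mon (?\<alpha>, {}))"
      using poisson_single(2)[OF assms(4) t2(1) \<alpha> t2(2) up' _ m0, of "{}", where 'b = 'a] unfolding two \<gamma>' by simp
    have f: "?f \<in> Hfun" using top_ge[OF assms(4)] assms(4) by (simp add: H_index_empty sgl_A)
    have "scaleO (\<tau> i * of_nat (?\<alpha> i)) (dv \<phi> (mon (?\<alpha>, {})) j) = dv \<phi> (poisson ?f ?g) j"
      unfolding poisson using dv_linear(2)[OF D(2)] H by simp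
    also have "\<dots> = - scaleO (\<tau> (conj_index j)) (ev (act (\<phi> (DH ?g)) (pd (conj_index j) ?f)))"
      using D(2) D(4)[OF assms(4)] f g assms(4) j
      by (intro dv_poisson_low2) (auto intro!: low_mon simp: size_index_sgl)
    also have "\<dots> = 0" unfolding ev_act_zero[OF E e0 pd_Osup] by simp
    finally show ?thesis using G(4)[of i] unfolding \<alpha>i by simp
  next
    case False
    let ?f = "mon (sgl i (Suc 0) + sgl c 1, {}) :: 'a sfun"
    have ci: "c \<noteq> conj_index i" using i1 c by (metis conj_conj)
    have t1: "Suc 0 \<le> top_index i" "1 \<le> top_index c" "Suc 0 \<le> ?\<alpha> i"
      using top_ge[OF assms(4)] top_ge[OF c(1)] \<alpha>i by simp_all
    have up': "?\<alpha> (conj_index c) < top_index (conj_index c)" using up c by simp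
    define \<alpha>' where "\<alpha>' = ?\<alpha>(i := ?\<alpha> i - 1, conj_index i := ?\<alpha> (conj_index i) - 1, c := Suc (?\<alpha> c), conj_index c := Suc (?\<alpha> (conj_index c)))"
    have \<gamma>': "?\<alpha>(i := ?\<alpha> i - Suc 0, conj_index c := Suc (?\<alpha> (conj_index c))) = \<gamma> + sgl 1 1"
      using c i1 by (auto simp: fun_eq_iff plus_fun_apply sgl_apply)
    obtain b where b: "poisson ?f ?g = scaleO (\<tau> c * of_nat (?\<alpha> i)) (mon (?\<alpha>, {}) :: 'a sfun) +
      (if ?\<alpha> (conj_index i) > 0 \<and> \<alpha>' \<in> A then scaleO b (mon (\<alpha>', {})) else 0)"
      using poisson_double(2)[OF assms(4) t1(1) c(1) _ ci t1(2) \<alpha> t1(3) up' _ m0, of "{}", where 'b = 'a, folded \<alpha>'_def] False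
      unfolding \<gamma>' by auto
    have ne: "conj_index i \<noteq> i" "conj_index i \<noteq> c" "conj_index i \<noteq> 1" "i \<noteq> conj_index c"
      using assms(4) ci i1 False c by (auto simp: c_def conj_eq_swap)
    have R: "dv \<phi> (if ?\<alpha> (conj_index i) > 0 \<and> \<alpha>' \<in> A then scaleO b (mon (\<alpha>', {})) else 0) j = 0"
      and RH: "(if ?\<alpha> (conj_index i) > 0 \<and> \<alpha>' \<in> A then scaleO b (mon (\<alpha>', {})) else 0) \<in> (Hfun :: 'a sfun set)"
    proof -
      have "dv \<phi> (mon (\<alpha>', {})) j = 0" if "\<alpha>' \<in> A" "?\<alpha> (conj_index i) > 0"
      proof -
        have a': "\<alpha>' (conj_index i) = \<gamma> (conj_index i) - 1" "\<gamma> (conj_index i) > 0" "\<alpha>' i = \<gamma> i"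
          using ne that(2) c False by (auto simp: \<alpha>'_def plus_fun_apply sgl_apply)
        then have "\<alpha>' (conj_index i) mod p = p - 1" using mod_pred[of "\<gamma> (conj_index i)"] G(2) by simp
        then show ?thesis
          using p_gt_3 G(3)[OF assms(4)] a' assms(4)
          by (intro dv_cubes[OF assms(1) H_index_empty[OF that(1)], of "conj_index i"]) auto
      qed
      then show "dv \<phi> (if ?\<alpha> (conj_index i) > 0 \<and> \<alpha>' \<in> A then scaleO b (mon (\<alpha>', {})) else 0) j = 0"
        "(if ?\<alpha> (conj_index i) > 0 \<and> \<alpha>' \<in> A then scaleO b (mon (\<alpha>', {})) else 0) \<in> (Hfun :: 'a sfun set)"
        using dv_linear(2)[OF D(2)] dv_zero[OF D(2)] H_index_empty by auto
    qed
    have f: "?f \<in> Hfun" using torus_H_index[OF assms(4) c(1) False, of 1] by simp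
    have "scaleO (\<tau> c * of_nat (?\<alpha> i)) (dv \<phi> (mon (?\<alpha>, {})) j) = dv \<phi> (poisson ?f ?g) j"
      unfolding b using dv_linear(1)[OF D(2) _ RH] dv_linear(2)[OF D(2)] H R by simp
    also have "\<dots> = - scaleO (\<tau> (conj_index j)) (ev (act (\<phi> (DH ?g)) (pd (conj_index j) ?f)))"
      using D(2) D(5)[OF assms(4) c(1) False] f g assms(4) c(1) j
      by (intro dv_poisson_low2) (auto intro!: low_mon simp: size_index_sgl size_index_add)
    also have "\<dots> = 0" unfolding ev_act_zero[OF E e0 pd_Osup] by simp
    finally show ?thesis using G(4)[of i] unfolding \<alpha>i by simp
  qed
qed

lemma dv_even:
  assumes "normalised \<phi>" "vanishing \<phi>" "\<alpha> \<in> A"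
  shows "dv \<phi> (mon (\<alpha>, {})) j = 0"
proof (rule ccontr)
  assume nz: "dv \<phi> (mon (\<alpha>, {})) j \<noteq> 0"
  note D = normalisedD[OF assms(1)]
  have z: "dv \<phi> (mon (0, {})) j = 0" using dv_zero[OF D(2), of j] by (simp add: dv_def)
  have x: "dv \<phi> (xe i) j = 0" if "i \<in> Y0" for i using D(3)[OF that] by (simp add: dv_def vf_apply ev_linear)
  show False
    using dv_exceptional[OF assms(1,3) nz] nz dv_top[OF assms(1,2)] dv_frobenius_indices[OF assms(1,2)]
      dv_frobenius_indices_Y0[OF assms(1,2)] z x by auto
qed

text \<open>Two odd variables are removed at a time. Below the top multi-index some \<alpha> i can
  be raised, and x^(\<alpha>) x^v is, up to a nonzero scalar, the bracket of x_i' x_k x_l with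
  x^(\<alpha> + \<epsilon>_i) x^w, where w is v without k and l. At the top nothing can be raised,
  and an odd variable is exchanged instead, starting from a monomial of the same odd degree below
  the top.\<close>

lemma dv_all:
  assumes "normalised \<phi>" "vanishing \<phi>"
  shows "(\<alpha>, u) \<in> H_index \<Longrightarrow> dv \<phi> (mon (\<alpha>, u)) j = 0"
proof (induction "card u" arbitrary: \<alpha> u j rule: less_induct)
  case less
  note D = normalisedD[OF assms(1)]
  have not_top: "dv \<phi> (mon (\<alpha>, v)) j = 0" if v: "(\<alpha>, v) \<in> H_index" "\<alpha> \<noteq> top_index" "card v = card u" for \<alpha> v j
  proof (cases "v = {} \<or> j \<notin> Y")
    case True
    then show ?thesis using dv_even[OF assms] H_indexD[OF v(1)] dv_outside[OF D(2), of "mon (\<alpha>, v)"] v(1) by auto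
  next
    case False
    note H = H_indexD[OF v(1)]
    have fin: "finite v" using H(2) by (rule finite_sub_Y1)
    have jY: "j \<in> Y" using False by simp
    obtain k where k: "k \<in> v" using False by auto
    have "v \<noteq> {k}" using H(3) by auto
    then obtain l where l: "l \<in> v" "l \<noteq> k" using k by auto
    define w where "w = v - {k, l}"
    have kl: "k \<in> Y1" "l \<in> Y1" "k \<noteq> l" using k l H by auto
    have vw: "v = {k, l} \<union> w" "{k, l} \<inter> w = {}" "k \<notin> w" "l \<notin> w" using k l by (auto simp: w_def)
    have w1: "w \<subseteq> Y1" using H(2) by (auto simp: w_def)
    have "v = insert k (insert l w)" "finite w" using vw fin by (auto simp: w_def)
    then have w: "w \<subseteq> Y1" "card v = card w + 2" using w1 vw kl by simp_all
    have wY: "w \<noteq> Y1" using vw kl by auto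
    have wc: "even (card w)" "card w < card u" using w H(3) v(3) by auto
    obtain i where i: "i \<in> Y0" "\<alpha> i < top_index i"
    proof -
      have "\<exists>i\<in>Y0. \<alpha> i < top_index i"
      proof (rule ccontr)
        assume "\<not> ?thesis"
        then have "\<alpha> i = top_index i" for i
          using A_le_top[OF H(1), of i] A_outside[OF H(1), of i] by (cases "i \<in> Y0") (auto simp: top_index_def not_less)
        then show False using v(2) by (auto simp: fun_eq_iff)
      qed
      then show thesis using that by blast
    qed
    let ?c = "conj_index i"
    have c: "?c \<in> Y0" using i by simp
    define \<beta> where "\<beta> = \<alpha>(i := Suc (\<alpha> i))"
    have \<beta>: "\<beta> \<in> A" using i H(1) by (auto simp: \<beta>_def A_iff)
    have B: "(\<beta>, w) \<in> H_index" "(\<alpha>, w) \<in> H_index" using \<beta> H(1) w wc wY by (auto intro!: H_indexI)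
    let ?g = "mon (\<beta>, w) :: 'a sfun"
    have g: "?g \<in> Hfun" using B by simp
    have pd: "pd i ?g = mon (\<alpha>, w)"
      using pd_mon_Y0[OF H_indexD(4)[OF B(1)] i(1), where 'a = 'a] by (simp add: \<beta>_def)
    have pdo: "pd s ?g = 0" if "s \<in> {k, l}" for s
      using pd_mon_Y1[OF H_indexD(4)[OF B(1)], of s, where 'a = 'a] kl vw that by auto
    obtain s where s: "s \<noteq> 0" "xx k l = scaleO s (mon (0, {k, l}) :: 'a sfun)" using xx_mon[OF kl, where 'b = 'a] by blast
    have sgn: "sort_sign {k, l} w \<noteq> (0 :: 'a)" by (simp add: sort_sign_def)
    have z: "(0 :: nat \<Rightarrow> nat) + \<alpha> = \<alpha>" by simp
    have "poisson (xexx ?c k l) ?g = scaleO (\<tau> ?c) (mult (xx k l) (mon (\<alpha>, w)))"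
      using poisson_xexx[OF c kl Hfun_Osup[OF g]] pd pdo by (simp add: so_def)
    also have "mult (xx k l) (mon (\<alpha>, w)) = scaleO (s * sort_sign {k, l} w) (mon (\<alpha>, v))"
      unfolding s mult_scale_left using H(1) kl w(1) vw z by (simp add: mult_mon_mon')
    finally have poisson: "poisson (xexx ?c k l) ?g = scaleO (\<tau> ?c * (s * sort_sign {k, l} w)) (mon (\<alpha>, v))" by simp
    have dg: "dv \<phi> ?g j = 0" "dv \<phi> (pd i ?g) j = 0" for j
      using less.hyps[OF wc(2) B(1)] less.hyps[OF wc(2) B(2)] pd by auto
    have "dv \<phi> (poisson (xexx ?c k l) ?g) j = 0"
      using dv_xexx[OF D(2) g D(9)[OF c kl] D(3) c kl jY] dg by simp
    then have "scaleO (\<tau> ?c * (s * sort_sign {k, l} w)) (dv \<phi> (mon (\<alpha>, v)) j) = 0"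
      unfolding poisson using dv_linear(2)[OF D(2)] v(1) by simp
    then show ?thesis using s(1) sgn by simp
  qed
  show ?case
  proof (cases "\<alpha> \<noteq> top_index \<or> u = {} \<or> j \<notin> Y")
    case True
    then show ?thesis using not_top[OF less.prems] dv_even[OF assms] H_indexD[OF less.prems]
        dv_outside[OF D(2), of "mon (\<alpha>, u)"] less.prems by auto
  next
    case False
    note H = H_indexD[OF less.prems]
    have top: "\<alpha> = top_index" and jY: "j \<in> Y" using False by auto
    have fin: "finite u" using H(2) by (rule finite_sub_Y1)
    have "u \<noteq> Y1" using less.prems top by (simp add: H_index_def)
    then obtain k where k: "k \<in> Y1" "k \<notin> u" using H(2) by auto
    obtain l where l: "l \<in> u" using False by auto
    have kl: "k \<in> Y1" "l \<in> Y1" "k \<noteq> l" using k l H by auto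
    \<comment> \<open>The rotation turns k back into l, so v leads to u; k exists because x^(pi)
      x^omega is not in the index set.\<close>
    define v where "v = insert k (u - {l})"
    have v: "v \<subseteq> Y1" "card v = card u" "k \<in> v" "l \<notin> v" "insert l (v - {k}) = u"
    proof -
      have "card u = Suc (card (u - {l}))" using fin l by (simp only: card_Suc_Diff1)
      then show "card v = card u" using k fin by (simp add: v_def)
      show "insert l (v - {k}) = u" using k l by (auto simp: v_def)
    qed (use k l H kl in \<open>auto simp: v_def\<close>)
    define \<beta> where "\<beta> = \<alpha>(1 := \<alpha> 1 - 1)"
    define c where "c = conj_index 1"
    have c: "c \<in> Y0" "conj_index c = 1" "c \<noteq> 1" using Y0_nonempty conj_neq'(1)[OF Y0_nonempty] by (simp_all add: c_def)
    have t1: "top_index 1 \<ge> 4" "top_index c \<ge> 4" using top_ge Y0_nonempty c by auto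
    have "\<beta> 1 \<noteq> top_index 1" using t1 top by (simp add: \<beta>_def)
    then have "\<beta> \<noteq> top_index" by metis
    moreover have "\<beta> \<in> A" using A_lower[OF H(1), of 1] by (simp add: \<beta>_def)
    ultimately have \<beta>: "\<beta> \<in> A" "\<beta> \<noteq> top_index" by simp_all
    let ?g = "mon (\<beta>, v) :: 'a sfun"
    have Bv: "(\<beta>, v) \<in> H_index" using \<beta> v H(3) by (intro H_indexI) auto
    have g: "?g \<in> Hfun" using Bv by simp
    have "\<beta> c \<noteq> 0" using c top t1 by (simp add: \<beta>_def)
    then have pd: "pd c ?g = mon (\<beta>(c := \<beta> c - 1), v)"
      using pd_mon_Y0[OF H_indexD(4)[OF Bv] c(1), where 'a = 'a] by simp
    have Bc: "\<beta>(c := \<beta> c - 1) \<in> A" "\<beta>(c := \<beta> c - 1) \<noteq> top_index"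
    proof -
      show "\<beta>(c := \<beta> c - 1) \<in> A" using A_lower[OF \<beta>(1), of c] by simp
      have "(\<beta>(c := \<beta> c - 1)) c \<noteq> top_index c" using c t1 top by (simp add: \<beta>_def)
      then show "\<beta>(c := \<beta> c - 1) \<noteq> top_index" by metis
    qed
    have Bcv: "(\<beta>(c := \<beta> c - 1), v) \<in> H_index" using Bc v H(3) by (intro H_indexI) auto
    have dg: "dv \<phi> ?g j = 0" "dv \<phi> (pd c ?g) j = 0" for j
      unfolding pd using not_top[OF Bv \<beta>(2) v(2)] not_top[OF Bcv Bc(2) v(2)] by auto
    have sub: "v - {k} \<subseteq> Y1" "{k, l} \<inter> v \<noteq> {}" "{l} \<inter> (v - {k}) = {}" using v by auto
    \<comment> \<open>The variable x_k already occurs in v, so only the rotation term of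
      \<open>poisson_xexx\<close> remains.\<close>
    have "mult (xx k l) (pd c ?g) = 0"
    proof -
      obtain s where "xx k l = scaleO s (mon (0, {k, l}) :: 'a sfun)" using xx_mon[OF kl, where 'b = 'a] by blast
      then show ?thesis unfolding pd using Bc v kl sub by (simp add: mult_linear mult_mon_mon' del: fun_upd_apply)
    qed
    moreover have "so k l ?g = scaleO (pass_sign k v * sort_sign {l} (v - {k})) (mon (\<beta>, u))"
    proof -
      have "pd k ?g = scaleO (pass_sign k v) (mon (\<beta>, v - {k}))" "pd l ?g = 0"
        using pd_mon_Y1[OF H_indexD(4)[OF Bv] kl(1), where 'a = 'a] pd_mon_Y1[OF H_indexD(4)[OF Bv] kl(2), where 'a = 'a] v by auto
      moreover have "(0 :: nat \<Rightarrow> nat) + \<beta> = \<beta>" by simp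
      ultimately show ?thesis unfolding so_def
        using kl sub \<beta> v by (simp add: mult_linear mult_mon_mon' del: Diff_insert0)
    qed
    \<comment> \<open>The coefficient is the maximal entry at 1, which is -1 in the field.\<close>
    moreover have "mult (xe 1) (mon (\<beta>, u)) = (- mon (\<alpha>, u) :: 'a sfun)"
    proof -
      have "sgl 1 (Suc 0) + \<beta> = \<alpha>" using top t1 by (auto simp: \<beta>_def fun_eq_iff plus_fun_apply sgl_apply)
      moreover have "sgl 1 (Suc 0) \<in> A" using t1 Y0_nonempty by (simp add: sgl_A)
      moreover have "Suc (\<beta> 1) = top_index 1" using top t1 by (simp add: \<beta>_def)
      ultimately show ?thesis using \<beta> H Y0_nonempty
        by (simp add: mult_mon_mon' multi_binom_sgl of_nat_top sfun.scale_minus_left)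
    qed
    ultimately have poisson: "poisson (xexx 1 k l) ?g = scaleO (- (pass_sign k v * sort_sign {l} (v - {k}))) (mon (\<alpha>, u))"
      using poisson_xexx[OF Y0_nonempty kl Hfun_Osup[OF g], folded c_def]
      by (simp add: mult_linear sfun.scale_minus_left)
    have "dv \<phi> (poisson (xexx 1 k l) ?g) j = 0"
      using dv_xexx[OF D(2) g D(9)[OF Y0_nonempty kl] D(3) Y0_nonempty kl jY, folded c_def] dg by simp
    moreover have "mon (\<alpha>, u) \<in> (Hfun :: 'a sfun set)" using less.prems by simp
    ultimately have "scaleO (- (pass_sign k v * sort_sign {l} (v - {k}))) (dv \<phi> (mon (\<alpha>, u)) j) = 0"
      unfolding poisson by (metis dv_linear(2)[OF D(2)])
    moreover have "pass_sign k v * sort_sign {l} (v - {k}) \<noteq> (0 :: 'a)" by (simp add: sort_sign_def)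
    ultimately show ?thesis by (simp add: sfun.scale_minus_left)
  qed
qed

theorem normalised_vanishing_zero:
  assumes "normalised \<phi>" "vanishing \<phi>"
  shows "\<phi> = 0"
proof (rule Lin_eqI_mon)
  note D = normalisedD[OF assms(1)]
  show "\<phi> \<in> Lin" "(0 :: 'a vfield \<Rightarrow> 'a vfield) \<in> Lin"
    using Der_Lin[OF D(2)] Lin_subspace by (auto simp: maps.subspace_def)
  fix b assume "b \<in> H_index"
  moreover obtain \<alpha> u where b: "b = (\<alpha>, u)" by (cases b)
  moreover have "(\<alpha>, u) \<in> H_index \<Longrightarrow> \<phi> (DH (mon (\<alpha>, u))) = 0"
  proof (induction "size_index \<alpha>" arbitrary: \<alpha> rule: less_induct)
    case less
    show ?case
    proof (rule Der_zero_of_dv[OF D(2,3)])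
      show "mon (\<alpha>, u) \<in> (Hfun :: 'a sfun set)" using less.prems by simp
      show "dv \<phi> (mon (\<alpha>, u)) j = 0" for j using less.prems by (rule dv_all[OF assms])
      fix i assume i: "i \<in> Y0"
      show "\<phi> (DH (pd i (mon (\<alpha>, u)))) = 0"
      proof (cases "\<alpha> i = 0")
        case True
        then show ?thesis
          using pd_mon_Y0[OF H_indexD(4)[OF less.prems] i, where 'a = 'a] Lin_DH_0[OF Der_Lin[OF D(2)]] by simp
      next
        case False
        let ?\<beta> = "\<alpha>(i := \<alpha> i - 1)"
        have "?\<beta>(i := Suc (?\<beta> i)) = \<alpha>" using False by auto
        then have "size_index ?\<beta> < size_index \<alpha>" using size_index_Suc[OF i, of ?\<beta>] by simp
        moreover have "(?\<beta>, u) \<in> H_index"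
        proof (rule H_indexI)
          show "?\<beta> \<in> A" using A_lower[OF H_indexD(1)[OF less.prems], of i] by simp
          have "?\<beta> i \<noteq> top_index i" using False A_le_top[OF H_indexD(1)[OF less.prems], of i] by auto
          then show "?\<beta> \<noteq> top_index \<or> u \<noteq> Y1" by metis
        qed (use H_indexD[OF less.prems] in auto)
        ultimately show ?thesis
          using less.hyps False pd_mon_Y0[OF H_indexD(4)[OF less.prems] i, where 'a = 'a] by simp
      qed
    qed
  qed
  ultimately have "\<phi> (DH (mon b)) = 0" by simp
  then show "\<phi> (DH (mon b)) = 0 (DH (mon b))" by (rule trans[OF _ zero_fun_apply[symmetric]])
qed

section \<open>Normalisation by inner derivations\<close>

lemma Der_deg_value:
  assumes "\<phi> \<in> Der_deg k" "f \<in> Hfun" "f \<in> homogeneous d"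
  shows "\<phi> (DH f) \<in> Weven_deg (d - 2 + k)"
proof -
  have "DH f \<in> Weven_deg (d - 2)" using assms by (intro DH_deg) simp_all
  then have "DH f \<in> H_deg (d - 2)" using assms(2) by (simp add: H_deg_def DH_in_H)
  then show ?thesis using assms(1) unfolding Der_deg_def by blast
qed

lemma Der_deg_Der: "\<phi> \<in> Der_deg k \<Longrightarrow> \<phi> \<in> Der"
  by (simp add: Der_deg_def)

lemma homogeneous_neg: "f \<in> homogeneous d \<Longrightarrow> d < 0 \<Longrightarrow> f = 0"
proof
  fix b :: monomial
  assume "f \<in> homogeneous d" "d < 0"
  then have "f b = 0" using homogeneousD[of f d b] by (force simp: deg_def)
  then show "f b = 0 b" by (simp add: sf_apply)
qed

lemma Weven_deg_low: "D \<in> Weven_deg k \<Longrightarrow> k < -1 \<Longrightarrow> D = (0 :: 'b::field vfield)"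
proof
  fix j assume "D \<in> Weven_deg k" "k < -1"
  then have "D j = 0" by (intro homogeneous_neg[OF Weven_deg_homogeneous]) auto
  then show "D j = 0 j" by (simp add: vf_apply)
qed

lemma Weven_deg_const:
  assumes "D \<in> Weven_deg (-1)"
  shows "D j = scaleO (D j (0, {})) (mon (0, {}) :: 'b::field sfun)"
proof
  fix b :: monomial
  have h: "D j \<in> homogeneous 0" using Weven_deg_homogeneous[OF assms, of j] by simp
  obtain \<alpha> u where b: "b = (\<alpha>, u)" by (cases b)
  show "D j b = scaleO (D j (0, {})) (mon (0, {})) b"
  proof (cases "b = (0, {})")
    case True
    then show ?thesis by (simp add: sf_apply(5) mon_apply)
  next
    case False
    have "D j b = 0"
    proof (rule ccontr)
      assume nz: "D j b \<noteq> 0"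
      then have d: "deg b = 0" using homogeneousD[OF h] by blast
      have "b \<in> Basis" using nz Osup_outside[OF homogeneous_Osup[OF h], of b] by blast
      then have B: "\<alpha> \<in> A" "finite u" by (simp_all add: b Basis_iff finite_sub_Y1)
      have "card u = 0" and size: "size_index \<alpha> = 0" using d by (simp_all add: b deg_def)
      then have "u = {}" using B(2) by simp
      have "\<alpha> i = 0" for i using size size_index_ge[of i \<alpha>] A_outside[OF B(1), of i] by (cases "i \<in> Y0") auto
      then show False using False \<open>u = {}\<close> b by (auto simp: fun_eq_iff zero_fun_apply)
    qed
    then show ?thesis using False by (simp add: sf_apply(5) mon_apply)
  qed
qed

text \<open>A constant times d_j with j odd is an odd field.\<close>

lemma Weven_deg_const_Y1:
  assumes "D \<in> Weven_deg (-1)" "j \<in> Y1"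
  shows "D j = (0 :: 'b::field sfun)"
proof -
  have "D j \<in> Opar 1" using Weven_Opar[OF Weven_deg_Weven[OF assms(1)], of j] assms(2) by simp
  then have "D j (0, {}) = 0" by (auto simp: Opar_def supp_on_def par_def)
  then show ?thesis using Weven_deg_const[OF assms(1), of j] by simp
qed

lemma Weven_deg_below:
  assumes "D \<in> Weven_deg k" "k \<le> -1"
  shows "D \<in> (Weven_deg (-1) :: 'b::field vfield set)"
proof (cases "k = -1")
  case False
  then have "D = 0" using assms by (intro Weven_deg_low[OF assms(1)]) auto
  then show ?thesis by simp
qed (use assms in simp)

definition torus_fun :: "nat \<Rightarrow> 'b::field sfun" where
  "torus_fun i = mon (sgl i 1 + sgl (conj_index i) 1, {})"

lemma torus_fun_conj: "torus_fun (conj_index i) = torus_fun i"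
  by (simp add: torus_fun_def add.commute)

lemma torus_fun_Hfun [simp]: "i \<in> Y0 \<Longrightarrow> torus_fun i \<in> (Hfun :: 'b::field sfun set)"
  using torus_H_index[of i "conj_index i" 1] by (simp add: torus_fun_def)

lemma homogeneous_mon: "b \<in> Basis \<Longrightarrow> deg b = d \<Longrightarrow> mon b \<in> homogeneous d"
  by (simp add: homogeneous_eq)

lemma torus_fun_homogeneous: "i \<in> Y0 \<Longrightarrow> torus_fun i \<in> (homogeneous 2 :: 'b::field sfun set)"
  unfolding torus_fun_def using H_index_Basis torus_H_index[of i "conj_index i" 1]
  by (intro homogeneous_mon) (auto simp: deg_def size_index_add size_index_sgl)

lemma pd_torus_fun: "i \<in> Y0 \<Longrightarrow> pd s (torus_fun i) = (if s = i then xe (conj_index i) else if s = conj_index i then xe i else (0 :: 'b::field sfun))"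
  unfolding torus_fun_def using pd_double[of i "conj_index i" 0 s, where 'b = 'b] top_ge1[of i] top_ge1[of "conj_index i"] by simp

lemma bracket_torus_fun:
  fixes E :: "'a vfield"
  assumes "i \<in> Y0" "E \<in> Weven_deg (-1)"
  shows "bracket (DH (torus_fun i)) E s = (if s = i then scaleO (\<tau> i) (E i) else if s = conj_index i then - scaleO (\<tau> i) (E (conj_index i)) else 0)"
proof -
  have W: "E \<in> Weven" using assms(2) by (rule Weven_deg_Weven)
  have "act (DH (torus_fun i)) (E s) = 0"
    by (subst Weven_deg_const[OF assms(2), of s]) (simp add: act_def pd_scale)
  moreover have "act E (DH (torus_fun i) s) = (if s = i then - scaleO (\<tau> i) (E i) else if s = conj_index i then scaleO (\<tau> i) (E (conj_index i)) else 0)"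
    using assms(1) W by (auto simp: DH_apply pd_torus_fun act_xe act_scale act_minus sfun.scale_minus_left conj_eq_swap)
  ultimately show ?thesis
    using assms(1) W by (simp add: bracket_eq)
qed

text \<open>The values on the torus are constant even fields, on which the torus acts diagonally. As
  the torus is commutative, the value on x_i x_i' has only the coordinates i and i', and these are
  those of an inner derivation because d_i and d_i' have weights 1 and -1 up to sign.\<close>

lemma torus_of_Der_deg:
  assumes "\<phi> \<in> Der_deg k" "k < 0"
  obtains w where "w \<in> Weven_deg (-1)" "w \<in> Weven_deg k" "kills_torus (\<phi> - restrict_H (ad w))"
proof -
  have D: "\<phi> \<in> Der" using assms(1) by (rule Der_deg_Der)
  have val: "\<phi> (DH (torus_fun i)) \<in> Weven_deg k" if "i \<in> Y0" for i
    using Der_deg_value[OF assms(1) torus_fun_Hfun torus_fun_homogeneous] that by simp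
  have val': "\<phi> (DH (torus_fun i)) \<in> Weven_deg (-1)" if "i \<in> Y0" for i
    using Weven_deg_below[OF val[OF that]] assms(2) by simp
  have off: "\<phi> (DH (torus_fun i)) s = 0" if "i \<in> Y0" "s \<noteq> i" "s \<noteq> conj_index i" for i s
  proof (cases "s \<in> Y0")
    case True
    have B: "(sgl s 1 + sgl (conj_index s) 1, {}) \<in> Basis"
      using H_index_Basis torus_H_index[OF True, of "conj_index s" 1] True by auto
    have "poisson (torus_fun i) (torus_fun s) = (0 :: 'a sfun)"
      using poisson_torus[OF that(1) top_ge1[OF that(1)] top_ge1[of "conj_index i"] B, where 'b = 'a] that True m_gt_1
      by (simp add: torus_fun_def plus_fun_apply sgl_apply conj_eq_swap)
    then have "bracket (DH (torus_fun i)) (\<phi> (DH (torus_fun s))) = bracket (DH (torus_fun s)) (\<phi> (DH (torus_fun i)))"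
      using Der_DH[OF D torus_fun_Hfun[OF that(1)] torus_fun_Hfun[OF True]] Lin_DH_0[OF Der_Lin[OF D]] by simp
    then have "0 = scaleO (\<tau> s) (\<phi> (DH (torus_fun i)) s)"
      using bracket_torus_fun[OF that(1) val'[OF True], of s] bracket_torus_fun[OF True val'[OF that(1)], of s] that by simp
    then show ?thesis by simp
  next
    case False
    then show ?thesis
      using Weven_deg_const_Y1[OF val'[OF that(1)]] Weven_outside[OF Weven_deg_Weven[OF val'[OF that(1)]]]
      by (cases "s \<in> Y1") (auto simp: Y_def)
  qed
  \<comment> \<open>The coordinate s is read off from the torus element of its own pair. The factor
    inverts the weight in \<open>bracket_torus_fun\<close>, and the minus sign comes from exchanging
    the arguments of the bracket.\<close>
  define w where "w = (\<lambda>s. if s \<in> Y0 then - scaleO (\<tau> s) (\<phi> (DH (torus_fun s)) s) else 0)"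
  have wd: "w \<in> Weven_deg k"
    unfolding Weven_deg_iff Weven_iff
  proof (intro conjI ballI allI impI)
    fix s
    show "s \<in> Y \<Longrightarrow> w s \<in> Opar (\<mu> s)"
      using Weven_Opar[OF Weven_deg_Weven[OF val], of s s] by (auto simp: w_def intro!: Opar_closed)
    show "s \<notin> Y \<Longrightarrow> w s = 0" by (auto simp: w_def)
    show "w s \<in> homogeneous (k + 1)"
      using Weven_deg_homogeneous[OF val, of s s] by (auto simp: w_def)
  qed
  have w1: "w \<in> Weven_deg (-1)" using Weven_deg_below[OF wd] assms(2) by simp
  have "kills_torus (\<phi> - restrict_H (ad w))"
    unfolding kills_torus_def
  proof (intro conjI ballI)
    show "\<phi> - restrict_H (ad w) \<in> Der"
      using Der_subspace D Der_deg_Der[OF ad_Der_deg[OF wd]] by (rule maps.subspace_diff)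
    fix i assume i: "i \<in> Y0"
    have W: "w \<in> Weven" using wd by (rule Weven_deg_Weven)
    have "bracket w (DH (torus_fun i)) s = \<phi> (DH (torus_fun i)) s" for s
    proof -
      have "bracket w (DH (torus_fun i)) s = - bracket (DH (torus_fun i)) w s"
        using bracket_minus[OF W DH_Weven[OF Hfun_Opar[OF torus_fun_Hfun[OF i]]]] by (simp add: vf_apply)
      then show ?thesis
        using bracket_torus_fun[OF i w1, of s] off[OF i, of s] i by (auto simp: w_def torus_fun_conj sfun.scale_minus_left)
    qed
    then have "bracket w (DH (torus_fun i)) = \<phi> (DH (torus_fun i))" by blast
    then show "(\<phi> - restrict_H (ad w)) (DH (mon (sgl i 1 + sgl (conj_index i) 1, {}))) = 0"
      unfolding torus_fun_def[symmetric] using i by (simp add: lf_apply restrict_H_def ad_def DH_in_H)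
  qed
  then show thesis using that wd w1 by blast
qed

text \<open>The number 4 is nonzero in the field because p is prime and hence different from
  4.\<close>

lemma small_nonzero: "(2 :: 'a) \<noteq> 0" "(3 :: 'a) \<noteq> 0" "(4 :: 'a) \<noteq> 0"
proof -
  have *: "of_nat c \<noteq> (0 :: 'a)" if "c > 0" "c < p" for c
    using that of_nat_eq_0_iff'[of c] by (auto dest: dvd_imp_le)
  have "p \<noteq> 4" using prime_p by auto
  then show "(2 :: 'a) \<noteq> 0" "(3 :: 'a) \<noteq> 0" "(4 :: 'a) \<noteq> 0"
    using *[of 2] *[of 3] *[of 4] p_gt_3 by simp_all
qed

text \<open>The constant fields have weights 0, 1 and -1, whereas x_i^(2) and x_i^(3) have weights 2
  and 3 up to sign.\<close>

lemma small_weights: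
  fixes x :: 'a
  assumes "x = 1 \<or> x = - 1 \<or> x = 0"
  shows "x \<noteq> 2" "x \<noteq> - 2" "x \<noteq> 3" "x \<noteq> - 3"
proof -
  have n: "(2 :: 'a) \<noteq> 1" "(3 :: 'a) \<noteq> 1" "(2 :: 'a) \<noteq> - 1" "(3 :: 'a) \<noteq> - 1"
  proof -
    have "(2 :: 'a) - 1 = 1" "(3 :: 'a) - 1 = 2" "(2 :: 'a) + 1 = 3" "(3 :: 'a) + 1 = 4" by simp_all
    then show "(2 :: 'a) \<noteq> 1" "(3 :: 'a) \<noteq> 1" "(2 :: 'a) \<noteq> - 1" "(3 :: 'a) \<noteq> - 1"
      using small_nonzero by (metis diff_self zero_neq_one, metis diff_self, metis add.left_inverse, metis add.left_inverse)
  qed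
  have *: "y \<noteq> 2" "y \<noteq> 3" if "y = 1 \<or> y = - 1 \<or> y = 0" for y :: 'a
    using that n small_nonzero by metis+
  have "- x = 1 \<or> - x = - 1 \<or> - x = 0" using assms by auto
  from *[OF assms] *[OF this] show "x \<noteq> 2" "x \<noteq> - 2" "x \<noteq> 3" "x \<noteq> - 3" by auto
qed

text \<open>The value on x_i has degree below -1. On quadratic elements the values are constant even
  fields, excluded by weights; on x_i^(3) and x_i^(2) x_j weights remove the leading coefficients,
  and the derivatives are quadratic. For x_i x_k x_l weights allow an even coordinate; there the
  leading coefficient is a constant and a rotation annihilates it.\<close>

lemma normalised_of_torus:
  assumes "\<phi> \<in> Der_deg d" "d < 0" "kills_torus \<phi>"
  shows "normalised \<phi>"
proof -
  have D: "\<phi> \<in> Der" using assms(1) by (rule Der_deg_Der)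
  have xe: "\<phi> (DH (xe i)) = 0" if "i \<in> Y0" for i
  proof -
    have "xe i \<in> (homogeneous 1 :: 'a sfun set)"
      using xe_Basis[OF that] that by (intro homogeneous_mon) (simp_all add: deg_def size_index_sgl)
    from Der_deg_value[OF assms(1) xe_Hfun[OF that] this] show ?thesis
      using assms(2) by (intro Weven_deg_low) auto
  qed
  have quadratic: "\<phi> (DH (mon (\<alpha>, u))) = 0"
    if H: "(\<alpha>, u) \<in> H_index" "deg (\<alpha>, u) = 2" and dv: "\<And>j. j \<in> Y0 \<Longrightarrow> dv \<phi> (mon (\<alpha>, u)) j = 0" for \<alpha> u
  proof
    fix j
    let ?E = "\<phi> (DH (mon (\<alpha>, u)))"
    have "mon (\<alpha>, u) \<in> (homogeneous 2 :: 'a sfun set)" using H H_indexD(4) by (intro homogeneous_mon) auto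
    then have "?E \<in> Weven_deg d" using Der_deg_value[OF assms(1), of "mon (\<alpha>, u)" 2] H by simp
    then have E: "?E \<in> Weven_deg (-1)" using assms(2) by (intro Weven_deg_below) auto
    have "?E j = 0"
    proof (cases "j \<in> Y0")
      case True
      have "?E j (0, {}) = dv \<phi> (mon (\<alpha>, u)) j (0, {})" by (simp add: dv_def ev_apply)
      then have "?E j (0, {}) = 0" using dv[OF True] by (simp add: sf_apply)
      then show ?thesis using Weven_deg_const[OF E, of j] by simp
    next
      case False
      then show ?thesis
        using Weven_deg_const_Y1[OF E] Weven_outside[OF Weven_deg_Weven[OF E]] by (cases "j \<in> Y1") (auto simp: Y_def)
    qed
    then show "?E j = 0 j" by (simp add: vf_apply)
  qed
  have weight': "of_nat (\<alpha> (conj_index i)) - of_nat (\<alpha> i) = (1 :: 'a) \<or> of_nat (\<alpha> (conj_index i)) - of_nat (\<alpha> i) = (-1 :: 'a)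
      \<or> of_nat (\<alpha> (conj_index i)) - of_nat (\<alpha> i) = (0 :: 'a)"
    if "(\<alpha>, u) \<in> H_index" "dv \<phi> (mon (\<alpha>, u)) j \<noteq> 0" "i \<in> Y0" for \<alpha> u i j
  proof -
    have "j \<in> Y" using dv_outside[OF D, of "mon (\<alpha>, u)" j] that by auto
    from weight[OF assms(3) that(1) this that(2,3)] show ?thesis by auto
  qed
  have sH: "(sgl i c, {}) \<in> H_index" if "i \<in> Y0" "c \<le> 3" for i c
    using top_ge[OF that(1)] that by (intro H_index_empty) (simp add: sgl_A)
  have sq: "\<phi> (DH (mon (sgl i 2, {}))) = 0" if i: "i \<in> Y0" for i
  proof (rule quadratic)
    show H: "(sgl i 2, {}) \<in> H_index" using sH[OF i] by simp
    show "deg (sgl i 2, {}) = 2" using i by (simp add: deg_def size_index_sgl)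
    show "dv \<phi> (mon (sgl i 2, {})) j = 0" for j
      using weight'[OF H _ i, of j] small_weights[of "- 2"] i by (auto simp: sgl_apply)
  qed
  have double: "\<phi> (DH (mon (sgl i 1 + sgl j 1, {}))) = 0" if ij: "i \<in> Y0" "j \<in> Y0" "i \<noteq> j" for i j
  proof (cases "j = conj_index i")
    case True
    then show ?thesis using assms(3) ij by (simp add: kills_torus_def)
  next
    case False
    show ?thesis
    proof (rule quadratic)
      show H: "(sgl i 1 + sgl j 1, {}) \<in> H_index" using torus_H_index[OF ij, of 1] by simp
      show "deg (sgl i 1 + sgl j 1, {}) = 2" using ij by (simp add: deg_def size_index_sgl size_index_add)
      fix s assume s: "s \<in> Y0"
      show "dv \<phi> (mon (sgl i 1 + sgl j 1, {})) s = 0"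
      \<comment> \<open>The weights at i and at j would force s to be conjugate to i and to j at
        once.\<close>
      proof (rule ccontr)
        assume nz: "dv \<phi> (mon (sgl i 1 + sgl j 1, {})) s \<noteq> 0"
        have ne: "conj_index i \<noteq> i" "conj_index j \<noteq> j" "conj_index i \<noteq> j" "conj_index j \<noteq> i"
          using ij False by (auto simp: conj_eq_swap)
        have "- 1 = (if s = i then 1 else if s = conj_index i then - 1 else (0 :: 'a))"
          using weight[OF assms(3) H Y0_sub[OF s] nz ij(1)] ne ij by (simp add: sgl_apply plus_fun_apply)
        then have "s = conj_index i" using two_neq_0 by (auto simp: neg_eq_iff_add_eq_0 split: if_splits)
        moreover have "- 1 = (if s = j then 1 else if s = conj_index j then - 1 else (0 :: 'a))"
          using weight[OF assms(3) H Y0_sub[OF s] nz ij(2)] ne ij by (simp add: sgl_apply plus_fun_apply)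
        then have "s = conj_index j" using two_neq_0 by (auto simp: neg_eq_iff_add_eq_0 split: if_splits)
        ultimately show False using ij(3) by simp
      qed
    qed
  qed
  have xx: "\<phi> (DH (xx k l)) = 0" if kl: "k \<in> Y1" "l \<in> Y1" "k \<noteq> l" for k l
  proof -
    have H: "(0, {k, l}) \<in> H_index" using kl top_index_neq_0 by (intro H_indexI) auto
    have "\<phi> (DH (mon (0, {k, l}))) = 0"
    proof (rule quadratic[OF H])
      show "deg (0, {k, l}) = 2" using kl by (simp add: deg_def size_index_def zero_fun_apply)
      show "dv \<phi> (mon (0, {k, l})) j = 0" if "j \<in> Y0" for j
        using weight[OF assms(3) H Y0_sub[OF that] _ that] by (auto simp: zero_fun_apply)
    qed
    moreover obtain s where "xx k l = scaleO s (mon (0, {k, l}) :: 'a sfun)" using xx_mon[OF kl, where 'b = 'a] by blast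
    ultimately show ?thesis using Lin_DH(3)[OF Der_Lin[OF D], of "mon (0, {k, l})"] H by simp
  qed
  have cube: "\<phi> (DH (mon (sgl i 3, {}))) = 0" if i: "i \<in> Y0" for i
  proof (rule Der_zero_of_dv[OF D xe])
    show "mon (sgl i 3, {}) \<in> (Hfun :: 'a sfun set)" using sH[OF i] by simp
    show "dv \<phi> (mon (sgl i 3, {})) j = 0" for j
      using weight'[OF sH[OF i, of 3] _ i, of j] small_weights[of "- 3"] i by (auto simp: sgl_apply)
    show "\<phi> (DH (pd s (mon (sgl i 3, {})))) = 0" if "s \<in> Y0" for s
      using pd_sgl[OF i, of 2 s, where 'b = 'a] top_ge[OF i] sq[OF i] Lin_DH_0[OF Der_Lin[OF D]]
      by (simp add: numeral_3_eq_3 numeral_2_eq_2)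
  qed
  have mixed: "\<phi> (DH (mon (sgl i 2 + sgl j 1, {}))) = 0"
    if ij: "i \<in> Y0" "j \<in> Y0" "j \<noteq> i" "j \<noteq> conj_index i" for i j
  proof (rule Der_zero_of_dv[OF D xe])
    have H: "(sgl i 2 + sgl j 1, {}) \<in> H_index" using torus_H_index[OF ij(1,2), of 2] ij by simp
    then show "mon (sgl i 2 + sgl j 1, {}) \<in> (Hfun :: 'a sfun set)" by simp
    show "dv \<phi> (mon (sgl i 2 + sgl j 1, {})) s = 0" for s
      using weight'[OF H _ ij(1), of s] small_weights[of "- 2"] ij by (auto simp: sgl_apply plus_fun_apply)
    have two: "Suc 1 = 2" by simp
    show "\<phi> (DH (pd s (mon (sgl i 2 + sgl j 1, {})))) = 0" if "s \<in> Y0" for s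
      using pd_double[OF ij(1-3), of 1 s, where 'b = 'a, unfolded two] top_ge[OF ij(1)] top_ge[OF ij(2)] sq[OF ij(1)] double[OF ij(1,2)] ij(3)
        Lin_DH_0[OF Der_Lin[OF D]] by auto
  qed
  have xexx: "\<phi> (DH (xexx i k l)) = 0" if i: "i \<in> Y0" and kl: "k \<in> Y1" "l \<in> Y1" "k \<noteq> l" for i k l
  proof -
    have H: "(sgl i 1, {a, b}) \<in> H_index" if "a \<in> Y1" "b \<in> Y1" "a \<noteq> b" for a b
    proof (rule H_indexI)
      show "sgl i 1 \<in> A" using xe_Basis[OF i] by (simp add: Basis_iff)
      have "sgl i 1 \<noteq> top_index" using top_ge[OF i] by (auto simp: sgl_def fun_eq_iff)
      then show "sgl i 1 \<noteq> top_index \<or> {a, b} \<noteq> Y1" by blast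
    qed (use that in auto)
    \<comment> \<open>The coordinate is a function of degree d + 2, at most 1. Its part without even
      variables has even parity, so only a constant is left.\<close>
    have const: "pd s (dv \<phi> (xexx i a b) j) = 0"
      if ab: "a \<in> Y1" "b \<in> Y1" "a \<noteq> b" and j: "j \<in> Y0" and s: "s \<in> Y1" for a b j s
    proof
      fix c :: monomial
      obtain \<alpha> v where c: "c = (\<alpha>, v)" by (cases c)
      let ?d = "dv \<phi> (xexx i a b) j"
      have X: "xexx i a b \<in> (Hfun :: 'a sfun set)" using i ab by simp
      have o: "?d \<in> Opar 0" using dv_Opar[OF D X, of j] j by simp
      have "xexx i a b \<in> (homogeneous 3 :: 'a sfun set)"
      proof -
        obtain z where "xexx i a b = scaleO z (mon (sgl i 1, {a, b}) :: 'a sfun)"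
          using xexx_mon[OF i ab, where 'b = 'a] by (metis One_nat_def)
        then show ?thesis using H[OF ab] H_indexD(4) ab i
          by (auto intro!: homogeneous_closed homogeneous_mon simp: deg_def size_index_sgl)
      qed
      from Weven_deg_homogeneous[OF Der_deg_value[OF assms(1) X this], of j]
      have h: "\<phi> (DH (xexx i a b)) j \<in> homogeneous (d + 2)" by (simp add: algebra_simps)
      have "?d (\<alpha>, insert s v) = 0"
      proof (rule ccontr)
        assume nz: "?d (\<alpha>, insert s v) \<noteq> 0"
        then have "\<alpha> = 0" by (rule dv_support)
        have "even (card (insert s v))" using o nz by (auto simp: Opar_def supp_on_def par_def)
        moreover have "insert s v \<subseteq> Y1"
          using Osup_outside[OF Opar_Osup[OF o], of "(\<alpha>, insert s v)"] nz by (auto simp: Basis_iff)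
        then have "card (insert s v) \<noteq> 0" using finite_sub_Y1[of "insert s v"] by simp
        ultimately have "card (insert s v) \<ge> 2" by (auto elim!: evenE)
        then have "deg (\<alpha>, insert s v) \<ge> 2" by (simp add: deg_def)
        moreover have "\<phi> (DH (xexx i a b)) j (\<alpha>, insert s v) \<noteq> 0"
          using nz by (auto simp: dv_def ev_apply split: if_splits)
        then have "deg (\<alpha>, insert s v) = d + 2" using homogeneousD[OF h] by blast
        ultimately show False using assms(2) by simp
      qed
      then show "pd s ?d c = 0 c" using s Opar_Osup[OF o] by (simp add: c pd_odd_apply sf_apply)
    qed
    \<comment> \<open>With a third odd index, x_i x_k x_l is up to sign the rotation of x_i x_a x_l
      in the plane of k and a.\<close>
    obtain a where a: "a \<in> Y1" "a \<noteq> k" "a \<noteq> l"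
    proof -
      have "card (Y1 - {k, l}) = n - 2" using kl by (simp add: card_Diff_subset card_Y1)
      then have "Y1 - {k, l} \<noteq> {}" using n_gt_3 by (intro notI) simp
      then show thesis using that by auto
    qed
    have X: "xexx i k l \<in> (Hfun :: 'a sfun set)" "xexx i a l \<in> (Hfun :: 'a sfun set)" using i kl a by simp_all
    have so: "so k a (xexx i a l) = - (xexx i k l :: 'a sfun)"
    proof -
      have "pd k (xexx i a l) = (0 :: 'a sfun)" "pd a (xexx i a l) = (mult (xe i) (xo l) :: 'a sfun)"
        using i kl a by (auto simp: pd_xexx pd_xx)
      moreover have "mult (xo k) (mult (xe i) (xo l)) = (xexx i k l :: 'a sfun)"
      proof -
        have "mult (xo k) (mult (xe i) (xo l)) = mult (mult (xo k) (xe i)) (xo l :: 'a sfun)"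
          using i kl by (intro mult_assoc[symmetric]) auto
        also have "mult (xo k) (xe i) = (mult (xe i) (xo k) :: 'a sfun)"
          using mult_commute[of "xo k" 1 "xe i :: 'a sfun" 0] i kl by (simp add: par_def)
        also have "mult (mult (xe i) (xo k)) (xo l) = (xexx i k l :: 'a sfun)"
          unfolding xexx_def using i kl by (intro mult_assoc) auto
        finally show ?thesis .
      qed
      ultimately show ?thesis by (simp add: so_def)
    qed
    show ?thesis
    proof (rule Der_zero_of_dv[OF D xe X(1)])
      fix j
      show "dv \<phi> (xexx i k l) j = 0"
      proof (cases "j \<in> Y")
        case False
        then show ?thesis using dv_outside[OF D X(1)] by simp
      next
        case jY: True
        show ?thesis
        proof (cases "j \<in> Y0")
          case True
          have "dv \<phi> (- xexx i k l) j = so k a (dv \<phi> (xexx i a l) j)"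
            using dv_xx[OF D X(2) xx[OF kl(1) a(1)] kl(1) a(1) _ jY] so a True kl by auto
          also have "\<dots> = 0" using const[OF a(1) kl(2) _ True] a kl by (simp add: so_def)
          finally show ?thesis using dv_linear(4)[OF D X(1)] by simp
        next
          case False
          obtain z where z: "z \<noteq> 0" "xexx i k l = scaleO z (mon (sgl i 1, {k, l}) :: 'a sfun)"
            using xexx_mon[OF i kl, where 'b = 'a] by (metis One_nat_def)
          have "j \<noteq> i" "j \<noteq> conj_index i" using i False by auto
          then have "dv \<phi> (mon (sgl i 1, {k, l})) j = 0"
            using weight[OF assms(3) H[OF kl] jY _ i] i False by (auto simp: sgl_apply)
          then show ?thesis unfolding z(2) using dv_linear(2)[OF D] H[OF kl] by simp
        qed
      qed
      fix s assume s: "s \<in> Y0"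
      have "pd s (xx k l) = (0 :: 'a sfun)" using pd_xx[OF kl(1,2) Y0_sub[OF s] kl(3)] s kl by auto
      then show "\<phi> (DH (pd s (xexx i k l))) = 0"
        using pd_xexx[OF i kl Y0_sub[OF s]] xx[OF kl] Lin_DH_0[OF Der_Lin[OF D]] by simp
    qed
  qed
  show ?thesis
    unfolding normalised_def using assms(3) xe sq double xx cube mixed xexx by blast
qed

section \<open>Coefficients of the generating family\<close>

text \<open>A condition covering all elements listed in \<open>normalised\<close>. The members of
  the family other than the inner derivations kill such elements, since p and all entries of the top
  index exceed 3.\<close>

definition cubic :: "'b::field sfun \<Rightarrow> bool" where
  "cubic f \<longleftrightarrow> (\<forall>\<alpha> u. f (\<alpha>, u) \<noteq> 0 \<longrightarrow> size_index \<alpha> \<le> 3)"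

lemma cubic_mon: "size_index \<alpha> \<le> 3 \<Longrightarrow> cubic (mon (\<alpha>, u))"
  by (auto simp: cubic_def mon_apply)

lemma cubic_scale: "cubic f \<Longrightarrow> cubic (scaleO c f)"
  by (simp add: cubic_def sf_apply)

lemma normalisedI:
  assumes "\<phi> \<in> Der" "\<And>f. f \<in> Hfun \<Longrightarrow> cubic f \<Longrightarrow> \<phi> (DH f) = 0"
  shows "normalised \<phi>"
proof -
  have sgl: "\<phi> (DH (mon (sgl i c, {}))) = 0" if "i \<in> Y0" "c \<le> 3" for i c
    using that top_ge[OF that(1)] by (intro assms(2) cubic_mon) (simp_all add: H_index_empty sgl_A size_index_sgl)
  have double: "\<phi> (DH (mon (sgl i c + sgl j 1, {}))) = 0" if "i \<in> Y0" "j \<in> Y0" "i \<noteq> j" "c \<le> 2" for i j c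
    using that torus_H_index[OF that(1-3), of c]
    by (intro assms(2) cubic_mon) (simp_all add: size_index_sgl size_index_add)
  have z: "size_index 0 = 0" by (simp add: size_index_def zero_fun_apply)
  have xx: "\<phi> (DH (xx k l)) = 0" if kl: "k \<in> Y1" "l \<in> Y1" "k \<noteq> l" for k l
  proof (rule assms(2))
    obtain s where "xx k l = scaleO s (mon (0, {k, l}) :: 'a sfun)" using xx_mon[OF kl, where 'b = 'a] by blast
    then show "cubic (xx k l :: 'a sfun)" by (simp add: cubic_scale cubic_mon z)
  qed (use kl in simp)
  have xexx: "\<phi> (DH (xexx i k l)) = 0" if i: "i \<in> Y0" and kl: "k \<in> Y1" "l \<in> Y1" "k \<noteq> l" for i k l
  proof (rule assms(2))
    obtain s where "xexx i k l = scaleO s (mon (sgl i (Suc 0), {k, l}) :: 'a sfun)" using xexx_mon[OF i kl, where 'b = 'a] by blast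
    then show "cubic (xexx i k l :: 'a sfun)" using i by (simp add: cubic_scale cubic_mon size_index_sgl)
  qed (use i kl in simp)
  have ne: "conj_index i \<in> Y0 \<and> i \<noteq> conj_index i" if "i \<in> Y0" for i using that by simp
  show ?thesis
    unfolding normalised_def kills_torus_def
    using assms(1) sgl[of _ "Suc 0"] sgl[of _ 2] sgl[of _ 3] double[of _ _ 1] double[of _ _ 2] xx xexx ne by auto
qed

lemma normalised_subspace: "maps.subspace {\<phi>. normalised \<phi>}"
proof -
  have D: "maps.subspace (Der :: ('a vfield \<Rightarrow> 'a vfield) set)" by (rule Der_subspace)
  show ?thesis
    unfolding maps.subspace_def
  proof (intro conjI ballI allI)
    show "0 \<in> {\<phi>. normalised \<phi>}"
      using D by (auto intro!: normalisedI simp: maps.subspace_def lf_apply)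
    show "\<phi> + \<psi> \<in> {\<phi>. normalised \<phi>}" if "\<phi> \<in> {\<phi>. normalised \<phi>}" "\<psi> \<in> {\<phi>. normalised \<phi>}" for \<phi> \<psi>
      using that D unfolding normalised_def kills_torus_def by (auto simp: maps.subspace_def lf_apply)
    show "scaleL c \<phi> \<in> {\<phi>. normalised \<phi>}" if "\<phi> \<in> {\<phi>. normalised \<phi>}" for c \<phi>
      using that D unfolding normalised_def kills_torus_def by (auto simp: maps.subspace_def lf_apply)
  qed
qed

lemma pd_pow_cubic:
  assumes "r \<in> Y0" "s \<ge> 1" "f \<in> Osup" "cubic f"
  shows "(pd r ^^ (p ^ s)) f = (0 :: 'b::field sfun)"
proof
  fix b :: monomial
  obtain \<alpha> u where b: "b = (\<alpha>, u)" by (cases b)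
  have "p ^ 1 \<le> p ^ s" using assms(2) p_gt_3 by (intro power_increasing) auto
  then have "size_index (\<alpha>(r := \<alpha> r + p ^ s)) > 3"
    using size_index_ge[OF assms(1), of "\<alpha>(r := \<alpha> r + p ^ s)"] p_gt_3 by simp
  then have "f (\<alpha>(r := \<alpha> r + p ^ s), u) = 0" using assms(4) unfolding cubic_def by (metis not_less)
  then show "(pd r ^^ (p ^ s)) f b = 0 b" using pd_pow_apply[OF assms(3,1)] by (simp add: b sf_apply)
qed

lemma cubic_top: "cubic f \<Longrightarrow> f (top_index, u) = 0"
  using size_index_ge[OF Y0_nonempty, of top_index] top_ge[OF Y0_nonempty] unfolding cubic_def by (metis Suc_n_not_le_n eval_nat_numeral(2) le_trans semiring_norm(26,27) numeral_eq_Suc)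

section \<open>Coefficient functionals and the powers of partial derivatives\<close>

definition frobenius_labels :: "(nat \<times> nat) set" where
  "frobenius_labels = (SIGMA r:Y0. {1..t r - 1})"

text \<open>The maps are labelled by pairs (r, s) and the coefficients by multi-indices;
  \<open>frobenius_index_inj\<close> makes the two interchangeable.\<close>

definition frobenius_index :: "nat \<times> nat \<Rightarrow> nat \<Rightarrow> nat" where
  "frobenius_index i = sgl (fst i) (p ^ snd i)"

lemma finite_frobenius_labels [simp]: "finite frobenius_labels"
  by (simp add: frobenius_labels_def)

lemma frobenius_labelsD: "i \<in> frobenius_labels \<Longrightarrow> fst i \<in> Y0" "i \<in> frobenius_labels \<Longrightarrow> 1 \<le> snd i"
  by (auto simp: frobenius_labels_def)

lemma frobenius_indices_frobenius_labels: "frobenius_indices = frobenius_index ` frobenius_labels"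
proof -
  have "s < t r \<longleftrightarrow> s \<le> t r - 1" if "r \<in> Y0" for r s
  proof -
    have "t r \<ge> 1" using t_pos that unfolding Y0_def by blast
    then show ?thesis by linarith
  qed
  then have "frobenius_labels = {(r, s). r \<in> Y0 \<and> 1 \<le> s \<and> s < t r}" by (auto simp: frobenius_labels_def)
  then show ?thesis by (auto simp: frobenius_indices_def frobenius_index_def image_def)
qed

lemma frobenius_index_inj: "i \<in> frobenius_labels \<Longrightarrow> j \<in> frobenius_labels \<Longrightarrow> frobenius_index i = frobenius_index j \<longleftrightarrow> i = j"
proof
  assume ij: "i \<in> frobenius_labels" "j \<in> frobenius_labels" "frobenius_index i = frobenius_index j"
  have "p ^ snd i \<noteq> 0" using p_gt_3 by simp
  moreover have "frobenius_index i (fst i) = frobenius_index j (fst i)" using ij by simp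
  ultimately have "fst i = fst j" "p ^ snd i = p ^ snd j" by (auto simp: frobenius_index_def sgl_apply split: if_splits)
  moreover have "p > 1" using p_gt_3 by simp
  ultimately show "i = j" by (simp add: prod_eq_iff)
qed simp

text \<open>With \<open>coeff_1\<close> below, the linear functionals that make up
  \<open>vanishing\<close>.\<close>

definition coeff_k0 :: "(nat \<Rightarrow> nat) \<Rightarrow> ('a vfield \<Rightarrow> 'a vfield) \<Rightarrow> 'a" where
  "coeff_k0 \<gamma> \<phi> = \<phi> (DH (mon (\<gamma>, {}))) k0 (0, Y1 - {k0})"

definition coeff_1 :: "(nat \<Rightarrow> nat) \<Rightarrow> nat set \<Rightarrow> ('a vfield \<Rightarrow> 'a vfield) \<Rightarrow> 'a" where
  "coeff_1 \<gamma> v \<phi> = \<phi> (DH (mon (\<gamma> + sgl 1 1, {}))) (conj_index 1) (0, v)"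

lemma coefficient_linear:
  "coeff_k0 \<gamma> (\<phi> + \<psi>) = coeff_k0 \<gamma> \<phi> + coeff_k0 \<gamma> \<psi>" "coeff_k0 \<gamma> (\<phi> - \<psi>) = coeff_k0 \<gamma> \<phi> - coeff_k0 \<gamma> \<psi>" "coeff_k0 \<gamma> (scaleL c \<phi>) = c * coeff_k0 \<gamma> \<phi>"
  "coeff_k0 \<gamma> (\<Sum>i\<in>X. F i) = (\<Sum>i\<in>X. coeff_k0 \<gamma> (F i))"
  "coeff_1 \<gamma> v (\<phi> + \<psi>) = coeff_1 \<gamma> v \<phi> + coeff_1 \<gamma> v \<psi>" "coeff_1 \<gamma> v (\<phi> - \<psi>) = coeff_1 \<gamma> v \<phi> - coeff_1 \<gamma> v \<psi>" "coeff_1 \<gamma> v (scaleL c \<phi>) = c * coeff_1 \<gamma> v \<phi>"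
  "coeff_1 \<gamma> v (\<Sum>i\<in>X. F i) = (\<Sum>i\<in>X. coeff_1 \<gamma> v (F i))"
  by (simp_all add: coeff_k0_def coeff_1_def lf_apply vf_apply sf_apply)

lemma vanishing_iff:
  "vanishing \<phi> \<longleftrightarrow> coeff_k0 top_index \<phi> = 0 \<and> (\<forall>i\<in>frobenius_labels. coeff_k0 (frobenius_index i) \<phi> = 0 \<and> coeff_1 (frobenius_index i) {} \<phi> = 0 \<and> coeff_1 (frobenius_index i) Y1 \<phi> = 0)"
  by (auto simp: vanishing_def frobenius_indices_frobenius_labels coeff_k0_def coeff_1_def dv_def ev_apply)

text \<open>The monomials at which coefficients are read are pairwise distinct, which will make the
  matrix of coefficients of the generating maps diagonal.\<close>

lemma frobenius_index_facts:
  assumes "i \<in> frobenius_labels"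
  shows "frobenius_index i \<in> A" "frobenius_index i \<noteq> top_index" "frobenius_index i + sgl 1 1 \<in> A" "frobenius_index i + sgl 1 1 \<noteq> top_index" "frobenius_index i \<noteq> 0"
    "\<And>j. j \<in> frobenius_labels \<Longrightarrow> frobenius_index i + sgl 1 1 \<noteq> frobenius_index j" "\<And>j. j \<in> frobenius_labels \<Longrightarrow> frobenius_index i + sgl 1 1 = frobenius_index j + sgl 1 1 \<longleftrightarrow> i = j"
proof -
  have "frobenius_index i \<in> frobenius_indices" using assms by (simp add: frobenius_indices_frobenius_labels)
  note P = frobenius_indicesD[OF this]
  show "frobenius_index i \<in> A" "frobenius_index i + sgl 1 1 \<in> A" using P(1) P(5)[OF Y0_nonempty] .
  show "frobenius_index i \<noteq> top_index" using P(3)[OF Y0_nonempty] by auto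
  have two: "2 \<in> Y0" using m_gt_1 by (simp add: Y0_def)
  show "frobenius_index i + sgl 1 1 \<noteq> top_index"
  proof
    assume e: "frobenius_index i + sgl 1 1 = top_index"
    have "(frobenius_index i + sgl 1 1) 2 = frobenius_index i 2" by (simp add: plus_fun_apply sgl_apply)
    then show False using P(3)[OF two] unfolding e by simp
  qed
  show "frobenius_index i \<noteq> 0" using p_gt_3 by (simp add: frobenius_index_def)
  show "frobenius_index i + sgl 1 1 \<noteq> frobenius_index j" if "j \<in> frobenius_labels" for j
  proof
    assume e: "frobenius_index i + sgl 1 1 = frobenius_index j"
    have "frobenius_index j \<in> frobenius_indices" using that by (simp add: frobenius_indices_frobenius_labels)
    then have "of_nat (frobenius_index j 1) = (0 :: 'a)" by (rule frobenius_indicesD)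
    then have "of_nat (frobenius_index i 1) + 1 = (0 :: 'a)" unfolding e[symmetric] by (simp add: plus_fun_apply sgl_apply add.commute)
    then show False using P(4)[of 1] by simp
  qed
  show "frobenius_index i + sgl 1 1 = frobenius_index j + sgl 1 1 \<longleftrightarrow> i = j" if "j \<in> frobenius_labels" for j
    using frobenius_index_inj[OF assms that] by simp
qed

definition ad_power :: "nat \<times> nat \<Rightarrow> 'a vfield \<Rightarrow> 'a vfield" where
  "ad_power i = restrict_H (ad (partial (fst i)) ^^ (p ^ snd i))"

lemma ad_power_DH: "i \<in> frobenius_labels \<Longrightarrow> f \<in> Hfun \<Longrightarrow> ad_power i (DH f) = DH ((pd (fst i) ^^ (p ^ snd i)) f)"
  by (simp add: ad_power_def ad_pow_eq_lift frobenius_labelsD lift_DH[OF liftable_pow])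

lemma ad_power_Der: "i \<in> frobenius_labels \<Longrightarrow> ad_power i \<in> Der"
  unfolding ad_power_def using ad_pow_Der_deg frobenius_labelsD Der_deg_Der by blast

lemma pow_cubic: "i \<in> frobenius_labels \<Longrightarrow> f \<in> Hfun \<Longrightarrow> cubic f \<Longrightarrow> (pd (fst i) ^^ (p ^ snd i)) f = (0 :: 'a sfun)"
  using pd_pow_cubic frobenius_labelsD Hfun_Osup by blast

lemma ad_power_normalised: "i \<in> frobenius_labels \<Longrightarrow> normalised (ad_power i)"
  by (rule normalisedI) (simp_all add: ad_power_Der ad_power_DH pow_cubic)

lemma pd_pow_frobenius_index:
  assumes "i \<in> frobenius_labels" "f \<in> Osup"
  shows "(pd (fst i) ^^ (p ^ snd i)) f (\<alpha>, u) = f (\<alpha> + frobenius_index i, u)"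
proof -
  have "\<alpha>(fst i := \<alpha> (fst i) + p ^ snd i) = \<alpha> + frobenius_index i"
    by (auto simp: fun_eq_iff plus_fun_apply frobenius_index_def sgl_apply)
  then show ?thesis using pd_pow_apply[OF assms(2) frobenius_labelsD(1)[OF assms(1)]] by simp
qed

lemma mon_empty_apply: "mon (\<alpha>, {}) (\<beta>, u) = (if \<beta> = \<alpha> \<and> u = {} then 1 else (0 :: 'b::field))"
  by (auto simp: mon_apply)

lemma DH_k0:
  assumes "f \<in> Opar 0"
  shows "DH f k0 = pd k0 (f :: 'b::field sfun)"
  using DH_apply[OF assms, of k0] by simp

lemma DH_c1:
  assumes "f \<in> Opar 0"
  shows "DH f (conj_index 1) = pd 1 (f :: 'b::field sfun)"
proof -
  have "\<tau> 1 = (1 :: 'b)" using m_gt_1 by (simp add: \<tau>_def)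
  then show ?thesis using DH_apply[OF assms, of "conj_index 1"] Y0_nonempty by simp
qed

lemma pd_1_const:
  assumes "f \<in> Osup"
  shows "pd 1 f (0, v) = f (sgl 1 1, v)"
proof -
  have "(0 :: nat \<Rightarrow> nat)(1 := Suc (0 1)) = sgl 1 1" by (auto simp: fun_eq_iff sgl_apply zero_fun_apply)
  then show ?thesis unfolding pd_even_apply[OF assms Y0_nonempty] by (rule arg_cong)
qed

lemma pow_Opar: "i \<in> frobenius_labels \<Longrightarrow> f \<in> Hfun \<Longrightarrow> (pd (fst i) ^^ (p ^ snd i)) f \<in> Opar 0"
  by (simp add: pd_pow_Opar frobenius_labelsD)

lemma ad_power_coeff_k0:
  assumes "i \<in> frobenius_labels" "\<gamma> \<in> A"
  shows "coeff_k0 \<gamma> (ad_power i) = 0"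
proof -
  have H: "mon (\<gamma>, {}) \<in> (Hfun :: 'a sfun set)" using assms by (simp add: H_index_empty)
  then show ?thesis using assms pow_Opar[OF assms(1) H]
    by (simp add: coeff_k0_def ad_power_DH DH_k0 pd_odd_apply Opar_Osup pd_pow_frobenius_index[OF assms(1) Hfun_Osup[OF H]] mon_empty_apply)
qed

lemma ad_power_coeff_1:
  assumes "i \<in> frobenius_labels" "j \<in> frobenius_labels"
  shows "coeff_1 (frobenius_index j) v (ad_power i) = (if i = j \<and> v = {} then 1 else 0)"
proof -
  have H: "mon (frobenius_index j + sgl 1 1, {}) \<in> (Hfun :: 'a sfun set)" using frobenius_index_facts(3)[OF assms(2)] by (simp add: H_index_empty)
  have "coeff_1 (frobenius_index j) v (ad_power i) = mon (frobenius_index j + sgl 1 1, {}) (sgl 1 1 + frobenius_index i, v)"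
    unfolding coeff_1_def ad_power_DH[OF assms(1) H] DH_c1[OF pow_Opar[OF assms(1) H]]
      pd_1_const[OF Opar_Osup[OF pow_Opar[OF assms(1) H]]] pd_pow_frobenius_index[OF assms(1) Hfun_Osup[OF H]] ..
  also have "\<dots> = (if i = j \<and> v = {} then 1 else 0)"
    using frobenius_index_facts(7)[OF assms] by (simp only: mon_empty_apply add.commute[of "sgl 1 1"])
  finally show ?thesis .
qed

text \<open>For odd n the monomials in question have the wrong parity for a coordinate of an even
  field.\<close>

lemma odd_coefficients:
  assumes "\<phi> \<in> Der" "\<gamma> \<in> A" "odd n"
  shows "coeff_k0 \<gamma> \<phi> = 0" "\<gamma> + sgl 1 1 \<in> A \<Longrightarrow> coeff_1 \<gamma> Y1 \<phi> = 0"
proof -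
  have "\<phi> (DH (mon (\<gamma>, {}))) k0 \<in> Opar 1"
    using Weven_Opar[OF Der_Weven[OF assms(1)], of "mon (\<gamma>, {})" k0] H_index_empty[OF assms(2)] by simp
  moreover have "even (card (Y1 - {k0}))" using assms(3) by (simp add: card_Y1)
  ultimately show "coeff_k0 \<gamma> \<phi> = 0" by (auto simp: coeff_k0_def Opar_def supp_on_def par_def)
  assume "\<gamma> + sgl 1 1 \<in> A"
  then have "\<phi> (DH (mon (\<gamma> + sgl 1 1, {}))) (conj_index 1) \<in> Opar 0"
    using Weven_Opar[OF Der_Weven[OF assms(1)], of "mon (\<gamma> + sgl 1 1, {})" "conj_index 1"] H_index_empty Y0_nonempty by simp
  then show "coeff_1 \<gamma> Y1 \<phi> = 0" using assms(3) by (auto simp: coeff_1_def Opar_def supp_on_def par_def card_Y1)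
qed

definition ad_power_part :: "('a vfield \<Rightarrow> 'a vfield) \<Rightarrow> 'a vfield \<Rightarrow> 'a vfield" where
  "ad_power_part \<phi> = (\<Sum>i\<in>frobenius_labels. scaleL (coeff_1 (frobenius_index i) {} \<phi>) (ad_power i))"

lemma normalised_sum: "(\<And>i. i \<in> X \<Longrightarrow> normalised (F i)) \<Longrightarrow> normalised (\<Sum>i\<in>X. scaleL (c i) (F i))"
  using maps.subspace_sum[OF normalised_subspace, of X "\<lambda>i. scaleL (c i) (F i)"] maps.subspace_scale[OF normalised_subspace] by simp

lemma ad_power_part_normalised: "normalised (ad_power_part \<phi>)"
  unfolding ad_power_part_def by (rule normalised_sum) (rule ad_power_normalised)

lemma ad_power_part_coefficients:
  "\<gamma> \<in> A \<Longrightarrow> coeff_k0 \<gamma> (ad_power_part \<phi>) = 0" "i \<in> frobenius_labels \<Longrightarrow> coeff_1 (frobenius_index i) v (ad_power_part \<phi>) = (if v = {} then coeff_1 (frobenius_index i) {} \<phi> else 0)"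
proof -
  show "\<gamma> \<in> A \<Longrightarrow> coeff_k0 \<gamma> (ad_power_part \<phi>) = 0" by (simp add: ad_power_part_def coefficient_linear ad_power_coeff_k0)
  assume i: "i \<in> frobenius_labels"
  have "coeff_1 (frobenius_index i) v (ad_power_part \<phi>) = (\<Sum>j\<in>frobenius_labels. if j = i then (if v = {} then coeff_1 (frobenius_index i) {} \<phi> else 0) else 0)"
    unfolding ad_power_part_def coefficient_linear by (intro sum.cong refl) (simp add: ad_power_coeff_1 i)
  then show "coeff_1 (frobenius_index i) v (ad_power_part \<phi>) = (if v = {} then coeff_1 (frobenius_index i) {} \<phi> else 0)" using i by simp
qed

lemma normalised_diff: "normalised \<phi> \<Longrightarrow> normalised \<psi> \<Longrightarrow> normalised (\<phi> - \<psi>)"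
  using maps.subspace_diff[OF normalised_subspace, of \<phi> \<psi>] by simp

text \<open>Subtracting \<open>ad_power_part\<close> clears the coefficients at the empty set,
  parity clears the others, and the difference is zero by
  \<open>normalised_vanishing_zero\<close>.\<close>

lemma odd_decomposition:
  assumes "odd n" "normalised \<phi>"
  shows "\<phi> = ad_power_part \<phi>"
proof -
  have k: "normalised (\<phi> - ad_power_part \<phi>)" using assms(2) ad_power_part_normalised by (rule normalised_diff)
  then have D: "\<phi> - ad_power_part \<phi> \<in> Der" by (rule normalisedD)
  have "vanishing (\<phi> - ad_power_part \<phi>)"
    unfolding vanishing_iff
    using odd_coefficients[OF D _ assms(1)] frobenius_index_facts(1,3)
    by (simp add: coefficient_linear ad_power_part_coefficients) 
  with k have "\<phi> - ad_power_part \<phi> = 0" by (rule normalised_vanishing_zero)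
  then show ?thesis by simp
qed

section \<open>Coefficients of the additional maps for even n\<close>

lemma ev_smul_omega:
  assumes "h \<in> Osup"
  shows "mult x_omega h (0, v) = (if v = Y1 then h (0, {}) else (0 :: 'b::field))"
  using assms
proof (induction rule: Osup_induct)
  case (mon b)
  obtain \<beta> w where b: "b = (\<beta>, w)" by (cases b)
  have B: "\<beta> \<in> A" "w \<subseteq> Y1" using mon by (auto simp: b Basis_iff)
  have z: "(0 :: nat \<Rightarrow> nat) + \<beta> = \<beta>" by simp
  have i: "Y1 \<inter> w = w" using B by auto
  have M: "mult x_omega (mon b) = (if w = {} then mon (\<beta>, Y1) else (0 :: 'b sfun))"
    using B z i unfolding x_omega_def b by (simp add: mult_mon_mon')
  show ?case unfolding M by (auto simp: b mon_apply sf_apply(4))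
next
  case zero
  show ?case by (subst mult_zero(2)) (simp add: sf_apply(4))
next
  case (add f g)
  show ?case by (subst mult_add_right) (simp add: sf_apply(1) add)
next
  case (scale c f)
  show ?case by (subst mult_scale_right) (simp add: sf_apply(5) scale)
qed

lemma mult_const_part:
  assumes "f \<in> Osup" "h \<in> Osup" "\<And>u. f (0, u) = (if u = {} then c else 0)"
  shows "mult f h (0, v) = c * (h (0, v) :: 'b::field)"
proof -
  have "ev f = scaleO c (mon (0, {}))"
  proof
    fix b :: monomial
    obtain \<alpha> u where "b = (\<alpha>, u)" by (cases b)
    then show "ev f b = scaleO c (mon (0, {})) b"
      using assms(3)[of u] by (simp add: ev_apply sf_apply(5) mon_apply)
  qed
  then have "ev (mult f h) = scaleO c (ev h)"
    using assms by (simp add: ev_mult mult_linear mult_one)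
  then have "ev (mult f h) (0, v) = c * ev h (0, v)" by (simp add: sf_apply(5))
  then show ?thesis by (simp add: ev_apply)
qed

text \<open>The coefficient of x^omega without \<open>k0\<close> in the coordinate \<open>k0\<close>
  of the field of x^omega. It is its own inverse, so it also serves to divide by itself.\<close>

definition k0_sign :: 'a where "k0_sign = pass_sign k0 Y1"

lemma k0_sign_sq [simp]: "k0_sign * k0_sign = 1" and k0_sign_nonzero [simp]: "k0_sign \<noteq> 0"
  by (simp_all add: k0_sign_def)

lemma k0_sign_mult [simp]: "x * k0_sign * k0_sign = x"
  by (simp add: mult.assoc)

context
  assumes even_n: "even n"
begin

lemma DH_omega_k0: "DH x_omega k0 (0, Y1 - {k0}) = k0_sign"
  using x_omega_Opar[OF even_n, where 'b = 'a]
  by (simp add: DH_k0 pd_x_omega_Y1 sf_apply(5) mon_apply k0_sign_def)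

lemma DH_omega_Y0: "j \<in> Y0 \<Longrightarrow> DH x_omega j = (0 :: 'a sfun)"
  using x_omega_Opar[OF even_n, where 'b = 'a] by (simp add: DH_apply pd_x_omega_Y0)

lemma gamma_DH: "f \<in> Hfun \<Longrightarrow> \<Gamma>1 (DH f) = scaleW (f (top_index, {})) (DH x_omega :: 'a vfield)"
  unfolding gamma_eq_lift[OF even_n] by (rule lift_DH[OF liftable_gamma[OF even_n]])

lemma phi_DH: "i \<in> frobenius_labels \<Longrightarrow> f \<in> Hfun \<Longrightarrow> \<Phi> (fst i) (snd i) (DH f) = smul ((pd (fst i) ^^ (p ^ snd i)) f) (DH x_omega :: 'a vfield)"
  unfolding Phi_eq_lift[OF even_n frobenius_labelsD(1)] by (rule lift_DH[OF liftable_Phi[OF even_n frobenius_labelsD(1)]])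

lemma theta_DH: "i \<in> frobenius_labels \<Longrightarrow> f \<in> Hfun \<Longrightarrow> \<Theta> (fst i) (snd i) (DH f) = smul x_omega (DH ((pd (fst i) ^^ (p ^ snd i)) f) :: 'a vfield)"
  unfolding Theta_eq_lift[OF even_n frobenius_labelsD(1)] by (rule lift_DH[OF liftable_Theta[OF even_n frobenius_labelsD(1)]])

lemma gamma_normalised: "normalised \<Gamma>1"
  by (rule normalisedI) (simp_all add: Der_deg_Der[OF gamma_Der_deg[OF even_n]] gamma_DH cubic_top)

lemma phi_normalised: "i \<in> frobenius_labels \<Longrightarrow> normalised (\<Phi> (fst i) (snd i))"
  by (rule normalisedI) (simp_all add: Der_deg_Der[OF Phi_Der_deg[OF even_n]] phi_DH pow_cubic frobenius_labelsD)

lemma theta_normalised: "i \<in> frobenius_labels \<Longrightarrow> normalised (\<Theta> (fst i) (snd i))"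
  by (rule normalisedI) (simp_all add: Der_deg_Der[OF Theta_Der_deg[OF even_n]] theta_DH pow_cubic frobenius_labelsD)

lemma gamma_coeff_k0: "\<gamma> \<in> A \<Longrightarrow> coeff_k0 \<gamma> \<Gamma>1 = (if \<gamma> = top_index then k0_sign else 0)"
proof -
  assume g: "\<gamma> \<in> A"
  then have H: "mon (\<gamma>, {}) \<in> (Hfun :: 'a sfun set)" by (simp add: H_index_empty)
  show ?thesis unfolding coeff_k0_def gamma_DH[OF H] vf_apply sf_apply DH_omega_k0 mon_empty_apply by auto
qed

lemma gamma_coeff_1: "i \<in> frobenius_labels \<Longrightarrow> coeff_1 (frobenius_index i) v \<Gamma>1 = 0"
proof -
  assume i: "i \<in> frobenius_labels"
  then have H: "mon (frobenius_index i + sgl 1 1, {}) \<in> (Hfun :: 'a sfun set)" using frobenius_index_facts(3) by (simp add: H_index_empty)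
  have c: "conj_index 1 \<in> Y0" using Y0_nonempty by simp
  show ?thesis unfolding coeff_1_def gamma_DH[OF H] vf_apply sf_apply DH_omega_Y0[OF c] by simp
qed

lemma pow_const:
  assumes "i \<in> frobenius_labels" "\<alpha> \<in> A"
  shows "(pd (fst i) ^^ (p ^ snd i)) (mon (\<alpha>, {})) (0, u) = (if u = {} then (if \<alpha> = frobenius_index i then 1 else 0) else (0 :: 'a))"
proof -
  have "mon (\<alpha>, {}) \<in> (Hfun :: 'a sfun set)" using assms by (simp add: H_index_empty)
  from pd_pow_frobenius_index[OF assms(1) Hfun_Osup[OF this], of 0 u] show ?thesis unfolding mon_empty_apply by auto
qed

lemma phi_coeff_k0:
  assumes "i \<in> frobenius_labels" "\<gamma> \<in> A"
  shows "coeff_k0 \<gamma> (\<Phi> (fst i) (snd i)) = (if \<gamma> = frobenius_index i then k0_sign else 0)"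
proof -
  have H: "mon (\<gamma>, {}) \<in> (Hfun :: 'a sfun set)" using assms by (simp add: H_index_empty)
  have "coeff_k0 \<gamma> (\<Phi> (fst i) (snd i)) = (if \<gamma> = frobenius_index i then 1 else 0) * DH x_omega k0 (0, Y1 - {k0})"
    unfolding coeff_k0_def phi_DH[OF assms(1) H] smul_def
    by (rule mult_const_part[OF Opar_Osup[OF pow_Opar[OF assms(1) H]] _ pow_const[OF assms]])
      (simp add: DH_omega_Weven[OF even_n])
  then show ?thesis by (simp add: DH_omega_k0)
qed

lemma phi_coeff_1:
  assumes "i \<in> frobenius_labels" "j \<in> frobenius_labels"
  shows "coeff_1 (frobenius_index j) v (\<Phi> (fst i) (snd i)) = 0"
proof -
  have H: "mon (frobenius_index j + sgl 1 1, {}) \<in> (Hfun :: 'a sfun set)" using frobenius_index_facts(3)[OF assms(2)] by (simp add: H_index_empty)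
  have c: "conj_index 1 \<in> Y0" using Y0_nonempty by simp
  show ?thesis unfolding coeff_1_def phi_DH[OF assms(1) H] smul_def DH_omega_Y0[OF c] by (simp add: sf_apply(4))
qed

lemma theta_coeff_k0:
  assumes "i \<in> frobenius_labels" "\<gamma> \<in> A"
  shows "coeff_k0 \<gamma> (\<Theta> (fst i) (snd i)) = 0"
proof -
  have H: "mon (\<gamma>, {}) \<in> (Hfun :: 'a sfun set)" using assms by (simp add: H_index_empty)
  have "Y1 - {k0} \<noteq> Y1" using k0_Y1 by blast
  then show ?thesis unfolding coeff_k0_def theta_DH[OF assms(1) H] smul_def
    by (subst ev_smul_omega) (simp_all add: DH_Weven[OF pow_Opar[OF assms(1) H]])
qed

lemma theta_coeff_1:
  assumes "i \<in> frobenius_labels" "j \<in> frobenius_labels"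
  shows "coeff_1 (frobenius_index j) v (\<Theta> (fst i) (snd i)) = (if i = j \<and> v = Y1 then 1 else 0)"
proof -
  have H: "mon (frobenius_index j + sgl 1 1, {}) \<in> (Hfun :: 'a sfun set)" using frobenius_index_facts(3)[OF assms(2)] by (simp add: H_index_empty)
  have "coeff_1 (frobenius_index j) v (\<Theta> (fst i) (snd i)) = (if v = Y1 then coeff_1 (frobenius_index j) {} (ad_power i) else 0)"
    unfolding coeff_1_def theta_DH[OF assms(1) H] smul_def ad_power_DH[OF assms(1) H]
    unfolding DH_c1[OF pow_Opar[OF assms(1) H]]
    by (rule ev_smul_omega) (simp add: Opar_Osup[OF pow_Opar[OF assms(1) H]])
  then show ?thesis by (simp add: ad_power_coeff_1 assms)
qed

text \<open>\<open>coeff_k0\<close> detects \<open>\<Gamma>1\<close> at the top index and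
  \<open>\<Phi>\<close> at the Frobenius indices, with value \<open>k0_sign\<close>, whence this
  factor. \<open>coeff_1\<close> detects the powers of \<open>ad (partial r)\<close> at the empty
  set and \<open>\<Theta>\<close> at \<open>Y1\<close>, with value 1.\<close>

lemma even_decomposition:
  assumes "normalised \<phi>"
  shows "\<phi> = ad_power_part \<phi> + scaleL (coeff_k0 top_index \<phi> * k0_sign) \<Gamma>1 + (\<Sum>i\<in>frobenius_labels. scaleL (coeff_k0 (frobenius_index i) \<phi> * k0_sign) (\<Phi> (fst i) (snd i)))
    + (\<Sum>i\<in>frobenius_labels. scaleL (coeff_1 (frobenius_index i) Y1 \<phi>) (\<Theta> (fst i) (snd i)))" (is "_ = ?\<psi>")
proof -
  have "normalised (scaleL (coeff_k0 top_index \<phi> * k0_sign) \<Gamma>1)"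
    using maps.subspace_scale[OF normalised_subspace] gamma_normalised by simp
  then have "?\<psi> \<in> {\<phi>. normalised \<phi>}"
    by (intro maps.subspace_add[OF normalised_subspace])
      (auto intro!: normalised_sum ad_power_part_normalised phi_normalised theta_normalised)
  then have k: "normalised (\<phi> - ?\<psi>)" using assms by (intro normalised_diff) auto
  have Lphi: "coeff_k0 \<gamma> (\<Sum>i\<in>frobenius_labels. scaleL (coeff_k0 (frobenius_index i) \<phi> * k0_sign) (\<Phi> (fst i) (snd i))) = (\<Sum>i\<in>frobenius_labels. if \<gamma> = frobenius_index i then coeff_k0 (frobenius_index i) \<phi> else 0)"
    if "\<gamma> \<in> A" for \<gamma>
    unfolding coefficient_linear by (intro sum.cong refl) (simp add: phi_coeff_k0 that)
  have Ltheta: "coeff_k0 \<gamma> (\<Sum>i\<in>frobenius_labels. scaleL (coeff_1 (frobenius_index i) Y1 \<phi>) (\<Theta> (fst i) (snd i))) = 0" if "\<gamma> \<in> A" for \<gamma>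
    unfolding coefficient_linear by (intro sum.neutral ballI) (simp add: theta_coeff_k0 that)
  have Mphi: "coeff_1 (frobenius_index j) v (\<Sum>i\<in>frobenius_labels. scaleL (coeff_k0 (frobenius_index i) \<phi> * k0_sign) (\<Phi> (fst i) (snd i))) = 0" if "j \<in> frobenius_labels" for j v
    unfolding coefficient_linear by (intro sum.neutral ballI) (simp add: phi_coeff_1 that)
  have Mtheta: "coeff_1 (frobenius_index j) v (\<Sum>i\<in>frobenius_labels. scaleL (coeff_1 (frobenius_index i) Y1 \<phi>) (\<Theta> (fst i) (snd i))) = (if v = Y1 then coeff_1 (frobenius_index j) Y1 \<phi> else 0)"
    if j: "j \<in> frobenius_labels" for j v
  proof -
    have "coeff_1 (frobenius_index j) v (\<Sum>i\<in>frobenius_labels. scaleL (coeff_1 (frobenius_index i) Y1 \<phi>) (\<Theta> (fst i) (snd i))) =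
        (\<Sum>i\<in>frobenius_labels. if i = j then (if v = Y1 then coeff_1 (frobenius_index j) Y1 \<phi> else 0) else 0)"
      unfolding coefficient_linear by (intro sum.cong refl) (simp add: theta_coeff_1 j)
    then show ?thesis using j by simp
  qed
  have "(\<Sum>i\<in>frobenius_labels. if top_index = frobenius_index i then coeff_k0 (frobenius_index i) \<phi> else 0) = 0"
    using frobenius_index_facts(2)[symmetric] by (intro sum.neutral) auto
  moreover have "(\<Sum>i\<in>frobenius_labels. if frobenius_index j = frobenius_index i then coeff_k0 (frobenius_index i) \<phi> else 0) = coeff_k0 (frobenius_index j) \<phi>" if "j \<in> frobenius_labels" for j
  proof -
    have "(\<Sum>i\<in>frobenius_labels. if frobenius_index j = frobenius_index i then coeff_k0 (frobenius_index i) \<phi> else 0) = (\<Sum>i\<in>frobenius_labels. if j = i then coeff_k0 (frobenius_index i) \<phi> else 0)"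
      by (intro sum.cong refl) (simp add: frobenius_index_inj[OF that])
    then show ?thesis using that by simp
  qed
  ultimately have "vanishing (\<phi> - ?\<psi>)"
    unfolding vanishing_iff coefficient_linear(1-3,5-7)
    using Y1_nonempty frobenius_index_facts(1,2)
    by (simp add: Lphi Ltheta Mphi Mtheta ad_power_part_coefficients gamma_coeff_k0 gamma_coeff_1)
  with k have "\<phi> - ?\<psi> = 0" by (rule normalised_vanishing_zero)
  then show ?thesis by simp
qed

end

text \<open>A nonzero coefficient reveals the degree of the derivation, so in negative degree only
  those members of the family occur that have negative degree themselves.\<close>

lemma coefficient_degree:
  assumes "\<phi> \<in> Der_deg k" "\<gamma> \<in> A"
  shows "coeff_k0 \<gamma> \<phi> \<noteq> 0 \<Longrightarrow> int n - int (size_index \<gamma>) = k"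
    "\<gamma> + sgl 1 1 \<in> A \<Longrightarrow> coeff_1 \<gamma> Y1 \<phi> \<noteq> 0 \<Longrightarrow> int n - int (size_index \<gamma>) = k"
proof -
  have h: "mon (\<alpha>, {}) \<in> (homogeneous (int (size_index \<alpha>)) :: 'a sfun set)" if "\<alpha> \<in> A" for \<alpha>
    using that by (intro homogeneous_mon) (simp_all add: Basis_iff deg_def)
  have H: "mon (\<alpha>, {}) \<in> (Hfun :: 'a sfun set)" if "\<alpha> \<in> A" for \<alpha>
    using that by (simp add: H_index_empty)
  note v = Weven_deg_homogeneous[OF Der_deg_value[OF assms(1) H h]]
  show "int n - int (size_index \<gamma>) = k" if "coeff_k0 \<gamma> \<phi> \<noteq> 0"
  proof -
    have "deg (0, Y1 - {k0}) = int n - 1"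
      using n_gt_3 k0_Y1 by (simp add: deg_def size_index_def zero_fun_apply card_Y1 of_nat_diff)
    then show ?thesis using homogeneousD[OF v[OF assms(2) assms(2)] that[unfolded coeff_k0_def]] by simp
  qed
  show "int n - int (size_index \<gamma>) = k" if g: "\<gamma> + sgl 1 1 \<in> A" and nz: "coeff_1 \<gamma> Y1 \<phi> \<noteq> 0"
  proof -
    have "deg (0, Y1) = int n" by (simp add: deg_def size_index_def zero_fun_apply card_Y1)
    moreover have "size_index (\<gamma> + sgl 1 1) = size_index \<gamma> + 1"
      unfolding size_index_add size_index_sgl[OF Y0_nonempty] ..
    ultimately show ?thesis using homogeneousD[OF v[OF g g] nz[unfolded coeff_1_def]] by simp
  qed
qed

lemma Der_deg_diff:
  assumes "\<phi> \<in> Der_deg k" "\<psi> \<in> (Der_deg k :: ('a vfield \<Rightarrow> 'a vfield) set)"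
  shows "\<phi> - \<psi> \<in> Der_deg k"
proof -
  have "\<phi> - \<psi> \<in> Der" using assms by (intro maps.subspace_diff[OF Der_subspace] Der_deg_Der)
  moreover have "(\<phi> - \<psi>) x \<in> Weven_deg (i + k)" if "x \<in> H_deg i" for i x
  proof -
    have "\<phi> x \<in> Weven_deg (i + k)" "\<psi> x \<in> Weven_deg (i + k)" using assms that unfolding Der_deg_def mem_Collect_eq image_subset_iff by blast+
    then show ?thesis by (simp add: lf_apply)
  qed
  ultimately show ?thesis unfolding Der_deg_def by blast
qed

lemma normalised_of_Der_deg:
  assumes "\<phi> \<in> Der_deg k" "k < 0"
  obtains w where "w \<in> Weven_deg (-1)" "\<phi> - restrict_H (ad w) \<in> Der_deg k" "normalised (\<phi> - restrict_H (ad w))"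
proof -
  obtain w where w: "w \<in> Weven_deg (-1)" "w \<in> Weven_deg k" "kills_torus (\<phi> - restrict_H (ad w))"
    using torus_of_Der_deg[OF assms] .
  have d: "\<phi> - restrict_H (ad w) \<in> Der_deg k" using assms(1) ad_Der_deg[OF w(2)] by (rule Der_deg_diff)
  show thesis using that[OF w(1) d normalised_of_torus[OF d assms(2) w(3)]] .
qed

text \<open>The common frame of both parities: by \<open>normalised_of_Der_deg\<close> a homogeneous
  derivation of negative degree is normalised after an inner derivation from degree -1 is
  subtracted.\<close>

lemma Der_neg_eq_span:
  assumes gen: "\<And>g. g \<in> S \<Longrightarrow> g \<in> Der_neg" and inner: "\<And>w. w \<in> Weven_deg (-1) \<Longrightarrow> restrict_H (ad w) \<in> S"
    and span: "\<And>k \<psi>. k < 0 \<Longrightarrow> \<psi> \<in> Der_deg k \<Longrightarrow> normalised \<psi> \<Longrightarrow> \<psi> \<in> maps.span S"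
  shows "(Der_neg :: ('a vfield \<Rightarrow> 'a vfield) set) = maps.span S"
proof
  have "\<phi> \<in> maps.span S" if neg: "\<phi> \<in> Der_deg k" "k < 0" for \<phi> k
  proof -
    obtain w where "w \<in> Weven_deg (-1)" "\<phi> - restrict_H (ad w) \<in> Der_deg k" "normalised (\<phi> - restrict_H (ad w))"
      using normalised_of_Der_deg[OF neg] .
    then have "(\<phi> - restrict_H (ad w)) + restrict_H (ad w) \<in> maps.span S"
      using span[OF neg(2)] inner by (intro maps.span_add) (auto intro: maps.span_base)
    then show ?thesis by simp
  qed
  then show "Der_neg \<subseteq> maps.span S"
    unfolding Der_neg_def by (intro maps.span_minimal maps.subspace_span) force
  show "maps.span S \<subseteq> Der_neg"
    using gen unfolding Der_neg_def by (intro maps.span_minimal maps.subspace_span) blast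
qed

lemma Der_deg_neg: "\<phi> \<in> Der_deg k \<Longrightarrow> k < 0 \<Longrightarrow> \<phi> \<in> Der_neg"
  unfolding Der_neg_def by (rule maps.span_base) force

lemma inner_neg: "w \<in> Weven_deg (-1) \<Longrightarrow> restrict_H (ad w) \<in> (Der_neg :: ('a vfield \<Rightarrow> 'a vfield) set)"
  using Der_deg_neg[OF ad_Der_deg] by simp

lemma ad_pow_neg: "r \<in> Y0 \<Longrightarrow> restrict_H (ad (partial r) ^^ (p ^ s)) \<in> (Der_neg :: ('a vfield \<Rightarrow> 'a vfield) set)"
  using Der_deg_neg[OF ad_pow_Der_deg] p_gt_3 by simp

lemma span_scale_if:
  assumes "c \<noteq> 0 \<Longrightarrow> g \<in> maps.span S"
  shows "scaleL c g \<in> maps.span S"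
  using assms by (cases "c = 0") (auto simp: maps.span_scale maps.span_zero)

lemma ad_power_part_span:
  assumes "\<And>i. i \<in> frobenius_labels \<Longrightarrow> ad_power i \<in> S"
  shows "ad_power_part \<phi> \<in> maps.span S"
  unfolding ad_power_part_def using assms by (intro maps.span_sum maps.span_scale maps.span_base)

lemma Der_neg_odd:
  assumes "odd n"
  shows "(Der_neg :: ('a vfield \<Rightarrow> 'a vfield) set) =
    maps.span ({restrict_H (ad w) |w. w \<in> Weven_deg (-1)}
      \<union> (\<Union>r\<in>Y0. \<Union>s\<in>{1..t r - 1}. {restrict_H (ad (partial r) ^^ (p ^ s))}))"
proof (rule Der_neg_eq_span)
  let ?S = "{restrict_H (ad w) |w. w \<in> Weven_deg (-1)}
    \<union> (\<Union>r\<in>Y0. \<Union>s\<in>{1..t r - 1}. {restrict_H (ad (partial r) ^^ (p ^ s))}) :: ('a vfield \<Rightarrow> 'a vfield) set"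
  show "g \<in> Der_neg" if "g \<in> ?S" for g using that inner_neg ad_pow_neg by blast
  show "restrict_H (ad w) \<in> ?S" if "w \<in> Weven_deg (-1)" for w using that by blast
  fix k \<psi> assume "normalised \<psi>"
  then have "\<psi> = ad_power_part \<psi>" using odd_decomposition[OF assms] by blast
  moreover have "ad_power i \<in> ?S" if "i \<in> frobenius_labels" for i 
    using that unfolding ad_power_def by (intro UnI2 UN_I[of "fst i"] UN_I[of "snd i"]) (auto simp: frobenius_labels_def)
  then have "ad_power_part \<psi> \<in> maps.span ?S" by (rule ad_power_part_span)
  ultimately show "\<psi> \<in> maps.span ?S" by simp
qed

lemma Der_neg_even:
  assumes "even n"
  shows "(Der_neg :: ('a vfield \<Rightarrow> 'a vfield) set) =
    maps.span ({restrict_H (ad w) |w. w \<in> Weven_deg (-1)}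
      \<union> {scaleL (if size_index top_index > n then 1 else 0) \<Gamma>1}
      \<union> (\<Union>r\<in>Y0. \<Union>s\<in>{s \<in> {1..t r - 1}. int n - int (p ^ s) < 0}. {\<Phi> r s, \<Theta> r s})
      \<union> (\<Union>r\<in>Y0. \<Union>s\<in>{1..t r - 1}. {restrict_H (ad (partial r) ^^ (p ^ s))}))"
    (is "_ = maps.span (?AD \<union> {?G} \<union> ?PT \<union> ?P)")
proof (rule Der_neg_eq_span)
  let ?S = "?AD \<union> {?G} \<union> ?PT \<union> ?P"
  have "?G \<in> Der_neg"
  proof (cases "size_index top_index > n")
    case True
    then show ?thesis using Der_deg_neg[OF gamma_Der_deg[OF assms]] by simp
  next
    case False
    then show ?thesis unfolding Der_neg_def by (simp add: maps.span_zero)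
  qed
  moreover have "g \<in> Der_neg" if g: "g \<in> ?PT" for g
  proof -
    obtain r s where "r \<in> Y0" "int n - int (p ^ s) < 0" "g = \<Phi> r s \<or> g = \<Theta> r s" using g by blast
    then show ?thesis using Der_deg_neg[OF Phi_Der_deg[OF assms]] Der_deg_neg[OF Theta_Der_deg[OF assms]] by blast
  qed
  ultimately show "g \<in> Der_neg" if "g \<in> ?S" for g using that inner_neg ad_pow_neg by blast
  show "restrict_H (ad w) \<in> ?S" if "w \<in> Weven_deg (-1)" for w using that by blast
  fix k \<psi> assume k: "k < 0" and d: "\<psi> \<in> Der_deg k" and "normalised \<psi>"
  have ad_power_part: "ad_power_part \<psi> \<in> maps.span ?S"
  proof (rule ad_power_part_span)
    show "ad_power i \<in> ?S" if "i \<in> frobenius_labels" for i 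
    using that unfolding ad_power_def by (intro UnI2 UN_I[of "fst i"] UN_I[of "snd i"]) (auto simp: frobenius_labels_def)
  qed
  have top: "top_index \<in> A" by (simp add: A_def top_index_def)
  have G: "scaleL (coeff_k0 top_index \<psi> * k0_sign) \<Gamma>1 \<in> maps.span ?S"
  proof (rule span_scale_if)
    assume "coeff_k0 top_index \<psi> * k0_sign \<noteq> 0"
    \<comment> \<open>The degree k is n - |pi|; being negative, it gives |pi| > n, so the factor of
      \<open>\<Gamma>1\<close> in the family is 1.\<close>
    then have "size_index top_index > n" using coefficient_degree(1)[OF d top] k by simp
    then have g: "?G = \<Gamma>1" by simp
    have "?G \<in> ?S" by (intro UnI1[of _ _ ?P] UnI1[of _ _ ?PT] UnI2 singletonI)
    then have "?G \<in> maps.span ?S" by (rule maps.span_base)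
    then show "\<Gamma>1 \<in> maps.span ?S" unfolding g .
  qed
  have PT: "\<Phi> (fst i) (snd i) \<in> maps.span ?S \<and> \<Theta> (fst i) (snd i) \<in> maps.span ?S"
    if i: "i \<in> frobenius_labels" and lt: "int n - int (size_index (frobenius_index i)) = k" for i
  proof -
    have "int n - int (p ^ snd i) < 0" using lt k frobenius_labelsD(1)[OF i] by (simp add: frobenius_index_def size_index_sgl)
    then have "\<Phi> (fst i) (snd i) \<in> ?PT \<and> \<Theta> (fst i) (snd i) \<in> ?PT" 
      using i by (intro conjI UN_I[of "fst i"] UN_I[of "snd i"]) (auto simp: frobenius_labels_def)
    then have "\<Phi> (fst i) (snd i) \<in> ?S" "\<Theta> (fst i) (snd i) \<in> ?S"
      by (auto simp only: intro: UnI1[of _ _ ?P] UnI2)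
    then show ?thesis by (intro conjI maps.span_base)
  qed
  have P: "(\<Sum>i\<in>frobenius_labels. scaleL (coeff_k0 (frobenius_index i) \<psi> * k0_sign) (\<Phi> (fst i) (snd i))) \<in> maps.span ?S"
    using coefficient_degree(1)[OF d frobenius_index_facts(1)] PT by (intro maps.span_sum span_scale_if) auto
  have T: "(\<Sum>i\<in>frobenius_labels. scaleL (coeff_1 (frobenius_index i) Y1 \<psi>) (\<Theta> (fst i) (snd i))) \<in> maps.span ?S"
    using coefficient_degree(2)[OF d frobenius_index_facts(1,3)] PT by (intro maps.span_sum span_scale_if) auto
  show "\<psi> \<in> maps.span ?S"
    by (subst even_decomposition[OF assms \<open>normalised \<psi>\<close>]) (intro maps.span_add ad_power_part G P T)
qed

end

theorem corollary4p15:
  fixes p m n :: nat and t :: "nat \<Rightarrow> nat"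
  assumes "CHAR('a::field) = p" and "p > 3" and "m > 1" and "n > 3"
    and "\<forall>i\<in>{1..2 * m}. t i \<ge> 1"
  shows "(even n \<longrightarrow>
      (hamiltonian.Der_neg p m n t :: ('a vfield \<Rightarrow> 'a vfield) set) =
      maps.span
        ( {hamiltonian.restrict_H p m n t (hamiltonian.ad p m n t w) | w.
             w \<in> hamiltonian.Weven_deg p m n t (-1)}
        \<union> {scaleL (if hamiltonian.size_index m (hamiltonian.top_index p m t)
                         > card (hamiltonian.Y1 m n) then 1 else 0)
             (hamiltonian.\<Gamma>1 p m n t)}
        \<union> (\<Union>r\<in>{1..2 * m}. \<Union>s\<in>{s \<in> {1..t r - 1}. int n - int (p ^ s) < 0}.
             {hamiltonian.\<Phi> p m n t r s, hamiltonian.\<Theta> p m n t r s})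
        \<union> (\<Union>r\<in>hamiltonian.Y0 m. \<Union>s\<in>{1..t r - 1}.
             {hamiltonian.restrict_H p m n t
                ((hamiltonian.ad p m n t (hamiltonian.partial r)) ^^ (p ^ s))})))
    \<and> (odd n \<longrightarrow>
      (hamiltonian.Der_neg p m n t :: ('a vfield \<Rightarrow> 'a vfield) set) =
      maps.span
        ( {hamiltonian.restrict_H p m n t (hamiltonian.ad p m n t w) | w.
             w \<in> hamiltonian.Weven_deg p m n t (-1)}
        \<union> (\<Union>r\<in>hamiltonian.Y0 m. \<Union>s\<in>{1..t r - 1}.
             {hamiltonian.restrict_H p m n t
                ((hamiltonian.ad p m n t (hamiltonian.partial r)) ^^ (p ^ s))})))"
proof -
  interpret hamiltonian_char p m n t "TYPE('a)"
    using assms by unfold_locales auto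
  have "{1..2 * m} = Y0" by (simp add: Y0_def)
  then show ?thesis using Der_neg_even Der_neg_odd unfolding card_Y1 by simp
qed

end
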